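(* Let $\mathbb{K}$ be an algebraically closed field, let $n$ and $r$ be positive integers with $r<n$, and let $w\in\mathfrak{S}_n$. The restriction to the Schubert variety $X_w\subseteq \mathrm{F\ell}(n)$ of the projection $\pi_r:\mathrm{F\ell}(n)\to \mathrm{Gr}(r,n)$, $\pi_r(V_\bullet)=V_r$, is a Zariski-locally trivial fiber bundle (over its image $\pi_r(X_w)$) if and only if $w$ avoids the split patterns $3|12$ and $23|1$ with respect to position $r$.
   Context: Flag varieties: $\mathrm{F\ell}(n)=\{V_\bullet=(V_1\subset V_2\subset\cdots\subset V_{n-1}\subset\mathbb{K}^n) : \dim V_i=i\}$ is the complete flag variety and $\mathrm{Gr}(r,n)=\{V\subset\mathbb{K}^n:\dim V=r\}$ is the Grassmannian. Schubert varieties: Fix a basis $\{e_1,\ldots,e_n\}$ of $\mathbb{K}^n$ and let $E_i=\mathrm{span}\langle e_1,\ldots,e_i\rangle$. Permutations $w\in\mathfrak{S}_n$ are written in one-line notation $w=w(1)w(2)\cdots w(n)$. For $w\in\mathfrak{S}_n$, set $r_w[i,j]=\#\{k\le j : w(k)\le i\}$, and $$X_w=\{V_\bullet\in\mathrm{F\ell}(n) : \dim(E_i\cap V_j)\ge r_w[i,j]\ \text{for all } i,j\}.$$ Split patterns: A split pattern $u=u(1)\cdots u(j)|u(j+1)\cdots u(k)$ is a permutation $u\in\mathfrak{S}_k$ in one-line notation together with a division after position $j$, where $1\le j\le k-1$. A permutation $w\in\mathfrak{S}_n$ contains the split pattern $u$ with respect to position $r$ if there are indices $1\le i_1<\cdots<i_k\le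 n$ such that (1) $w(i_1)\cdots w(i_k)$ has the same relative order as $u(1)\cdots u(k)$, and (2) $i_j\le r<i_{j+1}$. Otherwise $w$ avoids the split pattern $u$ with respect to position $r$. (Thus for $3|12$ the condition (2) is $i_1\le r<i_2$, and for $23|1$ it is $i_2\le r<i_3$.) *)

theory Defs
  imports
    "HOL-Analysis.Abstract_Topology"
    "HOL-Computational_Algebra.Polynomial"
    "HOL-Combinatorics.Permutations"
    "HOL-Library.Function_Algebras"
    "HOL-Library.FuncSet"
begin

section \<open>Spaces with functions and varieties\<close>

text \<open>
  Varieties are treated classically, by their closed points: a topological space together with
  the regular \<open>'k\<close>-valued functions on its open sets (a ``space with functions'' in the sense of
  Kempf, \<^emph>\<open>Algebraic Varieties\<close>). Over an algebraically closed field \<open>'k\<close> this category contains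
  the reduced separated schemes of finite type over \<open>'k\<close> as a full subcategory.
  A member of \<open>reg X U\<close> is a total function, of which only the values on \<open>U\<close> matter.
\<close>

record ('a, 'k) swf =
  zar :: "'a topology"
  reg :: "'a set \<Rightarrow> ('a \<Rightarrow> 'k) set"

abbreviation pts :: "('a, 'k) swf \<Rightarrow> 'a set" where
  "pts X \<equiv> topspace (zar X)"

definition space_with_functions :: "('a, 'k::field) swf \<Rightarrow> bool" where
  "space_with_functions X \<longleftrightarrow>
     (\<forall>U. openin (zar X) U \<longrightarrow>
        (\<forall>c. (\<lambda>_. c) \<in> reg X U) \<and>
        (\<forall>f\<in>reg X U. \<forall>g\<in>reg X U. (\<lambda>x. f x + g x) \<in> reg X U \<and> (\<lambda>x. f x * g x) \<in> reg X U) \<and>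
        (\<forall>f\<in>reg X U. \<forall>V. openin (zar X) V \<and> V \<subseteq> U \<longrightarrow> f \<in> reg X V) \<and>
        (\<forall>f. (\<forall>x\<in>U. \<exists>V g. openin (zar X) V \<and> x \<in> V \<and> V \<subseteq> U \<and> g \<in> reg X V \<and> (\<forall>y\<in>V. f y = g y))
              \<longrightarrow> f \<in> reg X U) \<and>
        (\<forall>f\<in>reg X U. openin (zar X) {x\<in>U. f x \<noteq> 0} \<and>
                      (\<lambda>x. inverse (f x)) \<in> reg X {x\<in>U. f x \<noteq> 0}))"

definition swf_morphism :: "('a, 'k) swf \<Rightarrow> ('b, 'k) swf \<Rightarrow> ('a \<Rightarrow> 'b) \<Rightarrow> bool" where
  "swf_morphism X Y \<phi> \<longleftrightarrow>
     continuous_map (zar X) (zar Y) \<phi> \<and>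
     (\<forall>V. openin (zar Y) V \<longrightarrow> (\<forall>f\<in>reg Y V. f \<circ> \<phi> \<in> reg X {x \<in> pts X. \<phi> x \<in> V}))"

definition swf_iso :: "('a, 'k) swf \<Rightarrow> ('b, 'k) swf \<Rightarrow> ('a \<Rightarrow> 'b) \<Rightarrow> bool" where
  "swf_iso X Y \<phi> \<longleftrightarrow>
     swf_morphism X Y \<phi> \<and>
     (\<exists>\<psi>. swf_morphism Y X \<psi> \<and> (\<forall>x\<in>pts X. \<psi> (\<phi> x) = x) \<and> (\<forall>y\<in>pts Y. \<phi> (\<psi> y) = y))"

text \<open>
  The structure induced on a subset \<open>S\<close> (used for locally closed \<open>S\<close>, where it is the reduced one):
  functions that locally extend to regular functions on open sets of \<open>X\<close>.
\<close>

definition swf_sub :: "('a, 'k) swf \<Rightarrow> 'a set \<Rightarrow> ('a, 'k) swf" where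
  "swf_sub X S =
     \<lparr>zar = subtopology (zar X) S,
      reg = (\<lambda>U. {f. \<forall>x\<in>U. \<exists>V g. openin (zar X) V \<and> x \<in> V \<and> g \<in> reg X V \<and> (\<forall>y\<in>V \<inter> U. f y = g y)})\<rparr>"

text \<open>
  The quotient structure along \<open>q\<close>: a set is open, and a function on it is regular, iff its
  pullback is.
\<close>

definition quotient_topology :: "'a topology \<Rightarrow> ('a \<Rightarrow> 'b) \<Rightarrow> 'b topology" where
  "quotient_topology T q =
     topology (\<lambda>V. V \<subseteq> q ` topspace T \<and> openin T {x \<in> topspace T. q x \<in> V})"

lemma openin_quotient_topology:
  "openin (quotient_topology T q) V \<longleftrightarrow>
     V \<subseteq> q ` topspace T \<and> openin T {x \<in> topspace T. q x \<in> V}"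
proof -
  have inter: "{x \<in> topspace T. q x \<in> A \<inter> B}
      = {x \<in> topspace T. q x \<in> A} \<inter> {x \<in> topspace T. q x \<in> B}" for A B
    by blast
  have union: "{x \<in> topspace T. q x \<in> \<Union>\<K>} = (\<Union>A\<in>\<K>. {x \<in> topspace T. q x \<in> A})" for \<K>
    by blast
  have "istopology (\<lambda>V. V \<subseteq> q ` topspace T \<and> openin T {x \<in> topspace T. q x \<in> V})"
    unfolding istopology_def inter union by blast
  then show ?thesis
    by (simp add: quotient_topology_def)
qed

definition swf_quotient :: "('a, 'k) swf \<Rightarrow> ('a \<Rightarrow> 'b) \<Rightarrow> ('b, 'k) swf" where
  "swf_quotient X q =
     \<lparr>zar = quotient_topology (zar X) q,
      reg = (\<lambda>U. {f. f \<circ> q \<in> reg X {x \<in> pts X. q x \<in> U}})\<rparr>"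

text \<open>
  The product in the category of spaces with functions. Its topology is in general finer than the
  product topology: a basis is given by the loci in \<open>U \<times> V\<close> where a function
  \<open>\<Sum>i. f\<^sub>i(x) g\<^sub>i(y)\<close>, with \<open>f\<^sub>i\<close> regular on \<open>U\<close> and \<open>g\<^sub>i\<close> regular on \<open>V\<close>, does not vanish.
\<close>

definition tensor_functions ::
  "('a, 'k::field) swf \<Rightarrow> ('b, 'k) swf \<Rightarrow> 'a set \<Rightarrow> 'b set \<Rightarrow> ('a \<times> 'b \<Rightarrow> 'k) set" where
  "tensor_functions X Y U V =
     {h. \<exists>(m::nat) f g. (\<forall>i<m. f i \<in> reg X U \<and> g i \<in> reg Y V) \<and>
            h = (\<lambda>z. \<Sum>i<m. f i (fst z) * g i (snd z))}"

definition swf_prod :: "('a, 'k::field) swf \<Rightarrow> ('b, 'k) swf \<Rightarrow> ('a \<times> 'b, 'k) swf" where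
  "swf_prod X Y =
     \<lparr>zar = topology_generated_by
              {{z \<in> U \<times> V. h z \<noteq> 0} | U V h.
                 openin (zar X) U \<and> openin (zar Y) V \<and> h \<in> tensor_functions X Y U V},
      reg = (\<lambda>W. {f. \<forall>z\<in>W. \<exists>U V a b. openin (zar X) U \<and> openin (zar Y) V \<and>
                       a \<in> tensor_functions X Y U V \<and> b \<in> tensor_functions X Y U V \<and>
                       z \<in> U \<times> V \<and> b z \<noteq> 0 \<and>
                       (\<forall>z'\<in>W \<inter> (U \<times> V). b z' \<noteq> 0 \<longrightarrow> f z' = a z' / b z')})\<rparr>"

text \<open>
  Since \<open>'k\<close> will be infinite, polynomials are identified with polynomial functions. Affine space
  has coordinates indexed by a finite set \<open>I\<close>; its points vanish off \<open>I\<close>.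
\<close>

inductive_set polyfun :: "'i set \<Rightarrow> (('i \<Rightarrow> 'k::field) \<Rightarrow> 'k) set" for I where
  const: "(\<lambda>_. c) \<in> polyfun I"
| coord: "i \<in> I \<Longrightarrow> (\<lambda>x. x i) \<in> polyfun I"
| add: "p \<in> polyfun I \<Longrightarrow> q \<in> polyfun I \<Longrightarrow> (\<lambda>x. p x + q x) \<in> polyfun I"
| mult: "p \<in> polyfun I \<Longrightarrow> q \<in> polyfun I \<Longrightarrow> (\<lambda>x. p x * q x) \<in> polyfun I"

definition affine_points :: "'i set \<Rightarrow> ('i \<Rightarrow> 'k::field) set" where
  "affine_points I = {x. \<forall>i. i \<notin> I \<longrightarrow> x i = 0}"

definition affine_topology :: "'i set \<Rightarrow> ('i \<Rightarrow> 'k::field) topology" where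
  "affine_topology I = topology_generated_by {{x \<in> affine_points I. p x \<noteq> 0} | p. p \<in> polyfun I}"

definition affine_space :: "'i set \<Rightarrow> ('i \<Rightarrow> 'k::field, 'k) swf" where
  "affine_space I =
     \<lparr>zar = affine_topology I,
      reg = (\<lambda>U. {f. \<forall>x\<in>U. \<exists>V p q. openin (affine_topology I) V \<and> x \<in> V \<and> V \<subseteq> U \<and>
                       p \<in> polyfun I \<and> q \<in> polyfun I \<and> (\<forall>y\<in>V. q y \<noteq> 0 \<and> f y = p y / q y)})\<rparr>"

definition affine_variety :: "('a, 'k::field) swf \<Rightarrow> bool" where
  "affine_variety X \<longleftrightarrow>
     (\<exists>(m::nat) Z \<phi>. closedin (zar (affine_space {..<m})) Z \<and>
                     swf_iso X (swf_sub (affine_space {..<m}) Z) \<phi>)"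

text \<open>Varieties are separated, but not required to be irreducible.\<close>

definition variety :: "('a, 'k::field) swf \<Rightarrow> bool" where
  "variety X \<longleftrightarrow>
     space_with_functions X \<and>
     (\<exists>\<U>. finite \<U> \<and> \<Union>\<U> = pts X \<and> (\<forall>U\<in>\<U>. openin (zar X) U \<and> affine_variety (swf_sub X U))) \<and>
     closedin (zar (swf_prod X X)) {(x, x) | x. x \<in> pts X}"

text \<open>
  The points of the fiber \<open>F\<close> are taken from the same type as those of the total space. This is no
  restriction: if \<open>Y\<close> is nonempty, then \<open>F\<close> is isomorphic to a fiber of \<open>\<pi>\<close>.
\<close>

definition zariski_locally_trivial ::
  "('a, 'k::field) swf \<Rightarrow> ('b, 'k) swf \<Rightarrow> ('a \<Rightarrow> 'b) \<Rightarrow> bool" where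
  "zariski_locally_trivial X Y \<pi> \<longleftrightarrow>
     swf_morphism X Y \<pi> \<and>
     (\<exists>F :: ('a, 'k) swf. variety F \<and>
        (\<forall>y\<in>pts Y. \<exists>U \<phi>. openin (zar Y) U \<and> y \<in> U \<and>
            swf_iso (swf_sub X {x \<in> pts X. \<pi> x \<in> U}) (swf_prod (swf_sub Y U) F) \<phi> \<and>
            (\<forall>x\<in>pts X. \<pi> x \<in> U \<longrightarrow> fst (\<phi> x) = \<pi> x)))"


section \<open>Flag varieties, Grassmannians and Schubert varieties\<close>

definition fun_scale :: "'k::field \<Rightarrow> (nat \<Rightarrow> 'k) \<Rightarrow> nat \<Rightarrow> 'k" where
  "fun_scale c v = (\<lambda>i. c * v i)"

global_interpretation fv: vector_space fun_scale
  by unfold_locales (auto simp: fun_scale_def fun_eq_iff algebra_simps)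

text \<open>The vector space \<open>'k\<^sup>n\<close>, with coordinates indexed from \<open>1\<close> to \<open>n\<close>.\<close>

abbreviation Kn :: "nat \<Rightarrow> (nat \<Rightarrow> 'k::field) set" where
  "Kn n \<equiv> affine_points {1..n}"

definition is_basis :: "nat \<Rightarrow> (nat \<Rightarrow> nat \<Rightarrow> 'k::field) \<Rightarrow> bool" where
  "is_basis n b \<longleftrightarrow> inj_on b {1..n} \<and> fv.independent (b ` {1..n}) \<and> fv.span (b ` {1..n}) = Kn n"

text \<open>A flag is indexed by \<open>{1..<n}\<close>, i.e. \<open>V\<^sub>0 = 0\<close> and \<open>V\<^sub>n = 'k\<^sup>n\<close> are not recorded.\<close>

definition flags :: "nat \<Rightarrow> (nat \<Rightarrow> (nat \<Rightarrow> 'k::field) set) set" where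
  "flags n = {V \<in> extensional {1..<n}.
     (\<forall>i\<in>{1..<n}. fv.subspace (V i) \<and> V i \<subseteq> Kn n \<and> fv.dim (V i) = i) \<and>
     (\<forall>i\<in>{1..<n}. \<forall>j\<in>{1..<n}. i \<le> j \<longrightarrow> V i \<subseteq> V j)}"

definition grassmannian :: "nat \<Rightarrow> nat \<Rightarrow> (nat \<Rightarrow> 'k::field) set set" where
  "grassmannian r n = {V. fv.subspace V \<and> V \<subseteq> Kn n \<and> fv.dim V = r}"

definition col :: "(nat \<times> nat \<Rightarrow> 'k) \<Rightarrow> nat \<Rightarrow> nat \<Rightarrow> 'k" where
  "col g j = (\<lambda>i. g (i, j))"

definition GL :: "nat \<Rightarrow> (nat \<times> nat \<Rightarrow> 'k::field, 'k) swf" where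
  "GL n = swf_sub (affine_space ({1..n} \<times> {1..n}))
                  {g \<in> affine_points ({1..n} \<times> {1..n}). is_basis n (col g)}"

definition column_flag :: "nat \<Rightarrow> (nat \<times> nat \<Rightarrow> 'k::field) \<Rightarrow> nat \<Rightarrow> (nat \<Rightarrow> 'k) set" where
  "column_flag n g = (\<lambda>i\<in>{1..<n}. fv.span (col g ` {1..i}))"

text \<open>
  The variety structures are those of the homogeneous spaces \<open>GL\<^sub>n/B\<close> and \<open>GL\<^sub>n/P\<close>. As every flag and
  every subspace has an adapted basis of \<open>'k\<^sup>n\<close>, the underlying point sets are
  \<^term>\<open>flags n\<close> and \<^term>\<open>grassmannian r n\<close>.
\<close>

definition flag_variety :: "nat \<Rightarrow> (nat \<Rightarrow> (nat \<Rightarrow> 'k::field) set, 'k) swf" where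
  "flag_variety n = swf_quotient (GL n) (column_flag n)"

definition grassmannian_variety :: "nat \<Rightarrow> nat \<Rightarrow> ((nat \<Rightarrow> 'k::field) set, 'k) swf" where
  "grassmannian_variety r n = swf_quotient (GL n) (\<lambda>g. fv.span (col g ` {1..r}))"

definition rank_number :: "(nat \<Rightarrow> nat) \<Rightarrow> nat \<Rightarrow> nat \<Rightarrow> nat" where
  "rank_number w i j = card {k \<in> {1..j}. w k \<le> i}"

definition schubert :: "nat \<Rightarrow> (nat \<Rightarrow> nat \<Rightarrow> 'k::field) \<Rightarrow> (nat \<Rightarrow> nat)
    \<Rightarrow> (nat \<Rightarrow> (nat \<Rightarrow> 'k) set) set" where
  "schubert n e w = {V \<in> flags n. \<forall>i\<in>{1..n}. \<forall>j\<in>{1..<n}.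
     fv.dim (fv.span (e ` {1..i}) \<inter> V j) \<ge> rank_number w i j}"

definition flag_proj :: "nat \<Rightarrow> (nat \<Rightarrow> 'v set) \<Rightarrow> 'v set" where
  "flag_proj r V = V r"


section \<open>Split patterns\<close>

text \<open>
  The split pattern \<open>u(1)\<cdots>u(j)|u(j+1)\<cdots>u(k)\<close> is given by the lists \<open>us = [u(1),\<dots>,u(j)]\<close> and
  \<open>vs = [u(j+1),\<dots>,u(k)]\<close>; the indices \<open>i\<^sub>1 < \<dots> < i\<^sub>k\<close> are the values of \<open>\<iota>\<close>.
\<close>

definition contains_split_pattern ::
  "nat \<Rightarrow> (nat \<Rightarrow> nat) \<Rightarrow> nat \<Rightarrow> nat list \<Rightarrow> nat list \<Rightarrow> bool" where
  "contains_split_pattern n w r us vs \<longleftrightarrow>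
     (let u = (\<lambda>a. (us @ vs) ! (a - 1)); j = length us; k = length us + length vs in
      \<exists>\<iota>. \<iota> ` {1..k} \<subseteq> {1..n} \<and> strict_mono_on {1..k} \<iota> \<and>
          (\<forall>a\<in>{1..k}. \<forall>b\<in>{1..k}. w (\<iota> a) < w (\<iota> b) \<longleftrightarrow> u a < u b) \<and>
          \<iota> j \<le> r \<and> r < \<iota> (j + 1))"

abbreviation avoids_split_pattern ::
  "nat \<Rightarrow> (nat \<Rightarrow> nat) \<Rightarrow> nat \<Rightarrow> nat list \<Rightarrow> nat list \<Rightarrow> bool" where
  "avoids_split_pattern n w r us vs \<equiv> \<not> contains_split_pattern n w r us vs"

end

theory Submission
  imports Defs "Jordan_Normal_Form.Determinant"
begin

text \<open>
  If \<open>w\<close> avoids both patterns, the fibers of the projection \<open>V \<mapsto> V\<^sub>r\<close> are cut out by rank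
  conditions that do not see where \<open>V\<^sub>r\<close> lies. Let \<open>lo\<close> be the smallest value of \<open>w\<close> on the right of
  the division and \<open>hi\<close> the largest one on the left. Each \<open>y\<close> in the image of the Schubert variety
  contains \<open>E\<^sub>i\<close> for \<open>i < lo\<close>, and it is contained in \<open>E\<^sub>i\<close> for \<open>i \<ge> hi\<close>. Avoidance of the patterns makes
  the rank conditions in these rows (the first ones for \<open>j < r\<close>, the other ones for \<open>j > r\<close>)
  imply the remaining ones as soon as \<open>V\<^sub>r\<close> is in the image (\<open>S_iff_essential\<close>). The spaces \<open>E\<^sub>i\<close> of these
  rows together with \<open>y\<close> form a partial flag. The local sections of \<open>GL\<^sub>n \<rightarrow> Gr(r,n)\<close> by reduced matrices
  can be chosen adapted to this partial flag for all \<open>y\<close> nearby (\<open>adapted_local_section\<close>), and they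
  transport a model fiber to the fiber over \<open>y\<close>, which trivializes the projection locally. That the
  model fiber is a variety is shown for all closed subsets of the flag variety
  (\<open>closed_sub_flag_variety\<close>), with charts given by lower unitriangular matrices.

  For the converse, all fibers of a locally trivial projection are homeomorphic. Compare the fiber
  over \<open>y\<^sub>w\<close>, the span of the \<open>e\<^sub>v\<close> for the values \<open>v\<close> of \<open>w\<close> on the left of the division, with the fiber
  over \<open>E\<^sub>r\<close>. The permutation of the basis that sorts the values on either side of the division takes
  \<open>y\<^sub>w\<close> to \<open>E\<^sub>r\<close>, and it maps the first fiber onto a closed subset of the second one
  (\<open>act_sort_fiber\<close>, \<open>act_sort_fiber_iff\<close>). If a pattern occurs, this subset is proper: exchange
  in \<open>w\<close> two values that sorting makes adjacent, and then sort. The resulting coordinate flag lies in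
  the fiber over \<open>E\<^sub>r\<close>, but not in the subset (\<open>exchange_not_in_image\<close>). Hence the second fiber would
  be homeomorphic to a proper closed subset of itself. This is impossible in a Noetherian space
  (\<open>noetherian_space_closed_embedding_onto\<close>), and flag varieties are Noetherian by Hilbert's basis
  theorem.
\<close>

section \<open>Spaces with functions\<close>

lemma
  assumes "space_with_functions X" and "openin (zar X) U"
  shows swf_const: "(\<lambda>_. c) \<in> reg X U"
    and swf_add: "f \<in> reg X U \<Longrightarrow> g \<in> reg X U \<Longrightarrow> (\<lambda>x. f x + g x) \<in> reg X U"
    and swf_mult: "f \<in> reg X U \<Longrightarrow> g \<in> reg X U \<Longrightarrow> (\<lambda>x. f x * g x) \<in> reg X U"
    and swf_restrict: "f \<in> reg X U \<Longrightarrow> openin (zar X) V \<Longrightarrow> V \<subseteq> U \<Longrightarrow> f \<in> reg X V"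
    and swf_nonzero_open: "f \<in> reg X U \<Longrightarrow> openin (zar X) {x \<in> U. f x \<noteq> 0}"
    and swf_inverse: "f \<in> reg X U \<Longrightarrow> (\<lambda>x. inverse (f x)) \<in> reg X {x \<in> U. f x \<noteq> 0}"
proof -
  note axioms = assms(1)[unfolded space_with_functions_def, THEN spec, THEN mp, OF assms(2)]
  show "(\<lambda>_. c) \<in> reg X U"
    by (rule axioms[THEN conjunct1, THEN spec])
  note axioms = axioms[THEN conjunct2]
  show "(\<lambda>x. f x + g x) \<in> reg X U" if "f \<in> reg X U" "g \<in> reg X U"
    by (rule axioms[THEN conjunct1, THEN bspec, OF that(1), THEN bspec, OF that(2), THEN conjunct1])
  show "(\<lambda>x. f x * g x) \<in> reg X U" if "f \<in> reg X U" "g \<in> reg X U"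
    by (rule axioms[THEN conjunct1, THEN bspec, OF that(1), THEN bspec, OF that(2), THEN conjunct2])
  note axioms = axioms[THEN conjunct2]
  show "f \<in> reg X V" if "f \<in> reg X U" "openin (zar X) V" "V \<subseteq> U"
    by (rule axioms[THEN conjunct1, THEN bspec, OF that(1), THEN spec, THEN mp, OF conjI[OF that(2,3)]])
  note axioms = axioms[THEN conjunct2, THEN conjunct2]
  show "openin (zar X) {x \<in> U. f x \<noteq> 0}" if "f \<in> reg X U"
    by (rule axioms[THEN bspec, OF that, THEN conjunct1])
  show "(\<lambda>x. inverse (f x)) \<in> reg X {x \<in> U. f x \<noteq> 0}" if "f \<in> reg X U"
    by (rule axioms[THEN bspec, OF that, THEN conjunct2])
qed

lemma space_with_functionsI:
  assumes "\<And>U c. openin (zar X) U \<Longrightarrow> (\<lambda>_. c) \<in> reg X U"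
    and "\<And>U f g. openin (zar X) U \<Longrightarrow> f \<in> reg X U \<Longrightarrow> g \<in> reg X U \<Longrightarrow> (\<lambda>x. f x + g x) \<in> reg X U"
    and "\<And>U f g. openin (zar X) U \<Longrightarrow> f \<in> reg X U \<Longrightarrow> g \<in> reg X U \<Longrightarrow> (\<lambda>x. f x * g x) \<in> reg X U"
    and "\<And>U V f. openin (zar X) U \<Longrightarrow> f \<in> reg X U \<Longrightarrow> openin (zar X) V \<Longrightarrow> V \<subseteq> U \<Longrightarrow> f \<in> reg X V"
    and "\<And>U f. openin (zar X) U \<Longrightarrow> (\<And>x. x \<in> U \<Longrightarrow> \<exists>V g. openin (zar X) V \<and> x \<in> V \<and> V \<subseteq> U \<and>
            g \<in> reg X V \<and> (\<forall>y\<in>V. f y = g y)) \<Longrightarrow> f \<in> reg X U"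
    and "\<And>U f. openin (zar X) U \<Longrightarrow> f \<in> reg X U \<Longrightarrow> openin (zar X) {x \<in> U. f x \<noteq> 0}"
    and "\<And>U f. openin (zar X) U \<Longrightarrow> f \<in> reg X U \<Longrightarrow>
            (\<lambda>x. inverse (f x)) \<in> reg X {x \<in> U. f x \<noteq> 0}"
  shows "space_with_functions X"
  unfolding space_with_functions_def
  apply (intro allI impI conjI ballI)
        apply (rule assms(1), assumption)
       apply (rule assms(2), assumption+)
      apply (rule assms(3), assumption+)
     apply (erule conjE, rule assms(4), assumption+)
    apply (rule assms(5), assumption, erule bspec, assumption)
   apply (rule assms(6), assumption+)
  apply (rule assms(7), assumption+)
  done

lemma swf_glue:
  assumes X: "space_with_functions X" and U: "openin (zar X) U"
    and loc: "\<And>x. x \<in> U \<Longrightarrow>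
      \<exists>V g. openin (zar X) V \<and> x \<in> V \<and> g \<in> reg X V \<and> (\<forall>y\<in>V \<inter> U. f y = g y)"
  shows "f \<in> reg X U"
proof -
  have "\<exists>V g. openin (zar X) V \<and> x \<in> V \<and> V \<subseteq> U \<and> g \<in> reg X V \<and> (\<forall>y\<in>V. f y = g y)"
    if "x \<in> U" for x
  proof -
    obtain V g where V: "openin (zar X) V" "x \<in> V" "g \<in> reg X V" "\<forall>y\<in>V \<inter> U. f y = g y"
      using loc[OF \<open>x \<in> U\<close>] by blast
    have "g \<in> reg X (V \<inter> U)"
      using swf_restrict[OF X V(1) V(3)] U V(1) by auto
    then show ?thesis
      using V U \<open>x \<in> U\<close> by (intro exI[of _ "V \<inter> U"] exI[of _ g]) auto
  qed
  then have "\<forall>x\<in>U. \<exists>V g. openin (zar X) V \<and> x \<in> V \<and> V \<subseteq> U \<and> g \<in> reg X V \<and> (\<forall>y\<in>V. f y = g y)"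
    by (rule ballI)
  then show ?thesis
    by (rule X[unfolded space_with_functions_def, THEN spec, THEN mp, OF U,
          THEN conjunct2, THEN conjunct2, THEN conjunct2, THEN conjunct1, THEN spec, THEN mp])
qed

lemma swf_cong:
  assumes "space_with_functions X" and "openin (zar X) U" and "f \<in> reg X U"
    and "\<And>x. x \<in> U \<Longrightarrow> g x = f x"
  shows "g \<in> reg X U"
  by (rule swf_glue[OF assms(1,2)]) (use assms in blast)

lemma swf_sum:
  assumes "space_with_functions X" and "openin (zar X) U"
    and "\<And>i. i \<in> I \<Longrightarrow> f i \<in> reg X U"
  shows "(\<lambda>x. \<Sum>i\<in>I. f i x) \<in> reg X U"
  using assms(3)
  by (induction I rule: infinite_finite_induct)
    (auto intro: swf_const[OF assms(1,2)] swf_add[OF assms(1,2)])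

lemma swf_divide:
  assumes X: "space_with_functions X" and U: "openin (zar X) U"
    and f: "f \<in> reg X U" and g: "g \<in> reg X U" and nz: "\<And>x. x \<in> U \<Longrightarrow> g x \<noteq> 0"
  shows "(\<lambda>x. f x / g x) \<in> reg X U"
proof -
  have "{x \<in> U. g x \<noteq> 0} = U"
    using nz by auto
  then have "(\<lambda>x. inverse (g x)) \<in> reg X U"
    using swf_inverse[OF X U g] by simp
  then show ?thesis
    using swf_mult[OF X U f] by (simp add: field_class.field_divide_inverse)
qed

lemma polyfun_reg:
  assumes X: "space_with_functions X" and U: "openin (zar X) U"
    and c: "\<And>i. i \<in> I \<Longrightarrow> (\<lambda>x. \<alpha> x i) \<in> reg X U" and p: "p \<in> polyfun I"
  shows "(\<lambda>x. p (\<alpha> x)) \<in> reg X U"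
  using p
  by induction (auto intro: c swf_const[OF X U] swf_add[OF X U] swf_mult[OF X U])

subsection \<open>Subspaces\<close>

lemma zar_sub [simp]: "zar (swf_sub X S) = subtopology (zar X) S"
  by (simp add: swf_sub_def)

lemma reg_sub_iff:
  "f \<in> reg (swf_sub X S) U \<longleftrightarrow>
     (\<forall>x\<in>U. \<exists>V g. openin (zar X) V \<and> x \<in> V \<and> g \<in> reg X V \<and> (\<forall>y\<in>V \<inter> U. f y = g y))"
  by (simp add: swf_sub_def)

lemma openin_localI:
  assumes "\<And>x. x \<in> U \<Longrightarrow> \<exists>V. openin T V \<and> x \<in> V \<and> V \<subseteq> U"
  shows "openin T U"
  by (subst openin_subopen) (use assms in blast)

lemma reg_sub_openin:
  assumes "space_with_functions X" and "openin (zar X) U"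
  shows "reg (swf_sub X S) U = reg X U"
proof
  show "reg (swf_sub X S) U \<subseteq> reg X U"
    using swf_glue[OF assms] unfolding reg_sub_iff subset_iff by blast
  show "reg X U \<subseteq> reg (swf_sub X S) U"
    using assms(2) unfolding reg_sub_iff subset_iff by blast
qed

lemma reg_imp_reg_sub:
  assumes "openin (zar X) V" and "f \<in> reg X V" and "U \<subseteq> V"
  shows "f \<in> reg (swf_sub X S) U"
  using assms unfolding reg_sub_iff by blast

lemma reg_subE:
  assumes "f \<in> reg (swf_sub X S) U" and "x \<in> U"
  obtains V g where "openin (zar X) V" "x \<in> V" "g \<in> reg X V" "\<forall>y\<in>V \<inter> U. f y = g y"
  using bspec[OF assms(1)[unfolded reg_sub_iff] assms(2)] by (elim exE conjE) (rule that)

lemma space_with_functions_sub: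
  fixes X :: "('a, 'k::field) swf"
  assumes X: "space_with_functions X"
  shows "space_with_functions (swf_sub X S)"
proof (rule space_with_functionsI)
  fix U f g
  assume f: "f \<in> reg (swf_sub X S) U" and g: "g \<in> reg (swf_sub X S) U"
  have ex: "\<exists>V a b. openin (zar X) V \<and> x \<in> V \<and> a \<in> reg X V \<and> b \<in> reg X V \<and>
      (\<forall>y\<in>V \<inter> U. f y = a y \<and> g y = b y)" if x: "x \<in> U" for x
  proof -
    obtain V a where V: "openin (zar X) V" "x \<in> V" "a \<in> reg X V" "\<forall>y\<in>V \<inter> U. f y = a y"
      by (rule reg_subE[OF f x])
    obtain W b where W: "openin (zar X) W" "x \<in> W" "b \<in> reg X W" "\<forall>y\<in>W \<inter> U. g y = b y"
      by (rule reg_subE[OF g x])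
    have VW: "openin (zar X) (V \<inter> W)"
      using V W by auto
    have "a \<in> reg X (V \<inter> W)" "b \<in> reg X (V \<inter> W)"
      using swf_restrict[OF X V(1,3) VW] swf_restrict[OF X W(1,3) VW] by simp_all
    then show ?thesis
      using V W VW by (intro exI[of _ "V \<inter> W"] exI[of _ a] exI[of _ b]) simp
  qed
  show "(\<lambda>x. f x + g x) \<in> reg (swf_sub X S) U"
    unfolding reg_sub_iff
  proof
    fix x assume "x \<in> U"
    from ex[OF this] obtain V a b where V: "openin (zar X) V" "x \<in> V" "a \<in> reg X V" "b \<in> reg X V"
      "\<forall>y\<in>V \<inter> U. f y = a y \<and> g y = b y" by blast
    then show "\<exists>V h. openin (zar X) V \<and> x \<in> V \<and> h \<in> reg X V \<and> (\<forall>y\<in>V \<inter> U. f y + g y = h y)"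
      using swf_add[OF X V(1) V(3) V(4)]
      by (intro exI[of _ V] exI[of _ "\<lambda>x. a x + b x"]) simp
  qed
  show "(\<lambda>x. f x * g x) \<in> reg (swf_sub X S) U"
    unfolding reg_sub_iff
  proof
    fix x assume "x \<in> U"
    from ex[OF this] obtain V a b where V: "openin (zar X) V" "x \<in> V" "a \<in> reg X V" "b \<in> reg X V"
      "\<forall>y\<in>V \<inter> U. f y = a y \<and> g y = b y" by blast
    then show "\<exists>V h. openin (zar X) V \<and> x \<in> V \<and> h \<in> reg X V \<and> (\<forall>y\<in>V \<inter> U. f y * g y = h y)"
      using swf_mult[OF X V(1) V(3) V(4)]
      by (intro exI[of _ V] exI[of _ "\<lambda>x. a x * b x"]) simp
  qed
next
  fix U and c :: 'k
  assume U: "openin (zar (swf_sub X S)) U"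
  have sub: "U \<subseteq> topspace (zar X)"
    using openin_subset[OF U] by simp
  show "(\<lambda>_. c) \<in> reg (swf_sub X S) U"
    by (rule reg_imp_reg_sub[OF openin_topspace swf_const[OF X openin_topspace] sub])
next
  fix U V f
  assume f: "f \<in> reg (swf_sub X S) U" and VU: "V \<subseteq> U"
  show "f \<in> reg (swf_sub X S) V"
    unfolding reg_sub_iff
  proof
    fix x assume "x \<in> V"
    then have "x \<in> U"
      using VU by blast
    then obtain W g where W: "openin (zar X) W" "x \<in> W" "g \<in> reg X W" "\<forall>y\<in>W \<inter> U. f y = g y"
      by (rule reg_subE[OF f])
    then show "\<exists>W g. openin (zar X) W \<and> x \<in> W \<and> g \<in> reg X W \<and> (\<forall>y\<in>W \<inter> V. f y = g y)"
      using VU by (intro exI[of _ W] exI[of _ g]) auto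
  qed
next
  fix U f
  assume U: "openin (zar (swf_sub X S)) U"
    and loc: "\<And>x. x \<in> U \<Longrightarrow> \<exists>V g. openin (zar (swf_sub X S)) V \<and> x \<in> V \<and> V \<subseteq> U \<and>
      g \<in> reg (swf_sub X S) V \<and> (\<forall>y\<in>V. f y = g y)"
  obtain U0 where U0: "openin (zar X) U0" "U = U0 \<inter> S"
    using U by (auto simp: openin_subtopology)
  show "f \<in> reg (swf_sub X S) U"
    unfolding reg_sub_iff
  proof
    fix x assume "x \<in> U"
    from loc[OF this] obtain V g where V: "openin (zar (swf_sub X S)) V" "x \<in> V" "V \<subseteq> U"
      "g \<in> reg (swf_sub X S) V" "\<forall>y\<in>V. f y = g y" by blast
    obtain V0 where V0: "openin (zar X) V0" "V = V0 \<inter> S"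
      using V(1) by (auto simp: openin_subtopology)
    obtain W h where W: "openin (zar X) W" "x \<in> W" "h \<in> reg X W" "\<forall>y\<in>W \<inter> V. g y = h y"
      by (rule reg_subE[OF V(4,2)])
    have WV: "openin (zar X) (W \<inter> V0)"
      using W V0 by auto
    have "h \<in> reg X (W \<inter> V0)"
      using swf_restrict[OF X W(1,3) WV] by simp
    moreover have "f y = h y" if "y \<in> W \<inter> V0 \<inter> U" for y
      using that V W V0 U0 by simp
    ultimately show "\<exists>V g. openin (zar X) V \<and> x \<in> V \<and> g \<in> reg X V \<and> (\<forall>y\<in>V \<inter> U. f y = g y)"
      using W(2) V(2) V0 WV by (intro exI[of _ "W \<inter> V0"] exI[of _ h]) simp
  qed
next
  fix U f
  assume U: "openin (zar (swf_sub X S)) U" and f: "f \<in> reg (swf_sub X S) U"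
  obtain U0 where U0: "openin (zar X) U0" "U = U0 \<inter> S"
    using U by (auto simp: openin_subtopology)
  have ex: "\<exists>V g. openin (zar X) V \<and> x \<in> V \<and> g \<in> reg X V \<and> (\<forall>y\<in>V \<inter> U. f y = g y)" if "x \<in> U" for x
    by (rule reg_subE[OF f that]) (intro exI conjI, assumption+)
  show "openin (zar (swf_sub X S)) {x \<in> U. f x \<noteq> 0}"
  proof (rule openin_localI)
    fix x assume x: "x \<in> {x \<in> U. f x \<noteq> 0}"
    then have "x \<in> U" by simp
    from ex[OF this] obtain V g where V: "openin (zar X) V" "x \<in> V" "g \<in> reg X V"
      "\<forall>y\<in>V \<inter> U. f y = g y" by blast
    have fg: "f x = g x"
      using V \<open>x \<in> U\<close> by simp
    have "openin (zar X) ({y \<in> V. g y \<noteq> 0} \<inter> U0)"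
      using swf_nonzero_open[OF X V(1,3)] U0 by auto
    then have "openin (zar (swf_sub X S)) ({y \<in> V. g y \<noteq> 0} \<inter> U0 \<inter> S)"
      unfolding zar_sub openin_subtopology by blast
    moreover have "x \<in> {y \<in> V. g y \<noteq> 0} \<inter> U0 \<inter> S"
      using x V U0 fg by simp
    moreover have "{y \<in> V. g y \<noteq> 0} \<inter> U0 \<inter> S \<subseteq> {x \<in> U. f x \<noteq> 0}"
      using V U0 by auto
    ultimately show "\<exists>V. openin (zar (swf_sub X S)) V \<and> x \<in> V \<and> V \<subseteq> {x \<in> U. f x \<noteq> 0}"
      by blast
  qed
  show "(\<lambda>x. inverse (f x)) \<in> reg (swf_sub X S) {x \<in> U. f x \<noteq> 0}"
    unfolding reg_sub_iff
  proof
    fix x assume x: "x \<in> {x \<in> U. f x \<noteq> 0}"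
    then have "x \<in> U" by simp
    from ex[OF this] obtain V g where V: "openin (zar X) V" "x \<in> V" "g \<in> reg X V"
      "\<forall>y\<in>V \<inter> U. f y = g y" by blast
    have fg: "f x = g x"
      using V \<open>x \<in> U\<close> by simp
    show "\<exists>V g. openin (zar X) V \<and> x \<in> V \<and> g \<in> reg X V \<and>
        (\<forall>y\<in>V \<inter> {x \<in> U. f x \<noteq> 0}. inverse (f y) = g y)"
      using V fg swf_nonzero_open[OF X V(1,3)] swf_inverse[OF X V(1,3)] x
      by (intro exI[of _ "{x \<in> V. g x \<noteq> 0}"] exI[of _ "\<lambda>x. inverse (g x)"]) simp
  qed
qed

subsection \<open>Morphisms\<close>

lemma swf_morphism_compose:
  assumes f: "swf_morphism X Y f" and g: "swf_morphism Y Z g"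
  shows "swf_morphism X Z (\<lambda>x. g (f x))"
proof -
  have cf: "continuous_map (zar X) (zar Y) f" and cg: "continuous_map (zar Y) (zar Z) g"
    using f g by (auto simp: swf_morphism_def)
  have "h \<circ> (\<lambda>x. g (f x)) \<in> reg X {x \<in> pts X. g (f x) \<in> V}"
    if V: "openin (zar Z) V" and h: "h \<in> reg Z V" for V h
  proof -
    have "h \<circ> g \<in> reg Y {y \<in> pts Y. g y \<in> V}"
      using g V h by (auto simp: swf_morphism_def)
    moreover have "openin (zar Y) {y \<in> pts Y. g y \<in> V}"
      using cg V openin_continuous_map_preimage by blast
    ultimately have "(h \<circ> g) \<circ> f \<in> reg X {x \<in> pts X. f x \<in> {y \<in> pts Y. g y \<in> V}}"
      using f by (auto simp: swf_morphism_def)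
    moreover have "{x \<in> pts X. f x \<in> {y \<in> pts Y. g y \<in> V}} = {x \<in> pts X. g (f x) \<in> V}"
      using continuous_map_image_subset_topspace[OF cf] by auto
    ultimately show ?thesis
      by (simp add: comp_def)
  qed
  moreover have "continuous_map (zar X) (zar Z) (\<lambda>x. g (f x))"
    using continuous_map_compose[OF cf cg] by (simp add: comp_def)
  ultimately show ?thesis
    by (simp add: swf_morphism_def)
qed

lemma swf_morphism_inclusion: "swf_morphism (swf_sub X S) X (\<lambda>x. x)"
proof -
  have "f \<in> reg (swf_sub X S) {x \<in> pts (swf_sub X S). x \<in> V}"
    if "openin (zar X) V" "f \<in> reg X V" for V f
    by (rule reg_imp_reg_sub[OF that]) auto
  moreover have "continuous_map (zar (swf_sub X S)) (zar X) (\<lambda>x. x)"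
    using continuous_map_from_subtopology[OF continuous_map_id, of "zar X" S] by (simp add: id_def)
  ultimately show ?thesis
    by (simp add: swf_morphism_def comp_def)
qed

lemma swf_morphism_in_pts: "swf_morphism X Y \<phi> \<Longrightarrow> x \<in> pts X \<Longrightarrow> \<phi> x \<in> pts Y"
  by (auto simp: swf_morphism_def continuous_map_def)

lemma swf_morphism_preimage:
  "swf_morphism X Y \<phi> \<Longrightarrow> openin (zar Y) V \<Longrightarrow> openin (zar X) {x \<in> pts X. \<phi> x \<in> V}"
  by (simp add: swf_morphism_def continuous_map_def)

lemma swf_morphism_into_sub:
  assumes X: "space_with_functions X" and m: "swf_morphism X Y \<phi>"
    and im: "\<And>x. x \<in> pts X \<Longrightarrow> \<phi> x \<in> T"
  shows "swf_morphism X (swf_sub Y T) \<phi>"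
proof -
  have c: "continuous_map (zar X) (zar (swf_sub Y T)) \<phi>"
    using m im by (auto simp: swf_morphism_def continuous_map_in_subtopology)
  have "f \<circ> \<phi> \<in> reg X {x \<in> pts X. \<phi> x \<in> V}"
    if V: "openin (zar (swf_sub Y T)) V" and f: "f \<in> reg (swf_sub Y T) V" for V f
  proof (rule swf_glue[OF X])
    show "openin (zar X) {x \<in> pts X. \<phi> x \<in> V}"
      using c V openin_continuous_map_preimage by blast
    fix x assume x: "x \<in> {x \<in> pts X. \<phi> x \<in> V}"
    then have "\<phi> x \<in> V"
      by simp
    then obtain W g where W: "openin (zar Y) W" "\<phi> x \<in> W" "g \<in> reg Y W" "\<forall>y\<in>W \<inter> V. f y = g y"
      by (rule reg_subE[OF f])
    then have "g \<circ> \<phi> \<in> reg X {x \<in> pts X. \<phi> x \<in> W}"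
      using m by (auto simp: swf_morphism_def)
    then show "\<exists>V' g. openin (zar X) V' \<and> x \<in> V' \<and> g \<in> reg X V' \<and>
        (\<forall>y\<in>V' \<inter> {x \<in> pts X. \<phi> x \<in> V}. (f \<circ> \<phi>) y = g y)"
      using swf_morphism_preimage[OF m W(1)] W x
      by (intro exI[of _ "{x \<in> pts X. \<phi> x \<in> W}"] exI[of _ "g \<circ> \<phi>"]) auto
  qed
  with c show ?thesis
    by (auto simp: swf_morphism_def)
qed

lemma swf_morphism_local:
  assumes X: "space_with_functions X"
    and loc: "\<And>x. x \<in> pts X \<Longrightarrow>
      \<exists>W. openin (zar X) W \<and> x \<in> W \<and> swf_morphism (swf_sub X W) Y \<phi>"
  shows "swf_morphism X Y \<phi>"
proof -
  have op: "openin (zar X) {x \<in> pts (swf_sub X W). \<phi> x \<in> V}"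
    if "openin (zar X) W" "swf_morphism (swf_sub X W) Y \<phi>" "openin (zar Y) V" for W V
    using openin_trans_full[OF swf_morphism_preimage[OF that(2,3), unfolded zar_sub] that(1)] by simp
  have pre: "openin (zar X) {x \<in> pts X. \<phi> x \<in> V}" if V: "openin (zar Y) V" for V
  proof (rule openin_localI)
    fix x assume x: "x \<in> {x \<in> pts X. \<phi> x \<in> V}"
    then obtain W where W: "openin (zar X) W" "x \<in> W" "swf_morphism (swf_sub X W) Y \<phi>"
      using loc by blast
    show "\<exists>W. openin (zar X) W \<and> x \<in> W \<and> W \<subseteq> {x \<in> pts X. \<phi> x \<in> V}"
      using op[OF W(1,3) V] W x by (intro exI[of _ "{x \<in> pts (swf_sub X W). \<phi> x \<in> V}"]) auto
  qed
  have im: "\<phi> x \<in> pts Y" if "x \<in> pts X" for x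
  proof -
    obtain W where W: "openin (zar X) W" "x \<in> W" "swf_morphism (swf_sub X W) Y \<phi>"
      using loc[OF \<open>x \<in> pts X\<close>] by blast
    show ?thesis
      using swf_morphism_in_pts[OF W(3), of x] W that by auto
  qed
  have "f \<circ> \<phi> \<in> reg X {x \<in> pts X. \<phi> x \<in> V}" if V: "openin (zar Y) V" and f: "f \<in> reg Y V" for V f
  proof (rule swf_glue[OF X pre[OF V]])
    fix x assume x: "x \<in> {x \<in> pts X. \<phi> x \<in> V}"
    then obtain W where W: "openin (zar X) W" "x \<in> W" "swf_morphism (swf_sub X W) Y \<phi>"
      using loc by blast
    let ?W = "{x \<in> pts (swf_sub X W). \<phi> x \<in> V}"
    have "f \<circ> \<phi> \<in> reg (swf_sub X W) ?W"
      using W(3) V f by (auto simp: swf_morphism_def)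
    then have "f \<circ> \<phi> \<in> reg X ?W"
      using reg_sub_openin[OF X op[OF W(1,3) V]] by simp
    then show "\<exists>V' g. openin (zar X) V' \<and> x \<in> V' \<and> g \<in> reg X V' \<and>
        (\<forall>y\<in>V' \<inter> {x \<in> pts X. \<phi> x \<in> V}. (f \<circ> \<phi>) y = g y)"
      using op[OF W(1,3) V] W x by (intro exI[of _ ?W] exI[of _ "f \<circ> \<phi>"]) auto
  qed
  then show ?thesis
    using pre im by (auto simp: swf_morphism_def continuous_map_def)
qed

lemma swf_morphism_cong:
  assumes X: "space_with_functions X" and m: "swf_morphism X Y \<phi>"
    and eq: "\<And>x. x \<in> pts X \<Longrightarrow> \<psi> x = \<phi> x"
  shows "swf_morphism X Y \<psi>"
proof -
  have c: "continuous_map (zar X) (zar Y) \<psi>"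
    using m eq continuous_map_eq[of "zar X" "zar Y" \<phi> \<psi>] by (simp add: swf_morphism_def)
  have "f \<circ> \<psi> \<in> reg X {x \<in> pts X. \<psi> x \<in> V}" if V: "openin (zar Y) V" and f: "f \<in> reg Y V" for V f
  proof (rule swf_cong[OF X])
    have e: "{x \<in> pts X. \<psi> x \<in> V} = {x \<in> pts X. \<phi> x \<in> V}"
      using eq by auto
    show "openin (zar X) {x \<in> pts X. \<psi> x \<in> V}"
      unfolding e by (rule swf_morphism_preimage[OF m V])
    show "f \<circ> \<phi> \<in> reg X {x \<in> pts X. \<psi> x \<in> V}"
      unfolding e using m V f by (auto simp: swf_morphism_def)
  qed (use eq in auto)
  with c show ?thesis
    by (simp add: swf_morphism_def)
qed

lemma swf_morphism_sub_sub:
  assumes X: "space_with_functions X" and m: "swf_morphism X Y \<phi>"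
    and im: "\<And>x. x \<in> pts X \<Longrightarrow> x \<in> S \<Longrightarrow> \<phi> x \<in> T"
  shows "swf_morphism (swf_sub X S) (swf_sub Y T) \<phi>"
  by (rule swf_morphism_into_sub[OF space_with_functions_sub[OF X]])
    (use swf_morphism_compose[OF swf_morphism_inclusion m] im in auto)

subsection \<open>Affine space\<close>

lemma polyfun_sum: "(\<And>i. i \<in> A \<Longrightarrow> p i \<in> polyfun I) \<Longrightarrow> (\<lambda>x. \<Sum>i\<in>A. p i x) \<in> polyfun I"
  by (induction A rule: infinite_finite_induct) (auto intro: polyfun.intros)

lemma polyfun_prod: "(\<And>i. i \<in> A \<Longrightarrow> p i \<in> polyfun I) \<Longrightarrow> (\<lambda>x. \<Prod>i\<in>A. p i x) \<in> polyfun I"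
  by (induction A rule: infinite_finite_induct) (auto intro: polyfun.intros)

lemma zar_affine [simp]: "zar (affine_space I) = affine_topology I"
  by (simp add: affine_space_def)

lemma openin_affine_basic: "p \<in> polyfun I \<Longrightarrow> openin (affine_topology I) {x \<in> affine_points I. p x \<noteq> 0}"
  unfolding affine_topology_def by (rule topology_generated_by_Basis) blast

lemma pts_affine [simp]: "topspace (affine_topology I) = (affine_points I :: ('i \<Rightarrow> 'k::field) set)"
proof
  have "{x \<in> affine_points I. (1::'k) \<noteq> 0} = affine_points I"
    by simp
  then have "openin (affine_topology I) (affine_points I :: ('i \<Rightarrow> 'k) set)"
    using openin_affine_basic[OF polyfun.const[of 1 I]] by simp
  then show "affine_points I \<subseteq> topspace (affine_topology I :: ('i \<Rightarrow> 'k) topology)"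
    by (rule openin_subset)
  show "topspace (affine_topology I) \<subseteq> (affine_points I :: ('i \<Rightarrow> 'k) set)"
    unfolding affine_topology_def topology_generated_by_topspace by blast
qed

lemma openin_affine_cases:
  assumes "openin (affine_topology I) W" and "x \<in> W"
  shows "\<exists>p\<in>polyfun I. p x \<noteq> 0 \<and> {y \<in> affine_points I. p y \<noteq> 0} \<subseteq> W"
proof -
  have "generate_topology_on {{x \<in> affine_points I. p x \<noteq> 0} | p. p \<in> polyfun I} W"
    using assms(1) unfolding affine_topology_def by (rule openin_topology_generated_by)
  then show ?thesis
    using assms(2)
  proof induction
    case (Int A B)
    have "x \<in> A" "x \<in> B"
      using Int.prems by auto
    obtain p where p: "p \<in> polyfun I" "p x \<noteq> 0" "{y \<in> affine_points I. p y \<noteq> 0} \<subseteq> A"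
      using Int.IH(1)[OF \<open>x \<in> A\<close>] by (elim bexE conjE)
    obtain q where q: "q \<in> polyfun I" "q x \<noteq> 0" "{y \<in> affine_points I. q y \<noteq> 0} \<subseteq> B"
      using Int.IH(2)[OF \<open>x \<in> B\<close>] by (elim bexE conjE)
    show ?case
      using p q by (intro bexI[of _ "\<lambda>x. p x * q x"]) (auto intro: polyfun.mult)
  next
    case (UN K)
    then obtain k where k: "k \<in> K" "x \<in> k"
      by blast
    obtain p where p: "p \<in> polyfun I" "p x \<noteq> 0" "{y \<in> affine_points I. p y \<noteq> 0} \<subseteq> k"
      using UN.IH[OF k] by (elim bexE conjE)
    show ?case
      using p k(1) by (intro bexI[of _ p]) auto
  next
    case (Basis s)
    then obtain p where "p \<in> polyfun I" "s = {x \<in> affine_points I. p x \<noteq> 0}"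
      by blast
    then show ?case
      using Basis.prems by (intro bexI[of _ p]) auto
  qed simp
qed

lemma reg_affine_iff:
  "f \<in> reg (affine_space I) U \<longleftrightarrow>
     (\<forall>x\<in>U. \<exists>V p q. openin (affine_topology I) V \<and> x \<in> V \<and> V \<subseteq> U \<and>
                       p \<in> polyfun I \<and> q \<in> polyfun I \<and> (\<forall>y\<in>V. q y \<noteq> 0 \<and> f y = p y / q y))"
  by (simp add: affine_space_def)

lemma reg_affineE:
  assumes "f \<in> reg (affine_space I) U" and "x \<in> U"
  obtains V p q where "openin (affine_topology I) V" "x \<in> V" "V \<subseteq> U"
    "p \<in> polyfun I" "q \<in> polyfun I" "\<forall>y\<in>V. q y \<noteq> 0" "\<forall>y\<in>V. f y = p y / q y"
proof -
  obtain V p q where V: "openin (affine_topology I) V" "x \<in> V" "V \<subseteq> U"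
    "p \<in> polyfun I" "q \<in> polyfun I" "\<forall>y\<in>V. q y \<noteq> 0 \<and> f y = p y / q y"
    using bspec[OF assms(1)[unfolded reg_affine_iff] assms(2)] by (elim exE conjE)
  show ?thesis
    by (rule that[OF V(1-5)]) (use V(6) in simp_all)
qed

lemma reg_affineI:
  assumes "\<And>x. x \<in> U \<Longrightarrow> \<exists>V p q. openin (affine_topology I) V \<and> x \<in> V \<and> V \<subseteq> U \<and>
                       p \<in> polyfun I \<and> q \<in> polyfun I \<and> (\<forall>y\<in>V. q y \<noteq> 0 \<and> f y = p y / q y)"
  shows "f \<in> reg (affine_space I) U"
  unfolding reg_affine_iff using assms by (rule ballI)

lemma polyfun_in_reg:
  assumes "openin (affine_topology I) U" and "p \<in> polyfun I"
  shows "p \<in> reg (affine_space I) U"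
proof (rule reg_affineI)
  fix x assume "x \<in> U"
  then show "\<exists>V p' q. openin (affine_topology I) V \<and> x \<in> V \<and> V \<subseteq> U \<and>
      p' \<in> polyfun I \<and> q \<in> polyfun I \<and> (\<forall>y\<in>V. q y \<noteq> 0 \<and> p y = p' y / q y)"
    using assms polyfun.const[of 1 I] by (intro exI[of _ U] exI[of _ p] exI[of _ "\<lambda>_. 1"]) simp
qed

lemma space_with_functions_affine: "space_with_functions (affine_space I :: ('i \<Rightarrow> 'k::field, 'k) swf)"
proof (rule space_with_functionsI)
  fix U and c :: 'k
  assume "openin (zar (affine_space I :: ('i \<Rightarrow> 'k, 'k) swf)) U"
  then show "(\<lambda>_. c) \<in> reg (affine_space I) U"
    by (intro polyfun_in_reg) (simp_all add: polyfun.const)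
next
  fix U and f g :: "('i \<Rightarrow> 'k) \<Rightarrow> 'k"
  assume f: "f \<in> reg (affine_space I) U" and g: "g \<in> reg (affine_space I) U"
  have ex: "\<exists>V p q p' q'. openin (affine_topology I) V \<and> x \<in> V \<and> V \<subseteq> U \<and>
      p \<in> polyfun I \<and> q \<in> polyfun I \<and> p' \<in> polyfun I \<and> q' \<in> polyfun I \<and>
      (\<forall>y\<in>V. q y \<noteq> 0 \<and> f y = p y / q y \<and> q' y \<noteq> 0 \<and> g y = p' y / q' y)" if x: "x \<in> U" for x
  proof -
    obtain V p q where V: "openin (affine_topology I) V" "x \<in> V" "V \<subseteq> U"
      "p \<in> polyfun I" "q \<in> polyfun I" "\<forall>y\<in>V. q y \<noteq> 0" "\<forall>y\<in>V. f y = p y / q y"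
      by (rule reg_affineE[OF f x])
    obtain V' p' q' where V': "openin (affine_topology I) V'" "x \<in> V'" "V' \<subseteq> U"
      "p' \<in> polyfun I" "q' \<in> polyfun I" "\<forall>y\<in>V'. q' y \<noteq> 0" "\<forall>y\<in>V'. g y = p' y / q' y"
      by (rule reg_affineE[OF g x])
    have "openin (affine_topology I) (V \<inter> V')" "V \<inter> V' \<subseteq> U"
      using V V' by auto
    then show ?thesis
      using V V'
      by (intro exI[of _ "V \<inter> V'"] exI[of _ p] exI[of _ q] exI[of _ p'] exI[of _ q']) simp
  qed
  show "(\<lambda>x. f x + g x) \<in> reg (affine_space I) U"
  proof (rule reg_affineI)
    fix x assume "x \<in> U"
    from ex[OF this] obtain V p q p' q' where V: "openin (affine_topology I) V" "x \<in> V" "V \<subseteq> U"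
      "p \<in> polyfun I" "q \<in> polyfun I" "p' \<in> polyfun I" "q' \<in> polyfun I"
      "\<forall>y\<in>V. q y \<noteq> 0 \<and> f y = p y / q y \<and> q' y \<noteq> 0 \<and> g y = p' y / q' y"
      by (elim exE conjE)
    then show "\<exists>V p q. openin (affine_topology I) V \<and> x \<in> V \<and> V \<subseteq> U \<and>
        p \<in> polyfun I \<and> q \<in> polyfun I \<and> (\<forall>y\<in>V. q y \<noteq> 0 \<and> f y + g y = p y / q y)"
      by (intro exI[of _ V] exI[of _ "\<lambda>y. p y * q' y + p' y * q y"] exI[of _ "\<lambda>y. q y * q' y"])
        (simp add: polyfun.intros add_frac_eq)
  qed
  show "(\<lambda>x. f x * g x) \<in> reg (affine_space I) U"
  proof (rule reg_affineI)
    fix x assume "x \<in> U"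
    from ex[OF this] obtain V p q p' q' where V: "openin (affine_topology I) V" "x \<in> V" "V \<subseteq> U"
      "p \<in> polyfun I" "q \<in> polyfun I" "p' \<in> polyfun I" "q' \<in> polyfun I"
      "\<forall>y\<in>V. q y \<noteq> 0 \<and> f y = p y / q y \<and> q' y \<noteq> 0 \<and> g y = p' y / q' y"
      by (elim exE conjE)
    then show "\<exists>V p q. openin (affine_topology I) V \<and> x \<in> V \<and> V \<subseteq> U \<and>
        p \<in> polyfun I \<and> q \<in> polyfun I \<and> (\<forall>y\<in>V. q y \<noteq> 0 \<and> f y * g y = p y / q y)"
      by (intro exI[of _ V] exI[of _ "\<lambda>y. p y * p' y"] exI[of _ "\<lambda>y. q y * q' y"])
        (simp add: polyfun.intros)
  qed
next
  fix U V and f :: "('i \<Rightarrow> 'k) \<Rightarrow> 'k"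
  assume f: "f \<in> reg (affine_space I) U" and V: "openin (zar (affine_space I)) V" "V \<subseteq> U"
  show "f \<in> reg (affine_space I) V"
  proof (rule reg_affineI)
    fix x assume x: "x \<in> V"
    then have xU: "x \<in> U"
      using V by blast
    obtain W p q where W: "openin (affine_topology I) W" "x \<in> W" "W \<subseteq> U"
      "p \<in> polyfun I" "q \<in> polyfun I" "\<forall>y\<in>W. q y \<noteq> 0" "\<forall>y\<in>W. f y = p y / q y"
      by (rule reg_affineE[OF f xU])
    have "openin (affine_topology I) (W \<inter> V)"
      using W V by auto
    then show "\<exists>W p q. openin (affine_topology I) W \<and> x \<in> W \<and> W \<subseteq> V \<and>
        p \<in> polyfun I \<and> q \<in> polyfun I \<and> (\<forall>y\<in>W. q y \<noteq> 0 \<and> f y = p y / q y)"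
      using W x by (intro exI[of _ "W \<inter> V"] exI[of _ p] exI[of _ q]) simp
  qed
next
  fix U and f :: "('i \<Rightarrow> 'k) \<Rightarrow> 'k"
  assume loc: "\<And>x. x \<in> U \<Longrightarrow> \<exists>V g. openin (zar (affine_space I)) V \<and> x \<in> V \<and> V \<subseteq> U \<and>
      g \<in> reg (affine_space I) V \<and> (\<forall>y\<in>V. f y = g y)"
  show "f \<in> reg (affine_space I) U"
  proof (rule reg_affineI)
    fix x assume "x \<in> U"
    from loc[OF this] obtain V g where V: "openin (zar (affine_space I)) V" "x \<in> V" "V \<subseteq> U"
      "g \<in> reg (affine_space I) V" "\<forall>y\<in>V. f y = g y" by (elim exE conjE)
    obtain W p q where W: "openin (affine_topology I) W" "x \<in> W" "W \<subseteq> V"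
      "p \<in> polyfun I" "q \<in> polyfun I" "\<forall>y\<in>W. q y \<noteq> 0" "\<forall>y\<in>W. g y = p y / q y"
      by (rule reg_affineE[OF V(4,2)])
    have "\<forall>y\<in>W. q y \<noteq> 0 \<and> f y = p y / q y"
      using W V(5) by auto
    then show "\<exists>W p q. openin (affine_topology I) W \<and> x \<in> W \<and> W \<subseteq> U \<and>
        p \<in> polyfun I \<and> q \<in> polyfun I \<and> (\<forall>y\<in>W. q y \<noteq> 0 \<and> f y = p y / q y)"
      using W V(3) by (intro exI[of _ W] exI[of _ p] exI[of _ q]) auto
  qed
next
  fix U and f :: "('i \<Rightarrow> 'k) \<Rightarrow> 'k"
  assume f: "f \<in> reg (affine_space I) U"
  have ex: "\<exists>W p q. openin (affine_topology I) W \<and> x \<in> W \<and> W \<subseteq> {x \<in> U. f x \<noteq> 0} \<and>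
      p \<in> polyfun I \<and> q \<in> polyfun I \<and> (\<forall>y\<in>W. q y \<noteq> 0 \<and> inverse (f y) = p y / q y)"
    if x: "x \<in> {x \<in> U. f x \<noteq> 0}" for x
  proof -
    have xU: "x \<in> U"
      using x by simp
    obtain V p q where V: "openin (affine_topology I) V" "x \<in> V" "V \<subseteq> U"
      "p \<in> polyfun I" "q \<in> polyfun I" "\<forall>y\<in>V. q y \<noteq> 0" "\<forall>y\<in>V. f y = p y / q y"
      by (rule reg_affineE[OF f xU])
    let ?W = "V \<inter> {y \<in> affine_points I. p y \<noteq> 0}"
    have "openin (affine_topology I) ?W"
      using V(1) openin_affine_basic[OF V(4)] by (rule openin_Int)
    moreover have "x \<in> ?W"
      using x V openin_subset[OF V(1)] by auto
    moreover have "?W \<subseteq> {x \<in> U. f x \<noteq> 0}"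
      using V(3,6,7) by auto
    moreover have "\<forall>y\<in>?W. p y \<noteq> 0 \<and> inverse (f y) = q y / p y"
      using V(7) by simp
    ultimately show ?thesis
      using V(4,5) by (intro exI[of _ ?W] exI[of _ q] exI[of _ p] conjI)
  qed
  show "(\<lambda>x. inverse (f x)) \<in> reg (affine_space I) {x \<in> U. f x \<noteq> 0}"
    by (rule reg_affineI) (rule ex)
  show "openin (zar (affine_space I)) {x \<in> U. f x \<noteq> 0}"
  proof (rule openin_localI)
    fix x assume "x \<in> {x \<in> U. f x \<noteq> 0}"
    from ex[OF this] show "\<exists>V. openin (zar (affine_space I)) V \<and> x \<in> V \<and> V \<subseteq> {x \<in> U. f x \<noteq> 0}"
      unfolding zar_affine by (elim exE conjE) (intro exI conjI)
  qed
qed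

text \<open>
  Sums, products and quotients with nonvanishing denominator of regular functions are regular, and
  the functions on affine space are built from its coordinates in this way.
\<close>

lemma swf_morphism_to_affine:
  fixes X :: "('a, 'k::field) swf" and \<phi> :: "'a \<Rightarrow> 'i \<Rightarrow> 'k"
  assumes X: "space_with_functions X"
    and im: "\<And>x. x \<in> pts X \<Longrightarrow> \<phi> x \<in> affine_points I"
    and c: "\<And>i. i \<in> I \<Longrightarrow> (\<lambda>x. \<phi> x i) \<in> reg X (pts X)"
  shows "swf_morphism X (affine_space I) \<phi>"
proof -
  have p: "(\<lambda>x. p (\<phi> x)) \<in> reg X (pts X)" if "p \<in> polyfun I" for p
    by (rule polyfun_reg[OF X openin_topspace c that])
  have cont: "continuous_map (zar X) (affine_topology I) \<phi>"
    unfolding affine_topology_def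
  proof (rule continuous_on_generated_topo)
    fix U :: "('i \<Rightarrow> 'k) set"
    assume "U \<in> {{x \<in> affine_points I. p x \<noteq> 0} |p. p \<in> polyfun I}"
    then obtain p where U: "U = {x \<in> affine_points I. p x \<noteq> 0}" "p \<in> polyfun I"
      by blast
    have "\<phi> -` U \<inter> pts X = {x \<in> pts X. p (\<phi> x) \<noteq> 0}"
      using im U by auto
    then show "openin (zar X) (\<phi> -` U \<inter> pts X)"
      using swf_nonzero_open[OF X openin_topspace p[OF U(2)]] by simp
  next
    show "\<phi> ` pts X \<subseteq> \<Union> {{x \<in> affine_points I. p x \<noteq> 0} |p. p \<in> polyfun I}"
      using im topology_generated_by_topspace[of "{{x \<in> affine_points I. p x \<noteq> 0} |p. p \<in> polyfun I}"]
        pts_affine[of I] unfolding affine_topology_def by auto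
  qed
  have pre: "openin (zar X) {x \<in> pts X. \<phi> x \<in> V}" if "openin (affine_topology I) V" for V
    using cont that by (simp add: continuous_map_def)
  have "f \<circ> \<phi> \<in> reg X {x \<in> pts X. \<phi> x \<in> V}"
    if V: "openin (affine_topology I) V" and f: "f \<in> reg (affine_space I) V" for V f
  proof (rule swf_glue[OF X pre[OF V]])
    fix x assume "x \<in> {x \<in> pts X. \<phi> x \<in> V}"
    then have x: "x \<in> pts X" "\<phi> x \<in> V"
      by auto
    obtain W a b where W: "openin (affine_topology I) W" "\<phi> x \<in> W" "W \<subseteq> V" "a \<in> polyfun I"
      "b \<in> polyfun I" "\<forall>y\<in>W. b y \<noteq> 0" "\<forall>y\<in>W. f y = a y / b y"
      by (rule reg_affineE[OF f x(2)])
    let ?W = "{x \<in> pts X. \<phi> x \<in> W}"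
    have res: "h \<in> reg X ?W" if "h \<in> reg X (pts X)" for h
      by (rule swf_restrict[OF X openin_topspace that pre[OF W(1)]]) auto
    have "(\<lambda>x. a (\<phi> x) / b (\<phi> x)) \<in> reg X ?W"
      by (rule swf_divide[OF X pre[OF W(1)] res[OF p[OF W(4)]] res[OF p[OF W(5)]]]) (use W(6) in simp)
    then show "\<exists>W g. openin (zar X) W \<and> x \<in> W \<and> g \<in> reg X W \<and>
        (\<forall>y\<in>W \<inter> {x \<in> pts X. \<phi> x \<in> V}. (f \<circ> \<phi>) y = g y)"
      using pre[OF W(1)] x W
      by (intro exI[of _ ?W] exI[of _ "\<lambda>x. a (\<phi> x) / b (\<phi> x)"]) simp
  qed
  with cont show ?thesis
    by (simp add: swf_morphism_def)
qed

subsection \<open>Quotients\<close>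

lemma openin_quotient:
  "openin (zar (swf_quotient X q)) V \<longleftrightarrow> V \<subseteq> q ` pts X \<and> openin (zar X) {x \<in> pts X. q x \<in> V}"
  by (simp add: swf_quotient_def openin_quotient_topology)

lemma reg_quotient: "f \<in> reg (swf_quotient X q) U \<longleftrightarrow> f \<circ> q \<in> reg X {x \<in> pts X. q x \<in> U}"
  by (simp add: swf_quotient_def)

lemma pts_quotient [simp]: "pts (swf_quotient X q) = q ` pts X"
proof
  show "pts (swf_quotient X q) \<subseteq> q ` pts X"
    using openin_topspace[of "zar (swf_quotient X q)"] unfolding openin_quotient by simp
  have "{x \<in> pts X. q x \<in> q ` pts X} = pts X"
    by auto
  then have "openin (zar (swf_quotient X q)) (q ` pts X)"
    by (simp add: openin_quotient)
  then show "q ` pts X \<subseteq> pts (swf_quotient X q)"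
    by (rule openin_subset)
qed

lemma space_with_functions_quotient:
  fixes X :: "('a, 'k::field) swf"
  assumes X: "space_with_functions X"
  shows "space_with_functions (swf_quotient X q)"
proof (rule space_with_functionsI)
  fix U and c :: 'k
  assume "openin (zar (swf_quotient X q)) U"
  then have "openin (zar X) {x \<in> pts X. q x \<in> U}"
    by (simp add: openin_quotient)
  then show "(\<lambda>_. c) \<in> reg (swf_quotient X q) U"
    using swf_const[OF X] by (simp add: reg_quotient comp_def)
next
  fix U and f g :: "'b \<Rightarrow> 'k"
  assume U: "openin (zar (swf_quotient X q)) U"
    and f: "f \<in> reg (swf_quotient X q) U" and g: "g \<in> reg (swf_quotient X q) U"
  have o: "openin (zar X) {x \<in> pts X. q x \<in> U}"
    using U by (simp add: openin_quotient)
  show "(\<lambda>x. f x + g x) \<in> reg (swf_quotient X q) U"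
    using swf_add[OF X o, of "f \<circ> q" "g \<circ> q"] f g by (simp add: reg_quotient comp_def)
  show "(\<lambda>x. f x * g x) \<in> reg (swf_quotient X q) U"
    using swf_mult[OF X o, of "f \<circ> q" "g \<circ> q"] f g by (simp add: reg_quotient comp_def)
next
  fix U V and f :: "'b \<Rightarrow> 'k"
  assume "openin (zar (swf_quotient X q)) U" "f \<in> reg (swf_quotient X q) U"
    "openin (zar (swf_quotient X q)) V" "V \<subseteq> U"
  then show "f \<in> reg (swf_quotient X q) V"
    unfolding reg_quotient openin_quotient
    by (elim conjE) (rule swf_restrict[OF X], assumption+, auto)
next
  fix U and f :: "'b \<Rightarrow> 'k"
  assume U: "openin (zar (swf_quotient X q)) U"
    and loc: "\<And>x. x \<in> U \<Longrightarrow> \<exists>V g. openin (zar (swf_quotient X q)) V \<and> x \<in> V \<and> V \<subseteq> U \<and>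
      g \<in> reg (swf_quotient X q) V \<and> (\<forall>y\<in>V. f y = g y)"
  have o: "openin (zar X) {x \<in> pts X. q x \<in> U}"
    using U by (simp add: openin_quotient)
  show "f \<in> reg (swf_quotient X q) U"
    unfolding reg_quotient
  proof (rule swf_glue[OF X o])
    fix x assume "x \<in> {x \<in> pts X. q x \<in> U}"
    then have x: "x \<in> pts X" "q x \<in> U"
      by auto
    obtain V g where V: "openin (zar (swf_quotient X q)) V" "q x \<in> V" "V \<subseteq> U"
      "g \<in> reg (swf_quotient X q) V" "\<forall>y\<in>V. f y = g y"
      using loc[OF x(2)] by (elim exE conjE)
    then show "\<exists>V g. openin (zar X) V \<and> x \<in> V \<and> g \<in> reg X V \<and>
        (\<forall>y\<in>V \<inter> {x \<in> pts X. q x \<in> U}. (f \<circ> q) y = g y)"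
      using x by (intro exI[of _ "{x \<in> pts X. q x \<in> V}"] exI[of _ "g \<circ> q"])
        (simp add: reg_quotient openin_quotient)
  qed
next
  fix U and f :: "'b \<Rightarrow> 'k"
  assume U: "openin (zar (swf_quotient X q)) U" and f: "f \<in> reg (swf_quotient X q) U"
  have o: "openin (zar X) {x \<in> pts X. q x \<in> U}" and sub: "U \<subseteq> q ` pts X"
    using U by (simp_all add: openin_quotient)
  have e: "{x \<in> pts X. q x \<in> {x \<in> U. f x \<noteq> 0}} = {x \<in> {x \<in> pts X. q x \<in> U}. (f \<circ> q) x \<noteq> 0}"
    by auto
  show "openin (zar (swf_quotient X q)) {x \<in> U. f x \<noteq> 0}"
    unfolding openin_quotient e
    using swf_nonzero_open[OF X o f[unfolded reg_quotient]] sub by blast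
  show "(\<lambda>x. inverse (f x)) \<in> reg (swf_quotient X q) {x \<in> U. f x \<noteq> 0}"
    unfolding reg_quotient e
    using swf_inverse[OF X o f[unfolded reg_quotient]] by (simp add: comp_def)
qed

lemma swf_morphism_quotient: "swf_morphism X (swf_quotient X q) q"
proof -
  have "f \<circ> q \<in> reg X {x \<in> pts X. q x \<in> V}" if "f \<in> reg (swf_quotient X q) V" for V f
    using that unfolding reg_quotient .
  then show ?thesis
    unfolding swf_morphism_def continuous_map_def
    by (auto simp: openin_quotient simp del: o_apply)
qed

text \<open>
  Continuity and regularity on a quotient are defined by pullback, so a map on it may be tested upstairs.
  The set \<open>W\<close> allows maps that are only defined locally.
\<close>

lemma swf_morphism_from_quotient:
  assumes X: "space_with_functions X" and W: "openin (zar (swf_quotient X q)) W"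
    and m: "swf_morphism (swf_sub X {x \<in> pts X. q x \<in> W}) Z (\<lambda>x. \<psi> (q x))"
  shows "swf_morphism (swf_sub (swf_quotient X q) W) Z \<psi>"
proof -
  let ?Q = "swf_quotient X q" and ?W = "{x \<in> pts X. q x \<in> W}"
  have oW: "openin (zar X) ?W" and WX: "W \<subseteq> q ` pts X"
    using W by (simp_all add: openin_quotient)
  have pW: "pts (swf_sub ?Q W) = W"
    using WX by auto
  have pX: "pts (swf_sub X ?W) = ?W"
    by auto
  have pre: "openin (zar ?Q) {w \<in> W. \<psi> w \<in> V}" and preX: "openin (zar X) {x \<in> ?W. \<psi> (q x) \<in> V}"
    if V: "openin (zar Z) V" for V
  proof -
    have "openin (subtopology (zar X) ?W) {x \<in> ?W. \<psi> (q x) \<in> V}"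
      using swf_morphism_preimage[OF m V] unfolding pX by simp
    then show o: "openin (zar X) {x \<in> ?W. \<psi> (q x) \<in> V}"
      using oW by (rule openin_trans_full)
    have "{x \<in> pts X. q x \<in> {w \<in> W. \<psi> w \<in> V}} = {x \<in> ?W. \<psi> (q x) \<in> V}"
      by auto
    then show "openin (zar ?Q) {w \<in> W. \<psi> w \<in> V}"
      using o WX unfolding openin_quotient by auto
  qed
  have im: "\<psi> w \<in> pts Z" if "w \<in> W" for w
  proof -
    have "w \<in> q ` pts X"
      using WX that by blast
    then show ?thesis
      using swf_morphism_in_pts[OF m] that by auto
  qed
  have "continuous_map (zar (swf_sub ?Q W)) (zar Z) \<psi>"
    unfolding continuous_map_def pW
  proof (intro conjI allI impI)
    show "\<psi> \<in> W \<rightarrow> pts Z"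
      using im by blast
    fix V assume "openin (zar Z) V"
    then show "openin (zar (swf_sub ?Q W)) {w \<in> W. \<psi> w \<in> V}"
      using pre by (auto simp: openin_subtopology)
  qed
  moreover have "f \<circ> \<psi> \<in> reg (swf_sub ?Q W) {w \<in> pts (swf_sub ?Q W). \<psi> w \<in> V}"
    if V: "openin (zar Z) V" and f: "f \<in> reg Z V" for V f
  proof -
    have "f \<circ> (\<lambda>x. \<psi> (q x)) \<in> reg (swf_sub X ?W) {x \<in> pts (swf_sub X ?W). \<psi> (q x) \<in> V}"
      using m V f by (simp add: swf_morphism_def)
    then have "f \<circ> (\<lambda>x. \<psi> (q x)) \<in> reg X {x \<in> ?W. \<psi> (q x) \<in> V}"
      unfolding pX using reg_sub_openin[OF X preX[OF V]] by simp
    moreover have "{x \<in> pts X. q x \<in> {w \<in> W. \<psi> w \<in> V}} = {x \<in> ?W. \<psi> (q x) \<in> V}"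
      by auto
    ultimately have "f \<circ> \<psi> \<in> reg ?Q {w \<in> W. \<psi> w \<in> V}"
      by (simp add: reg_quotient comp_def)
    then show ?thesis
      unfolding pW using reg_sub_openin[OF space_with_functions_quotient[OF X] pre[OF V]] by simp
  qed
  ultimately show ?thesis
    by (simp add: swf_morphism_def)
qed

subsection \<open>Products\<close>

lemma tensor_simple:
  assumes "f \<in> reg X U" and "g \<in> reg Y V"
  shows "(\<lambda>z. f (fst z) * g (snd z)) \<in> tensor_functions X Y U V"
  unfolding tensor_functions_def
  using assms by (intro CollectI exI[of _ 1] exI[of _ "\<lambda>_. f"] exI[of _ "\<lambda>_. g"]) simp

lemma tensorE:
  assumes "h \<in> tensor_functions X Y U V"
  obtains m :: nat and f g where "\<forall>i<m. f i \<in> reg X U \<and> g i \<in> reg Y V"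
    "h = (\<lambda>z. \<Sum>i<m. f i (fst z) * g i (snd z))"
  using assms unfolding tensor_functions_def by (elim CollectE exE conjE) (rule that)

lemma tensor_add:
  assumes "h \<in> tensor_functions X Y U V" and "h' \<in> tensor_functions X Y U V"
  shows "(\<lambda>z. h z + h' z) \<in> tensor_functions X Y U V"
proof -
  obtain m :: nat and f g where h: "\<forall>i<m. f i \<in> reg X U \<and> g i \<in> reg Y V"
    "h = (\<lambda>z. \<Sum>i<m. f i (fst z) * g i (snd z))"
    by (rule tensorE[OF assms(1)])
  obtain m' :: nat and f' g' where h': "\<forall>i<m'. f' i \<in> reg X U \<and> g' i \<in> reg Y V"
    "h' = (\<lambda>z. \<Sum>i<m'. f' i (fst z) * g' i (snd z))"
    by (rule tensorE[OF assms(2)])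
  let ?f = "\<lambda>i. if i < m then f i else f' (i - m)" and ?g = "\<lambda>i. if i < m then g i else g' (i - m)"
  have "(\<Sum>i<m + m'. ?f i x * ?g i y) = (\<Sum>i<m. f i x * g i y) + (\<Sum>i<m'. f' i x * g' i y)" for x y
    by (induction m') simp_all
  moreover have "?f i \<in> reg X U" "?g i \<in> reg Y V" if "i < m + m'" for i
    using that h h' by auto
  ultimately show ?thesis
    unfolding tensor_functions_def h h'
    by (intro CollectI exI[of _ "m + m'"] exI[of _ ?f] exI[of _ ?g]) simp
qed

lemma tensor_sum:
  assumes "finite I" and "I \<noteq> {}" and "\<And>i. i \<in> I \<Longrightarrow> h i \<in> tensor_functions X Y U V"
  shows "(\<lambda>z. \<Sum>i\<in>I. h i z) \<in> tensor_functions X Y U V"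
  using assms by (induction I rule: finite_ne_induct) (auto intro: tensor_add)

context
  fixes X :: "('a, 'k::field) swf" and Y :: "('b, 'k) swf"
  assumes X: "space_with_functions X" and Y: "space_with_functions Y"
begin

lemma tensor_const:
  assumes U: "openin (zar X) U" and V: "openin (zar Y) V"
  shows "(\<lambda>_. c) \<in> tensor_functions X Y U V"
  using tensor_simple[OF swf_const[OF X U, of c] swf_const[OF Y V, of 1]] by simp

lemma tensor_mult:
  assumes U: "openin (zar X) U" and V: "openin (zar Y) V"
    and h: "h \<in> tensor_functions X Y U V" and h': "h' \<in> tensor_functions X Y U V"
  shows "(\<lambda>z. h z * h' z) \<in> tensor_functions X Y U V"
proof -
  have simple: "(\<lambda>z. (f (fst z) * g (snd z)) * h' z) \<in> tensor_functions X Y U V"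
    if f: "f \<in> reg X U" and g: "g \<in> reg Y V" for f g
  proof -
    obtain m :: nat and f' g' where h': "\<forall>i<m. f' i \<in> reg X U \<and> g' i \<in> reg Y V"
      "h' = (\<lambda>z. \<Sum>i<m. f' i (fst z) * g' i (snd z))"
      by (rule tensorE[OF h'])
    have "(\<lambda>x. f x * f' i x) \<in> reg X U" "(\<lambda>y. g y * g' i y) \<in> reg Y V" if "i < m" for i
      using swf_mult[OF X U f] swf_mult[OF Y V g] h'(1) that by auto
    then show ?thesis
      unfolding tensor_functions_def h'(2)
      by (intro CollectI exI[of _ m] exI[of _ "\<lambda>i x. f x * f' i x"] exI[of _ "\<lambda>i y. g y * g' i y"])
        (simp add: sum_distrib_left mult_ac)
  qed
  obtain m :: nat and f g where h: "\<forall>i<m. f i \<in> reg X U \<and> g i \<in> reg Y V"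
    "h = (\<lambda>z. \<Sum>i<m. f i (fst z) * g i (snd z))"
    by (rule tensorE[OF h])
  show ?thesis
  proof (cases "m = 0")
    case True
    then show ?thesis
      using h tensor_const[OF U V, of 0] by simp
  next
    case False
    have "(\<lambda>z. \<Sum>i<m. (f i (fst z) * g i (snd z)) * h' z) \<in> tensor_functions X Y U V"
      by (rule tensor_sum) (use False h simple in auto)
    then show ?thesis
      by (simp add: h sum_distrib_right)
  qed
qed

lemma tensor_restrict:
  assumes U: "openin (zar X) U" and V: "openin (zar Y) V"
    and U': "openin (zar X) U'" "U' \<subseteq> U" and V': "openin (zar Y) V'" "V' \<subseteq> V"
    and h: "h \<in> tensor_functions X Y U V"
  shows "h \<in> tensor_functions X Y U' V'"
proof -
  obtain m :: nat and f g where h: "\<forall>i<m. f i \<in> reg X U \<and> g i \<in> reg Y V"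
    "h = (\<lambda>z. \<Sum>i<m. f i (fst z) * g i (snd z))"
    by (rule tensorE[OF h])
  have "f i \<in> reg X U'" "g i \<in> reg Y V'" if "i < m" for i
    using swf_restrict[OF X U _ U'] swf_restrict[OF Y V _ V'] h(1) that by auto
  then show ?thesis
    unfolding tensor_functions_def h(2)
    by (intro CollectI exI[of _ m] exI[of _ f] exI[of _ g]) simp
qed

lemma openin_prod_basic:
  assumes "openin (zar X) U" and "openin (zar Y) V" and "h \<in> tensor_functions X Y U V"
  shows "openin (zar (swf_prod X Y)) {z \<in> U \<times> V. h z \<noteq> 0}"
proof -
  have "{z \<in> U \<times> V. h z \<noteq> 0} \<in> {{z \<in> U \<times> V. h z \<noteq> 0} | U V h.
                 openin (zar X) U \<and> openin (zar Y) V \<and> h \<in> tensor_functions X Y U V}"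
    using assms by (intro CollectI exI conjI) (rule refl)
  then show ?thesis
    by (simp add: swf_prod_def topology_generated_by_Basis)
qed

lemma openin_prod_Times:
  assumes "openin (zar X) U" and "openin (zar Y) V"
  shows "openin (zar (swf_prod X Y)) (U \<times> V)"
  using openin_prod_basic[OF assms tensor_const[OF assms, of 1]] by simp

lemma pts_prod: "pts (swf_prod X Y) = pts X \<times> pts Y"
proof
  have "U \<times> V \<subseteq> pts X \<times> pts Y" if "openin (zar X) U" "openin (zar Y) V" for U V
    using openin_subset[OF that(1)] openin_subset[OF that(2)] by blast
  then show "pts (swf_prod X Y) \<subseteq> pts X \<times> pts Y"
    unfolding swf_prod_def swf.simps topology_generated_by_topspace by auto
  show "pts X \<times> pts Y \<subseteq> pts (swf_prod X Y)"
    by (rule openin_subset, rule openin_prod_Times) simp_all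
qed

lemma openin_prod_cases:
  assumes "openin (zar (swf_prod X Y)) W" and "z \<in> W"
  obtains U V h where "openin (zar X) U" "openin (zar Y) V" "h \<in> tensor_functions X Y U V"
    "z \<in> U \<times> V" "h z \<noteq> 0" "{z \<in> U \<times> V. h z \<noteq> 0} \<subseteq> W"
proof -
  have "generate_topology_on {{z \<in> U \<times> V. h z \<noteq> 0} | U V h.
      openin (zar X) U \<and> openin (zar Y) V \<and> h \<in> tensor_functions X Y U V} W"
    using assms(1) unfolding swf_prod_def swf.simps by (rule openin_topology_generated_by)
  then have "\<exists>U V h. openin (zar X) U \<and> openin (zar Y) V \<and> h \<in> tensor_functions X Y U V \<and>
      z \<in> U \<times> V \<and> h z \<noteq> 0 \<and> {z \<in> U \<times> V. h z \<noteq> 0} \<subseteq> W"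
    using assms(2)
  proof induction
    case (Int A B)
    have "z \<in> A" "z \<in> B"
      using Int.prems by auto
    obtain U V h where A: "openin (zar X) U" "openin (zar Y) V" "h \<in> tensor_functions X Y U V"
      "z \<in> U \<times> V" "h z \<noteq> 0" "{z \<in> U \<times> V. h z \<noteq> 0} \<subseteq> A"
      using Int.IH(1)[OF \<open>z \<in> A\<close>] by (elim exE conjE)
    obtain U' V' h' where B: "openin (zar X) U'" "openin (zar Y) V'" "h' \<in> tensor_functions X Y U' V'"
      "z \<in> U' \<times> V'" "h' z \<noteq> 0" "{z \<in> U' \<times> V'. h' z \<noteq> 0} \<subseteq> B"
      using Int.IH(2)[OF \<open>z \<in> B\<close>] by (elim exE conjE)
    have o: "openin (zar X) (U \<inter> U')" "openin (zar Y) (V \<inter> V')"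
      using A B by auto
    have "h \<in> tensor_functions X Y (U \<inter> U') (V \<inter> V')"
      using tensor_restrict[OF A(1,2) o(1) _ o(2) _ A(3)] by simp
    moreover have "h' \<in> tensor_functions X Y (U \<inter> U') (V \<inter> V')"
      using tensor_restrict[OF B(1,2) o(1) _ o(2) _ B(3)] by simp
    ultimately have "(\<lambda>z. h z * h' z) \<in> tensor_functions X Y (U \<inter> U') (V \<inter> V')"
      by (rule tensor_mult[OF o])
    then show ?case
      using o A B
      by (intro exI[of _ "U \<inter> U'"] exI[of _ "V \<inter> V'"] exI[of _ "\<lambda>z. h z * h' z"] conjI) auto
  next
    case (UN K)
    then obtain k where k: "k \<in> K" "z \<in> k"
      by blast
    obtain U V h where A: "openin (zar X) U" "openin (zar Y) V" "h \<in> tensor_functions X Y U V"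
      "z \<in> U \<times> V" "h z \<noteq> 0" "{z \<in> U \<times> V. h z \<noteq> 0} \<subseteq> k"
      using UN.IH[OF k] by (elim exE conjE)
    then show ?case
      using k(1) by (intro exI[of _ U] exI[of _ V] exI[of _ h] conjI) auto
  next
    case (Basis s)
    then obtain U V h where A: "openin (zar X) U" "openin (zar Y) V" "h \<in> tensor_functions X Y U V"
      "s = {z \<in> U \<times> V. h z \<noteq> 0}"
      by (elim CollectE exE conjE)
    then show ?case
      using Basis.prems by (intro exI[of _ U] exI[of _ V] exI[of _ h] conjI) auto
  qed simp
  then show ?thesis
    by (elim exE conjE) (rule that)
qed

lemma reg_prod_iff:
  "f \<in> reg (swf_prod X Y) W \<longleftrightarrow> (\<forall>z\<in>W. \<exists>U V a b. openin (zar X) U \<and> openin (zar Y) V \<and>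
     a \<in> tensor_functions X Y U V \<and> b \<in> tensor_functions X Y U V \<and> z \<in> U \<times> V \<and> b z \<noteq> 0 \<and>
     (\<forall>z'\<in>W \<inter> (U \<times> V). b z' \<noteq> 0 \<longrightarrow> f z' = a z' / b z'))"
  by (simp add: swf_prod_def)

lemma reg_prodE:
  assumes "f \<in> reg (swf_prod X Y) W" and "z \<in> W"
  obtains U V a b where "openin (zar X) U" "openin (zar Y) V"
    "a \<in> tensor_functions X Y U V" "b \<in> tensor_functions X Y U V" "z \<in> U \<times> V" "b z \<noteq> 0"
    "\<forall>z'\<in>W \<inter> (U \<times> V). b z' \<noteq> 0 \<longrightarrow> f z' = a z' / b z'"
  using bspec[OF assms(1)[unfolded reg_prod_iff] assms(2)] by (elim exE conjE) (rule that)

lemma reg_prodI: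
  assumes "\<And>z. z \<in> W \<Longrightarrow> \<exists>U V a b. openin (zar X) U \<and> openin (zar Y) V \<and>
     a \<in> tensor_functions X Y U V \<and> b \<in> tensor_functions X Y U V \<and> z \<in> U \<times> V \<and> b z \<noteq> 0 \<and>
     (\<forall>z'\<in>W \<inter> (U \<times> V). b z' \<noteq> 0 \<longrightarrow> f z' = a z' / b z')"
  shows "f \<in> reg (swf_prod X Y) W"
  unfolding reg_prod_iff using assms by (rule ballI)

lemma tensor_in_reg_prod:
  assumes "openin (zar X) U" and "openin (zar Y) V" and "h \<in> tensor_functions X Y U V"
    and "W \<subseteq> U \<times> V"
  shows "h \<in> reg (swf_prod X Y) W"
proof (rule reg_prodI)
  fix z assume "z \<in> W"
  then show "\<exists>U V a b. openin (zar X) U \<and> openin (zar Y) V \<and>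
     a \<in> tensor_functions X Y U V \<and> b \<in> tensor_functions X Y U V \<and> z \<in> U \<times> V \<and> b z \<noteq> 0 \<and>
     (\<forall>z'\<in>W \<inter> (U \<times> V). b z' \<noteq> 0 \<longrightarrow> h z' = a z' / b z')"
    using assms tensor_const[OF assms(1,2), of 1]
    by (intro exI[of _ U] exI[of _ V] exI[of _ h] exI[of _ "\<lambda>_. 1"] conjI) auto
qed

lemma space_with_functions_prod: "space_with_functions (swf_prod X Y)"
proof (rule space_with_functionsI)
  fix W and c :: 'k
  assume W: "openin (zar (swf_prod X Y)) W"
  then show "(\<lambda>_. c) \<in> reg (swf_prod X Y) W"
    using openin_subset[OF W] unfolding pts_prod
    by (intro tensor_in_reg_prod[OF _ _ tensor_const]) auto
next
  fix W and f g :: "'a \<times> 'b \<Rightarrow> 'k"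
  assume f: "f \<in> reg (swf_prod X Y) W" and g: "g \<in> reg (swf_prod X Y) W"
  have ex: "\<exists>U V a b a' b'. openin (zar X) U \<and> openin (zar Y) V \<and>
     a \<in> tensor_functions X Y U V \<and> b \<in> tensor_functions X Y U V \<and>
     a' \<in> tensor_functions X Y U V \<and> b' \<in> tensor_functions X Y U V \<and>
     z \<in> U \<times> V \<and> b z \<noteq> 0 \<and> b' z \<noteq> 0 \<and>
     (\<forall>z'\<in>W \<inter> (U \<times> V). b z' \<noteq> 0 \<longrightarrow> f z' = a z' / b z') \<and>
     (\<forall>z'\<in>W \<inter> (U \<times> V). b' z' \<noteq> 0 \<longrightarrow> g z' = a' z' / b' z')" if z: "z \<in> W" for z
  proof -
    obtain U V a b where A: "openin (zar X) U" "openin (zar Y) V"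
      "a \<in> tensor_functions X Y U V" "b \<in> tensor_functions X Y U V" "z \<in> U \<times> V" "b z \<noteq> 0"
      "\<forall>z'\<in>W \<inter> (U \<times> V). b z' \<noteq> 0 \<longrightarrow> f z' = a z' / b z'"
      by (rule reg_prodE[OF f z])
    obtain U' V' a' b' where B: "openin (zar X) U'" "openin (zar Y) V'"
      "a' \<in> tensor_functions X Y U' V'" "b' \<in> tensor_functions X Y U' V'" "z \<in> U' \<times> V'" "b' z \<noteq> 0"
      "\<forall>z'\<in>W \<inter> (U' \<times> V'). b' z' \<noteq> 0 \<longrightarrow> g z' = a' z' / b' z'"
      by (rule reg_prodE[OF g z])
    have o: "openin (zar X) (U \<inter> U')" "openin (zar Y) (V \<inter> V')"
      using A B by auto
    have tA: "h \<in> tensor_functions X Y (U \<inter> U') (V \<inter> V')" if "h \<in> tensor_functions X Y U V" for h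
      using tensor_restrict[OF A(1,2) o(1) _ o(2) _ that] by simp
    have tB: "h \<in> tensor_functions X Y (U \<inter> U') (V \<inter> V')" if "h \<in> tensor_functions X Y U' V'" for h
      using tensor_restrict[OF B(1,2) o(1) _ o(2) _ that] by simp
    show ?thesis
      using o tA[OF A(3)] tA[OF A(4)] tB[OF B(3)] tB[OF B(4)] A(5-) B(5-)
      by (intro exI[of _ "U \<inter> U'"] exI[of _ "V \<inter> V'"] exI[of _ a] exI[of _ b] exI[of _ a'] exI[of _ b'] conjI)
        auto
  qed
  show "(\<lambda>x. f x + g x) \<in> reg (swf_prod X Y) W"
  proof (rule reg_prodI)
    fix z assume "z \<in> W"
    from ex[OF this] obtain U V a b a' b' where A: "openin (zar X) U" "openin (zar Y) V"
      "a \<in> tensor_functions X Y U V" "b \<in> tensor_functions X Y U V"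
      "a' \<in> tensor_functions X Y U V" "b' \<in> tensor_functions X Y U V" "z \<in> U \<times> V"
      "b z \<noteq> 0" "b' z \<noteq> 0" "\<forall>z'\<in>W \<inter> (U \<times> V). b z' \<noteq> 0 \<longrightarrow> f z' = a z' / b z'"
      "\<forall>z'\<in>W \<inter> (U \<times> V). b' z' \<noteq> 0 \<longrightarrow> g z' = a' z' / b' z'"
      by (elim exE conjE)
    note tm = tensor_mult[OF A(1,2)]
    show "\<exists>U V a b. openin (zar X) U \<and> openin (zar Y) V \<and>
      a \<in> tensor_functions X Y U V \<and> b \<in> tensor_functions X Y U V \<and> z \<in> U \<times> V \<and> b z \<noteq> 0 \<and>
      (\<forall>z'\<in>W \<inter> (U \<times> V). b z' \<noteq> 0 \<longrightarrow> f z' + g z' = a z' / b z')"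
      using A tensor_add[OF tm[OF A(3,6)] tm[OF A(5,4)]] tm[OF A(4,6)]
      by (intro exI[of _ U] exI[of _ V] exI[of _ "\<lambda>z. a z * b' z + a' z * b z"]
          exI[of _ "\<lambda>z. b z * b' z"] conjI) (auto simp: add_frac_eq)
  qed
  show "(\<lambda>x. f x * g x) \<in> reg (swf_prod X Y) W"
  proof (rule reg_prodI)
    fix z assume "z \<in> W"
    from ex[OF this] obtain U V a b a' b' where A: "openin (zar X) U" "openin (zar Y) V"
      "a \<in> tensor_functions X Y U V" "b \<in> tensor_functions X Y U V"
      "a' \<in> tensor_functions X Y U V" "b' \<in> tensor_functions X Y U V" "z \<in> U \<times> V"
      "b z \<noteq> 0" "b' z \<noteq> 0" "\<forall>z'\<in>W \<inter> (U \<times> V). b z' \<noteq> 0 \<longrightarrow> f z' = a z' / b z'"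
      "\<forall>z'\<in>W \<inter> (U \<times> V). b' z' \<noteq> 0 \<longrightarrow> g z' = a' z' / b' z'"
      by (elim exE conjE)
    note tm = tensor_mult[OF A(1,2)]
    show "\<exists>U V a b. openin (zar X) U \<and> openin (zar Y) V \<and>
      a \<in> tensor_functions X Y U V \<and> b \<in> tensor_functions X Y U V \<and> z \<in> U \<times> V \<and> b z \<noteq> 0 \<and>
      (\<forall>z'\<in>W \<inter> (U \<times> V). b z' \<noteq> 0 \<longrightarrow> f z' * g z' = a z' / b z')"
      using A tm[OF A(3,5)] tm[OF A(4,6)]
      by (intro exI[of _ U] exI[of _ V] exI[of _ "\<lambda>z. a z * a' z"]
          exI[of _ "\<lambda>z. b z * b' z"] conjI) auto
  qed
next
  fix W W' and f :: "'a \<times> 'b \<Rightarrow> 'k"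
  assume f: "f \<in> reg (swf_prod X Y) W" and W': "W' \<subseteq> W"
  show "f \<in> reg (swf_prod X Y) W'"
  proof (rule reg_prodI)
    fix z assume "z \<in> W'"
    then have z: "z \<in> W"
      using W' by blast
    obtain U V a b where A: "openin (zar X) U" "openin (zar Y) V"
      "a \<in> tensor_functions X Y U V" "b \<in> tensor_functions X Y U V" "z \<in> U \<times> V" "b z \<noteq> 0"
      "\<forall>z'\<in>W \<inter> (U \<times> V). b z' \<noteq> 0 \<longrightarrow> f z' = a z' / b z'"
      by (rule reg_prodE[OF f z])
    then show "\<exists>U V a b. openin (zar X) U \<and> openin (zar Y) V \<and>
      a \<in> tensor_functions X Y U V \<and> b \<in> tensor_functions X Y U V \<and> z \<in> U \<times> V \<and> b z \<noteq> 0 \<and>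
      (\<forall>z'\<in>W' \<inter> (U \<times> V). b z' \<noteq> 0 \<longrightarrow> f z' = a z' / b z')"
      using W' by (intro exI[of _ U] exI[of _ V] exI[of _ a] exI[of _ b] conjI) auto
  qed
next
  fix W and f :: "'a \<times> 'b \<Rightarrow> 'k"
  assume loc: "\<And>z. z \<in> W \<Longrightarrow> \<exists>W' g. openin (zar (swf_prod X Y)) W' \<and> z \<in> W' \<and> W' \<subseteq> W \<and>
      g \<in> reg (swf_prod X Y) W' \<and> (\<forall>y\<in>W'. f y = g y)"
  show "f \<in> reg (swf_prod X Y) W"
  proof (rule reg_prodI)
    fix z assume "z \<in> W"
    from loc[OF this] obtain W' g where W': "openin (zar (swf_prod X Y)) W'" "z \<in> W'" "W' \<subseteq> W"
      "g \<in> reg (swf_prod X Y) W'" "\<forall>y\<in>W'. f y = g y"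
      by (elim exE conjE)
    obtain U V a b where A: "openin (zar X) U" "openin (zar Y) V"
      "a \<in> tensor_functions X Y U V" "b \<in> tensor_functions X Y U V" "z \<in> U \<times> V" "b z \<noteq> 0"
      "\<forall>z'\<in>W' \<inter> (U \<times> V). b z' \<noteq> 0 \<longrightarrow> g z' = a z' / b z'"
      by (rule reg_prodE[OF W'(4,2)])
    obtain U' V' h where B: "openin (zar X) U'" "openin (zar Y) V'" "h \<in> tensor_functions X Y U' V'"
      "z \<in> U' \<times> V'" "h z \<noteq> 0" "{z \<in> U' \<times> V'. h z \<noteq> 0} \<subseteq> W'"
      by (rule openin_prod_cases[OF W'(1,2)])
    \<comment> \<open>Multiplying numerator and denominator by \<open>h\<close> confines the identity to \<open>W'\<close>.\<close>
    have o: "openin (zar X) (U \<inter> U')" "openin (zar Y) (V \<inter> V')"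
      using A B by auto
    have tA: "k \<in> tensor_functions X Y (U \<inter> U') (V \<inter> V')" if "k \<in> tensor_functions X Y U V" for k
      using tensor_restrict[OF A(1,2) o(1) _ o(2) _ that] by simp
    have tB: "h \<in> tensor_functions X Y (U \<inter> U') (V \<inter> V')"
      using tensor_restrict[OF B(1,2) o(1) _ o(2) _ B(3)] by simp
    have "f z' = (a z' * h z') / (b z' * h z')"
      if z': "z' \<in> (U \<inter> U') \<times> (V \<inter> V')" "b z' * h z' \<noteq> 0" for z'
    proof -
      have "z' \<in> W'"
        using z' B(6) by auto
      then show ?thesis
        using z' A(7) W'(5) by auto
    qed
    then show "\<exists>U V a b. openin (zar X) U \<and> openin (zar Y) V \<and>
      a \<in> tensor_functions X Y U V \<and> b \<in> tensor_functions X Y U V \<and> z \<in> U \<times> V \<and> b z \<noteq> 0 \<and>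
      (\<forall>z'\<in>W \<inter> (U \<times> V). b z' \<noteq> 0 \<longrightarrow> f z' = a z' / b z')"
      using o A(5,6) B(4,5) tensor_mult[OF o tA[OF A(3)] tB] tensor_mult[OF o tA[OF A(4)] tB]
      by (intro exI[of _ "U \<inter> U'"] exI[of _ "V \<inter> V'"] exI[of _ "\<lambda>z. a z * h z"]
          exI[of _ "\<lambda>z. b z * h z"] conjI) auto
  qed
next
  fix W and f :: "'a \<times> 'b \<Rightarrow> 'k"
  assume W: "openin (zar (swf_prod X Y)) W" and f: "f \<in> reg (swf_prod X Y) W"
  have ex: "\<exists>U V a b. openin (zar X) U \<and> openin (zar Y) V \<and>
     a \<in> tensor_functions X Y U V \<and> b \<in> tensor_functions X Y U V \<and> z \<in> U \<times> V \<and> a z * b z \<noteq> 0 \<and>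
     (\<forall>z'\<in>W \<inter> (U \<times> V). b z' \<noteq> 0 \<longrightarrow> f z' = a z' / b z')" if z: "z \<in> {z \<in> W. f z \<noteq> 0}" for z
  proof -
    have zW: "z \<in> W"
      using z by simp
    obtain U V a b where A: "openin (zar X) U" "openin (zar Y) V"
      "a \<in> tensor_functions X Y U V" "b \<in> tensor_functions X Y U V" "z \<in> U \<times> V" "b z \<noteq> 0"
      "\<forall>z'\<in>W \<inter> (U \<times> V). b z' \<noteq> 0 \<longrightarrow> f z' = a z' / b z'"
      by (rule reg_prodE[OF f zW])
    then have "a z * b z \<noteq> 0"
      using z by auto
    then show ?thesis
      using A by (intro exI[of _ U] exI[of _ V] exI[of _ a] exI[of _ b] conjI)
  qed
  show "openin (zar (swf_prod X Y)) {z \<in> W. f z \<noteq> 0}"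
  proof (rule openin_localI)
    fix z assume z: "z \<in> {z \<in> W. f z \<noteq> 0}"
    from ex[OF z] obtain U V a b where A: "openin (zar X) U" "openin (zar Y) V"
      "a \<in> tensor_functions X Y U V" "b \<in> tensor_functions X Y U V" "z \<in> U \<times> V" "a z * b z \<noteq> 0"
      "\<forall>z'\<in>W \<inter> (U \<times> V). b z' \<noteq> 0 \<longrightarrow> f z' = a z' / b z'"
      by (elim exE conjE)
    let ?D = "{z \<in> U \<times> V. a z * b z \<noteq> 0}"
    have "openin (zar (swf_prod X Y)) (?D \<inter> W)"
      using openin_prod_basic[OF A(1,2) tensor_mult[OF A(1-4)]] W by auto
    moreover have "?D \<inter> W \<subseteq> {z \<in> W. f z \<noteq> 0}"
      using A(7) by auto
    ultimately show "\<exists>V. openin (zar (swf_prod X Y)) V \<and> z \<in> V \<and> V \<subseteq> {z \<in> W. f z \<noteq> 0}"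
      using z A(5,6) by (intro exI[of _ "?D \<inter> W"] conjI) auto
  qed
  show "(\<lambda>z. inverse (f z)) \<in> reg (swf_prod X Y) {z \<in> W. f z \<noteq> 0}"
  proof (rule reg_prodI)
    fix z assume "z \<in> {z \<in> W. f z \<noteq> 0}"
    from ex[OF this] obtain U V a b where A: "openin (zar X) U" "openin (zar Y) V"
      "a \<in> tensor_functions X Y U V" "b \<in> tensor_functions X Y U V" "z \<in> U \<times> V" "a z * b z \<noteq> 0"
      "\<forall>z'\<in>W \<inter> (U \<times> V). b z' \<noteq> 0 \<longrightarrow> f z' = a z' / b z'"
      by (elim exE conjE)
    then show "\<exists>U V a b. openin (zar X) U \<and> openin (zar Y) V \<and>
      a \<in> tensor_functions X Y U V \<and> b \<in> tensor_functions X Y U V \<and> z \<in> U \<times> V \<and> b z \<noteq> 0 \<and>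
      (\<forall>z'\<in>{z \<in> W. f z \<noteq> 0} \<inter> (U \<times> V). b z' \<noteq> 0 \<longrightarrow> inverse (f z') = a z' / b z')"
      using tensor_mult[OF A(1,2,4,4)] tensor_mult[OF A(1-4)]
      by (intro exI[of _ U] exI[of _ V] exI[of _ "\<lambda>z. b z * b z"] exI[of _ "\<lambda>z. a z * b z"] conjI)
        auto
  qed
qed

lemma swf_morphism_pair:
  fixes Z :: "('c, 'k) swf"
  assumes Z: "space_with_functions Z"
    and \<alpha>: "swf_morphism Z X \<alpha>" and \<beta>: "swf_morphism Z Y \<beta>"
  shows "swf_morphism Z (swf_prod X Y) (\<lambda>z. (\<alpha> z, \<beta> z))"
proof -
  let ?\<phi> = "\<lambda>z. (\<alpha> z, \<beta> z)"
  have oUV: "openin (zar Z) {z \<in> pts Z. \<alpha> z \<in> U \<and> \<beta> z \<in> V}"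
    if "openin (zar X) U" "openin (zar Y) V" for U V
  proof -
    have "{z \<in> pts Z. \<alpha> z \<in> U \<and> \<beta> z \<in> V} = {z \<in> pts Z. \<alpha> z \<in> U} \<inter> {z \<in> pts Z. \<beta> z \<in> V}"
      by auto
    then show ?thesis
      using swf_morphism_preimage[OF \<alpha> that(1)] swf_morphism_preimage[OF \<beta> that(2)] by auto
  qed
  have reg: "(\<lambda>z. h (\<alpha> z, \<beta> z)) \<in> reg Z {z \<in> pts Z. \<alpha> z \<in> U \<and> \<beta> z \<in> V}"
    if U: "openin (zar X) U" and V: "openin (zar Y) V" and h: "h \<in> tensor_functions X Y U V" for U V h
  proof -
    obtain m :: nat and f g where h: "\<forall>i<m. f i \<in> reg X U \<and> g i \<in> reg Y V"
      "h = (\<lambda>z. \<Sum>i<m. f i (fst z) * g i (snd z))"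
      by (rule tensorE[OF h])
    let ?W = "{z \<in> pts Z. \<alpha> z \<in> U \<and> \<beta> z \<in> V}"
    have "(\<lambda>z. f i (\<alpha> z)) \<in> reg Z ?W" "(\<lambda>z. g i (\<beta> z)) \<in> reg Z ?W" if i: "i < m" for i
    proof -
      have "f i \<circ> \<alpha> \<in> reg Z {z \<in> pts Z. \<alpha> z \<in> U}" "g i \<circ> \<beta> \<in> reg Z {z \<in> pts Z. \<beta> z \<in> V}"
        using \<alpha> \<beta> U V h(1) i by (auto simp: swf_morphism_def)
      then have "f i \<circ> \<alpha> \<in> reg Z ?W" "g i \<circ> \<beta> \<in> reg Z ?W"
        using swf_restrict[OF Z swf_morphism_preimage[OF \<alpha> U] _ oUV[OF U V], of "f i \<circ> \<alpha>"]
          swf_restrict[OF Z swf_morphism_preimage[OF \<beta> V] _ oUV[OF U V], of "g i \<circ> \<beta>"] by auto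
      then show "(\<lambda>z. f i (\<alpha> z)) \<in> reg Z ?W" "(\<lambda>z. g i (\<beta> z)) \<in> reg Z ?W"
        by (simp_all add: comp_def)
    qed
    then show ?thesis
      unfolding h fst_conv snd_conv
      by (intro swf_sum[OF Z oUV[OF U V]] swf_mult[OF Z oUV[OF U V]]) auto
  qed
  have im: "?\<phi> z \<in> pts (swf_prod X Y)" if "z \<in> pts Z" for z
    using swf_morphism_in_pts[OF \<alpha> that] swf_morphism_in_pts[OF \<beta> that] by (simp add: pts_prod)
  have pre: "openin (zar Z) {z \<in> pts Z. ?\<phi> z \<in> W}" if W: "openin (zar (swf_prod X Y)) W" for W
  proof (rule openin_localI)
    fix z assume "z \<in> {z \<in> pts Z. ?\<phi> z \<in> W}"
    then have z: "z \<in> pts Z" "?\<phi> z \<in> W"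
      by auto
    obtain U V h where A: "openin (zar X) U" "openin (zar Y) V" "h \<in> tensor_functions X Y U V"
      "?\<phi> z \<in> U \<times> V" "h (?\<phi> z) \<noteq> 0" "{z \<in> U \<times> V. h z \<noteq> 0} \<subseteq> W"
      by (rule openin_prod_cases[OF W z(2)])
    let ?D = "{z \<in> {z \<in> pts Z. \<alpha> z \<in> U \<and> \<beta> z \<in> V}. h (\<alpha> z, \<beta> z) \<noteq> 0}"
    have "openin (zar Z) ?D"
      by (rule swf_nonzero_open[OF Z oUV[OF A(1,2)] reg[OF A(1-3)]])
    then show "\<exists>V. openin (zar Z) V \<and> z \<in> V \<and> V \<subseteq> {z \<in> pts Z. ?\<phi> z \<in> W}"
      using z A by (intro exI[of _ ?D] conjI) auto
  qed
  have "f \<circ> ?\<phi> \<in> reg Z {z \<in> pts Z. ?\<phi> z \<in> W}"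
    if W: "openin (zar (swf_prod X Y)) W" and f: "f \<in> reg (swf_prod X Y) W" for W f
  proof (rule swf_glue[OF Z pre[OF W]])
    fix z assume "z \<in> {z \<in> pts Z. ?\<phi> z \<in> W}"
    then have z: "z \<in> pts Z" "?\<phi> z \<in> W"
      by auto
    obtain U V a b where A: "openin (zar X) U" "openin (zar Y) V"
      "a \<in> tensor_functions X Y U V" "b \<in> tensor_functions X Y U V" "?\<phi> z \<in> U \<times> V" "b (?\<phi> z) \<noteq> 0"
      "\<forall>z'\<in>W \<inter> (U \<times> V). b z' \<noteq> 0 \<longrightarrow> f z' = a z' / b z'"
      by (rule reg_prodE[OF f z(2)])
    let ?W = "{z \<in> pts Z. \<alpha> z \<in> U \<and> \<beta> z \<in> V}" and ?D = "{z \<in> {z \<in> pts Z. \<alpha> z \<in> U \<and> \<beta> z \<in> V}. b (\<alpha> z, \<beta> z) \<noteq> 0}"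
    have oD: "openin (zar Z) ?D"
      by (rule swf_nonzero_open[OF Z oUV[OF A(1,2)] reg[OF A(1,2,4)]])
    have res: "k \<in> reg Z ?D" if "k \<in> reg Z ?W" for k
      by (rule swf_restrict[OF Z oUV[OF A(1,2)] that oD]) auto
    have "(\<lambda>z. a (?\<phi> z) / b (?\<phi> z)) \<in> reg Z ?D"
      by (rule swf_divide[OF Z oD res[OF reg[OF A(1-3)]] res[OF reg[OF A(1,2,4)]]]) auto
    moreover have "(f \<circ> ?\<phi>) y = a (?\<phi> y) / b (?\<phi> y)" if "y \<in> ?D \<inter> {z \<in> pts Z. ?\<phi> z \<in> W}" for y
      using that A(7) by auto
    ultimately show "\<exists>V g. openin (zar Z) V \<and> z \<in> V \<and> g \<in> reg Z V \<and>
        (\<forall>y\<in>V \<inter> {z \<in> pts Z. ?\<phi> z \<in> W}. (f \<circ> ?\<phi>) y = g y)"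
      using oD z A(5,6)
      by (intro exI[of _ ?D] exI[of _ "\<lambda>z. a (?\<phi> z) / b (?\<phi> z)"] conjI ballI) auto
  qed
  then show ?thesis
    using pre im by (auto simp: swf_morphism_def continuous_map_def)
qed

end

section \<open>Noetherian spaces\<close>

definition noetherian_space :: "'a topology \<Rightarrow> bool" where
  "noetherian_space T \<longleftrightarrow>
     (\<forall>U::nat \<Rightarrow> 'a set. (\<forall>k. openin T (U k) \<and> U k \<subseteq> U (Suc k)) \<longrightarrow> (\<exists>N. \<forall>k\<ge>N. U k = U N))"

lemma noetherian_spaceD:
  assumes "noetherian_space T" and "\<And>k. openin T (U k)" and "\<And>k. U k \<subseteq> U (Suc k)"
  obtains N where "\<And>k. k \<ge> N \<Longrightarrow> U k = U N"
  using assms unfolding noetherian_space_def by meson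

lemma noetherian_space_subtopology:
  assumes T: "noetherian_space T"
  shows "noetherian_space (subtopology T S)"
  unfolding noetherian_space_def
proof (intro allI impI)
  fix U :: "nat \<Rightarrow> 'a set"
  assume U: "\<forall>k. openin (subtopology T S) (U k) \<and> U k \<subseteq> U (Suc k)"
  have inc: "U i \<subseteq> U j" if "i \<le> j" for i j
    using lift_Suc_mono_le[of U, OF _ that] U by simp
  have "\<forall>k. \<exists>W. openin T W \<and> U k = W \<inter> S"
    using U by (auto simp: openin_subtopology)
  then obtain W where W: "\<And>k. openin T (W k)" "\<And>k. U k = W k \<inter> S"
    by metis
  have e: "(\<Union>i\<le>k. W i) \<inter> S = U k" for k
    using inc W(2) by fastforce
  obtain N where "\<And>k. k \<ge> N \<Longrightarrow> (\<Union>i\<le>k. W i) = (\<Union>i\<le>N. W i)"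
    by (rule noetherian_spaceD[OF T, of "\<lambda>k. \<Union>i\<le>k. W i"]) (use W(1) in \<open>auto simp: atMost_Suc\<close>)
  then show "\<exists>N. \<forall>k\<ge>N. U k = U N"
    by (metis e)
qed

lemma noetherian_space_image:
  assumes T: "noetherian_space T" and f: "continuous_map T T' f" and s: "f ` topspace T = topspace T'"
  shows "noetherian_space T'"
  unfolding noetherian_space_def
proof (intro allI impI)
  fix U :: "nat \<Rightarrow> 'b set"
  assume U: "\<forall>k. openin T' (U k) \<and> U k \<subseteq> U (Suc k)"
  have e: "U k = f ` {x \<in> topspace T. f x \<in> U k}" for k
  proof -
    have "U k \<subseteq> f ` topspace T"
      using openin_subset[of T' "U k"] U s by simp
    then show ?thesis
      by blast
  qed
  obtain N where "\<And>k. k \<ge> N \<Longrightarrow> {x \<in> topspace T. f x \<in> U k} = {x \<in> topspace T. f x \<in> U N}"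
    by (rule noetherian_spaceD[OF T, of "\<lambda>k. {x \<in> topspace T. f x \<in> U k}"])
      (use U f in \<open>auto simp: continuous_map_def\<close>)
  then show "\<exists>N. \<forall>k\<ge>N. U k = U N"
    by (metis e)
qed

text \<open>
  Points chosen one after the other outside of the sets belonging to the previous ones would give
  a strictly ascending chain of open sets.
\<close>

lemma noetherian_space_finite_cover:
  assumes T: "noetherian_space T"
    and U: "\<And>x. x \<in> topspace T \<Longrightarrow> openin T (U x) \<and> x \<in> U x"
  obtains A where "finite A" "A \<subseteq> topspace T" "(\<Union>x\<in>A. U x) = topspace T"
proof (rule ccontr)
  assume "\<not> thesis"
  then have no: "(\<Union>x\<in>A. U x) \<noteq> topspace T" if "finite A" "A \<subseteq> topspace T" for A
    using that \<open>\<And>A. finite A \<Longrightarrow> A \<subseteq> topspace T \<Longrightarrow> \<Union> (U ` A) = topspace T \<Longrightarrow> thesis\<close> by blast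
  have "\<exists>x. x \<in> topspace T \<and> x \<notin> (\<Union>x\<in>A. U x)" if A: "finite A" "A \<subseteq> topspace T" for A
  proof -
    have "(\<Union>x\<in>A. U x) \<subseteq> topspace T"
      using U A openin_subset by (metis UN_least subsetD)
    then show ?thesis
      using no[OF A] by blast
  qed
  then obtain g where g: "\<And>A. finite A \<Longrightarrow> A \<subseteq> topspace T \<Longrightarrow> g A \<in> topspace T \<and> g A \<notin> (\<Union>x\<in>A. U x)"
    by metis
  define A where "A k = ((\<lambda>B. insert (g B) B) ^^ k) {}" for k :: nat
  have Suc: "A (Suc k) = insert (g (A k)) (A k)" for k
    by (simp add: A_def)
  have A: "finite (A k) \<and> A k \<subseteq> topspace T" for k
  proof (induction k)
    case 0
    then show ?case by (simp add: A_def)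
  next
    case (Suc k)
    then show ?case
      using g[of "A k"] by (simp add: \<open>A (Suc k) = insert (g (A k)) (A k)\<close>)
  qed
  have o: "openin T (\<Union>x\<in>A k. U x)" for k
    using A[of k] U by (intro openin_Union) blast
  have i: "(\<Union>x\<in>A k. U x) \<subseteq> (\<Union>x\<in>A (Suc k). U x)" for k
    by (auto simp: Suc)
  obtain N where N: "\<And>k. k \<ge> N \<Longrightarrow> (\<Union>x\<in>A k. U x) = (\<Union>x\<in>A N. U x)"
    by (rule noetherian_spaceD[OF T, of "\<lambda>k. \<Union>x\<in>A k. U x"]) (use o i in auto)
  have "g (A N) \<in> (\<Union>x\<in>A (Suc N). U x)"
    using g[of "A N"] A[of N] U by (auto simp: Suc)
  then show False
    using N[of "Suc N"] g[of "A N"] A[of N] by simp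
qed

text \<open>
  The images of the iterates of a closed self-embedding form a descending chain of closed sets,
  which is strictly descending unless the embedding is onto.
\<close>

lemma noetherian_space_closed_embedding_onto:
  assumes T: "noetherian_space T" and f: "closed_map T T f" and im: "f ` topspace T \<subseteq> topspace T"
    and inj: "inj_on f (topspace T)"
  shows "f ` topspace T = topspace T"
proof (rule ccontr)
  assume "f ` topspace T \<noteq> topspace T"
  then obtain x where x: "x \<in> topspace T" "x \<notin> f ` topspace T"
    using im by blast
  define C where "C k = (f ^^ k) ` topspace T" for k :: nat
  have C_Suc: "C (Suc k) = f ` C k" for k
    by (simp add: C_def image_image)
  have closed: "closedin T (C k)" for k
  proof (induction k)
    case 0
    then show ?case by (simp add: C_def)
  next
    case (Suc k)
    then show ?case
      using f by (simp add: C_Suc closed_map_def)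
  qed
  have sub: "C k \<subseteq> topspace T" for k
    using closed closedin_subset by blast
  have dec: "C (Suc k) \<subseteq> C k" for k
  proof (induction k)
    case 0
    then show ?case using im by (simp add: C_def)
  next
    case (Suc k)
    then show ?case unfolding C_Suc[of "Suc k"] C_Suc[of k] by (rule image_mono)
  qed
  have strict: "(f ^^ k) x \<in> C k \<and> (f ^^ k) x \<notin> C (Suc k)" for k
  proof (induction k)
    case 0
    then show ?case using x by (simp add: C_def)
  next
    case (Suc k)
    then show ?case
      using inj_on_image_mem_iff[OF inj, of "(f ^^ k) x" "C (Suc k)"] sub[of k] sub[of "Suc k"]
      unfolding C_Suc[of "Suc k"] C_Suc[of k] by auto
  qed
  obtain N where N: "\<And>k. k \<ge> N \<Longrightarrow> topspace T - C k = topspace T - C N"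
    by (rule noetherian_spaceD[OF T, of "\<lambda>k. topspace T - C k"]) (use closed dec in blast)+
  have "C (Suc N) = C N"
    using N[of "Suc N"] sub[of N] sub[of "Suc N"] by auto
  then show False
    using strict[of N] by simp
qed

subsection \<open>Hilbert's basis theorem\<close>

text \<open>
  The elements of the ideal generated by \<open>T\<close> in a ring \<open>A\<close> of functions arise by adding one
  multiple of a generator at a time.
\<close>

inductive_set ideal_gen :: "('x \<Rightarrow> 'k::field) set \<Rightarrow> ('x \<Rightarrow> 'k) set \<Rightarrow> ('x \<Rightarrow> 'k) set"
  for A T where
  zero: "(\<lambda>_. 0) \<in> ideal_gen A T"
| step: "g \<in> ideal_gen A T \<Longrightarrow> c \<in> A \<Longrightarrow> t \<in> T \<Longrightarrow> (\<lambda>x. g x + c x * t x) \<in> ideal_gen A T"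

text \<open>
  Quantifying over generating sets \<open>S\<close> instead of ideals also says that the finitely many
  generators can be chosen from \<open>S\<close>.
\<close>

definition finitely_generated_ideals :: "('x \<Rightarrow> 'k::field) set \<Rightarrow> bool" where
  "finitely_generated_ideals A \<longleftrightarrow> (\<forall>S\<subseteq>A. \<exists>T\<subseteq>S. finite T \<and> S \<subseteq> ideal_gen A T)"

lemma finitely_generated_idealsE:
  assumes "finitely_generated_ideals A" and "S \<subseteq> A"
  obtains T where "T \<subseteq> S" "finite T" "S \<subseteq> ideal_gen A T"
  using mp[OF spec[OF assms(1)[unfolded finitely_generated_ideals_def], of S] assms(2)]
  by (elim exE conjE) (rule that)

lemma ideal_gen_mono:
  assumes "g \<in> ideal_gen A T" and "T \<subseteq> T'"
  shows "g \<in> ideal_gen A T'"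
  using assms(1) by induction (use assms(2) in \<open>auto intro: ideal_gen.intros\<close>)

lemma ideal_gen_add:
  assumes "g \<in> ideal_gen A T" and "h \<in> ideal_gen A T"
  shows "(\<lambda>x. g x + h x) \<in> ideal_gen A T"
  using assms(2)
proof induction
  case zero
  then show ?case using assms(1) by simp
next
  case (step h c t)
  then have "(\<lambda>x. (g x + h x) + c x * t x) \<in> ideal_gen A T"
    by (intro ideal_gen.step)
  then show ?case by (simp add: add.assoc)
qed

lemma ideal_gen_mult:
  assumes "g \<in> ideal_gen (polyfun I) T" and a: "a \<in> polyfun I"
  shows "(\<lambda>x. a x * g x) \<in> ideal_gen (polyfun I) T"
  using assms(1)
proof induction
  case zero
  then show ?case by (simp add: ideal_gen.zero)
next
  case (step h c t)
  then have "(\<lambda>x. a x * h x + (a x * c x) * t x) \<in> ideal_gen (polyfun I) T"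
    using a by (intro ideal_gen.step polyfun.mult)
  then show ?case by (simp add: algebra_simps)
qed

lemma ideal_gen_incl:
  assumes "t \<in> T"
  shows "t \<in> ideal_gen (polyfun I) T"
  using ideal_gen.step[OF ideal_gen.zero polyfun.const[of 1 I] assms] by simp

lemma ideal_gen_trans:
  assumes "g \<in> ideal_gen (polyfun I) T" and "T \<subseteq> ideal_gen (polyfun I) T'"
  shows "g \<in> ideal_gen (polyfun I) T'"
  using assms(1)
proof induction
  case zero
  then show ?case by (rule ideal_gen.zero)
next
  case (step h c t)
  then show ?case
    using assms(2) by (intro ideal_gen_add ideal_gen_mult) auto
qed

lemma ideal_gen_subset:
  assumes "g \<in> ideal_gen (polyfun I) T" and "T \<subseteq> polyfun I"
  shows "g \<in> polyfun I"
  using assms(1) by induction (use assms(2) in \<open>auto intro!: polyfun.intros\<close>)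

lemma ideal_gen_finite_support:
  assumes "g \<in> ideal_gen A S"
  obtains T where "finite T" "T \<subseteq> S" "g \<in> ideal_gen A T"
proof -
  have "\<exists>T. finite T \<and> T \<subseteq> S \<and> g \<in> ideal_gen A T"
    using assms
  proof induction
    case zero
    then show ?case by (intro exI[of _ "{}"]) (simp add: ideal_gen.zero)
  next
    case (step h c t)
    then obtain T where T: "finite T" "T \<subseteq> S" "h \<in> ideal_gen A T"
      by blast
    have "(\<lambda>x. h x + c x * t x) \<in> ideal_gen A (insert t T)"
      by (rule ideal_gen.step[OF ideal_gen_mono[OF T(3)] step(2)]) auto
    then show ?case
      using T step by (intro exI[of _ "insert t T"]) auto
  qed
  then show ?thesis
    using that by blast
qed

lemma ideal_gen_vanish:
  assumes "g \<in> ideal_gen A T" and "\<And>t. t \<in> T \<Longrightarrow> t x = 0"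
  shows "g x = 0"
  using assms(1) by induction (use assms(2) in auto)

lemma finitely_generated_ideals_seq:
  assumes "finitely_generated_ideals A" and "\<And>k::nat. a k \<in> A"
  obtains N where "a N \<in> ideal_gen A (a ` {..<N})"
proof -
  have "range a \<subseteq> A"
    using assms(2) by blast
  then obtain T where T: "T \<subseteq> range a" "finite T" "range a \<subseteq> ideal_gen A T"
    by (rule finitely_generated_idealsE[OF assms(1)])
  obtain F where F: "finite F" "T = a ` F"
    using finite_subset_image[OF T(2,1)] by blast
  obtain M where M: "F \<subseteq> {..<M}"
    using finite_nat_bounded[OF F(1)] by blast
  have "T \<subseteq> a ` {..<M}"
    using F(2) M by blast
  moreover have "a M \<in> ideal_gen A T"
    using T(3) by blast
  ultimately have "a M \<in> ideal_gen A (a ` {..<M})"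
    using ideal_gen_mono by blast
  then show ?thesis
    by (rule that)
qed

text \<open>
  An expansion of \<open>f\<close> in powers of the coordinate \<open>i\<close>. Leading zeros are permitted, so \<open>D\<close> only
  bounds the degree, and a function may have several expansions.
\<close>

definition expansion where
  "expansion I i D c f \<longleftrightarrow>
     (\<forall>d. c d \<in> polyfun I) \<and> f = (\<lambda>x. \<Sum>d\<le>D. c d x * x i ^ d)" for D :: nat

lemma expansion_pad:
  assumes "expansion I i D c f" and "D \<le> D'"
  shows "expansion I i D' (\<lambda>d. if d \<le> D then c d else (\<lambda>_. 0)) f"
proof -
  have "(\<Sum>d\<le>D'. (if d \<le> D then c d else (\<lambda>_. 0)) x * x i ^ d) = (\<Sum>d\<le>D. c d x * x i ^ d)" for x
    by (rule sum.mono_neutral_cong_right) (use assms(2) in auto)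
  then show ?thesis
    using assms(1) by (auto simp: expansion_def intro: polyfun.const)
qed

lemma expansion_add:
  assumes "expansion I i D c f" and "expansion I i D c' f'"
  shows "expansion I i D (\<lambda>d x. c d x + c' d x) (\<lambda>x. f x + f' x)"
  using assms by (auto simp: expansion_def sum.distrib distrib_right intro: polyfun.add)

lemma expansion_scale:
  assumes "expansion I i D c f" and "a \<in> polyfun I"
  shows "expansion I i D (\<lambda>d x. a x * c d x) (\<lambda>x. a x * f x)"
  using assms by (auto simp: expansion_def sum_distrib_left mult.assoc intro: polyfun.mult)

lemma expansion_shift:
  assumes "expansion I i D c f"
  shows "expansion I i (Suc D) (\<lambda>d. case d of 0 \<Rightarrow> (\<lambda>_. 0) | Suc d \<Rightarrow> c d) (\<lambda>x. x i * f x)"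
  using assms
  by (auto simp: expansion_def sum.atMost_Suc_shift sum_distrib_left mult_ac
      intro: polyfun.const split: nat.split simp del: sum.atMost_Suc)

lemma expansion_shifts:
  assumes "expansion I i D c f"
  shows "\<exists>c'. expansion I i (D + e) c' (\<lambda>x. x i ^ e * f x) \<and> c' (D + e) = c D"
proof (induction e)
  case 0
  then show ?case using assms by auto
next
  case (Suc e)
  then obtain c' where "expansion I i (D + e) c' (\<lambda>x. x i ^ e * f x)" "c' (D + e) = c D"
    by blast
  then show ?case
    using expansion_shift[of I i "D + e" c' "\<lambda>x. x i ^ e * f x"]
    by (intro exI[of _ "\<lambda>d. case d of 0 \<Rightarrow> (\<lambda>_. 0) | Suc d \<Rightarrow> c' d"]) (simp add: mult.assoc)
qed

lemma polyfun_mono: "p \<in> polyfun I \<Longrightarrow> I \<subseteq> J \<Longrightarrow> p \<in> polyfun J"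
  by (induction rule: polyfun.induct) (auto intro: polyfun.intros)

lemma expansion_exists:
  assumes "f \<in> polyfun (insert i I)"
  shows "\<exists>D c. expansion I i D c f"
proof -
  let ?R = "{f. \<exists>D c. expansion I i D c f}"
  have add: "(\<lambda>x. f x + g x) \<in> ?R" if "f \<in> ?R" "g \<in> ?R" for f g
  proof -
    obtain D c where "expansion I i D c f"
      using \<open>f \<in> ?R\<close> by (elim CollectE exE)
    moreover obtain D' c' where "expansion I i D' c' g"
      using \<open>g \<in> ?R\<close> by (elim CollectE exE)
    ultimately show ?thesis
      using expansion_add[OF expansion_pad[of I i D c f "max D D'"] expansion_pad[of I i D' c' g "max D D'"]]
      by auto
  qed
  have scale: "(\<lambda>x. a x * f x) \<in> ?R" if "a \<in> polyfun I" "f \<in> ?R" for a f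
    using that by (elim CollectE exE) (rule CollectI, intro exI, rule expansion_scale, assumption+)
  have shift: "(\<lambda>x. x i ^ e * f x) \<in> ?R" if f: "f \<in> ?R" for e f
  proof -
    obtain D c where "expansion I i D c f"
      using f by (elim CollectE exE)
    from expansion_shifts[OF this, of e] show ?thesis
      by (elim exE conjE) (intro CollectI exI)
  qed
  have base: "a \<in> ?R" if "a \<in> polyfun I" for a
    using that by (intro CollectI exI[of _ 0] exI[of _ "\<lambda>_. a"]) (simp add: expansion_def)
  have mult: "(\<lambda>x. f x * g x) \<in> ?R" if f: "f \<in> ?R" and g: "g \<in> ?R" for f g
  proof -
    obtain D c where c: "\<And>d. c d \<in> polyfun I" "f = (\<lambda>x. \<Sum>d\<le>D. c d x * x i ^ d)"
      using f by (auto simp: expansion_def)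
    have "(\<lambda>x. (\<Sum>d\<le>m. c d x * x i ^ d) * g x) \<in> ?R" for m
    proof (induction m)
      case 0
      then show ?case using scale[OF c(1) g] by simp
    next
      case (Suc m)
      have "(\<lambda>x. (\<Sum>d\<le>m. c d x * x i ^ d) * g x + c (Suc m) x * (x i ^ Suc m * g x)) \<in> ?R"
        by (rule add[OF Suc scale[OF c(1) shift[OF g]]])
      then show ?case
        by (simp add: distrib_right mult.assoc)
    qed
    then show ?thesis
      by (simp add: c(2))
  qed
  have "f \<in> ?R"
    using assms
  proof induction
    case (coord j)
    show ?case
    proof (cases "j = i")
      case True
      then show ?thesis
        using shift[OF base[OF polyfun.const[of 1 I]], of 1] by simp
    next
      case False
      then show ?thesis
        using coord by (intro base polyfun.coord) simp
    qed
  next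
    case (const a)
    then show ?case
      by (rule base[OF polyfun.const])
  next
    case (add p q)
    then show ?case by (intro \<open>\<And>g f. f \<in> ?R \<Longrightarrow> g \<in> ?R \<Longrightarrow> (\<lambda>x. f x + g x) \<in> ?R\<close>)
  next
    case (mult p q)
    then show ?case by (intro \<open>\<And>g f. f \<in> ?R \<Longrightarrow> g \<in> ?R \<Longrightarrow> (\<lambda>x. f x * g x) \<in> ?R\<close>)
  qed
  then show ?thesis by blast
qed

text \<open>
  The classical argument: in an ideal that is not finitely generated, pick successively elements of
  minimal degree outside the ideal generated by the previous ones. A relation between the leading
  coefficients lowers the degree of one of them, a contradiction. The degree of a function is the
  least degree of its expansions in powers of the new coordinate.
\<close>

lemma finitely_generated_ideals_insert:
  fixes I :: "'i set"
  assumes fg: "finitely_generated_ideals (polyfun I :: (('i \<Rightarrow> 'k::field) \<Rightarrow> 'k) set)"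
  shows "finitely_generated_ideals (polyfun (insert i I) :: (('i \<Rightarrow> 'k) \<Rightarrow> 'k) set)"
  unfolding finitely_generated_ideals_def
proof (intro allI impI, rule ccontr)
  fix S :: "(('i \<Rightarrow> 'k) \<Rightarrow> 'k) set"
  let ?A = "polyfun (insert i I) :: (('i \<Rightarrow> 'k) \<Rightarrow> 'k) set"
  assume S: "S \<subseteq> ?A" and no: "\<not> (\<exists>T\<subseteq>S. finite T \<and> S \<subseteq> ideal_gen ?A T)"
  define J where "J = ideal_gen ?A S"
  define deg where "deg f = (LEAST D. \<exists>c. expansion I i D c f)" for f :: "('i \<Rightarrow> 'k) \<Rightarrow> 'k"
  have deg_le: "deg f \<le> D" if "expansion I i D c f" for D c f
    unfolding deg_def using that by (intro Least_le) blast
  have deg_ex: "\<exists>c. expansion I i (deg f) c f" if "f \<in> J" for f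
  proof -
    have "f \<in> ?A"
      using that S ideal_gen_subset unfolding J_def by blast
    show ?thesis
      unfolding deg_def by (rule LeastI_ex[OF expansion_exists]) fact
  qed
  have J_not_fg: "\<exists>f\<in>J. f \<notin> ideal_gen ?A F" if F: "finite F" "F \<subseteq> J" for F
  proof (rule ccontr)
    assume c: "\<not> ?thesis"
    have "\<exists>T. finite T \<and> T \<subseteq> S \<and> F \<subseteq> ideal_gen ?A T"
      using F
    proof (induction F)
      case empty
      then show ?case by blast
    next
      case (insert f F)
      then obtain T where T: "finite T" "T \<subseteq> S" "F \<subseteq> ideal_gen ?A T"
        by auto
      obtain T' where T': "finite T'" "T' \<subseteq> S" "f \<in> ideal_gen ?A T'"
        using ideal_gen_finite_support[of f ?A S] insert.prems unfolding J_def by auto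
      have "insert f F \<subseteq> ideal_gen ?A (T \<union> T')"
        using T(3) T'(3) ideal_gen_mono[of _ ?A _ "T \<union> T'"] by blast
      then show ?case
        using T T' by (intro exI[of _ "T \<union> T'"]) auto
    qed
    then obtain T where T: "finite T" "T \<subseteq> S" "F \<subseteq> ideal_gen ?A T"
      by blast
    have "S \<subseteq> ideal_gen ?A T"
    proof
      fix s assume "s \<in> S"
      then have "s \<in> J"
        unfolding J_def by (rule ideal_gen_incl)
      then have "s \<in> ideal_gen ?A F"
        using c by blast
      then show "s \<in> ideal_gen ?A T"
        using T(3) by (rule ideal_gen_trans)
    qed
    then show False
      using no T by blast
  qed
  \<comment> \<open>The sequence \<open>f\<close> to be constructed satisfies \<open>P f N (f N)\<close> for all \<open>N\<close>.\<close>
  define P where "P f N r \<longleftrightarrow> r \<in> J \<and> r \<notin> ideal_gen ?A (f ` {..<N}) \<and>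
      (\<forall>g\<in>J. g \<notin> ideal_gen ?A (f ` {..<N}) \<longrightarrow> deg r \<le> deg g)" for f :: "nat \<Rightarrow> _" and N r
  have "\<exists>f. \<forall>N. P f N (f N)"
  proof (rule dependent_wellorder_choice)
    fix r and f g :: "nat \<Rightarrow> ('i \<Rightarrow> 'k) \<Rightarrow> 'k" and N :: nat
    assume "\<And>k. k < N \<Longrightarrow> f k = g k"
    then have "f ` {..<N} = g ` {..<N}"
      by (intro image_cong) auto
    then show "P f N r = P g N r"
      by (simp add: P_def)
  next
    fix N :: nat and f :: "nat \<Rightarrow> ('i \<Rightarrow> 'k) \<Rightarrow> 'k"
    assume "\<And>k. k < N \<Longrightarrow> P f k (f k)"
    then have "f ` {..<N} \<subseteq> J"
      by (auto simp: P_def)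
    then obtain h where "h \<in> J \<and> h \<notin> ideal_gen ?A (f ` {..<N})"
      using J_not_fg[of "f ` {..<N}"] by auto
    from ex_has_least_nat[of "\<lambda>h. h \<in> J \<and> h \<notin> ideal_gen ?A (f ` {..<N})", OF this, of deg]
    show "\<exists>r. P f N r"
      unfolding P_def by blast
  qed
  then obtain f where f: "\<And>N. P f N (f N)"
    by blast
  have fJ: "f k \<in> J" for k
    using f by (simp add: P_def)
  have mono: "deg (f k) \<le> deg (f N)" if "k < N" for k N
  proof -
    have "f ` {..<k} \<subseteq> f ` {..<N}"
      using that by auto
    then have "f N \<notin> ideal_gen ?A (f ` {..<k})"
      using f[of N] ideal_gen_mono[of "f N" ?A "f ` {..<k}" "f ` {..<N}"] that by (auto simp: P_def)
    then show ?thesis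
      using f[of k] fJ[of N] by (auto simp: P_def)
  qed
  obtain c where c: "\<And>k. expansion I i (deg (f k)) (c k) (f k)"
    using deg_ex[OF fJ] by metis
  have "c k (deg (f k)) \<in> polyfun I" for k
    using c[of k] by (simp add: expansion_def)
  from finitely_generated_ideals_seq[of "polyfun I" "\<lambda>k. c k (deg (f k))", OF fg this]
  obtain N where N: "c N (deg (f N)) \<in> ideal_gen (polyfun I) ((\<lambda>k. c k (deg (f k))) ` {..<N})" .
  let ?D = "deg (f N)"
  \<comment> \<open>Each combination of the previous leading coefficients is the coefficient of degree \<open>?D\<close> of a
    combination of the previous functions, multiplied by suitable powers of the coordinate.\<close>
  have "\<exists>g b. g \<in> ideal_gen ?A (f ` {..<N}) \<and> expansion I i ?D b g \<and> b ?D = a"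
    if "a \<in> ideal_gen (polyfun I) ((\<lambda>k. c k (deg (f k))) ` {..<N})" for a
    using that
  proof induction
    case zero
    then show ?case
      by (intro exI[of _ "\<lambda>_. 0"] exI[of _ "\<lambda>_ _. 0"])
        (simp add: ideal_gen.zero expansion_def polyfun.const)
  next
    case (step a' a t)
    then obtain g b where g: "g \<in> ideal_gen ?A (f ` {..<N})" "expansion I i ?D b g" "b ?D = a'"
      by blast
    obtain k where k: "k < N" "t = c k (deg (f k))"
      using step.hyps by blast
    define m where "m = ?D - deg (f k)"
    have m: "deg (f k) + m = ?D"
      using mono[OF k(1)] by (simp add: m_def)
    obtain c' where c': "expansion I i ?D c' (\<lambda>x. x i ^ m * f k x)" "c' ?D = t"
      using expansion_shifts[OF c, of k m] unfolding m k(2) by blast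
    have "expansion I i ?D (\<lambda>d x. b d x + a x * c' d x) (\<lambda>x. g x + a x * (x i ^ m * f k x))"
      using expansion_add[OF g(2) expansion_scale[OF c'(1) step.hyps(2)]] .
    moreover have "(\<lambda>x. g x + (a x * x i ^ m) * f k x) \<in> ideal_gen ?A (f ` {..<N})"
    proof (rule ideal_gen.step[OF g(1)])
      have "(\<lambda>x. x i ^ m) \<in> ?A"
        by (induction m) (auto intro: polyfun.intros)
      then show "(\<lambda>x. a x * x i ^ m) \<in> ?A"
        using polyfun_mono[OF step.hyps(2)] by (intro polyfun.mult) auto
    qed (use k in auto)
    ultimately show ?case
      using g(3) c'(2)
      by (intro exI[of _ "\<lambda>x. g x + a x * (x i ^ m * f k x)"] exI[of _ "\<lambda>d x. b d x + a x * c' d x"])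
        (simp add: mult.assoc)
  qed
  from this[OF N] obtain g b where g: "g \<in> ideal_gen ?A (f ` {..<N})" "expansion I i ?D b g"
    "b ?D = c N ?D"
    by blast
  have const: "(\<lambda>_. - 1) \<in> ?A"
    by (rule polyfun.const)
  define h where "h = (\<lambda>x. f N x + (- 1) * g x)"
  have h: "expansion I i ?D (\<lambda>d x. c N d x + (- 1) * b d x) h"
    unfolding h_def by (rule expansion_add[OF c expansion_scale[OF g(2) polyfun.const]])
  have not: "h \<notin> ideal_gen ?A (f ` {..<N})"
  proof
    assume "h \<in> ideal_gen ?A (f ` {..<N})"
    from ideal_gen_add[OF this g(1)] have "f N \<in> ideal_gen ?A (f ` {..<N})"
      by (simp add: h_def)
    then show False
      using f[of N] by (simp add: P_def)
  qed
  have "g \<in> J"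
    unfolding J_def by (rule ideal_gen_trans[OF g(1)]) (use fJ in \<open>auto simp: J_def\<close>)
  then have hJ: "h \<in> J"
    using fJ[of N] ideal_gen_add ideal_gen_mult[OF _ const] unfolding h_def J_def by blast
  show False
  proof (cases ?D)
    case 0
    then have "h = (\<lambda>_. 0)"
      using h g(3) by (simp add: expansion_def)
    then show False
      using not ideal_gen.zero[of ?A "f ` {..<N}"] by simp
  next
    case (Suc D)
    then have "expansion I i D (\<lambda>d x. c N d x + (- 1) * b d x) h"
      using h g(3) by (simp add: expansion_def)
    then have "deg h \<le> D"
      by (rule deg_le)
    moreover have "?D \<le> deg h"
      using f[of N] not hJ by (auto simp: P_def)
    ultimately show False
      using Suc by simp
  qed
qed

theorem hilbert_basis:
  fixes I :: "'i set"
  assumes "finite I"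
  shows "finitely_generated_ideals (polyfun I :: (('i \<Rightarrow> 'k::field) \<Rightarrow> 'k) set)"
  using assms
proof (induction I)
  case empty
  have const: "\<exists>a. p = (\<lambda>_. a)" if "p \<in> polyfun {}" for p :: "('i \<Rightarrow> 'k) \<Rightarrow> 'k"
    using that by induction auto
  show ?case
    unfolding finitely_generated_ideals_def
  proof (intro allI impI)
    fix S :: "(('i \<Rightarrow> 'k) \<Rightarrow> 'k) set"
    assume S: "S \<subseteq> polyfun {}"
    show "\<exists>T\<subseteq>S. finite T \<and> S \<subseteq> ideal_gen (polyfun {}) T"
    proof (cases "S \<subseteq> {\<lambda>_. 0}")
      case True
      then show ?thesis
        using ideal_gen.zero by (intro exI[of _ "{}"]) auto
    next
      case False
      then obtain s where s: "s \<in> S" "s \<noteq> (\<lambda>_. 0)"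
        by blast
      then obtain a where a: "s = (\<lambda>_. a)" "a \<noteq> 0"
        using const S by blast
      have "S \<subseteq> ideal_gen (polyfun {}) {s}"
      proof
        fix p assume "p \<in> S"
        then obtain b where "p = (\<lambda>_. b)"
          using const S by blast
        then show "p \<in> ideal_gen (polyfun {}) {s}"
          using ideal_gen.step[OF ideal_gen.zero polyfun.const[of "b / a" "{}"], of s "{s}"] a by simp
      qed
      then show ?thesis
        using s by (intro exI[of _ "{s}"]) auto
    qed
  qed
next
  case (insert i I)
  then show ?case by (intro finitely_generated_ideals_insert)
qed

text \<open>
  The functions that vanish outside of some member of an ascending chain of open sets generate an
  ideal. Finitely many generators already belong to one member of the chain.
\<close>

lemma noetherian_space_affine:
  fixes I :: "'i set"
  assumes "finite I"
  shows "noetherian_space (affine_topology I :: ('i \<Rightarrow> 'k::field) topology)"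
  unfolding noetherian_space_def
proof (intro allI impI)
  fix U :: "nat \<Rightarrow> ('i \<Rightarrow> 'k) set"
  assume U: "\<forall>k. openin (affine_topology I) (U k) \<and> U k \<subseteq> U (Suc k)"
  have inc: "U i \<subseteq> U j" if "i \<le> j" for i j
    using lift_Suc_mono_le[of U, OF _ that] U by simp
  let ?D = "\<lambda>p. {x \<in> affine_points I. p x \<noteq> (0::'k)}"
  define S where "S = {p \<in> polyfun I. \<exists>k. ?D p \<subseteq> U k}"
  have "S \<subseteq> polyfun I"
    by (auto simp: S_def)
  then obtain T where T: "T \<subseteq> S" "finite T" "S \<subseteq> ideal_gen (polyfun I) T"
    by (rule finitely_generated_idealsE[OF hilbert_basis[OF assms]])
  have "\<exists>N. \<forall>p\<in>T. ?D p \<subseteq> U N"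
    using T(2,1)
  proof (induction T)
    case (insert p T)
    then obtain N where N: "\<forall>p\<in>T. ?D p \<subseteq> U N"
      by auto
    obtain k where "?D p \<subseteq> U k"
      using insert.prems by (auto simp: S_def)
    then have "?D p \<subseteq> U (max N k)" "\<forall>p\<in>T. ?D p \<subseteq> U (max N k)"
      using N inc[of N "max N k"] inc[of k "max N k"] by (blast intro: max.cobounded1 max.cobounded2)+
    then show ?case
      by (intro exI[of _ "max N k"]) auto
  qed simp
  then obtain N where N: "\<And>p. p \<in> T \<Longrightarrow> ?D p \<subseteq> U N"
    by blast
  have "U k \<subseteq> U N" for k
  proof
    fix x assume x: "x \<in> U k"
    have o: "openin (affine_topology I) (U k)"
      using U by blast
    obtain p where p: "p \<in> polyfun I" "p x \<noteq> 0" "?D p \<subseteq> U k"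
      using openin_affine_cases[OF o x] by (elim bexE conjE)
    have "p \<in> ideal_gen (polyfun I) T"
      using T(3) p unfolding S_def by blast
    then obtain t where "t \<in> T" "t x \<noteq> 0"
      using ideal_gen_vanish[of p "polyfun I" T x] p(2) by blast
    moreover have "x \<in> affine_points I"
      using openin_subset[OF o] x by auto
    ultimately show "x \<in> U N"
      using N by blast
  qed
  then have "\<forall>k\<ge>N. U k = U N"
    using inc by (intro allI impI subset_antisym) auto
  then show "\<exists>N. \<forall>k\<ge>N. U k = U N"
    by (rule exI)
qed

hide_const (open) Matrix.col Matrix.row

section \<open>Linear algebra in \<open>K\<^sup>n\<close>\<close>

subsection \<open>Dimensions of finite-dimensional subspaces\<close>

definition finite_dim :: "('k::field \<Rightarrow> 'b::ab_group_add \<Rightarrow> 'b) \<Rightarrow> 'b set \<Rightarrow> bool" where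
  "finite_dim s S \<longleftrightarrow> (\<exists>B. finite B \<and> S \<subseteq> module.span s B)"

context vector_space
begin

lemma finite_dim_subset: "finite_dim scale S \<Longrightarrow> T \<subseteq> S \<Longrightarrow> finite_dim scale T"
  unfolding finite_dim_def by blast

lemma extend_to_basis:
  assumes S: "finite_dim scale S" and A: "independent A" "A \<subseteq> S"
  obtains B where "A \<subseteq> B" "B \<subseteq> S" "independent B" "S \<subseteq> span B" "finite B" "card B = dim S"
proof -
  obtain B where B: "A \<subseteq> B" "B \<subseteq> S" "independent B" "S \<subseteq> span B"
    by (rule maximal_independent_subset_extend[OF A(2,1)])
  obtain F where F: "finite F" "S \<subseteq> span F"
    using S unfolding finite_dim_def by blast
  have "finite B"
    using independent_span_bound[OF F(1) B(3)] B(2) F(2) by blast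
  moreover have "card B = dim S"
    by (rule basis_card_eq_dim[OF B(2,4,3)])
  ultimately show ?thesis
    using that B by blast
qed

lemma finite_dim_basis:
  assumes "finite_dim scale S"
  obtains B where "B \<subseteq> S" "independent B" "S \<subseteq> span B" "finite B" "card B = dim S"
  by (rule extend_to_basis[OF assms independent_empty empty_subsetI]) (rule that)

lemma finite_dim_mono:
  assumes "finite_dim scale T" and "S \<subseteq> T"
  shows "dim S \<le> dim T"
proof -
  obtain A where A: "A \<subseteq> S" "independent A" "S \<subseteq> span A" "finite A" "card A = dim S"
    by (rule finite_dim_basis[OF finite_dim_subset[OF assms]])
  have "A \<subseteq> T"
    using A(1) assms(2) by blast
  then obtain B where "A \<subseteq> B" "B \<subseteq> T" "independent B" "T \<subseteq> span B" "finite B" "card B = dim T"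
    by (rule extend_to_basis[OF assms(1) A(2)])
  then show ?thesis
    using card_mono[of B A] A(5) by simp
qed

lemma subspace_eq_if_dim_ge:
  assumes T: "finite_dim scale T" and ST: "S \<subseteq> T" and S: "subspace S" and d: "dim T \<le> dim S"
  shows "S = T"
proof -
  obtain A where A: "A \<subseteq> S" "independent A" "S \<subseteq> span A" "finite A" "card A = dim S"
    by (rule finite_dim_basis[OF finite_dim_subset[OF T ST]])
  have "A \<subseteq> T"
    using A(1) ST by blast
  then obtain B where B: "A \<subseteq> B" "B \<subseteq> T" "independent B" "T \<subseteq> span B" "finite B" "card B = dim T"
    by (rule extend_to_basis[OF T A(2)])
  have "A = B"
    using B(1,5,6) A(5) d by (intro card_seteq) auto
  then have "T \<subseteq> S"
    using B(4) span_minimal[OF A(1) S] by simp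
  then show ?thesis
    using ST by blast
qed

lemma independent_card_le:
  assumes "finite_dim scale S" and "independent A" and "A \<subseteq> S"
  shows "card A \<le> dim S"
proof -
  obtain B where "A \<subseteq> B" "B \<subseteq> S" "independent B" "S \<subseteq> span B" "finite B" "card B = dim S"
    by (rule extend_to_basis[OF assms])
  then show ?thesis
    using card_mono[of B A] by simp
qed

lemma independent_Un_disjoint:
  assumes fin: "finite S" "finite T" and dis: "S \<inter> T = {}"
  shows "independent (S \<union> T) \<longleftrightarrow>
    independent S \<and> independent T \<and> span S \<inter> span T = {0}"
proof (intro iffI conjI)
  assume i: "independent (S \<union> T)"
  show "independent S"
    by (rule independent_mono[OF i]) simp
  show "independent T"
    by (rule independent_mono[OF i]) simp
  have "v = 0" if v: "v \<in> span S" "v \<in> span T" for v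
  proof -
  obtain a where a: "v = (\<Sum>x\<in>S. a x *s x)"
    using v(1) span_finite[OF fin(1)] by auto
  obtain b where b: "v = (\<Sum>x\<in>T. b x *s x)"
    using v(2) span_finite[OF fin(2)] by auto
  let ?c = "\<lambda>x. if x \<in> S then a x else - b x"
  have "(\<Sum>x\<in>S. ?c x *s x) = v"
    unfolding a by (rule sum.cong) auto
  moreover have "(\<Sum>x\<in>T. ?c x *s x) = (\<Sum>x\<in>T. - (b x *s x))"
    by (rule sum.cong) (use dis in \<open>auto simp: scale_minus_left\<close>)
  ultimately have "(\<Sum>x\<in>S \<union> T. ?c x *s x) = 0"
    using b by (simp add: sum.union_disjoint[OF fin dis] sum_negf)
  then have "?c x = 0" if "x \<in> S" for x
    using independentD[OF i, of "S \<union> T" ?c x] fin that by auto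
  then show "v = 0"
    unfolding a by auto
  qed
  then show "span S \<inter> span T = {0}"
    using span_zero by blast
next
  assume a: "independent S \<and> independent T \<and> span S \<inter> span T = {0}"
  then have i: "independent S" "independent T" and z: "span S \<inter> span T = {0}"
    by auto
  show "independent (S \<union> T)"
  proof
  assume d: "dependent (S \<union> T)"
  have "finite (S \<union> T)"
    using fin by simp
  from d[unfolded dependent_finite[OF this]]
  obtain u where u: "\<exists>v\<in>S \<union> T. u v \<noteq> 0" "(\<Sum>v\<in>S \<union> T. u v *s v) = 0"
    by blast
  have e: "(\<Sum>v\<in>S. u v *s v) = - (\<Sum>v\<in>T. u v *s v)"
    using u(2) by (simp add: sum.union_disjoint[OF fin dis] eq_neg_iff_add_eq_0)
  have "(\<Sum>v\<in>S. u v *s v) \<in> span S"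
    by (intro span_sum span_scale span_base)
  moreover have "(\<Sum>v\<in>S. u v *s v) \<in> span T"
    unfolding e by (intro span_neg span_sum span_scale span_base)
  ultimately have zS: "(\<Sum>v\<in>S. u v *s v) = 0"
    using z by blast
  then have zT: "(\<Sum>v\<in>T. u v *s v) = 0"
    using e by simp
  show False
    using u(1) independentD[OF i(1) fin(1) order_refl zS] independentD[OF i(2) fin(2) order_refl zT]
    by blast
  qed
qed

lemma dim_Int_Un:
  assumes AB: "finite_dim scale A" "finite_dim scale B" and s: "subspace A" "subspace B"
  shows "dim A + dim B = dim (A \<inter> B) + dim (span (A \<union> B))"
proof -
  obtain C where C: "C \<subseteq> A \<inter> B" "independent C" "A \<inter> B \<subseteq> span C" "finite C" "card C = dim (A \<inter> B)"
    by (rule finite_dim_basis[OF finite_dim_subset[OF AB(1) Int_lower1]])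
  obtain A' where A': "C \<subseteq> A'" "A' \<subseteq> A" "independent A'" "A \<subseteq> span A'" "finite A'" "card A' = dim A"
    by (rule extend_to_basis[OF AB(1) C(2)]) (use C(1) in auto)
  obtain B' where B': "C \<subseteq> B'" "B' \<subseteq> B" "independent B'" "B \<subseteq> span B'" "finite B'" "card B' = dim B"
    by (rule extend_to_basis[OF AB(2) C(2)]) (use C(1) in auto)
  let ?D = "B' - C"
  have "independent (C \<union> ?D)"
    using B'(1,3) by (simp add: Un_absorb1)
  then have D: "independent ?D" "span C \<inter> span ?D = {0}"
    using independent_Un_disjoint[of C ?D] C(4) B'(5) by auto
  have sA: "span A' = A"
    using A' s(1) span_subspace by blast
  have "span ?D \<subseteq> B"
    using B'(2) s(2) by (intro span_minimal) auto
  then have z: "span A' \<inter> span ?D = {0}"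
    using C(3) D(2) sA span_zero[of A'] span_zero[of ?D] by auto
  have dis: "A' \<inter> ?D = {}"
  proof (rule ccontr)
    assume "A' \<inter> ?D \<noteq> {}"
    then obtain x where x: "x \<in> A'" "x \<in> ?D" by blast
    then have "x = 0"
      using z span_base[of x A'] span_base[of x ?D] by blast
    then show False
      using x(1) A'(3) dependent_zero by blast
  qed
  have i: "independent (A' \<union> ?D)"
    using independent_Un_disjoint[OF A'(5) _ dis] B'(5) A'(3) D(1) z by auto
  have "span (A' \<union> ?D) = span (A \<union> B)"
    unfolding span_eq
  proof
    show "A' \<union> ?D \<subseteq> span (A \<union> B)"
      using A'(2) B'(2) span_superset[of "A \<union> B"] by blast
    have "B' \<subseteq> A' \<union> ?D"
      using A'(1) by blast
    then show "A \<union> B \<subseteq> span (A' \<union> ?D)"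
      using A'(4) B'(4) span_mono[of A' "A' \<union> ?D"] span_mono[of B' "A' \<union> ?D"] by blast
  qed
  then have "dim (span (A \<union> B)) = card (A' \<union> ?D)"
    using dim_span_eq_card_independent[OF i] by simp
  also have "\<dots> = card A' + (card B' - card C)"
    using card_Un_disjoint[OF A'(5) _ dis] B'(5) card_Diff_subset[OF C(4) B'(1)] by simp
  finally show ?thesis
    using A'(6) B'(6) C(5) card_mono[OF B'(5,1)] by simp
qed

lemma dim_Int_subspace:
  assumes B: "finite_dim scale B" and AB: "A \<subseteq> B" and s: "subspace A" "subspace B" "subspace C"
  shows "dim (C \<inter> B) + dim A \<le> dim (C \<inter> A) + dim B"
proof -
  have "dim (C \<inter> B) + dim A = dim (C \<inter> B \<inter> A) + dim (span (C \<inter> B \<union> A))"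
    using B AB s by (intro dim_Int_Un) (auto intro: finite_dim_subset subspace_inter)
  also have "C \<inter> B \<inter> A = C \<inter> A"
    using AB by blast
  also have "dim (span (C \<inter> B \<union> A)) \<le> dim B"
    using AB s(2) by (intro finite_dim_mono[OF B] span_minimal) auto
  finally show ?thesis by simp
qed

lemma span_image_eq_range:
  assumes "finite I"
  shows "span (b ` I) = range (\<lambda>c. \<Sum>i\<in>I. c i *s b i)"
proof
  have "subspace (range (\<lambda>c. \<Sum>i\<in>I. c i *s b i))"
  proof (rule subspaceI)
    have "0 = (\<Sum>i\<in>I. (0::'a) *s b i)"
      by simp
    then show "0 \<in> range (\<lambda>c. \<Sum>i\<in>I. c i *s b i)"
      by (rule range_eqI[where x = "\<lambda>_. 0"])
  next
    fix x y assume "x \<in> range (\<lambda>c. \<Sum>i\<in>I. c i *s b i)" "y \<in> range (\<lambda>c. \<Sum>i\<in>I. c i *s b i)"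
    then obtain c d where "x = (\<Sum>i\<in>I. c i *s b i)" "y = (\<Sum>i\<in>I. d i *s b i)"
      by blast
    then have "x + y = (\<Sum>i\<in>I. (c i + d i) *s b i)"
      by (simp add: scale_left_distrib sum.distrib)
    then show "x + y \<in> range (\<lambda>c. \<Sum>i\<in>I. c i *s b i)"
      by (rule range_eqI[where x = "\<lambda>i. c i + d i"])
  next
    fix a x assume "x \<in> range (\<lambda>c. \<Sum>i\<in>I. c i *s b i)"
    then obtain c where "x = (\<Sum>i\<in>I. c i *s b i)"
      by blast
    then have "a *s x = (\<Sum>i\<in>I. (a * c i) *s b i)"
      by (simp add: scale_sum_right)
    then show "a *s x \<in> range (\<lambda>c. \<Sum>i\<in>I. c i *s b i)"
      by (rule range_eqI[where x = "\<lambda>i. a * c i"])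
  qed
  moreover have "b ` I \<subseteq> range (\<lambda>c. \<Sum>i\<in>I. c i *s b i)"
  proof
    fix x assume "x \<in> b ` I"
    then obtain j where j: "j \<in> I" "x = b j" by blast
    have "(\<Sum>i\<in>I. (if i = j then 1 else 0) *s b i) = (\<Sum>i\<in>I. if i = j then b j else 0)"
      by (rule sum.cong) auto
    then have "x = (\<Sum>i\<in>I. (if i = j then 1 else 0) *s b i)"
      using j assms by simp
    then show "x \<in> range (\<lambda>c. \<Sum>i\<in>I. c i *s b i)"
      by (rule range_eqI[where x = "\<lambda>i. if i = j then 1 else 0"])
  qed
  ultimately show "span (b ` I) \<subseteq> range (\<lambda>c. \<Sum>i\<in>I. c i *s b i)"
    by (intro span_minimal)
  show "range (\<lambda>c. \<Sum>i\<in>I. c i *s b i) \<subseteq> span (b ` I)"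
    by (rule image_subsetI, rule span_sum, rule span_scale, rule span_base, erule imageI)
qed

lemma independent_family_iff:
  assumes "finite I"
  shows "inj_on b I \<and> independent (b ` I) \<longleftrightarrow>
    (\<forall>c. (\<Sum>i\<in>I. c i *s b i) = 0 \<longrightarrow> (\<forall>i\<in>I. c i = 0))"
proof
  assume a: "inj_on b I \<and> independent (b ` I)"
  show "\<forall>c. (\<Sum>i\<in>I. c i *s b i) = 0 \<longrightarrow> (\<forall>i\<in>I. c i = 0)"
  proof (intro allI impI ballI)
    fix c i assume c: "(\<Sum>i\<in>I. c i *s b i) = 0" and i: "i \<in> I"
    have "(\<Sum>v\<in>b ` I. c (inv_into I b v) *s v) = (\<Sum>i\<in>I. c i *s b i)"
      using a by (simp add: sum.reindex)
    then have "(\<Sum>v\<in>b ` I. c (inv_into I b v) *s v) = 0"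
      using c by simp
    from independentD[OF conjunct2[OF a] _ order_refl this, of "b i"] show "c i = 0"
      using assms i a by simp
  qed
next
  assume a: "\<forall>c. (\<Sum>i\<in>I. c i *s b i) = 0 \<longrightarrow> (\<forall>i\<in>I. c i = 0)"
  have inj: "inj_on b I"
  proof (rule inj_onI, rule ccontr)
    fix i j assume ij: "i \<in> I" "j \<in> I" "b i = b j" "i \<noteq> j"
    let ?c = "\<lambda>l. if l = i then 1 else if l = j then - 1 else (0::'a)"
    have "(\<Sum>l\<in>I. ?c l *s b l) = (\<Sum>l\<in>I. (if l = i then b i else 0) + (if l = j then - b j else 0))"
      by (rule sum.cong) (use ij in auto)
    also have "\<dots> = 0"
      using assms ij by (simp add: sum.distrib)
    finally have z: "(\<Sum>l\<in>I. ?c l *s b l) = 0" .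
    have "?c i = 0"
      by (rule bspec[OF mp[OF spec[OF a, of ?c] z] ij(1)])
    then show False by simp
  qed
  moreover have "independent (b ` I)"
  proof
    have "finite (b ` I)"
      using assms by simp
    moreover assume "dependent (b ` I)"
    ultimately obtain u where u: "\<exists>v\<in>b ` I. u v \<noteq> 0" "(\<Sum>v\<in>b ` I. u v *s v) = 0"
      using dependent_finite[of "b ` I"] by blast
    have "(\<Sum>i\<in>I. u (b i) *s b i) = 0"
      using u(2) inj by (simp add: sum.reindex)
    then have "\<forall>i\<in>I. u (b i) = 0"
      using spec[OF a, of "\<lambda>i. u (b i)"] by blast
    then show False
      using u(1) by blast
  qed
  ultimately show "inj_on b I \<and> independent (b ` I)" ..
qed

lemma dim_span_image:
  assumes "inj_on b I" "independent (b ` I)" "J \<subseteq> I"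
  shows "dim (span (b ` J)) = card J"
proof -
  have "independent (b ` J)"
    using independent_mono[OF assms(2)] assms(3) by blast
  then show ?thesis
    using dim_span_eq_card_independent card_image[OF inj_on_subset[OF assms(1,3)]] by simp
qed

lemma span_image_Int:
  assumes I: "finite I" "inj_on b I" "independent (b ` I)" and J: "J \<subseteq> I" "L \<subseteq> I"
  shows "span (b ` J) \<inter> span (b ` L) = span (b ` (J \<inter> L))"
proof
  show "span (b ` (J \<inter> L)) \<subseteq> span (b ` J) \<inter> span (b ` L)"
    using span_mono[of "b ` (J \<inter> L)" "b ` J"] span_mono[of "b ` (J \<inter> L)" "b ` L"] by auto
  show "span (b ` J) \<inter> span (b ` L) \<subseteq> span (b ` (J \<inter> L))"
  proof
    fix v assume v: "v \<in> span (b ` J) \<inter> span (b ` L)"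
    have fin: "finite J" "finite L"
      using J I(1) finite_subset by auto
    obtain c where c: "v = (\<Sum>i\<in>J. c i *s b i)"
      using v span_image_eq_range[OF fin(1), of b] by auto
    obtain d where d: "v = (\<Sum>i\<in>L. d i *s b i)"
      using v span_image_eq_range[OF fin(2), of b] by auto
    let ?e = "\<lambda>i. (if i \<in> J then c i else 0) - (if i \<in> L then d i else 0)"
    have "(\<Sum>i\<in>I. (if i \<in> J then c i else 0) *s b i) = v"
      unfolding c by (rule sum.mono_neutral_cong_right) (use I(1) J in auto)
    moreover have "(\<Sum>i\<in>I. (if i \<in> L then d i else 0) *s b i) = v"
      unfolding d by (rule sum.mono_neutral_cong_right) (use I(1) J in auto)
    ultimately have z: "(\<Sum>i\<in>I. ?e i *s b i) = 0"
      by (simp add: scale_left_diff_distrib sum_subtractf)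
    have e: "\<forall>i\<in>I. ?e i = 0"
      by (rule mp[OF spec[OF iffD1[OF independent_family_iff[OF I(1)] conjI[OF I(2,3)]], of ?e] z])
    have z: "c i = 0" if "i \<in> J - L" for i
    proof -
      have "?e i = 0"
        using e that J by blast
      then show ?thesis
        using that by simp
    qed
    have "v = (\<Sum>i\<in>J \<inter> L. c i *s b i)"
      unfolding c by (rule sum.mono_neutral_right) (use fin z in auto)
    also have "\<dots> \<in> span (b ` (J \<inter> L))"
      by (rule span_sum, rule span_scale, rule span_base, erule imageI)
    finally show "v \<in> span (b ` (J \<inter> L))" .
  qed
qed

end

lemma dim_linear_image:
  assumes f: "Vector_Spaces.linear s s f" and S: "module.subspace s S" and inj: "inj_on f S"
    and fd: "finite_dim s S"
  shows "vector_space.dim s (f ` S) = vector_space.dim s S"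
proof -
  interpret Vector_Spaces.linear s s f by (rule f)
  obtain B where B: "B \<subseteq> S" "vs1.independent B" "S \<subseteq> vs1.span B" "finite B" "card B = vs1.dim S"
    by (rule vs1.finite_dim_basis[OF fd])
  have SB: "vs1.span B = S"
    using B S vs1.span_subspace by blast
  have "vs1.independent (f ` B)"
    by (rule independent_injective_image[OF B(2)]) (simp add: SB inj)
  then have "vs1.dim (vs1.span (f ` B)) = card (f ` B)"
    by (rule vs1.dim_span_eq_card_independent)
  then show ?thesis
    using card_image[OF inj_on_subset[OF inj B(1)]] B(5) by (simp add: span_image SB)
qed

subsection \<open>Vectors and matrices\<close>

text \<open>Coordinates are indexed from \<open>1\<close>, which the simplifier should not turn into \<open>Suc 0\<close>.\<close>

declare One_nat_def [simp del]

abbreviation mats :: "nat \<Rightarrow> (nat \<times> nat \<Rightarrow> 'k::field) set" where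
  "mats n \<equiv> affine_points ({1..n} \<times> {1..n})"

definition std :: "nat \<Rightarrow> nat \<Rightarrow> 'k::field" where
  "std i = (\<lambda>j. if j = i then 1 else 0)"

definition mv :: "nat \<Rightarrow> (nat \<times> nat \<Rightarrow> 'k::field) \<Rightarrow> (nat \<Rightarrow> 'k) \<Rightarrow> nat \<Rightarrow> 'k" where
  "mv n g v = (\<lambda>i. \<Sum>j\<in>{1..n}. g (i, j) * v j)"

definition mm :: "nat \<Rightarrow> (nat \<times> nat \<Rightarrow> 'k::field) \<Rightarrow> (nat \<times> nat \<Rightarrow> 'k) \<Rightarrow> nat \<times> nat \<Rightarrow> 'k" where
  "mm n g h = (\<lambda>(i, j). \<Sum>l\<in>{1..n}. g (i, l) * h (l, j))"

definition idm :: "nat \<Rightarrow> nat \<times> nat \<Rightarrow> 'k::field" where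
  "idm n = (\<lambda>(i, j). if i = j \<and> i \<in> {1..n} then 1 else 0)"

lemma sum_fun_apply: "(\<Sum>a\<in>A. f a) i = (\<Sum>a\<in>A. f a i)"
  by (induction A rule: infinite_finite_induct) (auto simp: zero_fun_def plus_fun_def)

lemma subspace_Kn: "fv.subspace (Kn n)"
  by (rule fv.subspaceI) (auto simp: affine_points_def zero_fun_def plus_fun_def fun_scale_def)

lemma Kn_eqI:
  assumes "v \<in> Kn n" "w \<in> Kn n" and "\<And>i. i \<in> {1..n} \<Longrightarrow> v i = w i"
  shows "v = w"
proof
  fix i show "v i = w i"
    using assms by (cases "i \<in> {1..n}") (auto simp: affine_points_def)
qed

lemma mv_eq_sum: "mv n g v = (\<Sum>j\<in>{1..n}. fun_scale (v j) (col g j))"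
  by (rule ext) (simp add: mv_def sum_fun_apply fun_scale_def Defs.col_def mult.commute)

lemma linear_mv: "Vector_Spaces.linear fun_scale fun_scale (mv n g)"
  unfolding Vector_Spaces.linear_iff
proof (intro conjI allI)
  show "vector_space (fun_scale :: 'a \<Rightarrow> (nat \<Rightarrow> 'a) \<Rightarrow> nat \<Rightarrow> 'a)"
    by (rule fv.vector_space_axioms)
  then show "vector_space (fun_scale :: 'a \<Rightarrow> (nat \<Rightarrow> 'a) \<Rightarrow> nat \<Rightarrow> 'a)" .
qed (auto simp: mv_def fun_scale_def plus_fun_def distrib_left sum.distrib sum_distrib_left mult_ac)

interpretation mv: Vector_Spaces.linear fun_scale fun_scale "mv n g" for n and g :: "nat \<times> nat \<Rightarrow> 'k::field"
  by (rule linear_mv)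

lemma mats_cols: "g \<in> mats n \<longleftrightarrow> (\<forall>j\<in>{1..n}. col g j \<in> Kn n) \<and> (\<forall>i j. j \<notin> {1..n} \<longrightarrow> g (i, j) = 0)"
  by (auto simp: affine_points_def Defs.col_def)

lemma col_in_Kn: "g \<in> mats n \<Longrightarrow> col g j \<in> Kn n"
  by (auto simp: affine_points_def Defs.col_def)

lemma mats_eqI:
  assumes "g \<in> mats n" "h \<in> mats n" and "\<And>j. j \<in> {1..n} \<Longrightarrow> col g j = col h j"
  shows "g = h"
proof
  fix x :: "nat \<times> nat"
  obtain i j where x: "x = (i, j)" by (cases x)
  show "g x = h x"
  proof (cases "j \<in> {1..n}")
    case True
    then show ?thesis
      using fun_cong[OF assms(3)[OF True], of i] by (simp add: x Defs.col_def)
  next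
    case False
    then show ?thesis
      using assms(1,2) by (simp add: x affine_points_def)
  qed
qed

lemma mv_in_Kn: "g \<in> mats n \<Longrightarrow> mv n g v \<in> Kn n"
  by (auto simp: affine_points_def mv_def intro!: sum.neutral)

lemma mm_in_mats: "g \<in> mats n \<Longrightarrow> h \<in> mats n \<Longrightarrow> mm n g h \<in> mats n"
  by (auto simp: affine_points_def mm_def intro!: sum.neutral)

lemma idm_in_mats: "idm n \<in> mats n"
  by (auto simp: affine_points_def idm_def)

lemma col_mm: "col (mm n g h) j = mv n g (col h j)"
  by (simp add: Defs.col_def mm_def mv_def)

lemma mv_mm: "mv n (mm n g h) v = mv n g (mv n h v)"
proof
  fix i
  have "mv n (mm n g h) v i = (\<Sum>j\<in>{1..n}. \<Sum>l\<in>{1..n}. g (i, l) * h (l, j) * v j)"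
    by (simp add: mv_def mm_def sum_distrib_right)
  also have "\<dots> = (\<Sum>l\<in>{1..n}. \<Sum>j\<in>{1..n}. g (i, l) * h (l, j) * v j)"
    by (rule sum.swap)
  also have "\<dots> = mv n g (mv n h v) i"
    by (simp add: mv_def sum_distrib_left mult.assoc)
  finally show "mv n (mm n g h) v i = mv n g (mv n h v) i" .
qed

lemma mm_assoc: "mm n (mm n g h) k = mm n g (mm n h k)"
proof
  fix x :: "nat \<times> nat"
  obtain i j where x: "x = (i, j)" by (cases x)
  have "col (mm n (mm n g h) k) j = col (mm n g (mm n h k)) j"
    by (simp add: col_mm mv_mm)
  from fun_cong[OF this, of i] show "mm n (mm n g h) k x = mm n g (mm n h k) x"
    by (simp add: x Defs.col_def)
qed

lemma mv_idm:
  assumes "v \<in> Kn n"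
  shows "mv n (idm n) v = v"
proof
  fix i
  have "mv n (idm n) v i = (\<Sum>j\<in>{1..n}. if i = j then v i else 0)"
    unfolding mv_def idm_def by (rule sum.cong) auto
  also have "\<dots> = v i"
    using assms by (auto simp: affine_points_def)
  finally show "mv n (idm n) v i = v i" .
qed

lemma mm_idm_left:
  assumes "g \<in> mats n"
  shows "mm n (idm n) g = g"
  by (rule mats_eqI[OF mm_in_mats[OF idm_in_mats assms] assms])
    (simp add: col_mm mv_idm[OF col_in_Kn[OF assms]])

lemma std_in_Kn: "i \<in> {1..n} \<Longrightarrow> std i \<in> Kn n"
  by (auto simp: affine_points_def std_def)

lemma col_idm: "j \<in> {1..n} \<Longrightarrow> col (idm n) j = std j"
  by (auto simp: Defs.col_def idm_def std_def)

lemma mv_std: "j \<in> {1..n} \<Longrightarrow> mv n g (std j) = col g j"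
  by (rule ext) (simp add: mv_def std_def Defs.col_def if_distrib cong: if_cong)

lemma span_cols:
  assumes "d \<le> n"
  shows "fv.span (col g ` {1..d}) = mv n g ` {v. \<forall>i. i \<notin> {1..d} \<longrightarrow> v i = 0}"
proof
  have e: "(\<Sum>j\<in>{1..d}. fun_scale (c j) (col g j)) = mv n g (\<lambda>j. if j \<in> {1..d} then c j else 0)" for c
    unfolding mv_eq_sum by (rule sum.mono_neutral_cong_left) (use assms in auto)
  show "fv.span (col g ` {1..d}) \<subseteq> mv n g ` {v. \<forall>i. i \<notin> {1..d} \<longrightarrow> v i = 0}"
    unfolding fv.span_image_eq_range[OF finite_atLeastAtMost] e
    by (rule image_subsetI, rule imageI) simp
  show "mv n g ` {v. \<forall>i. i \<notin> {1..d} \<longrightarrow> v i = 0} \<subseteq> fv.span (col g ` {1..d})"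
  proof (rule image_subsetI)
    fix v :: "nat \<Rightarrow> 'a" assume v: "v \<in> {v. \<forall>i. i \<notin> {1..d} \<longrightarrow> v i = 0}"
    have "v = (\<lambda>j. if j \<in> {1..d} then v j else 0)"
      using v by auto
    then have "mv n g v = (\<Sum>j\<in>{1..d}. fun_scale (v j) (col g j))"
      unfolding e by simp
    then show "mv n g v \<in> fv.span (col g ` {1..d})"
      unfolding fv.span_image_eq_range[OF finite_atLeastAtMost] by (rule range_eqI[where x = v])
  qed
qed

lemma span_std:
  assumes "d \<le> n"
  shows "fv.span (std ` {1..d}) = (Kn d :: (nat \<Rightarrow> 'k::field) set)"
proof -
  have "std ` {1..d} = col (idm n :: nat \<times> nat \<Rightarrow> 'k) ` {1..d}"
    by (rule image_cong) (use assms in \<open>auto simp: col_idm\<close>)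
  then have "fv.span (std ` {1..d}) = fv.span (col (idm n :: nat \<times> nat \<Rightarrow> 'k) ` {1..d})"
    by (rule arg_cong)
  also have "\<dots> = mv n (idm n) ` Kn d"
    unfolding span_cols[OF assms] affine_points_def ..
  also have "\<dots> = (\<lambda>v. v) ` Kn d"
  proof (rule image_cong[OF refl])
    fix v :: "nat \<Rightarrow> 'k" assume "v \<in> Kn d"
    then have "v \<in> Kn n"
      using assms by (auto simp: affine_points_def)
    then show "mv n (idm n) v = v"
      by (rule mv_idm)
  qed
  finally show ?thesis by simp
qed

lemma independent_std: "inj_on (std :: nat \<Rightarrow> nat \<Rightarrow> 'k::field) {1..n}" "fv.independent (std ` {1..n} :: (nat \<Rightarrow> 'k) set)"
proof -
  have "\<forall>i\<in>{1..n}. c i = 0" if "(\<Sum>i\<in>{1..n}. fun_scale (c i) (std i)) = (0 :: nat \<Rightarrow> 'k)" for c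
  proof
    fix i assume i: "i \<in> {1..n}"
    have "(\<Sum>j\<in>{1..n}. fun_scale (c j) (std j)) i = (\<Sum>j\<in>{1..n}. if i = j then c i else 0)"
      unfolding sum_fun_apply by (rule sum.cong) (auto simp: fun_scale_def std_def)
    then show "c i = 0"
      using that i by simp
  qed
  then show "inj_on (std :: nat \<Rightarrow> nat \<Rightarrow> 'k) {1..n}" "fv.independent (std ` {1..n} :: (nat \<Rightarrow> 'k) set)"
    using fv.independent_family_iff[of "{1..n}" "std :: nat \<Rightarrow> nat \<Rightarrow> 'k"] by auto
qed

lemma finite_dim_Kn: "finite_dim fun_scale (Kn n)"
  unfolding finite_dim_def
  by (rule exI[of _ "std ` {1..n}"]) (use span_std[of n n] in auto)

lemma finite_dim_in_Kn: "S \<subseteq> Kn n \<Longrightarrow> finite_dim fun_scale S"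
  using fv.finite_dim_subset[OF finite_dim_Kn] .

lemma dim_Kn: "fv.dim (Kn n :: (nat \<Rightarrow> 'k::field) set) = n"
proof -
  have "fv.dim (fv.span (std ` {1..n} :: (nat \<Rightarrow> 'k) set)) = card {1..n}"
    by (rule fv.dim_span_image[OF independent_std order_refl])
  then show ?thesis
    unfolding span_std[OF order_refl] by simp
qed

lemma is_basis_iff:
  "is_basis n b \<longleftrightarrow> (\<forall>i\<in>{1..n}. b i \<in> Kn n) \<and>
     (\<forall>c. (\<Sum>i\<in>{1..n}. fun_scale (c i) (b i)) = 0 \<longrightarrow> (\<forall>i\<in>{1..n}. c i = 0))"
proof -
  have "fv.span (b ` {1..n}) = Kn n \<longleftrightarrow> (\<forall>i\<in>{1..n}. b i \<in> Kn n)"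
    if i: "inj_on b {1..n}" "fv.independent (b ` {1..n})"
  proof
    assume "fv.span (b ` {1..n}) = Kn n"
    then show "\<forall>i\<in>{1..n}. b i \<in> Kn n"
      using fv.span_superset by blast
  next
    assume "\<forall>i\<in>{1..n}. b i \<in> Kn n"
    then have "fv.span (b ` {1..n}) \<subseteq> Kn n"
      by (intro fv.span_minimal subspace_Kn) auto
    moreover have "fv.dim (fv.span (b ` {1..n})) = n"
      using fv.dim_span_image[OF i order_refl] by simp
    ultimately show "fv.span (b ` {1..n}) = Kn n"
      by (intro fv.subspace_eq_if_dim_ge[OF finite_dim_Kn _ fv.subspace_span]) (simp_all add: dim_Kn)
  qed
  then show ?thesis
    unfolding is_basis_def using fv.independent_family_iff[of "{1..n}" b] by blast
qed

subsection \<open>Leading minors\<close>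

text \<open>
  The entries of \<open>lead_mat\<close> are numbered from \<open>0\<close>, those of \<open>g\<close> and of the adjugate \<open>lead_adj\<close> from
  \<open>1\<close>. Outside of the block of size \<open>d\<close> the adjugate is \<open>0\<close>, as the points of affine space are.
\<close>

definition lead_mat :: "nat \<Rightarrow> (nat \<times> nat \<Rightarrow> 'k::field) \<Rightarrow> 'k mat" where
  "lead_mat d g = mat d d (\<lambda>(i, j). g (Suc i, Suc j))"

definition lead_minor :: "nat \<Rightarrow> (nat \<times> nat \<Rightarrow> 'k::field) \<Rightarrow> 'k" where
  "lead_minor d g = det (lead_mat d g)"

definition lead_adj :: "nat \<Rightarrow> (nat \<times> nat \<Rightarrow> 'k::field) \<Rightarrow> nat \<times> nat \<Rightarrow> 'k" where
  "lead_adj d g = (\<lambda>(i, j). if i \<in> {1..d} \<and> j \<in> {1..d} then adj_mat (lead_mat d g) $$ (i - 1, j - 1) else 0)"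

lemma lead_mat_carrier: "lead_mat d g \<in> carrier_mat d d"
  by (simp add: lead_mat_def)

lemma sum_1_to_d: "(\<Sum>l\<in>{1..d}. f l) = (\<Sum>l<d. f (Suc l))"
  using sum.atLeast1_atMost_eq[of f d] by (simp add: One_nat_def)

lemma lead_adj_right:
  assumes "i \<in> {1..d}" "j \<in> {1..d}"
  shows "(\<Sum>l\<in>{1..d}. g (i, l) * lead_adj d g (l, j)) = (if i = j then lead_minor d g else 0)"
proof -
  let ?A = "lead_mat d g"
  have c: "?A \<in> carrier_mat d d" "adj_mat ?A \<in> carrier_mat d d"
    using lead_mat_carrier adj_mat(1) by blast+
  have "(?A * adj_mat ?A) $$ (i - 1, j - 1) = (det ?A \<cdot>\<^sub>m 1\<^sub>m d) $$ (i - 1, j - 1)"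
    using adj_mat(2)[OF c(1)] by simp
  also have "\<dots> = (if i = j then lead_minor d g else 0)"
    using assms by (auto simp: lead_minor_def)
  finally have "(?A * adj_mat ?A) $$ (i - 1, j - 1) = (if i = j then lead_minor d g else 0)" .
  moreover have "(?A * adj_mat ?A) $$ (i - 1, j - 1) = (\<Sum>l<d. ?A $$ (i - 1, l) * adj_mat ?A $$ (l, j - 1))"
    using assms c by (auto simp: scalar_prod_def atLeast0LessThan intro!: sum.cong)
  moreover have "\<dots> = (\<Sum>l<d. g (i, Suc l) * lead_adj d g (Suc l, j))"
    by (rule sum.cong) (use assms in \<open>auto simp: lead_mat_def lead_adj_def\<close>)
  ultimately show ?thesis
    unfolding sum_1_to_d by simp
qed

lemma lead_adj_left:
  assumes "i \<in> {1..d}" "j \<in> {1..d}"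
  shows "(\<Sum>l\<in>{1..d}. lead_adj d g (i, l) * g (l, j)) = (if i = j then lead_minor d g else 0)"
proof -
  let ?A = "lead_mat d g"
  have c: "?A \<in> carrier_mat d d" "adj_mat ?A \<in> carrier_mat d d"
    using lead_mat_carrier adj_mat(1) by blast+
  have "(adj_mat ?A * ?A) $$ (i - 1, j - 1) = (det ?A \<cdot>\<^sub>m 1\<^sub>m d) $$ (i - 1, j - 1)"
    using adj_mat(3)[OF c(1)] by simp
  also have "\<dots> = (if i = j then lead_minor d g else 0)"
    using assms by (auto simp: lead_minor_def)
  finally have "(adj_mat ?A * ?A) $$ (i - 1, j - 1) = (if i = j then lead_minor d g else 0)" .
  moreover have "(adj_mat ?A * ?A) $$ (i - 1, j - 1) = (\<Sum>l<d. adj_mat ?A $$ (i - 1, l) * ?A $$ (l, j - 1))"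
    using assms c by (auto simp: scalar_prod_def atLeast0LessThan intro!: sum.cong)
  moreover have "\<dots> = (\<Sum>l<d. lead_adj d g (i, Suc l) * g (Suc l, j))"
    by (rule sum.cong) (use assms in \<open>auto simp: lead_mat_def lead_adj_def\<close>)
  ultimately show ?thesis
    unfolding sum_1_to_d by simp
qed

lemma lead_minor_kernel:
  assumes nz: "lead_minor d g \<noteq> 0"
    and c: "\<And>i. i \<in> {1..d} \<Longrightarrow> (\<Sum>l\<in>{1..d}. g (i, l) * c l) = 0" and j: "j \<in> {1..d}"
  shows "c j = 0"
proof -
  have "(\<Sum>i\<in>{1..d}. lead_adj d g (j, i) * (\<Sum>l\<in>{1..d}. g (i, l) * c l)) = 0"
    by (rule sum.neutral) (simp add: c)
  moreover have "(\<Sum>i\<in>{1..d}. lead_adj d g (j, i) * (\<Sum>l\<in>{1..d}. g (i, l) * c l))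
      = (\<Sum>l\<in>{1..d}. (\<Sum>i\<in>{1..d}. lead_adj d g (j, i) * g (i, l)) * c l)"
    unfolding sum_distrib_left sum_distrib_right by (subst sum.swap) (simp add: mult.assoc)
  moreover have "\<dots> = (\<Sum>l\<in>{1..d}. if j = l then lead_minor d g * c j else 0)"
    by (rule sum.cong) (auto simp: lead_adj_left[OF j])
  ultimately show ?thesis
    using nz j by simp
qed

lemma lead_minor_0:
  assumes "lead_minor d g = 0"
  obtains c where "\<exists>l\<in>{1..d}. c l \<noteq> 0" "\<forall>i\<in>{1..d}. (\<Sum>l\<in>{1..d}. g (i, l) * c l) = 0"
proof -
  obtain v where v: "v \<in> carrier_vec d" "v \<noteq> 0\<^sub>v d" "lead_mat d g *\<^sub>v v = 0\<^sub>v d"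
    using assms det_0_iff_vec_prod_zero_field[OF lead_mat_carrier] unfolding lead_minor_def by blast
  have "\<exists>l<d. v $ l \<noteq> 0"
  proof (rule ccontr)
    assume "\<not> ?thesis"
    then have "v = 0\<^sub>v d"
      using v(1) by (intro eq_vecI) auto
    then show False
      using v(2) by simp
  qed
  then obtain l where l: "l < d" "v $ l \<noteq> 0"
    by blast
  show ?thesis
  proof (rule that[of "\<lambda>l. v $ (l - 1)"])
    show "\<exists>l\<in>{1..d}. v $ (l - 1) \<noteq> 0"
      using l by (intro bexI[of _ "Suc l"]) auto
    show "\<forall>i\<in>{1..d}. (\<Sum>l\<in>{1..d}. g (i, l) * v $ (l - 1)) = 0"
    proof
    fix i assume i: "i \<in> {1..d}"
    have "(lead_mat d g *\<^sub>v v) $ (i - 1) = 0"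
      unfolding v(3) using i by (subst index_zero_vec(1)) auto
    moreover have "(lead_mat d g *\<^sub>v v) $ (i - 1) = (\<Sum>l<d. g (i, Suc l) * v $ l)"
      using i v(1) by (auto simp: lead_mat_def scalar_prod_def atLeast0LessThan intro!: sum.cong)
    ultimately show "(\<Sum>l\<in>{1..d}. g (i, l) * v $ (l - 1)) = 0"
      unfolding sum_1_to_d by simp
    qed
  qed
qed

lemma polyfun_det:
  assumes "\<And>x. M x \<in> carrier_mat d d"
    and "\<And>i j. i < d \<Longrightarrow> j < d \<Longrightarrow> (\<lambda>x. M x $$ (i, j)) \<in> polyfun I"
  shows "(\<lambda>x. det (M x)) \<in> polyfun I"
proof -
  have "(\<lambda>x. \<Sum>p\<in>{p. p permutes {0..<d}}. signof p * (\<Prod>i = 0..<d. M x $$ (i, p i))) \<in> polyfun I"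
  proof (rule polyfun_sum, rule polyfun.mult[OF polyfun.const], rule polyfun_prod)
    fix p i assume "p \<in> {p. p permutes {0..<d}}" "i \<in> {0..<d}"
    then have "p i \<in> {0..<d}" "i < d"
      using permutes_in_image by fastforce+
    then show "(\<lambda>x. M x $$ (i, p i)) \<in> polyfun I"
      by (intro assms(2)) auto
  qed
  then show ?thesis
    unfolding det_def'[OF assms(1)] .
qed

lemma polyfun_lead_minor:
  assumes "d \<le> n"
  shows "lead_minor d \<in> polyfun ({1..n} \<times> {1..n})"
proof -
  have "(\<lambda>g. det (lead_mat d g)) \<in> polyfun ({1..n} \<times> {1..n})"
    by (rule polyfun_det[OF lead_mat_carrier]) (use assms in \<open>auto simp: lead_mat_def intro!: polyfun.coord\<close>)
  then show ?thesis
    by (simp add: lead_minor_def[abs_def])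
qed

lemma polyfun_lead_adj:
  assumes "d \<le> n"
  shows "(\<lambda>g. lead_adj d g (i, j)) \<in> (polyfun ({1..n} \<times> {1..n}) :: ((nat \<times> nat \<Rightarrow> 'k::field) \<Rightarrow> 'k) set)"
proof (cases "i \<in> {1..d} \<and> j \<in> {1..d}")
  case True
  have "(\<lambda>g. (- 1) ^ (j - 1 + (i - 1)) * det (mat_delete (lead_mat d g) (j - 1) (i - 1)))
      \<in> (polyfun ({1..n} \<times> {1..n}) :: ((nat \<times> nat \<Rightarrow> 'k) \<Rightarrow> 'k) set)"
  proof (rule polyfun.mult[OF polyfun.const], rule polyfun_det[of _ "d - 1"])
    fix g :: "nat \<times> nat \<Rightarrow> 'k"
    show "mat_delete (lead_mat d g) (j - 1) (i - 1) \<in> carrier_mat (d - 1) (d - 1)"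
      by (rule mat_delete_carrier[OF lead_mat_carrier])
  next
    fix a b assume ab: "a < d - 1" "b < d - 1"
    have "(\<lambda>g :: nat \<times> nat \<Rightarrow> 'k. mat_delete (lead_mat d g) (j - 1) (i - 1) $$ (a, b))
      = (\<lambda>g. g (Suc (if a < j - 1 then a else Suc a), Suc (if b < i - 1 then b else Suc b)))"
      using ab by (auto simp: mat_delete_def lead_mat_def)
    moreover have "(\<lambda>g :: nat \<times> nat \<Rightarrow> 'k. g (Suc (if a < j - 1 then a else Suc a), Suc (if b < i - 1 then b else Suc b)))
      \<in> polyfun ({1..n} \<times> {1..n})"
      using ab assms by (intro polyfun.coord) auto
    ultimately show "(\<lambda>g :: nat \<times> nat \<Rightarrow> 'k. mat_delete (lead_mat d g) (j - 1) (i - 1) $$ (a, b)) \<in> polyfun ({1..n} \<times> {1..n})"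
      by simp
  qed
  moreover have "lead_adj d g (i, j)
      = (- 1) ^ (j - 1 + (i - 1)) * det (mat_delete (lead_mat d g) (j - 1) (i - 1))" for g :: "nat \<times> nat \<Rightarrow> 'k"
    using True by (auto simp: lead_adj_def adj_mat_def cofactor_def lead_mat_def)
  ultimately show ?thesis
    by simp
next
  case False
  then have "lead_adj d g (i, j) = 0" for g :: "nat \<times> nat \<Rightarrow> 'k"
    by (auto simp: lead_adj_def)
  then show ?thesis
    by (simp add: polyfun.const)
qed

subsection \<open>Invertible matrices\<close>

definition GLs :: "nat \<Rightarrow> (nat \<times> nat \<Rightarrow> 'k::field) set" where
  "GLs n = {g \<in> mats n. is_basis n (col g)}"

lemma GLs_mats: "g \<in> GLs n \<Longrightarrow> g \<in> mats n"
  by (simp add: GLs_def)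

lemma GLs_iff_kernel: "g \<in> GLs n \<longleftrightarrow> g \<in> mats n \<and> (\<forall>v\<in>Kn n. mv n g v = 0 \<longrightarrow> v = 0)"
proof -
  have e: "(\<forall>c. (\<Sum>i\<in>{1..n}. fun_scale (c i) (col g i)) = 0 \<longrightarrow> (\<forall>i\<in>{1..n}. c i = 0)) \<longleftrightarrow>
      (\<forall>v\<in>Kn n. mv n g v = 0 \<longrightarrow> v = 0)"
    unfolding mv_eq_sum[symmetric]
  proof safe
    fix v :: "nat \<Rightarrow> 'a" assume a: "\<forall>c. mv n g c = 0 \<longrightarrow> (\<forall>i\<in>{1..n}. c i = 0)" "v \<in> Kn n" "mv n g v = 0"
    then show "v = 0"
      by (intro Kn_eqI[of v n]) (auto simp: affine_points_def)
  next
    fix c i assume a: "\<forall>v\<in>Kn n. mv n g v = 0 \<longrightarrow> v = 0" "mv n g c = 0" "i \<in> {1..n}"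
    let ?v = "\<lambda>j. if j \<in> {1..n} then c j else 0"
    have "mv n g ?v = mv n g c"
      unfolding mv_def by (intro ext sum.cong) auto
    then have "mv n g ?v = 0"
      using a(2) by simp
    moreover have "?v \<in> Kn n"
      by (auto simp: affine_points_def)
    ultimately have "?v = 0"
      using a(1) by blast
    from fun_cong[OF this, of i] show "c i = 0"
      using a(3) by simp
  qed
  have c: "\<forall>i\<in>{1..n}. col g i \<in> Kn n" if "g \<in> mats n"
    using col_in_Kn[OF that] by blast
  show ?thesis
    by (simp only: GLs_def is_basis_iff mem_Collect_eq e) (use c in blast)
qed

lemma inj_on_mv: "g \<in> GLs n \<Longrightarrow> inj_on (mv n g) (Kn n)"
  by (subst mv.inj_on_iff_eq_0[OF subspace_Kn]) (simp add: GLs_iff_kernel)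

lemma GLs_iff_minor: "g \<in> GLs n \<longleftrightarrow> g \<in> mats n \<and> lead_minor n g \<noteq> 0"
proof -
  have "(\<forall>v\<in>Kn n. mv n g v = 0 \<longrightarrow> v = 0) \<longleftrightarrow> lead_minor n g \<noteq> 0" if g: "g \<in> mats n"
  proof
    assume nz: "lead_minor n g \<noteq> 0"
    show "\<forall>v\<in>Kn n. mv n g v = 0 \<longrightarrow> v = 0"
    proof (intro ballI impI)
      fix v assume v: "v \<in> Kn n" "mv n g v = 0"
      have "v j = 0" if "j \<in> {1..n}" for j
        by (rule lead_minor_kernel[OF nz _ that]) (use fun_cong[OF v(2)] in \<open>simp add: mv_def\<close>)
      then show "v = 0"
        using v(1) by (intro Kn_eqI[of v n]) (auto simp: affine_points_def)
    qed
  next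
    assume k: "\<forall>v\<in>Kn n. mv n g v = 0 \<longrightarrow> v = 0"
    show "lead_minor n g \<noteq> 0"
    proof
      assume "lead_minor n g = 0"
      then obtain c where c: "\<exists>l\<in>{1..n}. c l \<noteq> 0" "\<forall>i\<in>{1..n}. (\<Sum>l\<in>{1..n}. g (i, l) * c l) = 0"
        by (rule lead_minor_0)
      let ?v = "\<lambda>j. if j \<in> {1..n} then c j else 0"
      have "?v \<in> Kn n"
        by (auto simp: affine_points_def)
      moreover have "mv n g ?v = 0"
      proof (rule Kn_eqI[OF mv_in_Kn[OF g]])
        fix i assume "i \<in> {1..n}"
        then show "mv n g ?v i = 0 i"
          using c(2) by (simp add: mv_def)
      qed (auto simp: affine_points_def)
      ultimately have "?v = 0"
        using k by blast
      from fun_cong[OF this] c(1) show False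
        by (metis zero_fun_apply)
    qed
  qed
  then show ?thesis
    unfolding GLs_iff_kernel by blast
qed

definition minv :: "nat \<Rightarrow> (nat \<times> nat \<Rightarrow> 'k::field) \<Rightarrow> nat \<times> nat \<Rightarrow> 'k" where
  "minv n g = (\<lambda>x. lead_adj n g x / lead_minor n g)"

lemma minv_in_mats: "minv n g \<in> mats n"
  by (auto simp: affine_points_def minv_def lead_adj_def)

lemma mm_minv:
  assumes "g \<in> GLs n"
  shows "mm n g (minv n g) = idm n" and "mm n (minv n g) g = idm n"
proof -
  have g: "g \<in> mats n" and nz: "lead_minor n g \<noteq> 0"
    using assms by (auto simp: GLs_iff_minor)
  show "mm n g (minv n g) = idm n"
  proof (rule mats_eqI[OF mm_in_mats[OF g minv_in_mats] idm_in_mats])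
    fix j assume j: "j \<in> {1..n}"
    show "col (mm n g (minv n g)) j = col (idm n) j"
    proof (rule Kn_eqI[OF col_in_Kn[OF mm_in_mats[OF g minv_in_mats]] col_in_Kn[OF idm_in_mats]])
      fix i assume i: "i \<in> {1..n}"
      show "col (mm n g (minv n g)) j i = col (idm n) j i"
        using lead_adj_right[OF i j, of g] nz i
        by (simp add: Defs.col_def mm_def minv_def idm_def sum_divide_distrib[symmetric] split: if_splits)
    qed
  qed
  show "mm n (minv n g) g = idm n"
  proof (rule mats_eqI[OF mm_in_mats[OF minv_in_mats g] idm_in_mats])
    fix j assume j: "j \<in> {1..n}"
    show "col (mm n (minv n g) g) j = col (idm n) j"
    proof (rule Kn_eqI[OF col_in_Kn[OF mm_in_mats[OF minv_in_mats g]] col_in_Kn[OF idm_in_mats]])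
      fix i assume i: "i \<in> {1..n}"
      show "col (mm n (minv n g) g) j i = col (idm n) j i"
        using lead_adj_left[OF i j, of g] nz i
        by (simp add: Defs.col_def mm_def minv_def idm_def sum_divide_distrib[symmetric] split: if_splits)
    qed
  qed
qed

lemma GLs_left_inverse:
  assumes "g \<in> mats n" and "mm n h g = idm n"
  shows "g \<in> GLs n"
  unfolding GLs_iff_kernel
proof (intro conjI ballI impI)
  fix v assume v: "v \<in> Kn n" "mv n g v = 0"
  have "v = mv n (mm n h g) v"
    using v(1) by (simp add: assms(2) mv_idm)
  then show "v = 0"
    using v(2) by (simp add: mv_mm mv.zero)
qed (rule assms(1))

lemma minv_in_GLs: "g \<in> GLs n \<Longrightarrow> minv n g \<in> GLs n"
  by (rule GLs_left_inverse[OF minv_in_mats mm_minv(1)])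

lemma mm_in_GLs:
  assumes "g \<in> GLs n" "h \<in> GLs n"
  shows "mm n g h \<in> GLs n"
  using assms mm_in_mats[of g n h] mv_in_Kn[of h n] by (auto simp: GLs_iff_kernel mv_mm)

lemma mv_minv:
  assumes "g \<in> GLs n" "v \<in> Kn n"
  shows "mv n g (mv n (minv n g) v) = v" and "mv n (minv n g) (mv n g v) = v"
  using mm_minv[OF assms(1)] mv_idm[OF assms(2)] by (simp_all add: mv_mm[symmetric])

lemma mm_minv_cancel:
  assumes "g \<in> GLs n" "h \<in> mats n"
  shows "mm n g (mm n (minv n g) h) = h" and "mm n (minv n g) (mm n g h) = h"
  using mm_minv[OF assms(1)] mm_idm_left[OF assms(2)] by (simp_all add: mm_assoc[symmetric])

lemma dim_mv_image:
  assumes "g \<in> GLs n" "fv.subspace S" "S \<subseteq> Kn n"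
  shows "fv.dim (mv n g ` S) = fv.dim S"
  by (rule dim_linear_image[OF linear_mv assms(2) inj_on_subset[OF inj_on_mv[OF assms(1)] assms(3)]
        finite_dim_in_Kn[OF assms(3)]])

lemma dim_span_cols:
  assumes "g \<in> GLs n" "d \<le> n"
  shows "fv.dim (fv.span (col g ` {1..d})) = d"
proof -
  have "fv.dim (fv.span (col g ` {1..d})) = card {1..d}"
    by (rule fv.dim_span_image[of _ "{1..n}"]) (use assms in \<open>auto simp: GLs_def is_basis_def\<close>)
  then show ?thesis by simp
qed

lemma span_cols_in_Kn: "g \<in> mats n \<Longrightarrow> fv.span (col g ` S) \<subseteq> Kn n"
  using col_in_Kn[of g n] by (intro fv.span_minimal subspace_Kn) auto

lemma span_cols_mm: "fv.span (col (mm n g h) ` S) = mv n g ` fv.span (col h ` S)"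
  using mv.span_image[of n g "col h ` S"] by (simp add: image_image col_mm)

text \<open>
  The first nonzero coordinate of a vector is unchanged by a lower unitriangular matrix, so that
  the kernel is zero.
\<close>

lemma unitriangular_in_GLs:
  assumes u: "u \<in> mats n"
    and tri: "\<And>i j. j \<in> {1..n} \<Longrightarrow> i \<in> {1..j} \<Longrightarrow> u (i, j) = (if i = j then 1 else 0)"
  shows "u \<in> GLs n"
  unfolding GLs_iff_kernel
proof (intro conjI ballI impI)
  fix v assume v: "v \<in> Kn n" "mv n u v = 0"
  have "v i = 0" if "i \<in> {1..n}" for i
    using that
  proof (induction i rule: less_induct)
    case (less i)
    have "u (i, j) * v j = (if i = j then v i else 0)" if j: "j \<in> {1..n}" for j
    proof (cases "j < i")
      case True
      then show ?thesis
        using less.IH[OF True] j by auto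
    next
      case False
      then show ?thesis
        using tri[OF j, of i] less.prems by auto
    qed
    then have "mv n u v i = (\<Sum>j\<in>{1..n}. if i = j then v i else 0)"
      unfolding mv_def by (intro sum.cong) auto
    then show ?case
      using v(2) less.prems by simp
  qed
  then show "v = 0"
    using v(1) by (intro Kn_eqI[of v n]) (auto simp: affine_points_def)
qed (rule u)

subsection \<open>Reduced bases\<close>

text \<open>
  If the leading minor of size \<open>d\<close> of \<open>g\<close> does not vanish, the span of the first \<open>d\<close> columns projects
  isomorphically to the first \<open>d\<close> coordinates, and \<open>reduced d g j\<close> is its element projecting to the
  \<open>j\<close>-th standard vector. So it depends on that span only, while its coordinates are rational
  functions of \<open>g\<close> by Cramer's rule.
\<close>

definition reduced :: "nat \<Rightarrow> (nat \<times> nat \<Rightarrow> 'k::field) \<Rightarrow> nat \<Rightarrow> nat \<Rightarrow> 'k" where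
  "reduced d g j = (\<lambda>i. (\<Sum>l\<in>{1..d}. g (i, l) * lead_adj d g (l, j)) / lead_minor d g)"

lemma reduced_coords:
  assumes "lead_minor d g \<noteq> 0" "i \<in> {1..d}" "j \<in> {1..d}"
  shows "reduced d g j i = (if i = j then 1 else 0)"
  using lead_adj_right[OF assms(2,3), of g] assms(1) by (simp add: reduced_def)

lemma reduced_in_span: "reduced d g j \<in> fv.span (col g ` {1..d})"
proof -
  have "reduced d g j = (\<Sum>l\<in>{1..d}. fun_scale (lead_adj d g (l, j) / lead_minor d g) (col g l))"
    by (rule ext) (simp add: reduced_def sum_fun_apply fun_scale_def Defs.col_def sum_divide_distrib mult.commute)
  then show ?thesis
    unfolding fv.span_image_eq_range[OF finite_atLeastAtMost]
    by (rule range_eqI[where x = "\<lambda>l. lead_adj d g (l, j) / lead_minor d g"])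
qed

lemma lead_minor_span_0:
  assumes nz: "lead_minor d g \<noteq> 0" and v: "v \<in> fv.span (col g ` {1..d})"
    and z: "\<And>i. i \<in> {1..d} \<Longrightarrow> v i = 0"
  shows "v = 0"
proof -
  obtain c where c: "v = (\<Sum>l\<in>{1..d}. fun_scale (c l) (col g l))"
    using v unfolding fv.span_image_eq_range[OF finite_atLeastAtMost] by blast
  have vi: "v i = (\<Sum>l\<in>{1..d}. g (i, l) * c l)" for i
    unfolding c by (simp add: sum_fun_apply fun_scale_def Defs.col_def mult.commute)
  have "c l = 0" if "l \<in> {1..d}" for l
    by (rule lead_minor_kernel[OF nz _ that]) (use z vi in auto)
  then show ?thesis
    unfolding c by (intro sum.neutral) (simp add: fun_scale_def zero_fun_def)
qed

lemma lead_minor_cong_span: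
  assumes g: "g \<in> GLs n" and h: "h \<in> GLs n" and d: "d \<le> n"
    and eq: "fv.span (col g ` {1..d}) = fv.span (col h ` {1..d})" and nz: "lead_minor d g \<noteq> 0"
  shows "lead_minor d h \<noteq> 0"
proof
  assume "lead_minor d h = 0"
  then obtain c where c: "\<exists>l\<in>{1..d}. c l \<noteq> 0" "\<forall>i\<in>{1..d}. (\<Sum>l\<in>{1..d}. h (i, l) * c l) = 0"
    by (rule lead_minor_0)
  let ?v = "\<Sum>l\<in>{1..d}. fun_scale (c l) (col h l)"
  have "?v \<in> fv.span (col h ` {1..d})"
    unfolding fv.span_image_eq_range[OF finite_atLeastAtMost] by (rule rangeI)
  moreover have "?v i = 0" if "i \<in> {1..d}" for i
    using bspec[OF c(2) that] by (simp add: sum_fun_apply fun_scale_def Defs.col_def mult.commute)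
  ultimately have z: "?v = 0"
    using lead_minor_span_0[OF nz] unfolding eq by blast
  have i: "inj_on (col h) {1..n}" "fv.independent (col h ` {1..n})"
    using h by (auto simp: GLs_def is_basis_def)
  have sub: "{1..d} \<subseteq> {1..n}"
    using d by auto
  have "inj_on (col h) {1..d} \<and> fv.independent (col h ` {1..d})"
    using inj_on_subset[OF i(1) sub] fv.independent_mono[OF i(2) image_mono[OF sub]] by blast
  then have "\<forall>c. (\<Sum>i\<in>{1..d}. fun_scale (c i) (col h i)) = 0 \<longrightarrow> (\<forall>i\<in>{1..d}. c i = 0)"
    unfolding fv.independent_family_iff[OF finite_atLeastAtMost] .
  then show False
    using z c(1) by blast
qed

lemma reduced_cong_span:
  assumes g: "g \<in> GLs n" and h: "h \<in> GLs n" and d: "d \<le> n"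
    and eq: "fv.span (col g ` {1..d}) = fv.span (col h ` {1..d})" and nz: "lead_minor d g \<noteq> 0"
    and j: "j \<in> {1..d}"
  shows "reduced d h j = reduced d g j"
proof -
  have "reduced d h j - reduced d g j = 0"
  proof (rule lead_minor_span_0[OF nz])
    show "reduced d h j - reduced d g j \<in> fv.span (col g ` {1..d})"
      using reduced_in_span[of d h j] reduced_in_span[of d g j] unfolding eq by (rule fv.span_diff)
    fix i assume "i \<in> {1..d}"
    then show "(reduced d h j - reduced d g j) i = 0"
      using reduced_coords[OF nz _ j] reduced_coords[OF lead_minor_cong_span[OF g h d eq nz] _ j]
      by simp
  qed
  then show ?thesis by simp
qed

text \<open>
  The matrix of reduced vectors, the \<open>j\<close>-th one in the span of the first \<open>\<delta> j\<close> columns. For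
  \<open>\<delta> j = j\<close> it is the unipotent factor of a triangular decomposition of \<open>g\<close>.
\<close>

definition reduced_mat :: "nat \<Rightarrow> (nat \<Rightarrow> nat) \<Rightarrow> (nat \<times> nat \<Rightarrow> 'k::field) \<Rightarrow> nat \<times> nat \<Rightarrow> 'k" where
  "reduced_mat n \<delta> g = (\<lambda>(i, j). if j \<in> {1..n} then reduced (\<delta> j) g j i else 0)"

lemma col_reduced_mat: "j \<in> {1..n} \<Longrightarrow> col (reduced_mat n \<delta> g) j = reduced (\<delta> j) g j"
  by (simp add: Defs.col_def reduced_mat_def)

context
  fixes n :: nat and \<delta> :: "nat \<Rightarrow> nat" and g :: "nat \<times> nat \<Rightarrow> 'k::field"
  assumes g: "g \<in> GLs n" and \<delta>: "\<And>j. j \<in> {1..n} \<Longrightarrow> j \<le> \<delta> j \<and> \<delta> j \<le> n"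
    and nz: "\<And>j. j \<in> {1..n} \<Longrightarrow> lead_minor (\<delta> j) g \<noteq> 0"
begin

lemma reduced_mat_in_mats: "reduced_mat n \<delta> g \<in> mats n"
  unfolding mats_cols
proof (intro conjI ballI allI impI)
  fix j assume j: "j \<in> {1..n}"
  show "col (reduced_mat n \<delta> g) j \<in> Kn n"
    unfolding col_reduced_mat[OF j]
    using reduced_in_span span_cols_in_Kn[OF GLs_mats[OF g]] by blast
qed (auto simp: reduced_mat_def)

lemma reduced_mat_coords:
  assumes "j \<in> {1..n}" "i \<in> {1..\<delta> j}"
  shows "reduced_mat n \<delta> g (i, j) = (if i = j then 1 else 0)"
  using reduced_coords[OF nz[OF assms(1)] assms(2), of j] \<delta>[OF assms(1)] assms(1)
  by (simp add: reduced_mat_def)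

lemma reduced_mat_in_GLs: "reduced_mat n \<delta> g \<in> GLs n"
proof (rule unitriangular_in_GLs[OF reduced_mat_in_mats])
  fix i j assume "j \<in> {1..n}" "i \<in> {1..j}"
  then show "reduced_mat n \<delta> g (i, j) = (if i = j then 1 else 0)"
    using \<delta>[of j] by (intro reduced_mat_coords) auto
qed

lemma span_reduced_mat:
  assumes d: "d \<le> n" and le: "\<And>j. j \<in> {1..d} \<Longrightarrow> \<delta> j \<le> d"
  shows "fv.span (col (reduced_mat n \<delta> g) ` {1..d}) = fv.span (col g ` {1..d})"
proof (rule fv.subspace_eq_if_dim_ge[OF finite_dim_in_Kn[OF span_cols_in_Kn]])
  have "reduced (\<delta> j) g j \<in> fv.span (col g ` {1..d})" if "j \<in> {1..d}" for j
  proof -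
    have "col g ` {1..\<delta> j} \<subseteq> col g ` {1..d}"
      using le[OF that] by auto
    then show ?thesis
      using reduced_in_span[of "\<delta> j" g j] fv.span_mono by blast
  qed
  then show "fv.span (col (reduced_mat n \<delta> g) ` {1..d}) \<subseteq> fv.span (col g ` {1..d})"
    using d by (intro fv.span_minimal) (auto simp: col_reduced_mat)
  show "fv.dim (fv.span (col g ` {1..d})) \<le> fv.dim (fv.span (col (reduced_mat n \<delta> g) ` {1..d}))"
    unfolding dim_span_cols[OF g d] dim_span_cols[OF reduced_mat_in_GLs d] by simp
qed (use GLs_mats[OF g] in auto)

end

lemma reduced_mat_cong:
  assumes g: "g \<in> GLs n" and h: "h \<in> GLs n"
    and \<delta>: "\<And>j. j \<in> {1..n} \<Longrightarrow> j \<le> \<delta> j \<and> \<delta> j \<le> n"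
    and nz: "\<And>j. j \<in> {1..n} \<Longrightarrow> lead_minor (\<delta> j) g \<noteq> 0"
    and eq: "\<And>j. j \<in> {1..n} \<Longrightarrow> fv.span (col g ` {1..\<delta> j}) = fv.span (col h ` {1..\<delta> j})"
  shows "reduced_mat n \<delta> h = reduced_mat n \<delta> g"
proof
  fix x :: "nat \<times> nat"
  obtain i j where x: "x = (i, j)" by (cases x)
  show "reduced_mat n \<delta> h x = reduced_mat n \<delta> g x"
  proof (cases "j \<in> {1..n}")
    case True
    then have "reduced (\<delta> j) h j = reduced (\<delta> j) g j"
      using \<delta>[OF True] nz[OF True] by (intro reduced_cong_span[OF g h _ eq]) auto
    then show ?thesis
      by (simp add: x reduced_mat_def)
  qed (auto simp: x reduced_mat_def)
qed

section \<open>Regular maps into the general linear group\<close>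

lemma GL_eq: "GL n = swf_sub (affine_space ({1..n} \<times> {1..n})) (GLs n)"
  by (simp add: GL_def GLs_def)

lemma pts_GL: "pts (GL n) = GLs n"
  by (auto simp: GL_eq GLs_def)

lemma space_with_functions_GL: "space_with_functions (GL n)"
  unfolding GL_eq by (rule space_with_functions_sub[OF space_with_functions_affine])

lemma openin_GL_nonzero:
  assumes "p \<in> polyfun ({1..n} \<times> {1..n})"
  shows "openin (zar (GL n)) {g \<in> GLs n. p g \<noteq> 0}"
proof -
  have "{g \<in> GLs n. p g \<noteq> 0} = {g \<in> mats n. p g \<noteq> 0} \<inter> GLs n"
    using GLs_mats by blast
  then show ?thesis
    using openin_affine_basic[OF assms] unfolding GL_eq zar_sub zar_affine openin_subtopology by blast
qed

lemma openin_mats_GLs: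
  "openin (affine_topology ({1..n} \<times> {1..n})) (GLs n :: (nat \<times> nat \<Rightarrow> 'k::field) set)"
proof -
  have "GLs n = {g \<in> mats n. lead_minor n g \<noteq> (0::'k)}"
    using GLs_iff_minor by blast
  then show ?thesis
    using openin_affine_basic[OF polyfun_lead_minor[of n n]] by simp
qed

lemma polyfun_compose:
  assumes "p \<in> polyfun I" and "\<And>i. i \<in> I \<Longrightarrow> (\<lambda>x. \<alpha> x i) \<in> polyfun J"
  shows "(\<lambda>x. p (\<alpha> x)) \<in> polyfun J"
  using assms(1) by induction (auto intro: polyfun.intros assms(2))

definition reg_mat :: "('a, 'k::field) swf \<Rightarrow> nat \<Rightarrow> 'a set \<Rightarrow> ('a \<Rightarrow> nat \<times> nat \<Rightarrow> 'k) \<Rightarrow> bool" where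
  "reg_mat X n U \<alpha> \<longleftrightarrow> (\<forall>i\<in>{1..n}. \<forall>j\<in>{1..n}. (\<lambda>x. \<alpha> x (i, j)) \<in> reg X U)"

lemma reg_matD: "reg_mat X n U \<alpha> \<Longrightarrow> i \<in> {1..n} \<Longrightarrow> j \<in> {1..n} \<Longrightarrow> (\<lambda>x. \<alpha> x (i, j)) \<in> reg X U"
  by (simp add: reg_mat_def)

lemma reg_mat_sub:
  assumes "openin (zar X) V" and "reg_mat X n V \<alpha>" and "U \<subseteq> V"
  shows "reg_mat (swf_sub X S) n U \<alpha>"
  using reg_imp_reg_sub[OF assms(1) _ assms(3)] assms(2) unfolding reg_mat_def by simp

lemma reg_mat_id_GL:
  assumes "U \<subseteq> GLs n"
  shows "reg_mat (GL n) n U (\<lambda>g. g)"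
  unfolding reg_mat_def GL_eq
proof (intro ballI)
  fix i j assume "i \<in> {1..n}" "j \<in> {1..n}"
  then have p: "(\<lambda>g. g (i, j)) \<in> polyfun ({1..n} \<times> {1..n})"
    by (intro polyfun.coord) simp
  show "(\<lambda>g. g (i, j)) \<in> reg (swf_sub (affine_space ({1..n} \<times> {1..n})) (GLs n)) U"
    by (rule reg_imp_reg_sub[OF _ polyfun_in_reg[OF _ p], of "mats n"])
      (use assms GLs_mats openin_topspace[of "affine_topology ({1..n} \<times> {1..n})"] in auto)
qed

context
  fixes X :: "('a, 'k::field) swf" and U :: "'a set" and n :: nat
  assumes X: "space_with_functions X" and U: "openin (zar X) U"
begin

lemma reg_mat_const: "reg_mat X n U (\<lambda>_. g)"
  using swf_const[OF X U] by (simp add: reg_mat_def)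

lemma reg_mat_cong: "reg_mat X n U \<alpha> \<Longrightarrow> (\<And>x. x \<in> U \<Longrightarrow> \<beta> x = \<alpha> x) \<Longrightarrow> reg_mat X n U \<beta>"
  unfolding reg_mat_def by (intro ballI, rule swf_cong[OF X U]) simp_all

lemma reg_mat_mm:
  assumes "reg_mat X n U \<alpha>" and "reg_mat X n U \<beta>"
  shows "reg_mat X n U (\<lambda>x. mm n (\<alpha> x) (\<beta> x))"
  unfolding reg_mat_def mm_def prod.case
  by (intro ballI swf_sum[OF X U] swf_mult[OF X U] reg_matD[OF assms(1)] reg_matD[OF assms(2)])

lemma polyfun_reg_mat:
  assumes "reg_mat X n U \<alpha>" and "p \<in> polyfun ({1..n} \<times> {1..n})"
  shows "(\<lambda>x. p (\<alpha> x)) \<in> reg X U"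
  by (rule polyfun_reg[OF X U _ assms(2)]) (use assms(1) in \<open>auto simp: reg_mat_def\<close>)

lemma reg_mat_minv:
  assumes \<alpha>: "reg_mat X n U \<alpha>" and GL: "\<And>x. x \<in> U \<Longrightarrow> \<alpha> x \<in> GLs n"
  shows "reg_mat X n U (\<lambda>x. minv n (\<alpha> x))"
  unfolding reg_mat_def minv_def
  by (intro ballI swf_divide[OF X U] polyfun_reg_mat[OF \<alpha>] polyfun_lead_minor polyfun_reg_mat[OF \<alpha> polyfun_lead_adj])
    (use GL in \<open>auto simp: GLs_iff_minor\<close>)

lemma reg_mat_reduced_mat:
  assumes \<alpha>: "reg_mat X n U \<alpha>" and \<delta>: "\<And>j. j \<in> {1..n} \<Longrightarrow> \<delta> j \<le> n"
    and nz: "\<And>x j. x \<in> U \<Longrightarrow> j \<in> {1..n} \<Longrightarrow> lead_minor (\<delta> j) (\<alpha> x) \<noteq> 0"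
  shows "reg_mat X n U (\<lambda>x. reduced_mat n \<delta> (\<alpha> x))"
  unfolding reg_mat_def
proof (intro ballI)
  fix i j assume ij: "i \<in> {1..n}" "j \<in> {1..n}"
  have "(\<lambda>x. (\<Sum>l\<in>{1..\<delta> j}. \<alpha> x (i, l) * lead_adj (\<delta> j) (\<alpha> x) (l, j)) / lead_minor (\<delta> j) (\<alpha> x)) \<in> reg X U"
  proof (rule swf_divide[OF X U])
    show "(\<lambda>x. \<Sum>l\<in>{1..\<delta> j}. \<alpha> x (i, l) * lead_adj (\<delta> j) (\<alpha> x) (l, j)) \<in> reg X U"
      using \<delta>[OF ij(2)] ij
      by (intro swf_sum[OF X U] swf_mult[OF X U] reg_matD[OF \<alpha>]
          polyfun_reg_mat[OF \<alpha> polyfun_lead_adj]) auto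
    show "(\<lambda>x. lead_minor (\<delta> j) (\<alpha> x)) \<in> reg X U"
      by (rule polyfun_reg_mat[OF \<alpha> polyfun_lead_minor[OF \<delta>[OF ij(2)]]])
  qed (use nz ij in auto)
  then show "(\<lambda>x. reduced_mat n \<delta> (\<alpha> x) (i, j)) \<in> reg X U"
    using ij(2) by (simp add: reduced_mat_def reduced_def)
qed

end

lemma swf_morphism_to_GL:
  assumes X: "space_with_functions X" and GL: "\<And>x. x \<in> pts X \<Longrightarrow> \<alpha> x \<in> GLs n"
    and \<alpha>: "reg_mat X n (pts X) \<alpha>"
  shows "swf_morphism X (GL n) \<alpha>"
  unfolding GL_eq
proof (rule swf_morphism_into_sub[OF X swf_morphism_to_affine[OF X]])
  fix ij assume "ij \<in> {1..n} \<times> {1..n}"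
  then show "(\<lambda>x. \<alpha> x ij) \<in> reg X (pts X)"
    using reg_matD[OF \<alpha>] by (cases ij) auto
qed (use GL GLs_mats in blast)+

section \<open>Local sections over flag varieties and Grassmannians\<close>

text \<open>
  Both quotients remember the spans of the first \<open>\<delta> j\<close> columns, for \<open>j\<close> from \<open>1\<close> to \<open>n\<close>: for the
  flag variety \<open>\<delta> j = j\<close>, and for the Grassmannian \<open>\<delta> j\<close> is \<open>r\<close> if \<open>j \<le> r\<close> and \<open>n\<close> otherwise. Near the
  class of \<open>a\<close> a section of the quotient map sends the class of \<open>g\<close> to \<open>a u\<close>, where \<open>u\<close> is the
  matrix of reduced vectors of \<open>a\<^sup>-\<^sup>1 g\<close>.
\<close>

locale flag_quotient =
  fixes n :: nat and \<delta> :: "nat \<Rightarrow> nat" and q :: "(nat \<times> nat \<Rightarrow> 'k::field) \<Rightarrow> 'b"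
  assumes \<delta>: "j \<in> {1..n} \<Longrightarrow> j \<le> \<delta> j \<and> \<delta> j \<le> n"
    and \<delta>_le: "j \<in> {1..n} \<Longrightarrow> l \<in> {1..\<delta> j} \<Longrightarrow> \<delta> l \<le> \<delta> j"
    and q_eq_iff: "g \<in> GLs n \<Longrightarrow> h \<in> GLs n \<Longrightarrow> q g = q h \<longleftrightarrow>
      (\<forall>j\<in>{1..n}. fv.span (col g ` {1..\<delta> j}) = fv.span (col h ` {1..\<delta> j}))"
begin

abbreviation Q :: "('b, 'k) swf" where
  "Q \<equiv> swf_quotient (GL n) q"

definition cell :: "(nat \<times> nat \<Rightarrow> 'k) \<Rightarrow> (nat \<times> nat \<Rightarrow> 'k) set" where
  "cell a = {g \<in> GLs n. \<forall>j\<in>{1..n}. lead_minor (\<delta> j) (mm n (minv n a) g) \<noteq> 0}"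

definition chart :: "(nat \<times> nat \<Rightarrow> 'k) \<Rightarrow> 'b set" where
  "chart a = q ` cell a"

definition lift :: "(nat \<times> nat \<Rightarrow> 'k) \<Rightarrow> (nat \<times> nat \<Rightarrow> 'k) \<Rightarrow> nat \<times> nat \<Rightarrow> 'k" where
  "lift a g = mm n a (reduced_mat n \<delta> (mm n (minv n a) g))"

definition local_section :: "(nat \<times> nat \<Rightarrow> 'k) \<Rightarrow> 'b \<Rightarrow> nat \<times> nat \<Rightarrow> 'k" where
  "local_section a y = lift a (inv_into (GLs n) q y)"

lemma space_with_functions_Q: "space_with_functions Q"
  by (rule space_with_functions_quotient[OF space_with_functions_GL])

lemma cell_GLs: "g \<in> cell a \<Longrightarrow> g \<in> GLs n"
  by (simp add: cell_def)

lemma span_eq_if_q_eq: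
  assumes "g \<in> GLs n" "h \<in> GLs n" "q g = q h" "j \<in> {1..n}"
  shows "fv.span (col (mm n b g) ` {1..\<delta> j}) = fv.span (col (mm n b h) ` {1..\<delta> j})"
  using assms q_eq_iff by (simp add: span_cols_mm)

lemma cell_saturated:
  assumes a: "a \<in> GLs n" and g: "g \<in> cell a" and h: "h \<in> GLs n" and eq: "q g = q h"
  shows "h \<in> cell a"
  unfolding cell_def
proof (intro CollectI conjI h ballI)
  fix j assume j: "j \<in> {1..n}"
  show "lead_minor (\<delta> j) (mm n (minv n a) h) \<noteq> 0"
  proof (rule lead_minor_cong_span)
    show "mm n (minv n a) g \<in> GLs n" "mm n (minv n a) h \<in> GLs n"
      using a g h by (auto intro: mm_in_GLs minv_in_GLs cell_GLs)
    show "fv.span (col (mm n (minv n a) g) ` {1..\<delta> j}) = fv.span (col (mm n (minv n a) h) ` {1..\<delta> j})"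
      by (rule span_eq_if_q_eq[OF cell_GLs[OF g] h eq j])
  qed (use g j \<delta> in \<open>auto simp: cell_def\<close>)
qed

lemma q_in_chart_iff:
  assumes "a \<in> GLs n" and "g \<in> GLs n"
  shows "q g \<in> chart a \<longleftrightarrow> g \<in> cell a"
  unfolding chart_def using cell_saturated[OF assms(1) _ assms(2)] by fastforce

lemma openin_chart:
  assumes a: "a \<in> GLs n"
  shows "openin (zar Q) (chart a)"
proof -
  let ?p = "\<lambda>g. \<Prod>j\<in>{1..n}. lead_minor (\<delta> j) (mm n (minv n a) g)"
  have "?p \<in> polyfun ({1..n} \<times> {1..n})"
  proof (rule polyfun_prod)
    fix j assume j: "j \<in> {1..n}"
    have "(\<lambda>g. mm n (minv n a) g ij) \<in> polyfun ({1..n} \<times> {1..n})" if "ij \<in> {1..n} \<times> {1..n}" for ij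
      using that unfolding mm_def
      by (cases ij) (auto intro!: polyfun_sum polyfun.mult polyfun.const polyfun.coord)
    then show "(\<lambda>g. lead_minor (\<delta> j) (mm n (minv n a) g)) \<in> polyfun ({1..n} \<times> {1..n})"
      using j \<delta> by (intro polyfun_compose[OF polyfun_lead_minor[of _ n]]) auto
  qed
  from openin_GL_nonzero[OF this] have "openin (zar (GL n)) {g \<in> GLs n. ?p g \<noteq> 0}" .
  moreover have "{g \<in> GLs n. ?p g \<noteq> 0} = {g \<in> pts (GL n). q g \<in> chart a}"
    using q_in_chart_iff[OF a] by (auto simp: pts_GL cell_def)
  ultimately show ?thesis
    using cell_GLs unfolding openin_quotient by (auto simp: pts_GL chart_def)
qed

lemma base_in_cell:
  assumes "a \<in> GLs n"
  shows "a \<in> cell a"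
proof -
  have "lead_minor d (idm n :: nat \<times> nat \<Rightarrow> 'k) \<noteq> 0" if d: "d \<le> n" for d
  proof
    assume "lead_minor d (idm n :: nat \<times> nat \<Rightarrow> 'k) = 0"
    then obtain c where c: "\<exists>l\<in>{1..d}. c l \<noteq> (0::'k)"
      "\<forall>i\<in>{1..d}. (\<Sum>l\<in>{1..d}. idm n (i, l) * c l) = 0"
      by (rule lead_minor_0)
    have "(\<Sum>l\<in>{1..d}. idm n (i, l) * c l) = c i" if "i \<in> {1..d}" for i
    proof -
      have "(\<Sum>l\<in>{1..d}. idm n (i, l) * c l) = (\<Sum>l\<in>{1..d}. if i = l then c i else 0)"
        by (rule sum.cong) (use that d in \<open>auto simp: idm_def\<close>)
      then show ?thesis
        using that by simp
    qed
    then show False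
      using c by auto
  qed
  then show ?thesis
    using assms \<delta> mm_minv(2)[OF assms] by (simp add: cell_def)
qed

context
  fixes a g assumes a: "a \<in> GLs n" and g: "g \<in> cell a"
begin

lemma reduced_cell:
  shows "mm n (minv n a) g \<in> GLs n"
    and "j \<in> {1..n} \<Longrightarrow> lead_minor (\<delta> j) (mm n (minv n a) g) \<noteq> 0"
  using a g by (auto intro: mm_in_GLs minv_in_GLs simp: cell_def)

lemma lift_in_GLs: "lift a g \<in> GLs n"
  unfolding lift_def by (rule mm_in_GLs[OF a reduced_mat_in_GLs[OF reduced_cell(1) \<delta> reduced_cell(2)]])

lemma span_lift:
  assumes "d \<le> n" and "\<And>l. l \<in> {1..d} \<Longrightarrow> \<delta> l \<le> d"
  shows "fv.span (col (lift a g) ` {1..d}) = fv.span (col g ` {1..d})"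
proof -
  have "fv.span (col (reduced_mat n \<delta> (mm n (minv n a) g)) ` {1..d})
      = fv.span (col (mm n (minv n a) g) ` {1..d})"
    by (rule span_reduced_mat[OF reduced_cell(1) \<delta> reduced_cell(2) assms])
  then have "fv.span (col (lift a g) ` {1..d}) = fv.span (col (mm n a (mm n (minv n a) g)) ` {1..d})"
    unfolding lift_def span_cols_mm[of n a] by simp
  then show ?thesis
    using mm_minv_cancel(1)[OF a GLs_mats[OF cell_GLs[OF g]]] by simp
qed

lemma q_lift: "q (lift a g) = q g"
proof (subst q_eq_iff[OF lift_in_GLs cell_GLs[OF g]], rule ballI)
  fix j assume j: "j \<in> {1..n}"
  show "fv.span (col (lift a g) ` {1..\<delta> j}) = fv.span (col g ` {1..\<delta> j})"
    using \<delta>[OF j] \<delta>_le[OF j] by (intro span_lift) auto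
qed

lemma minv_lift_coords:
  assumes "j \<in> {1..n}" "i \<in> {1..\<delta> j}"
  shows "mm n (minv n a) (lift a g) (i, j) = (if i = j then 1 else 0)"
proof -
  have "mm n (minv n a) (lift a g) = reduced_mat n \<delta> (mm n (minv n a) g)"
    unfolding lift_def
    by (rule mm_minv_cancel(2)[OF a reduced_mat_in_mats[OF reduced_cell(1) \<delta> reduced_cell(2)]])
  then show ?thesis
    using reduced_mat_coords[OF reduced_cell(1) \<delta> reduced_cell(2) assms] by simp
qed

text \<open>
  The reduced vectors depend on spans of columns only, so the arbitrary representative in the
  definition of \<open>local_section\<close> does not matter.
\<close>

lemma local_section_q: "local_section a (q g) = lift a g"
proof -
  let ?h = "inv_into (GLs n) q (q g)"
  have h: "?h \<in> GLs n" "q ?h = q g"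
    using inv_into_into[OF imageI[OF cell_GLs[OF g]]] f_inv_into_f[OF imageI[OF cell_GLs[OF g]]] by auto
  then have hc: "?h \<in> cell a"
    by (intro cell_saturated[OF a g]) auto
  have "reduced_mat n \<delta> (mm n (minv n a) ?h) = reduced_mat n \<delta> (mm n (minv n a) g)"
  proof (rule reduced_mat_cong[OF reduced_cell(1) _ \<delta> reduced_cell(2)])
    show "mm n (minv n a) ?h \<in> GLs n"
      by (rule mm_in_GLs[OF minv_in_GLs[OF a] h(1)])
    fix j assume "j \<in> {1..n}"
    then show "fv.span (col (mm n (minv n a) g) ` {1..\<delta> j}) = fv.span (col (mm n (minv n a) ?h) ` {1..\<delta> j})"
      using h by (intro span_eq_if_q_eq[OF cell_GLs[OF g]]) auto
  qed
  then show ?thesis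
    by (simp add: local_section_def lift_def)
qed

end

lemma
  assumes a: "a \<in> GLs n" and y: "y \<in> chart a"
  shows local_section_in_GLs: "local_section a y \<in> GLs n"
    and q_local_section: "q (local_section a y) = y"
    and local_section_coords: "j \<in> {1..n} \<Longrightarrow> i \<in> {1..\<delta> j} \<Longrightarrow>
      mm n (minv n a) (local_section a y) (i, j) = (if i = j then 1 else 0)"
proof -
  obtain g where g: "g \<in> cell a" "y = q g"
    using y by (auto simp: chart_def)
  show "local_section a y \<in> GLs n" "q (local_section a y) = y"
    using lift_in_GLs[OF a g(1)] q_lift[OF a g(1)] local_section_q[OF a g(1)] by (simp_all add: g(2))
  show "mm n (minv n a) (local_section a y) (i, j) = (if i = j then 1 else 0)"
    if "j \<in> {1..n}" "i \<in> {1..\<delta> j}"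
    using minv_lift_coords[OF a g(1) that] local_section_q[OF a g(1)] by (simp add: g(2))
qed

lemma reg_mat_local_section:
  assumes a: "a \<in> GLs n"
  shows "reg_mat Q n (chart a) (local_section a)"
proof -
  have o: "openin (zar (GL n)) (cell a)"
  proof -
    have "{g \<in> pts (GL n). q g \<in> chart a} = cell a"
      using q_in_chart_iff[OF a] cell_GLs by (auto simp: pts_GL)
    then show ?thesis
      using openin_chart[OF a] unfolding openin_quotient by simp
  qed
  note X = space_with_functions_GL
  have "reg_mat (GL n) n (cell a) (lift a)"
    unfolding lift_def[abs_def]
  proof (intro reg_mat_mm[OF X o] reg_mat_const[OF X o] reg_mat_reduced_mat[OF X o] reg_mat_id_GL)
    show "cell a \<subseteq> GLs n"
      using cell_GLs by blast
    fix j assume "j \<in> {1..n}"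
    then show "\<delta> j \<le> n"
      using \<delta> by blast
  qed (simp add: cell_def)
  then have r: "reg_mat (GL n) n (cell a) (\<lambda>g. local_section a (q g))"
    by (rule reg_mat_cong[OF X o]) (rule local_section_q[OF a])
  have e: "{g \<in> pts (GL n). q g \<in> chart a} = cell a"
    using q_in_chart_iff[OF a] cell_GLs by (auto simp: pts_GL)
  show ?thesis
    unfolding reg_mat_def reg_quotient e comp_def using reg_matD[OF r] by blast
qed

end

subsection \<open>The flag variety and the Grassmannian\<close>

lemma span_all_cols: "g \<in> GLs n \<Longrightarrow> fv.span (col g ` {1..n}) = Kn n"
  by (simp add: GLs_def is_basis_def)

interpretation fl: flag_quotient n "\<lambda>j. j" "column_flag n" for n
proof
  fix g h :: "nat \<times> nat \<Rightarrow> 'a"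
  assume g: "g \<in> GLs n" and h: "h \<in> GLs n"
  have "column_flag n g = column_flag n h \<longleftrightarrow>
      (\<forall>j\<in>{1..<n}. fv.span (col g ` {1..j}) = fv.span (col h ` {1..j}))"
    unfolding column_flag_def restrict_def fun_eq_iff by auto
  also have "\<dots> \<longleftrightarrow> (\<forall>j\<in>{1..n}. fv.span (col g ` {1..j}) = fv.span (col h ` {1..j}))"
    using span_all_cols[OF g] span_all_cols[OF h] by (metis atLeastAtMost_iff atLeastLessThan_iff le_neq_implies_less less_imp_le)
  finally show "column_flag n g = column_flag n h \<longleftrightarrow>
      (\<forall>j\<in>{1..n}. fv.span (col g ` {1..j}) = fv.span (col h ` {1..j}))" .
qed auto

lemma flag_quotient_grassmannian:
  assumes "0 < r" "r < n"
  shows "flag_quotient n (\<lambda>j. if j \<le> r then r else n) (\<lambda>g :: nat \<times> nat \<Rightarrow> 'k::field. fv.span (col g ` {1..r}))"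
proof
  fix g h :: "nat \<times> nat \<Rightarrow> 'k"
  assume g: "g \<in> GLs n" and h: "h \<in> GLs n"
  show "fv.span (col g ` {1..r}) = fv.span (col h ` {1..r}) \<longleftrightarrow>
      (\<forall>j\<in>{1..n}. fv.span (col g ` {1..if j \<le> r then r else n}) = fv.span (col h ` {1..if j \<le> r then r else n}))"
  proof
    assume "fv.span (col g ` {1..r}) = fv.span (col h ` {1..r})"
    then show "\<forall>j\<in>{1..n}. fv.span (col g ` {1..if j \<le> r then r else n}) = fv.span (col h ` {1..if j \<le> r then r else n})"
      using span_all_cols[OF g] span_all_cols[OF h] by auto
  next
    assume "\<forall>j\<in>{1..n}. fv.span (col g ` {1..if j \<le> r then r else n}) = fv.span (col h ` {1..if j \<le> r then r else n})"
    from bspec[OF this, of r] show "fv.span (col g ` {1..r}) = fv.span (col h ` {1..r})"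
      using assms by simp
  qed
qed (use assms in \<open>auto split: if_splits\<close>)

text \<open>
  The induction step for a basis adapted to a partial flag: the vectors spanning a smaller subspace
  are kept when passing to a larger one.
\<close>

lemma extend_family:
  assumes b: "inj_on b {1..i}" "fv.independent (b ` {1..i})" "b ` {1..i} \<subseteq> W"
    and W: "fv.subspace W" "W \<subseteq> Kn n" "fv.dim W = j"
  obtains b' where "\<And>l. l \<in> {1..i} \<Longrightarrow> b' l = b l" "inj_on b' {1..j}" "fv.independent (b' ` {1..j})"
    "fv.span (b' ` {1..j}) = W" "i \<le> j"
proof -
  obtain B where B: "b ` {1..i} \<subseteq> B" "B \<subseteq> W" "fv.independent B" "W \<subseteq> fv.span B" "finite B" "card B = fv.dim W"
    by (rule fv.extend_to_basis[OF finite_dim_in_Kn[OF W(2)] b(2,3)])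
  have ci: "card (b ` {1..i}) = i"
    using card_image[OF b(1)] by simp
  have ij: "i \<le> j"
    using card_mono[OF B(5,1)] ci B(6) W(3) by simp
  have "card {i<..j} = card (B - b ` {1..i})"
    using card_Diff_subset[OF _ B(1)] ci B(6) W(3) by simp
  then obtain f where f: "bij_betw f {i<..j} (B - b ` {1..i})"
    using finite_same_card_bij[of "{i<..j}" "B - b ` {1..i}"] B(5) by auto
  let ?b' = "\<lambda>l. if l \<in> {1..i} then b l else f l"
  have un: "{1..j} = {1..i} \<union> {i<..j}"
    using ij by auto
  have "bij_betw ?b' {1..i} (b ` {1..i})"
    by (subst bij_betw_cong[of _ _ b]) (simp_all add: inj_on_imp_bij_betw b(1))
  moreover have "bij_betw ?b' {i<..j} (B - b ` {1..i})"
    using f by (subst bij_betw_cong[of _ _ f]) auto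
  ultimately have "bij_betw ?b' ({1..i} \<union> {i<..j}) (b ` {1..i} \<union> (B - b ` {1..i}))"
    by (rule bij_betw_combine) auto
  then have bij: "bij_betw ?b' {1..j} B"
    unfolding un using B(1) by (simp add: Un_absorb1)
  then have "?b' ` {1..j} = B" "inj_on ?b' {1..j}"
    by (auto simp: bij_betw_def)
  then show ?thesis
    using B ij fv.span_subspace[OF B(2,4) W(1)] by (intro that[of ?b']) auto
qed

lemma adapted_basis:
  fixes W :: "nat \<Rightarrow> (nat \<Rightarrow> 'k::field) set"
  assumes D: "D \<subseteq> {1..n}" "n \<in> D" and W: "\<And>i. i \<in> D \<Longrightarrow> fv.subspace (W i) \<and> W i \<subseteq> Kn n \<and> fv.dim (W i) = i"
    and mono: "\<And>i j. i \<in> D \<Longrightarrow> j \<in> D \<Longrightarrow> i \<le> j \<Longrightarrow> W i \<subseteq> W j"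
  obtains g where "g \<in> GLs n" "\<And>i. i \<in> D \<Longrightarrow> fv.span (col g ` {1..i}) = W i"
proof -
  have "\<exists>b j. inj_on b {1..j} \<and> fv.independent (b ` {1..j}) \<and> (j = 0 \<or> j \<in> D) \<and> j \<le> m \<and>
      (\<forall>i\<in>D. i \<le> m \<longrightarrow> i \<le> j \<and> fv.span (b ` {1..i}) = W i)" for m
  proof (induction m)
    case 0
    have "\<forall>i\<in>D. \<not> i \<le> 0"
      using D by auto
    then show ?case
      by (intro exI[of _ "\<lambda>_. 0"] exI[of _ 0]) (auto simp: fv.independent_empty)
  next
    case (Suc m)
    then obtain b j where b: "inj_on b {1..j}" "fv.independent (b ` {1..j})" "j = 0 \<or> j \<in> D" "j \<le> m"
      "\<forall>i\<in>D. i \<le> m \<longrightarrow> i \<le> j \<and> fv.span (b ` {1..i}) = W i"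
      by (elim exE conjE)
    show ?case
    proof (cases "Suc m \<in> D")
      case False
      then have "\<forall>i\<in>D. i \<le> Suc m \<longrightarrow> i \<le> m"
        by (metis le_Suc_eq)
      then show ?thesis
        using b by (intro exI[of _ b] exI[of _ j]) auto
    next
      case True
      have "b ` {1..j} \<subseteq> W (Suc m)"
      proof (cases "j = 0")
        case False
        then have "j \<in> D"
          using b(3) by simp
        then have "fv.span (b ` {1..j}) = W j" "W j \<subseteq> W (Suc m)"
          using b(4,5) mono[OF _ True, of j] by auto
        then show ?thesis
          using fv.span_superset by blast
      qed simp
      moreover have "fv.subspace (W (Suc m))" "W (Suc m) \<subseteq> Kn n" "fv.dim (W (Suc m)) = Suc m"
        using W[OF True] by auto
      ultimately obtain b' where b': "\<And>l. l \<in> {1..j} \<Longrightarrow> b' l = b l" "inj_on b' {1..Suc m}"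
        "fv.independent (b' ` {1..Suc m})" "fv.span (b' ` {1..Suc m}) = W (Suc m)" "j \<le> Suc m"
        using extend_family[OF b(1,2)] by metis
      have "i \<le> Suc m \<and> fv.span (b' ` {1..i}) = W i" if i: "i \<in> D" "i \<le> Suc m" for i
      proof (cases "i = Suc m")
        case True
        then show ?thesis
          using b'(4) by simp
      next
        case False
        then have ij: "i \<le> j" "fv.span (b ` {1..i}) = W i"
          using b(5) i by auto
        have "b' ` {1..i} = b ` {1..i}"
          by (rule image_cong) (use b'(1) ij(1) in auto)
        then show ?thesis
          using ij i by simp
      qed
      then show ?thesis
        using b' True by (intro exI[of _ b'] exI[of _ "Suc m"]) simp
    qed
  qed
  from this[of n] obtain b j where b: "inj_on b {1..j}" "fv.independent (b ` {1..j})" "j \<le> n"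
    "\<forall>i\<in>D. i \<le> n \<longrightarrow> i \<le> j \<and> fv.span (b ` {1..i}) = W i"
    by (elim exE conjE)
  have j: "j = n"
    using b(3,4) D(2) by auto
  have Wn: "W n = Kn n"
    using W[OF D(2)] by (intro fv.subspace_eq_if_dim_ge[OF finite_dim_Kn]) (auto simp: dim_Kn)
  let ?g = "\<lambda>(i, j). if j \<in> {1..n} then b j i else 0"
  have cg: "col ?g l = b l" if "l \<in> {1..n}" for l
    using that by (simp add: Defs.col_def)
  have img: "col ?g ` {1..i} = b ` {1..i}" if "i \<le> n" for i
    by (rule image_cong) (use cg that in auto)
  have "fv.span (b ` {1..n}) = Kn n"
    using b(4) D(2) Wn by auto
  then have bK: "b l \<in> Kn n" if "l \<in> {1..n}" for l
    using fv.span_base[of "b l" "b ` {1..n}"] that by auto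
  have "?g \<in> GLs n"
    unfolding GLs_def
  proof (intro CollectI conjI)
    show "?g \<in> mats n"
      using bK by (auto simp: affine_points_def)
    have "inj_on (col ?g) {1..n} \<longleftrightarrow> inj_on b {1..n}"
      by (rule inj_on_cong) (rule cg)
    then show "is_basis n (col ?g)"
      using b j \<open>fv.span (b ` {1..n}) = Kn n\<close> unfolding is_basis_def img[OF order_refl] by simp
  qed
  moreover have "fv.span (col ?g ` {1..i}) = W i" if "i \<in> D" for i
    using b(4) that D(1) img[of i] by auto
  ultimately show ?thesis
    by (rule that)
qed

lemma column_flag_nth: "j \<in> {1..<n} \<Longrightarrow> column_flag n g j = fv.span (col g ` {1..j})"
  by (simp add: column_flag_def)

lemma pts_flag_variety:
  assumes "0 < n"
  shows "column_flag n ` GLs n = (flags n :: (nat \<Rightarrow> (nat \<Rightarrow> 'k::field) set) set)"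
proof
  show "column_flag n ` GLs n \<subseteq> (flags n :: (nat \<Rightarrow> (nat \<Rightarrow> 'k) set) set)"
  proof (rule image_subsetI)
    fix g :: "nat \<times> nat \<Rightarrow> 'k" assume g: "g \<in> GLs n"
    show "column_flag n g \<in> flags n"
      unfolding flags_def
    proof (intro CollectI conjI ballI impI)
      show "column_flag n g \<in> extensional {1..<n}"
        by (simp add: column_flag_def)
      fix i assume i: "i \<in> {1..<n}"
      show "fv.subspace (column_flag n g i)" "column_flag n g i \<subseteq> Kn n"
        using span_cols_in_Kn[OF GLs_mats[OF g]] by (simp_all add: column_flag_nth[OF i])
      show "fv.dim (column_flag n g i) = i"
        using dim_span_cols[OF g, of i] i unfolding column_flag_nth[OF i] by simp
      fix j assume j: "j \<in> {1..<n}" "i \<le> j"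
      then show "column_flag n g i \<subseteq> column_flag n g j"
        unfolding column_flag_nth[OF i] column_flag_nth[OF j(1)] by (intro fv.span_mono image_mono) auto
    qed
  qed
next
  show "(flags n :: (nat \<Rightarrow> (nat \<Rightarrow> 'k) set) set) \<subseteq> column_flag n ` GLs n"
  proof
    fix V :: "nat \<Rightarrow> (nat \<Rightarrow> 'k) set" assume V: "V \<in> flags n"
    let ?W = "\<lambda>i. if i < n then V i else Kn n"
    obtain g where g: "g \<in> GLs n" "\<And>i. i \<in> {1..n} \<Longrightarrow> fv.span (col g ` {1..i}) = ?W i"
    proof (rule adapted_basis[of "{1..n}" n ?W])
      fix i assume i: "i \<in> {1..n}"
      show "fv.subspace (?W i) \<and> ?W i \<subseteq> Kn n \<and> fv.dim (?W i) = i"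
      proof (cases "i < n")
        case True
        then show ?thesis
          using V i unfolding flags_def by simp
      next
        case False
        then show ?thesis
          using i by (auto simp: subspace_Kn dim_Kn)
      qed
      fix j assume "j \<in> {1..n}" "i \<le> j"
      then show "?W i \<subseteq> ?W j"
        using V i unfolding flags_def by auto
    next
      show "n \<in> {1..n}"
        using assms by auto
    qed auto
    have "column_flag n g = V"
    proof
      fix i show "column_flag n g i = V i"
      proof (cases "i \<in> {1..<n}")
        case True
        then show ?thesis
          using g(2)[of i] by (simp add: column_flag_nth)
      next
        case False
        then show ?thesis
          using V by (simp add: flags_def column_flag_def extensional_def del: atLeastLessThan_iff)
      qed
    qed
    then show "V \<in> column_flag n ` GLs n"
      using g(1) by blast
  qed
qed

subsection \<open>The action of the general linear group on flags\<close>

definition act :: "nat \<Rightarrow> (nat \<times> nat \<Rightarrow> 'k::field) \<Rightarrow> (nat \<Rightarrow> (nat \<Rightarrow> 'k) set) \<Rightarrow> nat \<Rightarrow> (nat \<Rightarrow> 'k) set" where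
  "act n h V = (\<lambda>i\<in>{1..<n}. mv n h ` V i)"

lemma act_nth: "j \<in> {1..<n} \<Longrightarrow> act n h V j = mv n h ` V j"
  by (simp add: act_def)

lemma column_flag_mm: "column_flag n (mm n h g) = act n h (column_flag n g)"
  by (rule ext) (simp add: column_flag_def act_def span_cols_mm restrict_def)

lemma flags_nth:
  assumes "V \<in> flags n" "j \<in> {1..<n}"
  shows "fv.subspace (V j)" "V j \<subseteq> Kn n" "fv.dim (V j) = j"
  using assms by (simp_all add: flags_def del: atLeastLessThan_iff)

lemma flags_mono: "V \<in> flags n \<Longrightarrow> i \<in> {1..<n} \<Longrightarrow> j \<in> {1..<n} \<Longrightarrow> i \<le> j \<Longrightarrow> V i \<subseteq> V j"
  by (simp add: flags_def del: atLeastLessThan_iff)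

lemma flags_eqI:
  assumes "V \<in> flags n" "V' \<in> flags n" "\<And>j. j \<in> {1..<n} \<Longrightarrow> V j = V' j"
  shows "V = V'"
  by (rule extensionalityI[of _ "{1..<n}"]) (use assms in \<open>auto simp: flags_def\<close>)

lemma act_in_flags:
  assumes "0 < n" "h \<in> GLs n" "V \<in> flags n"
  shows "act n h V \<in> flags n"
proof -
  obtain g where g: "g \<in> GLs n" "V = column_flag n g"
    using assms(3) pts_flag_variety[OF assms(1)] by blast
  then have "act n h V = column_flag n (mm n h g)"
    by (simp add: column_flag_mm)
  then show ?thesis
    using pts_flag_variety[OF assms(1)] mm_in_GLs[OF assms(2) g(1)] by blast
qed

lemma act_minv:
  assumes n: "0 < n" and h: "h \<in> GLs n" and V: "V \<in> flags n"
  shows "act n (minv n h) (act n h V) = V" and "act n h (act n (minv n h) V) = V"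
proof -
  note h' = minv_in_GLs[OF h]
  show "act n (minv n h) (act n h V) = V"
  proof (rule flags_eqI[OF act_in_flags[OF n h' act_in_flags[OF n h V]] V])
    fix j assume j: "j \<in> {1..<n}"
    have "mv n (minv n h) ` mv n h ` V j = (\<lambda>v. v) ` V j"
      unfolding image_image
      by (rule image_cong) (use mv_minv(2)[OF h] flags_nth(2)[OF V j] in auto)
    then show "act n (minv n h) (act n h V) j = V j"
      by (simp add: act_nth[OF j])
  qed
  show "act n h (act n (minv n h) V) = V"
  proof (rule flags_eqI[OF act_in_flags[OF n h act_in_flags[OF n h' V]] V])
    fix j assume j: "j \<in> {1..<n}"
    have "mv n h ` mv n (minv n h) ` V j = (\<lambda>v. v) ` V j"
      unfolding image_image
      by (rule image_cong) (use mv_minv(1)[OF h] flags_nth(2)[OF V j] in auto)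
    then show "act n h (act n (minv n h) V) j = V j"
      by (simp add: act_nth[OF j])
  qed
qed

lemma dim_Int_act:
  assumes h: "h \<in> GLs n" and V: "V \<in> flags n" and j: "j \<in> {1..<n}"
    and E: "fv.subspace E" "E \<subseteq> Kn n"
  shows "fv.dim (mv n h ` E \<inter> act n h V j) = fv.dim (E \<inter> V j)"
proof -
  have "mv n h ` E \<inter> act n h V j = mv n h ` (E \<inter> V j)"
    unfolding act_nth[OF j] by (rule inj_on_image_Int[OF inj_on_mv[OF h] E(2) flags_nth(2)[OF V j], symmetric])
  then show ?thesis
    using E by (simp add: dim_mv_image[OF h fv.subspace_inter[OF E(1) flags_nth(1)[OF V j]]] le_infI1)
qed

lemma reg_quotient_reg_mat:
  assumes "reg_mat (swf_quotient (GL n) q) n W \<alpha>"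
  shows "reg_mat (GL n) n {g \<in> GLs n. q g \<in> W} (\<lambda>g. \<alpha> (q g))"
  using assms by (simp add: reg_mat_def reg_quotient comp_def pts_GL)

text \<open>Pulled back to matrices, the action is a multiplication by a regular family.\<close>

lemma swf_morphism_act:
  fixes \<alpha> :: "(nat \<Rightarrow> (nat \<Rightarrow> 'k::field) set) \<Rightarrow> nat \<times> nat \<Rightarrow> 'k"
  assumes W: "openin (zar (flag_variety n)) W" and GL: "\<And>V. V \<in> W \<Longrightarrow> \<alpha> V \<in> GLs n"
    and \<alpha>: "reg_mat (flag_variety n) n W \<alpha>"
  shows "swf_morphism (swf_sub (flag_variety n) W) (flag_variety n) (\<lambda>V. act n (\<alpha> V) V)"
  unfolding flag_variety_def
proof (rule swf_morphism_from_quotient[OF space_with_functions_GL W[unfolded flag_variety_def]])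
  let ?q = "column_flag n :: _ \<Rightarrow> _ \<Rightarrow> (nat \<Rightarrow> 'k) set"
  let ?W = "{g \<in> pts (GL n). ?q g \<in> W}"
  note X = space_with_functions_GL[of n]
  note X' = space_with_functions_sub[OF X, of ?W]
  have o: "openin (zar (GL n)) ?W"
    using W unfolding flag_variety_def openin_quotient by simp
  have pW: "pts (swf_sub (GL n) ?W) = ?W"
    by auto
  have "reg_mat (GL n) n ?W (\<lambda>g. mm n (\<alpha> (?q g)) g)"
    using reg_quotient_reg_mat[OF \<alpha>[unfolded flag_variety_def]]
    by (intro reg_mat_mm[OF X o] reg_mat_id_GL) (auto simp: pts_GL)
  then have "reg_mat (swf_sub (GL n) ?W) n (pts (swf_sub (GL n) ?W)) (\<lambda>g. mm n (\<alpha> (?q g)) g)"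
    unfolding pW by (rule reg_mat_sub[OF o _ order_refl])
  then have "swf_morphism (swf_sub (GL n) ?W) (GL n) (\<lambda>g. mm n (\<alpha> (?q g)) g)"
    by (rule swf_morphism_to_GL[OF X', rotated]) (auto simp: pts_GL intro: mm_in_GLs GL)
  from swf_morphism_compose[OF this swf_morphism_quotient, of ?q]
  show "swf_morphism (swf_sub (GL n) ?W) (swf_quotient (GL n) ?q) (\<lambda>g. act n (\<alpha> (?q g)) (?q g))"
    by (simp add: column_flag_mm)
qed

lemma space_with_functions_flag_variety: "space_with_functions (flag_variety n)"
  unfolding flag_variety_def by (rule fl.space_with_functions_Q)

lemma pts_flags: "0 < n \<Longrightarrow> pts (flag_variety n) = flags n"
  unfolding flag_variety_def pts_quotient pts_GL by (rule pts_flag_variety)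

lemma continuous_map_act:
  fixes h :: "nat \<times> nat \<Rightarrow> 'k::field"
  assumes "h \<in> GLs n"
  shows "continuous_map (zar (flag_variety n)) (zar (flag_variety n)) (act n h)"
proof -
  let ?X = "flag_variety n :: (nat \<Rightarrow> (nat \<Rightarrow> 'k) set, 'k) swf"
  have "swf_morphism (swf_sub ?X (pts ?X)) ?X (\<lambda>V. act n h V)"
    by (rule swf_morphism_act[OF openin_topspace])
      (use assms reg_mat_const[OF space_with_functions_flag_variety openin_topspace] in auto)
  then show ?thesis
    by (simp add: swf_morphism_def subtopology_topspace)
qed

subsection \<open>Rank conditions are closed\<close>

text \<open>
  Extend a basis of \<open>E\<close> by columns of \<open>x\<close> to a basis of \<open>E + span (x\<^sub>1, \<dots>, x\<^sub>j)\<close>, and then to a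
  basis of \<open>K\<^sup>n\<close>. If the columns of \<open>x\<close> in this basis move, it remains a basis as long as a
  determinant does not vanish, so that the dimension of the sum does not drop.
\<close>

lemma openin_dim_Int_less:
  fixes E :: "(nat \<Rightarrow> 'k::field) set"
  assumes E: "fv.subspace E" "E \<subseteq> Kn n" and j: "j \<le> n"
  shows "openin (zar (GL n)) {g \<in> GLs n. fv.dim (E \<inter> fv.span (col g ` {1..j})) < c}"
proof (rule openin_localI)
  fix x assume "x \<in> {g \<in> GLs n. fv.dim (E \<inter> fv.span (col g ` {1..j})) < c}"
  then have x: "x \<in> GLs n" "fv.dim (E \<inter> fv.span (col x ` {1..j})) < c"
    by auto
  let ?S = "\<lambda>g. fv.span (col g ` {1..j})"
  have dim_sum: "fv.dim E + j = fv.dim (E \<inter> ?S g) + fv.dim (fv.span (E \<union> ?S g))" if g: "g \<in> GLs n" for g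
    using fv.dim_Int_Un[OF finite_dim_in_Kn[OF E(2)] finite_dim_in_Kn[OF span_cols_in_Kn[OF GLs_mats[OF g]]]
        E(1) fv.subspace_span, of "{1..j}"] dim_span_cols[OF g j] by simp
  obtain BE where BE: "BE \<subseteq> E" "fv.independent BE" "E \<subseteq> fv.span BE" "finite BE" "card BE = fv.dim E"
    by (rule fv.finite_dim_basis[OF finite_dim_in_Kn[OF E(2)]])
  let ?G = "BE \<union> col x ` {1..j}"
  have GK: "?G \<subseteq> Kn n"
    using BE(1) E(2) col_in_Kn[OF GLs_mats[OF x(1)]] by auto
  obtain B where B: "BE \<subseteq> B" "B \<subseteq> ?G" "fv.independent B" "?G \<subseteq> fv.span B" "finite B" "card B = fv.dim ?G"
    by (rule fv.extend_to_basis[OF finite_dim_in_Kn[OF GK] BE(2)]) auto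
  obtain B' where B': "B \<subseteq> B'" "B' \<subseteq> Kn n" "fv.independent B'" "Kn n \<subseteq> fv.span B'" "finite B'" "card B' = fv.dim (Kn n :: (nat \<Rightarrow> 'k) set)"
    by (rule fv.extend_to_basis[OF finite_dim_Kn[of n] B(3) order_trans[OF B(2) GK]])
  obtain b where b: "bij_betw b {1..n} B'"
    using finite_same_card_bij[of "{1..n}" B'] B'(5,6) by (auto simp: dim_Kn)
  define L where "L = {l \<in> {1..n}. b l \<in> B - BE}"
  have "\<exists>t. t \<in> {1..j} \<and> b l = col x t" if l: "l \<in> L" for l
  proof -
    have "b l \<in> col x ` {1..j}"
      using l B(2) unfolding L_def by blast
    then show ?thesis by blast
  qed
  then obtain t where t: "\<And>l. l \<in> L \<Longrightarrow> t l \<in> {1..j} \<and> b l = col x (t l)"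
    by metis
  define N where "N g = (\<lambda>(i, l). if l \<in> L then g (i, t l) else if l \<in> {1..n} then b l i else 0)"
    for g :: "nat \<times> nat \<Rightarrow> 'k"
  have LN: "L \<subseteq> {1..n}"
    by (auto simp: L_def)
  have colN: "col (N g) l = (if l \<in> L then col g (t l) else b l)" if "l \<in> {1..n}" for g l
    using that by (auto simp: N_def Defs.col_def)
  have bK: "b l \<in> Kn n" if "l \<in> {1..n}" for l
    using b B'(2) that by (auto simp: bij_betw_def)
  have N_mats: "N g \<in> mats n" if g: "g \<in> mats n" for g
    unfolding mats_cols
  proof (intro conjI ballI allI impI)
    fix l assume "l \<in> {1..n}"
    then show "col (N g) l \<in> Kn n"
      using bK col_in_Kn[OF g] by (simp add: colN)
  next
    fix i l assume "l \<notin> {1..n}"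
    then show "N g (i, l) = 0"
      using LN by (auto simp: N_def)
  qed
  have "(\<lambda>g. lead_minor n (N g)) \<in> polyfun ({1..n} \<times> {1..n})"
  proof (rule polyfun_compose[OF polyfun_lead_minor[OF order_refl]])
    fix il assume il: "il \<in> {1..n} \<times> {1..n}"
    obtain i l where il': "il = (i, l)" "i \<in> {1..n}" "l \<in> {1..n}"
      using il by auto
    show "(\<lambda>g. N g il) \<in> polyfun ({1..n} \<times> {1..n})"
    proof (cases "l \<in> L")
      case True
      then show ?thesis
        using t[OF True] j il' by (auto simp: N_def intro!: polyfun.coord)
    next
      case False
      then show ?thesis
        using il' by (simp add: N_def polyfun.const)
    qed
  qed
  from openin_GL_nonzero[OF this]
  have o: "openin (zar (GL n)) {g \<in> GLs n. lead_minor n (N g) \<noteq> 0}" .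
  have "N x \<in> GLs n"
    unfolding GLs_def
  proof (intro CollectI conjI N_mats[OF GLs_mats[OF x(1)]])
    have e: "col (N x) l = b l" if "l \<in> {1..n}" for l
      using that t by (simp add: colN)
    have img: "col (N x) ` {1..n} = B'"
      using b e by (simp add: bij_betw_def)
    have "inj_on (col (N x)) {1..n} \<longleftrightarrow> inj_on b {1..n}"
      by (rule inj_on_cong) (rule e)
    then show "is_basis n (col (N x))"
      using b B'(3) fv.span_subspace[OF B'(2,4) subspace_Kn] unfolding is_basis_def img
      by (simp add: bij_betw_def)
  qed
  then have xo: "x \<in> {g \<in> GLs n. lead_minor n (N g) \<noteq> 0}"
    using x(1) GLs_iff_minor by blast
  have "fv.dim (E \<inter> ?S g) < c" if g: "g \<in> GLs n" "lead_minor n (N g) \<noteq> 0" for g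
  proof -
    have N: "N g \<in> GLs n"
      using N_mats[OF GLs_mats[OF g(1)]] g(2) GLs_iff_minor by blast
    let ?L = "{l \<in> {1..n}. b l \<in> B}"
    have "b ` ?L = B"
    proof -
      have "B \<subseteq> b ` {1..n}"
        using b B'(1) unfolding bij_betw_def by blast
      then show ?thesis by blast
    qed
    moreover have "inj_on b ?L"
      by (rule inj_on_subset[OF bij_betw_imp_inj_on[OF b]]) blast
    ultimately have cL: "card ?L = card B"
      using card_image by fastforce
    have i: "inj_on (col (N g)) {1..n}" "fv.independent (col (N g) ` {1..n})"
      using N by (auto simp: GLs_def is_basis_def)
    have "col (N g) l \<in> fv.span (E \<union> ?S g)" if l: "l \<in> ?L" for l
    proof (cases "l \<in> L")
      case True
      then have "col g (t l) \<in> ?S g"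
        using t by (intro fv.span_base) auto
      then show ?thesis
        using True l by (intro fv.span_base) (auto simp: colN)
    next
      case False
      then have "b l \<in> E"
        using l BE(1) by (auto simp: L_def)
      then show ?thesis
        using False l by (intro fv.span_base) (auto simp: colN)
    qed
    moreover have SK: "fv.span (E \<union> ?S g) \<subseteq> Kn n"
      using E(2) span_cols_in_Kn[OF GLs_mats[OF g(1)]] by (intro fv.span_minimal subspace_Kn) auto
    ultimately have "card (col (N g) ` ?L) \<le> fv.dim (fv.span (E \<union> ?S g))"
      by (intro fv.independent_card_le[OF finite_dim_in_Kn[OF SK]] fv.independent_mono[OF i(2)]) auto
    moreover have "card (col (N g) ` ?L) = card ?L"
      by (rule card_image, rule inj_on_subset[OF i(1)]) auto
    moreover have "fv.span (E \<union> ?S x) = fv.span ?G"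
      unfolding fv.span_eq
    proof
      have "E \<subseteq> fv.span ?G"
        using BE(3) fv.span_mono[of BE ?G] by auto
      moreover have "?S x \<subseteq> fv.span ?G"
        by (rule fv.span_mono) auto
      ultimately show "E \<union> ?S x \<subseteq> fv.span ?G"
        by auto
      show "?G \<subseteq> fv.span (E \<union> ?S x)"
        using BE(1) fv.span_superset[of "col x ` {1..j}"] fv.span_superset[of "E \<union> ?S x"] by blast
    qed
    then have "fv.dim (fv.span (E \<union> ?S x)) = card B"
      using B(6) by simp
    ultimately show ?thesis
      using dim_sum[OF g(1)] dim_sum[OF x(1)] cL x(2) by linarith
  qed
  then show "\<exists>V. openin (zar (GL n)) V \<and> x \<in> V \<and> V \<subseteq> {g \<in> GLs n. fv.dim (E \<inter> ?S g) < c}"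
    using o xo by (intro exI[of _ "{g \<in> GLs n. lead_minor n (N g) \<noteq> 0}"]) auto
qed

lemma closedin_flag_condition:
  fixes E :: "(nat \<Rightarrow> 'k::field) set"
  assumes E: "fv.subspace E" "E \<subseteq> Kn n" and j: "j \<in> {1..<n}"
  shows "closedin (zar (flag_variety n)) {V \<in> flags n. c \<le> fv.dim (E \<inter> V j)}"
proof -
  have n: "0 < n" using j by simp
  let ?C = "{V \<in> flags n. c \<le> fv.dim (E \<inter> V j)}"
  have "{g \<in> GLs n. column_flag n g \<in> flags n - ?C} = {g \<in> GLs n. fv.dim (E \<inter> fv.span (col g ` {1..j})) < c}"
    using pts_flag_variety[OF n] by (auto simp: column_flag_nth[OF j])
  then have "openin (zar (flag_variety n)) (flags n - ?C)"
    unfolding flag_variety_def openin_quotient pts_GL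
    using openin_dim_Int_less[OF E, of j c] j pts_flag_variety[OF n] by auto
  then show ?thesis
    unfolding closedin_def pts_flags[OF n] by blast
qed

lemma noetherian_space_flag_variety:
  "noetherian_space (zar (flag_variety n :: (nat \<Rightarrow> (nat \<Rightarrow> 'k::field) set, 'k) swf))"
proof (rule noetherian_space_image)
  show "noetherian_space (zar (GL n :: (nat \<times> nat \<Rightarrow> 'k, 'k) swf))"
    unfolding GL_eq zar_sub zar_affine
    by (rule noetherian_space_subtopology, rule noetherian_space_affine) simp
  show "continuous_map (zar (GL n)) (zar (flag_variety n)) (column_flag n)"
    using swf_morphism_quotient[of "GL n" "column_flag n"]
    unfolding swf_morphism_def flag_variety_def by (rule conjunct1)
  show "column_flag n ` pts (GL n) = pts (flag_variety n)"
    by (simp add: flag_variety_def)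
qed

subsection \<open>Closed subsets of the flag variety are varieties\<close>

lemma closedin_mats_zero:
  assumes "p \<in> polyfun I"
  shows "closedin (affine_topology I) {x \<in> affine_points I. p x = 0}"
proof -
  have "affine_points I - {x \<in> affine_points I. p x = 0} = {x \<in> affine_points I. p x \<noteq> 0}"
    by auto
  then show ?thesis
    unfolding closedin_def pts_affine using openin_affine_basic[OF assms] by auto
qed

text \<open>
  A chart around the class of \<open>a\<close> is identified with the matrices \<open>a u\<close> with \<open>u\<close> lower
  unitriangular, a closed set of affine space.
\<close>

lemma affine_variety_chart:
  fixes a :: "nat \<times> nat \<Rightarrow> 'k::field"
  assumes a: "a \<in> GLs n" and C: "closedin (zar (flag_variety n)) C"
  shows "affine_variety (swf_sub (swf_sub (flag_variety n) C) (fl.chart n a \<inter> C))"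
proof -
  let ?q = "column_flag n :: _ \<Rightarrow> _ \<Rightarrow> (nat \<Rightarrow> 'k) set"
  let ?Fl = "flag_variety n :: (nat \<Rightarrow> (nat \<Rightarrow> 'k) set, 'k) swf"
  let ?U = "fl.chart n a \<inter> C" and ?N = "n * n"
  let ?X = "swf_sub (swf_sub ?Fl C) ?U"
  note Fl = space_with_functions_flag_variety[of n]
  note X = space_with_functions_sub[OF space_with_functions_sub[OF Fl, of C], of ?U]
  have oC: "openin (zar ?Fl) (fl.chart n a)"
    unfolding flag_variety_def by (rule fl.openin_chart[OF a])
  have pX: "pts ?X = ?U"
    using openin_subset[OF oC] by auto
  have "card {..<?N} = card ({1..n} \<times> {1..n})"
    by simp
  then obtain f where f: "bij_betw f {..<?N} ({1..n} \<times> {1..n})"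
    using finite_same_card_bij[of "{..<?N}" "{1..n} \<times> {1..n}"] by blast
  let ?f' = "inv_into {..<?N} f"
  have f': "?f' x \<in> {..<?N}" "f (?f' x) = x" if x: "x \<in> {1..n} \<times> {1..n}" for x
  proof -
    have "x \<in> f ` {..<?N}"
      using x f unfolding bij_betw_def by blast
    then show "?f' x \<in> {..<?N}" "f (?f' x) = x"
      by (rule inv_into_into, rule f_inv_into_f)
  qed
  have ff: "?f' (f m) = m" "f m \<in> {1..n} \<times> {1..n}" if "m \<in> {..<?N}" for m
    using that f by (auto simp: bij_betw_def)
  \<comment> \<open>The definition of affine varieties numbers the coordinates by \<open>0, 1, \<dots>\<close>, so matrices are turned
    into vectors by \<open>\<rho>\<close>, with inverse \<open>\<rho>'\<close>.\<close>
  define \<rho> where "\<rho> M = (\<lambda>m. if m \<in> {..<?N} then M (f m) else 0)" for M :: "nat \<times> nat \<Rightarrow> 'k"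
  define \<rho>' where "\<rho>' v = (\<lambda>x. if x \<in> {1..n} \<times> {1..n} then v (?f' x) else 0)" for v :: "nat \<Rightarrow> 'k"
  have \<rho>\<rho>': "\<rho>' (\<rho> M) = M" if "M \<in> mats n" for M
  proof
    fix x show "\<rho>' (\<rho> M) x = M x"
    proof (cases "x \<in> {1..n} \<times> {1..n}")
      case True
      then show ?thesis
        using f' by (simp add: \<rho>_def \<rho>'_def)
    next
      case False
      then show ?thesis
        using that by (cases x) (auto simp: \<rho>'_def affine_points_def)
    qed
  qed
  have \<rho>'\<rho>: "\<rho> (\<rho>' v) = v" if "v \<in> affine_points {..<?N}" for v
  proof
    fix m show "\<rho> (\<rho>' v) m = v m"
    proof (cases "m \<in> {..<?N}")
      case True
      then show ?thesis
        using ff by (simp add: \<rho>_def \<rho>'_def del: lessThan_iff mem_Sigma_iff)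
    next
      case False
      then show ?thesis
        using that by (simp add: \<rho>_def affine_points_def)
    qed
  qed
  have \<rho>_in: "\<rho> M \<in> affine_points {..<?N}" for M
    by (auto simp: \<rho>_def affine_points_def)
  have \<rho>'_in: "\<rho>' v \<in> mats n" for v
    by (auto simp: \<rho>'_def affine_points_def)
  \<comment> \<open>The matrices \<open>a u\<close> with \<open>u\<close> lower unitriangular, those among them with a flag in \<open>C\<close>, and the
    latter written as vectors.\<close>
  define T where "T = {M \<in> mats n. \<forall>j\<in>{1..n}. \<forall>i\<in>{1..j}. mm n (minv n a) M (i, j) - (if i = j then 1 else 0) = 0}"
  define Z0 where "Z0 = {M \<in> T. ?q M \<in> C}"
  define Z where "Z = {v \<in> affine_points {..<?N}. \<rho>' v \<in> Z0}"
  have T_GL: "M \<in> GLs n" if "M \<in> T" for M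
  proof -
    have M: "M \<in> mats n"
      using that by (simp add: T_def)
    have "mm n (minv n a) M \<in> GLs n"
    proof (rule unitriangular_in_GLs[OF mm_in_mats[OF minv_in_mats M]])
      fix i j assume "j \<in> {1..n}" "i \<in> {1..j}"
      then have "mm n (minv n a) M (i, j) - (if i = j then 1 else 0) = 0"
        using that unfolding T_def by blast
      then show "mm n (minv n a) M (i, j) = (if i = j then 1 else 0)"
        by simp
    qed
    from mm_in_GLs[OF a this] show ?thesis
      using mm_minv_cancel(1)[OF a M] by simp
  qed
  have closed_T: "closedin (affine_topology ({1..n} \<times> {1..n})) T"
  proof -
    have p: "(\<lambda>M. mm n (minv n a) M (i, j) - (if i = j then 1 else 0)) \<in> polyfun ({1..n} \<times> {1..n})"
      if ij: "j \<in> {1..n}" "i \<in> {1..j}" for i j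
    proof -
      have "(\<lambda>M. mm n (minv n a) M (i, j) + (if i = j then - 1 else 0)) \<in> polyfun ({1..n} \<times> {1..n})"
        unfolding mm_def prod.case using ij
        by (intro polyfun.add polyfun_sum polyfun.mult polyfun.const polyfun.coord) auto
      then show ?thesis
        by (cases "i = j") simp_all
    qed
    have "T = mats n \<inter> (\<Inter>j\<in>{1..n}. \<Inter>i\<in>{1..j}. {M \<in> mats n. mm n (minv n a) M (i, j) - (if i = j then 1 else 0) = 0})"
      unfolding T_def by blast
    also have "closedin (affine_topology ({1..n} \<times> {1..n})) \<dots>"
    proof (cases "n = 0")
      case True
      then show ?thesis
        using closedin_topspace[of "affine_topology ({1..n} \<times> {1..n})"] by simp
    next
      case False
      show ?thesis
      proof (intro closedin_Int closedin_Inter)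
        show "closedin (affine_topology ({1..n} \<times> {1..n})) (mats n)"
          using closedin_topspace[of "affine_topology ({1..n} \<times> {1..n})"] by simp
        fix S assume "S \<in> (\<lambda>j. \<Inter>i\<in>{1..j}. {M \<in> mats n. mm n (minv n a) M (i, j) - (if i = j then 1 else 0) = 0}) ` {1..n}"
        then obtain j where j: "j \<in> {1..n}" "S = (\<Inter>i\<in>{1..j}. {M \<in> mats n. mm n (minv n a) M (i, j) - (if i = j then 1 else 0) = 0})"
          by blast
        show "closedin (affine_topology ({1..n} \<times> {1..n})) S"
          unfolding j(2)
          by (rule closedin_Inter) (use j(1) closedin_mats_zero[OF p] in auto)
      qed (use False in auto)
    qed
    finally show ?thesis .
  qed
  have closed_Z0: "closedin (affine_topology ({1..n} \<times> {1..n})) Z0"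
  proof -
    have "openin (zar ?Fl) (pts ?Fl - C)"
      using C by (simp add: closedin_def)
    then have "openin (zar (GL n)) {M \<in> GLs n. ?q M \<in> pts ?Fl - C}"
      unfolding flag_variety_def openin_quotient pts_GL by simp
    then have o: "openin (affine_topology ({1..n} \<times> {1..n})) {M \<in> GLs n. ?q M \<in> pts ?Fl - C}"
      unfolding GL_eq zar_sub zar_affine using openin_trans_full[OF _ openin_mats_GLs] by blast
    have "Z0 = T - {M \<in> GLs n. ?q M \<in> pts ?Fl - C}"
      using T_GL unfolding Z0_def flag_variety_def pts_quotient pts_GL by auto
    then show ?thesis
      using closedin_diff[OF closed_T o] by simp
  qed
  note A = space_with_functions_affine
  have m\<rho>': "swf_morphism (affine_space {..<?N}) (affine_space ({1..n} \<times> {1..n})) \<rho>'"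
  proof (rule swf_morphism_to_affine[OF A \<rho>'_in])
    fix x assume x: "x \<in> {1..n} \<times> {1..n}"
    have "(\<lambda>v. v (?f' x)) \<in> reg (affine_space {..<?N}) (pts (affine_space {..<?N}))"
      unfolding zar_affine
      by (rule polyfun_in_reg[OF openin_topspace polyfun.coord[OF f'(1)[OF x]]])
    then show "(\<lambda>v. \<rho>' v x) \<in> reg (affine_space {..<?N}) (pts (affine_space {..<?N}))"
      using x by (simp add: \<rho>'_def del: mem_Sigma_iff)
  qed
  have closed_Z: "closedin (zar (affine_space {..<?N})) Z"
    using closedin_continuous_map_preimage[OF conjunct1[OF m\<rho>'[unfolded swf_morphism_def]], of Z0] closed_Z0
    unfolding Z_def by simp
  let ?\<phi> = "\<lambda>V. \<rho> (fl.local_section n a V)" and ?\<psi> = "\<lambda>v. ?q (\<rho>' v)"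
  have sec: "fl.local_section n a V \<in> Z0" "?q (fl.local_section n a V) = V" if V: "V \<in> ?U" for V
  proof -
    have V': "V \<in> fl.chart n a" "V \<in> C"
      using V by auto
    show q: "?q (fl.local_section n a V) = V"
      by (rule fl.q_local_section[OF a V'(1)])
    show "fl.local_section n a V \<in> Z0"
      using fl.local_section_in_GLs[OF a V'(1)] fl.local_section_coords[OF a V'(1)] q V'(2) GLs_mats
      unfolding Z0_def T_def by auto
  qed
  have sub: "\<rho>' v \<in> Z0" if "v \<in> Z" for v
    using that by (simp add: Z_def)
  \<comment> \<open>A unitriangular matrix is its own matrix of reduced vectors, so \<open>Z0\<close> consists of values of the
    section.\<close>
  have cell: "M \<in> fl.cell n a" "fl.lift n a M = M" if M: "M \<in> Z0" for M
  proof -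
    have MT: "M \<in> T" "M \<in> GLs n"
      using M T_GL by (auto simp: Z0_def)
    let ?u = "mm n (minv n a) M"
    have u: "?u \<in> GLs n"
      by (rule mm_in_GLs[OF minv_in_GLs[OF a] MT(2)])
    have uc: "?u (i, j) = (if i = j then 1 else 0)" if "j \<in> {1..n}" "i \<in> {1..j}" for i j
    proof -
      have "?u (i, j) - (if i = j then 1 else 0) = 0"
        using MT(1) that unfolding T_def by blast
      then show ?thesis by simp
    qed
    have nz: "lead_minor j ?u \<noteq> 0" if j: "j \<in> {1..n}" for j
    proof
      assume "lead_minor j ?u = 0"
      then obtain c where c: "\<exists>l\<in>{1..j}. c l \<noteq> 0" "\<forall>i\<in>{1..j}. (\<Sum>l\<in>{1..j}. ?u (i, l) * c l) = 0"
        by (rule lead_minor_0)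
      have "c i = 0" if "i \<in> {1..j}" for i
        using that
      proof (induction i rule: less_induct)
        case (less i)
        have "?u (i, l) * c l = (if i = l then c i else 0)" if l: "l \<in> {1..j}" for l
        proof (cases "l < i")
          case True
          then show ?thesis
            using less.IH[OF True] l by auto
        next
          case False
          then show ?thesis
            using uc[of l i] less.prems l j by auto
        qed
        then have "(\<Sum>l\<in>{1..j}. ?u (i, l) * c l) = (\<Sum>l\<in>{1..j}. if i = l then c i else 0)"
          by (intro sum.cong) auto
        then show ?case
          using c(2) less.prems by simp
      qed
      then show False
        using c(1) by blast
    qed
    show Mc: "M \<in> fl.cell n a"
      using MT nz by (simp add: fl.cell_def)
    have "reduced_mat n (\<lambda>j. j) ?u = ?u"
    proof (rule mats_eqI[OF reduced_mat_in_mats[OF u _ nz] GLs_mats[OF u]])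
      fix j assume j: "j \<in> {1..n}"
      have "reduced j ?u j - col ?u j = 0"
      proof (rule lead_minor_span_0[OF nz[OF j]])
        show "reduced j ?u j - col ?u j \<in> fv.span (col ?u ` {1..j})"
          using j by (intro fv.span_diff reduced_in_span fv.span_base) auto
        fix i assume i: "i \<in> {1..j}"
        then show "(reduced j ?u j - col ?u j) i = 0"
          using reduced_coords[OF nz[OF j] i, of j] uc[OF j i] j by (simp add: Defs.col_def)
      qed
      then show "col (reduced_mat n (\<lambda>j. j) ?u) j = col ?u j"
        by (simp add: col_reduced_mat[OF j])
    qed auto
    then show "fl.lift n a M = M"
      using mm_minv_cancel(1)[OF a GLs_mats[OF MT(2)]] by (simp add: fl.lift_def)
  qed
  have \<psi>_in: "?\<psi> v \<in> ?U" "fl.local_section n a (?\<psi> v) = \<rho>' v" if v: "v \<in> Z" for v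
    using cell[OF sub[OF v]] sub[OF v] fl.local_section_q[OF a cell(1)[OF sub[OF v]]]
    by (auto simp: fl.chart_def Z0_def)
  have "swf_morphism ?X (swf_sub (affine_space {..<?N}) Z) ?\<phi>"
  proof (rule swf_morphism_into_sub[OF X swf_morphism_to_affine[OF X \<rho>_in]])
    fix m assume m: "m \<in> {..<?N}"
    obtain i j where ij: "f m = (i, j)" "i \<in> {1..n}" "j \<in> {1..n}"
      using ff(2)[OF m] by (cases "f m") auto
    have "reg_mat ?Fl n (fl.chart n a) (fl.local_section n a)"
      unfolding flag_variety_def by (rule fl.reg_mat_local_section[OF a])
    then have r: "reg_mat (swf_sub ?Fl C) n (fl.chart n a \<inter> pts (swf_sub ?Fl C)) (fl.local_section n a)"
      by (rule reg_mat_sub[OF oC]) auto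
    have o: "openin (zar (swf_sub ?Fl C)) (fl.chart n a \<inter> pts (swf_sub ?Fl C))"
      using oC openin_subset[OF oC] unfolding zar_sub openin_subtopology by auto
    have "reg_mat ?X n ?U (fl.local_section n a)"
      by (rule reg_mat_sub[OF o r]) (use pX in auto)
    from reg_matD[OF this ij(2,3)] show "(\<lambda>V. ?\<phi> V m) \<in> reg ?X (pts ?X)"
      using m unfolding pX by (simp add: \<rho>_def ij(1))
  next
    fix V assume "V \<in> pts ?X"
    then have V: "V \<in> ?U"
      unfolding pX .
    have "fl.local_section n a V \<in> mats n"
      using sec(1)[OF V] by (simp add: Z0_def T_def)
    then show "?\<phi> V \<in> Z"
      using sec(1)[OF V] \<rho>_in \<rho>\<rho>' by (simp add: Z_def)
  qed
  moreover have "swf_morphism (swf_sub (affine_space {..<?N}) Z) ?X ?\<psi>"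
  proof -
    note AZ = space_with_functions_sub[OF A, of "{..<?N}" Z]
    have pZ: "v \<in> Z" if "v \<in> pts (swf_sub (affine_space {..<?N}) Z)" for v
      using that by auto
    have "swf_morphism (swf_sub (affine_space {..<?N}) Z) (GL n) \<rho>'"
      unfolding GL_eq
      by (rule swf_morphism_into_sub[OF AZ swf_morphism_compose[OF swf_morphism_inclusion m\<rho>']])
        (use pZ sub T_GL in \<open>auto simp: Z0_def\<close>)
    from swf_morphism_compose[OF this swf_morphism_quotient]
    have "swf_morphism (swf_sub (affine_space {..<?N}) Z) ?Fl ?\<psi>"
      unfolding flag_variety_def .
    then show ?thesis
      by (intro swf_morphism_into_sub[OF AZ]) (use pZ \<psi>_in in auto)
  qed
  moreover have "?\<psi> (?\<phi> V) = V" if "V \<in> pts ?X" for V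
  proof -
    have V: "V \<in> ?U"
      using that unfolding pX .
    have "fl.local_section n a V \<in> mats n"
      using sec(1)[OF V] by (simp add: Z0_def T_def)
    then show ?thesis
      using sec(2)[OF V] by (simp add: \<rho>\<rho>')
  qed
  moreover have "?\<phi> (?\<psi> v) = v" if "v \<in> pts (swf_sub (affine_space {..<?N}) Z)" for v
  proof -
    have "v \<in> Z" "v \<in> affine_points {..<?N}"
      using that by auto
    then show ?thesis
      using \<psi>_in(2) \<rho>'\<rho> by simp
  qed
  ultimately have "swf_iso ?X (swf_sub (affine_space {..<?N}) Z) ?\<phi>"
    unfolding swf_iso_def by (intro conjI exI[of _ ?\<psi>] ballI)
  then show ?thesis
    unfolding affine_variety_def using closed_Z by (intro exI[of _ ?N] exI[of _ Z] exI[of _ ?\<phi>] conjI)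
qed

text \<open>
  By Noetherianity finitely many of the charts cover. Separatedness holds because two different
  flags are told apart by a coordinate of a vector of one in a basis adapted to the other.
\<close>

lemma closed_sub_flag_variety:
  fixes C :: "(nat \<Rightarrow> (nat \<Rightarrow> 'k::field) set) set"
  assumes n: "0 < n" and C: "closedin (zar (flag_variety n)) C"
  shows "variety (swf_sub (flag_variety n) C)"
proof -
  let ?q = "column_flag n :: _ \<Rightarrow> _ \<Rightarrow> (nat \<Rightarrow> 'k) set"
  let ?Fl = "flag_variety n :: (nat \<Rightarrow> (nat \<Rightarrow> 'k) set, 'k) swf"
  let ?X = "swf_sub ?Fl C"
  note Fl = space_with_functions_flag_variety[of n]
  note X = space_with_functions_sub[OF Fl, of C]
  have CF: "C \<subseteq> flags n"
    using closedin_subset[OF C] by (simp add: pts_flags[OF n])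
  have pX: "pts ?X = C"
    using CF by (auto simp: pts_flags[OF n])
  define rep where "rep V = inv_into (GLs n) ?q V" for V
  have rep: "rep V \<in> GLs n" "?q (rep V) = V" if V: "V \<in> C" for V
  proof -
    have "V \<in> ?q ` GLs n"
      using CF V pts_flag_variety[OF n] by blast
    then show "rep V \<in> GLs n" "?q (rep V) = V"
      unfolding rep_def by (rule inv_into_into, rule f_inv_into_f)
  qed
  let ?U = "\<lambda>V. fl.chart n (rep V) \<inter> C"
  have oFl: "openin (zar ?Fl) (fl.chart n (rep V))" if V: "V \<in> C" for V
    unfolding flag_variety_def by (rule fl.openin_chart[OF rep(1)[OF V]])
  have oU: "openin (zar ?X) (?U V)" if V: "V \<in> C" for V
    using oFl[OF V] unfolding zar_sub openin_subtopology by blast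
  have mU: "V \<in> ?U V" if V: "V \<in> C" for V
    using fl.base_in_cell[OF rep(1)[OF V]] rep(2)[OF V] V unfolding fl.chart_def by force
  have reg: "reg_mat ?X n (?U V) (fl.local_section n (rep V))" if V: "V \<in> C" for V
    using reg_mat_sub[OF oFl[OF V]] fl.reg_mat_local_section[OF rep(1)[OF V]]
    unfolding flag_variety_def by blast
  have "noetherian_space (zar ?X)"
    unfolding zar_sub by (rule noetherian_space_subtopology[OF noetherian_space_flag_variety])
  then obtain A where A: "finite A" "A \<subseteq> C" "(\<Union>V\<in>A. ?U V) = C"
    using noetherian_space_finite_cover[of "zar ?X" ?U] oU mU unfolding pX by metis
  have cover: "\<exists>\<U>. finite \<U> \<and> \<Union>\<U> = pts ?X \<and> (\<forall>U\<in>\<U>. openin (zar ?X) U \<and> affine_variety (swf_sub ?X U))"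
  proof (intro exI[of _ "?U ` A"] conjI ballI)
    show "finite (?U ` A)"
      using A(1) by simp
    show "\<Union> (?U ` A) = pts ?X"
      using A(3) unfolding pX .
    fix U assume "U \<in> ?U ` A"
    then obtain V where V: "V \<in> C" "U = ?U V"
      using A(2) by blast
    show "openin (zar ?X) U"
      unfolding V(2) by (rule oU[OF V(1)])
    show "affine_variety (swf_sub ?X U)"
      unfolding V(2) by (rule affine_variety_chart[OF rep(1)[OF V(1)] C])
  qed
  \<comment> \<open>If the column \<open>k \<le> j\<close> of a section near \<open>V'\<close> lies outside \<open>V\<^sub>j\<close>, its expansion in the
    basis given by a section near \<open>V\<close> has a nonzero coordinate with index beyond \<open>j\<close>. This
    coordinate is a tensor function, and it vanishes on the diagonal.\<close>
  have sep: "openin (zar (swf_prod ?X ?X)) (C \<times> C - {(x, x) | x. x \<in> C})"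
  proof (rule openin_localI)
    fix z assume "z \<in> C \<times> C - {(x, x) | x. x \<in> C}"
    then obtain V V' where z: "z = (V, V')" "V \<in> C" "V' \<in> C" "V \<noteq> V'"
      by auto
    let ?s = "fl.local_section n (rep V)" and ?s' = "fl.local_section n (rep V')"
    have s: "?s W \<in> GLs n" "j \<in> {1..<n} \<Longrightarrow> fv.span (col (?s W) ` {1..j}) = W j" if "W \<in> ?U V" for W j
    proof -
      have W: "W \<in> fl.chart n (rep V)"
        using that by blast
      show "?s W \<in> GLs n"
        by (rule fl.local_section_in_GLs[OF rep(1)[OF z(2)] W])
      show "fv.span (col (?s W) ` {1..j}) = W j" if "j \<in> {1..<n}"
        using fl.q_local_section[OF rep(1)[OF z(2)] W] column_flag_nth[OF that, of "?s W"] by simp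
    qed
    have s': "?s' W \<in> GLs n" "j \<in> {1..<n} \<Longrightarrow> fv.span (col (?s' W) ` {1..j}) = W j" if "W \<in> ?U V'" for W j
    proof -
      have W: "W \<in> fl.chart n (rep V')"
        using that by blast
      show "?s' W \<in> GLs n"
        by (rule fl.local_section_in_GLs[OF rep(1)[OF z(3)] W])
      show "fv.span (col (?s' W) ` {1..j}) = W j" if "j \<in> {1..<n}"
        using fl.q_local_section[OF rep(1)[OF z(3)] W] column_flag_nth[OF that, of "?s' W"] by simp
    qed
    obtain j where j: "j \<in> {1..<n}" "V j \<noteq> V' j"
      using flags_eqI[of V n V'] z CF by blast
    have "\<not> V' j \<subseteq> V j"
    proof
      have V: "V \<in> flags n" "V' \<in> flags n"
        using z CF by auto
      assume "V' j \<subseteq> V j"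
      then have "V' j = V j"
        using flags_nth[OF V(1) j(1)] flags_nth[OF V(2) j(1)]
        by (intro fv.subspace_eq_if_dim_ge[OF finite_dim_in_Kn]) auto
      then show False
        using j(2) by simp
    qed
    then have "\<not> col (?s' V') ` {1..j} \<subseteq> V j"
      using fv.span_minimal[of "col (?s' V') ` {1..j}" "V j"] flags_nth(1)[OF _ j(1)] z(2) CF
        s'(2)[OF mU[OF z(3)] j(1)] by auto
    then obtain k where k: "k \<in> {1..j}" "col (?s' V') k \<notin> V j"
      by blast
    have kn: "k \<in> {1..n}"
      using k j by auto
    define h where "h i z = (\<Sum>l\<in>{1..n}. minv n (?s (fst z)) (i, l) * ?s' (snd z) (l, k))" for i z
    have h: "h i (W, W') = mv n (minv n (?s W)) (col (?s' W') k) i" for i W W'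
      by (simp add: h_def mv_def Defs.col_def)
    have mem: "(\<forall>i\<in>{j<..n}. h i (W, W') = 0) \<longleftrightarrow> col (?s' W') k \<in> W j"
      if W: "W \<in> ?U V" "W' \<in> ?U V'" for W W'
    proof -
      let ?c = "col (?s' W') k"
      let ?v = "mv n (minv n (?s W)) ?c"
      have c: "?c \<in> Kn n"
        by (rule col_in_Kn[OF GLs_mats[OF s'(1)[OF W(2)]]])
      have v: "?v \<in> Kn n"
        by (rule mv_in_Kn[OF minv_in_mats])
      have "?c \<in> W j \<longleftrightarrow> ?c \<in> mv n (?s W) ` {v. \<forall>i. i \<notin> {1..j} \<longrightarrow> v i = 0}"
        using s(2)[OF W(1) j(1)] span_cols[of j n "?s W"] j(1) by simp
      also have "\<dots> \<longleftrightarrow> (\<forall>i. i \<notin> {1..j} \<longrightarrow> ?v i = 0)"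
      proof
        assume "?c \<in> mv n (?s W) ` {v. \<forall>i. i \<notin> {1..j} \<longrightarrow> v i = 0}"
        then obtain v where v: "?c = mv n (?s W) v" "\<forall>i. i \<notin> {1..j} \<longrightarrow> v i = 0"
          by blast
        have "v \<in> Kn n"
          using v(2) j(1) by (auto simp: affine_points_def)
        then show "\<forall>i. i \<notin> {1..j} \<longrightarrow> ?v i = 0"
          using mv_minv(2)[OF s(1)[OF W(1)]] v by simp
      next
        assume "\<forall>i. i \<notin> {1..j} \<longrightarrow> ?v i = 0"
        then show "?c \<in> mv n (?s W) ` {v. \<forall>i. i \<notin> {1..j} \<longrightarrow> v i = 0}"
          using mv_minv(1)[OF s(1)[OF W(1)] c] by (intro image_eqI[of _ _ ?v]) auto
      qed
      also have "\<dots> \<longleftrightarrow> (\<forall>i\<in>{j<..n}. ?v i = 0)"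
      proof
        assume a: "\<forall>i\<in>{j<..n}. ?v i = 0"
        show "\<forall>i. i \<notin> {1..j} \<longrightarrow> ?v i = 0"
        proof (intro allI impI)
          fix i assume "i \<notin> {1..j}"
          then show "?v i = 0"
            using a v by (cases "i \<in> {1..n}") (auto simp: affine_points_def)
        qed
      qed auto
      finally show ?thesis
        by (simp add: h)
    qed
    obtain i where i: "i \<in> {j<..n}" "h i (V, V') \<noteq> 0"
      using mem[OF mU[OF z(2)] mU[OF z(3)]] k(2) by blast
    have "(\<lambda>z. h i z) \<in> tensor_functions ?X ?X (?U V) (?U V')"
      unfolding h_def
    proof (rule tensor_sum)
      show "finite {1..n}" "{1..n} \<noteq> {}"
        using n by auto
      fix l assume l: "l \<in> {1..n}"
      have "reg_mat ?X n (?U V) (\<lambda>W. minv n (?s W))"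
        by (rule reg_mat_minv[OF X oU[OF z(2)] reg[OF z(2)] s(1)])
      then have "(\<lambda>W. minv n (?s W) (i, l)) \<in> reg ?X (?U V)"
        by (rule reg_matD) (use i l j in auto)
      moreover have "(\<lambda>W. ?s' W (l, k)) \<in> reg ?X (?U V')"
        by (rule reg_matD[OF reg[OF z(3)] l kn])
      ultimately show "(\<lambda>z. minv n (?s (fst z)) (i, l) * ?s' (snd z) (l, k)) \<in> tensor_functions ?X ?X (?U V) (?U V')"
        by (rule tensor_simple)
    qed
    then have o: "openin (zar (swf_prod ?X ?X)) {z \<in> ?U V \<times> ?U V'. h i z \<noteq> 0}"
      by (rule openin_prod_basic[OF X X oU[OF z(2)] oU[OF z(3)]])
    have "h i (W, W) = 0" if W: "W \<in> ?U V" "W \<in> ?U V'" for W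
    proof -
      have "col (?s' W) k \<in> W j"
        unfolding s'(2)[OF W(2) j(1), symmetric] using k(1) by (intro fv.span_base) auto
      then show ?thesis
        using mem[OF W] i(1) by blast
    qed
    then show "\<exists>D. openin (zar (swf_prod ?X ?X)) D \<and> z \<in> D \<and> D \<subseteq> C \<times> C - {(x, x) | x. x \<in> C}"
      using o z(1) mU[OF z(2)] mU[OF z(3)] i(2)
      by (intro exI[of _ "{z \<in> ?U V \<times> ?U V'. h i z \<noteq> 0}"] conjI) auto
  qed
  have "closedin (zar (swf_prod ?X ?X)) {(x, x) | x. x \<in> pts ?X}"
    unfolding closedin_def pts_prod[OF X X] pX using sep by auto
  then show ?thesis
    unfolding variety_def using X cover by blast
qed

section \<open>The two patterns\<close>

lemma atLeastAtMost_1_3: "{1..3::nat} = {1, 2, 3}"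
  by auto

lemma contains_23_1_iff:
  "contains_split_pattern n w r [2, 3] [1] \<longleftrightarrow>
     (\<exists>a b c. 1 \<le> a \<and> a < b \<and> b \<le> r \<and> r < c \<and> c \<le> n \<and> w c < w a \<and> w a < w b)"
proof -
  have l: "length [2::nat, 3] = 2" "length [1::nat] = 1" "(2::nat) + 1 = 3"
    by simp_all
  have s: "(\<forall>a\<in>{1..3}. \<forall>b\<in>{1..3}. w (\<iota> a) < w (\<iota> b) \<longleftrightarrow> ([2, 3] @ [1] :: nat list) ! (a - 1) < ([2, 3] @ [1]) ! (b - 1))
      \<longleftrightarrow> w (\<iota> 3) < w (\<iota> 1) \<and> w (\<iota> 1) < w (\<iota> 2)" for \<iota> :: "nat \<Rightarrow> nat"
    unfolding atLeastAtMost_1_3 by auto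
  have m: "strict_mono_on {1..3} \<iota> \<longleftrightarrow> \<iota> 1 < \<iota> 2 \<and> \<iota> 2 < \<iota> 3" for \<iota> :: "nat \<Rightarrow> nat"
    unfolding atLeastAtMost_1_3 strict_mono_on_def by auto
  have i: "\<iota> ` {1..3} \<subseteq> {1..n} \<longleftrightarrow> \<iota> 1 \<in> {1..n} \<and> \<iota> 2 \<in> {1..n} \<and> \<iota> 3 \<in> {1..n}" for \<iota> :: "nat \<Rightarrow> nat"
    unfolding atLeastAtMost_1_3 by auto
  show ?thesis
    unfolding contains_split_pattern_def Let_def l s m i
  proof
    assume "\<exists>a b c. 1 \<le> a \<and> a < b \<and> b \<le> r \<and> r < c \<and> c \<le> n \<and> w c < w a \<and> w a < w b"
    then obtain a b c where abc: "1 \<le> a" "a < b" "b \<le> r" "r < c" "c \<le> n" "w c < w a" "w a < w b"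
      by blast
    then show "\<exists>\<iota> :: nat \<Rightarrow> nat. (\<iota> 1 \<in> {1..n} \<and> \<iota> 2 \<in> {1..n} \<and> \<iota> 3 \<in> {1..n}) \<and> (\<iota> 1 < \<iota> 2 \<and> \<iota> 2 < \<iota> 3) \<and>
        (w (\<iota> 3) < w (\<iota> 1) \<and> w (\<iota> 1) < w (\<iota> 2)) \<and> \<iota> 2 \<le> r \<and> r < \<iota> 3"
      by (intro exI[of _ "\<lambda>x::nat. if x = 1 then a else if x = 2 then b else c"]) auto
  next
    assume "\<exists>\<iota> :: nat \<Rightarrow> nat. (\<iota> 1 \<in> {1..n} \<and> \<iota> 2 \<in> {1..n} \<and> \<iota> 3 \<in> {1..n}) \<and> (\<iota> 1 < \<iota> 2 \<and> \<iota> 2 < \<iota> 3) \<and>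
        (w (\<iota> 3) < w (\<iota> 1) \<and> w (\<iota> 1) < w (\<iota> 2)) \<and> \<iota> 2 \<le> r \<and> r < \<iota> 3"
    then obtain \<iota> :: "nat \<Rightarrow> nat" where "\<iota> 1 \<in> {1..n}" "\<iota> 2 \<in> {1..n}" "\<iota> 3 \<in> {1..n}" "\<iota> 1 < \<iota> 2" "\<iota> 2 < \<iota> 3"
      "w (\<iota> 3) < w (\<iota> 1)" "w (\<iota> 1) < w (\<iota> 2)" "\<iota> 2 \<le> r" "r < \<iota> 3"
      by (elim exE conjE)
    then show "\<exists>a b c. 1 \<le> a \<and> a < b \<and> b \<le> r \<and> r < c \<and> c \<le> n \<and> w c < w a \<and> w a < w b"
      by (intro exI[of _ "\<iota> 1"] exI[of _ "\<iota> 2"] exI[of _ "\<iota> 3"]) auto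
  qed
qed

lemma contains_3_12_iff:
  "contains_split_pattern n w r [3] [1, 2] \<longleftrightarrow>
     (\<exists>a b c. 1 \<le> a \<and> a \<le> r \<and> r < b \<and> b < c \<and> c \<le> n \<and> w b < w c \<and> w c < w a)"
proof -
  have l: "length [3::nat] = 1" "length [1::nat, 2] = 2" "(1::nat) + 2 = 3" "(1::nat) + 1 = 2"
    by simp_all
  have s: "(\<forall>a\<in>{1..3}. \<forall>b\<in>{1..3}. w (\<iota> a) < w (\<iota> b) \<longleftrightarrow> ([3] @ [1, 2] :: nat list) ! (a - 1) < ([3] @ [1, 2]) ! (b - 1))
      \<longleftrightarrow> w (\<iota> 2) < w (\<iota> 3) \<and> w (\<iota> 3) < w (\<iota> 1)" for \<iota> :: "nat \<Rightarrow> nat"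
    unfolding atLeastAtMost_1_3 by auto
  have m: "strict_mono_on {1..3} \<iota> \<longleftrightarrow> \<iota> 1 < \<iota> 2 \<and> \<iota> 2 < \<iota> 3" for \<iota> :: "nat \<Rightarrow> nat"
    unfolding atLeastAtMost_1_3 strict_mono_on_def by auto
  have i: "\<iota> ` {1..3} \<subseteq> {1..n} \<longleftrightarrow> \<iota> 1 \<in> {1..n} \<and> \<iota> 2 \<in> {1..n} \<and> \<iota> 3 \<in> {1..n}" for \<iota> :: "nat \<Rightarrow> nat"
    unfolding atLeastAtMost_1_3 by auto
  show ?thesis
    unfolding contains_split_pattern_def Let_def l s m i
  proof
    assume "\<exists>a b c. 1 \<le> a \<and> a \<le> r \<and> r < b \<and> b < c \<and> c \<le> n \<and> w b < w c \<and> w c < w a"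
    then obtain a b c where abc: "1 \<le> a" "a \<le> r" "r < b" "b < c" "c \<le> n" "w b < w c" "w c < w a"
      by blast
    then show "\<exists>\<iota> :: nat \<Rightarrow> nat. (\<iota> 1 \<in> {1..n} \<and> \<iota> 2 \<in> {1..n} \<and> \<iota> 3 \<in> {1..n}) \<and> (\<iota> 1 < \<iota> 2 \<and> \<iota> 2 < \<iota> 3) \<and>
        (w (\<iota> 2) < w (\<iota> 3) \<and> w (\<iota> 3) < w (\<iota> 1)) \<and> \<iota> 1 \<le> r \<and> r < \<iota> 2"
      by (intro exI[of _ "\<lambda>x::nat. if x = 1 then a else if x = 2 then b else c"]) auto
  next
    assume "\<exists>\<iota> :: nat \<Rightarrow> nat. (\<iota> 1 \<in> {1..n} \<and> \<iota> 2 \<in> {1..n} \<and> \<iota> 3 \<in> {1..n}) \<and> (\<iota> 1 < \<iota> 2 \<and> \<iota> 2 < \<iota> 3) \<and>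
        (w (\<iota> 2) < w (\<iota> 3) \<and> w (\<iota> 3) < w (\<iota> 1)) \<and> \<iota> 1 \<le> r \<and> r < \<iota> 2"
    then obtain \<iota> :: "nat \<Rightarrow> nat" where "\<iota> 1 \<in> {1..n}" "\<iota> 2 \<in> {1..n}" "\<iota> 3 \<in> {1..n}" "\<iota> 1 < \<iota> 2" "\<iota> 2 < \<iota> 3"
      "w (\<iota> 2) < w (\<iota> 3)" "w (\<iota> 3) < w (\<iota> 1)" "\<iota> 1 \<le> r" "r < \<iota> 2"
      by (elim exE conjE)
    then show "\<exists>a b c. 1 \<le> a \<and> a \<le> r \<and> r < b \<and> b < c \<and> c \<le> n \<and> w b < w c \<and> w c < w a"
      by (intro exI[of _ "\<iota> 1"] exI[of _ "\<iota> 2"] exI[of _ "\<iota> 3"]) auto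
  qed
qed

section \<open>The projection of a Schubert variety\<close>

lemma rank_number_le: "rank_number w i j \<le> j"
  unfolding rank_number_def by (rule order_trans[OF card_mono[of "{1..j}"]]) auto

lemma rank_number_mono: "i \<le> i' \<Longrightarrow> rank_number w i j \<le> rank_number w i' j"
  unfolding rank_number_def by (rule card_mono) auto

locale schubert_projection =
  fixes n r :: nat and w :: "nat \<Rightarrow> nat" and e :: "nat \<Rightarrow> nat \<Rightarrow> 'k::field"
  assumes r: "0 < r" "r < n" and w: "w permutes {1..n}" and e: "is_basis n e"
begin

abbreviation R :: "nat \<Rightarrow> nat \<Rightarrow> nat" where
  "R \<equiv> rank_number w"

definition E :: "nat \<Rightarrow> (nat \<Rightarrow> 'k) set" where
  "E i = fv.span (e ` {1..i})"

definition S :: "(nat \<Rightarrow> (nat \<Rightarrow> 'k) set) set" where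
  "S = schubert n e w"

lemma n: "0 < n"
  using r by simp

lemma r_in: "r \<in> {1..<n}"
  using r by simp

lemma w_in: "k \<in> {1..n} \<Longrightarrow> w k \<in> {1..n}"
  using permutes_in_image[OF w] by blast

lemma w_inj: "w a = w b \<longleftrightarrow> a = b"
  using permutes_inj[OF w] by (auto simp: inj_def)

lemma w_surj: "v \<in> {1..n} \<Longrightarrow> \<exists>k\<in>{1..n}. w k = v"
  using permutes_image[OF w] by (metis imageE)

lemma S_iff: "V \<in> S \<longleftrightarrow> V \<in> flags n \<and> (\<forall>i\<in>{1..n}. \<forall>j\<in>{1..<n}. R i j \<le> fv.dim (E i \<inter> V j))"
  by (simp add: S_def schubert_def E_def)

lemma subspace_E: "fv.subspace (E i)"
  by (simp add: E_def)

lemma e_basis: "inj_on e {1..n}" "fv.independent (e ` {1..n})" "fv.span (e ` {1..n}) = Kn n"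
  using e by (auto simp: is_basis_def)

lemma E_in_Kn:
  assumes "i \<le> n"
  shows "E i \<subseteq> Kn n"
proof -
  have "e ` {1..i} \<subseteq> e ` {1..n}"
    using assms by auto
  then show ?thesis
    unfolding E_def e_basis(3)[symmetric] by (rule fv.span_mono)
qed

lemma E_mono: "i \<le> j \<Longrightarrow> E i \<subseteq> E j"
  unfolding E_def by (intro fv.span_mono image_mono) auto

lemma dim_E:
  assumes "i \<le> n"
  shows "fv.dim (E i) = i"
proof -
  have "fv.dim (E i) = card {1..i}"
    unfolding E_def by (rule fv.dim_span_image[OF e_basis(1,2)]) (use assms in auto)
  then show ?thesis by simp
qed

lemma R_le_row: "i \<le> n \<Longrightarrow> j \<le> n \<Longrightarrow> R i j \<le> i"
proof -
  assume ij: "i \<le> n" "j \<le> n"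
  have "w ` {k \<in> {1..j}. w k \<le> i} \<subseteq> {1..i}"
    using w_in ij by fastforce
  then have "card (w ` {k \<in> {1..j}. w k \<le> i}) \<le> card {1..i}"
    by (intro card_mono) auto
  moreover have "card (w ` {k \<in> {1..j}. w k \<le> i}) = card {k \<in> {1..j}. w k \<le> i}"
    by (rule card_image) (simp add: inj_on_def w_inj)
  ultimately show ?thesis
    by (simp add: rank_number_def)
qed

text \<open>
  The smallest value of \<open>w\<close> to the right of the division, and the largest one to the left. Every
  space \<open>V\<close> in the image of the Schubert variety contains \<open>E i\<close> for \<open>i < lo\<close>, and it is contained
  in \<open>E i\<close> for \<open>i \<ge> hi\<close>.
\<close>

definition lo :: nat where
  "lo = Min (w ` {r<..n})"

definition hi :: nat where
  "hi = Max (w ` {1..r})"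

lemma lo: "lo \<in> w ` {r<..n}" "\<And>k. k \<in> {r<..n} \<Longrightarrow> lo \<le> w k"
  using r unfolding lo_def by (auto intro!: Min_in)

lemma hi: "hi \<in> w ` {1..r}" "\<And>k. k \<in> {1..r} \<Longrightarrow> w k \<le> hi"
  using r unfolding hi_def by (auto intro!: Max_in)

lemma lo_in: "lo \<in> {1..n}"
  using lo(1) w_in r by auto

lemma hi_in: "hi \<in> {1..n}"
  using hi(1) w_in r by auto

lemma R_below_lo:
  assumes "i < lo"
  shows "R i r = i"
proof -
  have "w ` {k \<in> {1..r}. w k \<le> i} = {1..i}"
  proof
    show "w ` {k \<in> {1..r}. w k \<le> i} \<subseteq> {1..i}"
      using w_in r by fastforce
    show "{1..i} \<subseteq> w ` {k \<in> {1..r}. w k \<le> i}"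
    proof
      fix v assume v: "v \<in> {1..i}"
      then have "v \<in> {1..n}"
        using assms lo_in by auto
      then obtain k where k: "k \<in> {1..n}" "w k = v"
        using w_surj by blast
      have "k \<le> r"
        using lo(2)[of k] k v assms by force
      then show "v \<in> w ` {k \<in> {1..r}. w k \<le> i}"
        using k v by auto
    qed
  qed
  then have "card (w ` {k \<in> {1..r}. w k \<le> i}) = i"
    by simp
  moreover have "card (w ` {k \<in> {1..r}. w k \<le> i}) = card {k \<in> {1..r}. w k \<le> i}"
    by (rule card_image) (simp add: inj_on_def w_inj)
  ultimately show ?thesis
    by (simp add: rank_number_def)
qed

lemma R_above_hi:
  assumes "hi \<le> i"
  shows "R i r = r"
proof -
  have "{k \<in> {1..r}. w k \<le> i} = {1..r}"
    using hi(2) assms by fastforce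
  then show ?thesis
    by (simp add: rank_number_def)
qed

definition in_image_cond :: "(nat \<Rightarrow> 'k) set \<Rightarrow> bool" where
  "in_image_cond y \<longleftrightarrow> fv.subspace y \<and> y \<subseteq> Kn n \<and> fv.dim y = r \<and> (\<forall>i\<in>{1..n}. R i r \<le> fv.dim (E i \<inter> y))"

lemma in_image_cond_flag: "V \<in> S \<Longrightarrow> in_image_cond (V r)"
  using r_in flags_nth[of V n r] by (simp add: in_image_cond_def S_iff)

lemma E_sub_if_below_lo:
  assumes y: "in_image_cond y" and i: "i < lo"
  shows "E i \<subseteq> y"
proof (cases "i = 0")
  case True
  then show ?thesis
    using y fv.subspace_0 by (auto simp: E_def in_image_cond_def)
next
  case False
  then have i': "i \<in> {1..n}"
    using i lo_in by auto
  have "E i \<inter> y = E i"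
  proof (rule fv.subspace_eq_if_dim_ge[OF finite_dim_in_Kn[OF E_in_Kn]])
    show "fv.dim (E i) \<le> fv.dim (E i \<inter> y)"
    proof -
      have "R i r \<le> fv.dim (E i \<inter> y)"
        using y i' unfolding in_image_cond_def by blast
      then show ?thesis
        using i' R_below_lo[OF i] dim_E[of i] by simp
    qed
  qed (use y i' in \<open>auto simp: in_image_cond_def intro: fv.subspace_inter subspace_E\<close>)
  then show ?thesis by blast
qed

lemma sub_E_if_above_hi:
  assumes y: "in_image_cond y" and i: "hi \<le> i" "i \<le> n"
  shows "y \<subseteq> E i"
proof -
  have i': "i \<in> {1..n}"
    using i hi_in by auto
  have "E i \<inter> y = y"
  proof (rule fv.subspace_eq_if_dim_ge[OF finite_dim_in_Kn[of y]])
    show "fv.dim y \<le> fv.dim (E i \<inter> y)"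
    proof -
      have "R i r \<le> fv.dim (E i \<inter> y)" "fv.dim y = r"
        using y i' unfolding in_image_cond_def by blast+
      then show ?thesis
        using R_above_hi[OF i(1)] by simp
    qed
  qed (use y i' in \<open>auto simp: in_image_cond_def intro: fv.subspace_inter subspace_E\<close>)
  then show ?thesis by blast
qed

text \<open>
  Avoidance of \<open>23|1\<close> says that the values above \<open>lo\<close> decrease on the left, and avoidance of
  \<open>3|12\<close> that the values below \<open>hi\<close> decrease on the right. If a value between \<open>lo\<close> and \<open>i\<close> occurs
  among the first \<open>j\<close> positions, the ones from \<open>j + 1\<close> to \<open>r\<close> hence carry values at most \<open>i\<close>;
  otherwise row \<open>i\<close> has no more entries than row \<open>lo - 1\<close>.
\<close>

lemma R_left:
  assumes av: "avoids_split_pattern n w r [2, 3] [1]" and j: "j < r" and i: "lo \<le> i"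
  shows "R i j \<le> R (lo - 1) j \<or> R i j + (r - j) \<le> R i r"
proof (cases "\<exists>q\<in>{1..j}. lo \<le> w q \<and> w q \<le> i")
  case True
  then obtain q where q: "q \<in> {1..j}" "lo \<le> w q" "w q \<le> i"
    by blast
  obtain c where c: "c \<in> {r<..n}" "lo = w c"
    using lo(1) by blast
  have "w c < w q"
    using q c j w_inj[of q c] by (auto simp: order_le_less)
  have "w q' \<le> i" if q': "q' \<in> {j<..r}" for q'
  proof (rule ccontr)
    assume "\<not> w q' \<le> i"
    then have "contains_split_pattern n w r [2, 3] [1]"
      unfolding contains_23_1_iff using q c q' \<open>w c < w q\<close>
      by (intro exI[of _ q] exI[of _ q'] exI[of _ c]) auto
    then show False
      using av by blast
  qed
  then have "{k \<in> {1..j}. w k \<le> i} \<union> {j<..r} \<subseteq> {k \<in> {1..r}. w k \<le> i}"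
    using j by auto
  then have "card ({k \<in> {1..j}. w k \<le> i} \<union> {j<..r}) \<le> R i r"
    unfolding rank_number_def by (intro card_mono) auto
  moreover have "card ({k \<in> {1..j}. w k \<le> i} \<union> {j<..r}) = R i j + (r - j)"
    unfolding rank_number_def by (subst card_Un_disjoint) auto
  ultimately show ?thesis by simp
next
  case False
  have "{k \<in> {1..j}. w k \<le> i} \<subseteq> {k \<in> {1..j}. w k \<le> lo - 1}"
  proof
    fix k assume k: "k \<in> {k \<in> {1..j}. w k \<le> i}"
    then have "w k < lo"
      using False by (intro not_le_imp_less) auto
    then show "k \<in> {k \<in> {1..j}. w k \<le> lo - 1}"
      using k by auto
  qed
  then have "R i j \<le> R (lo - 1) j"
    unfolding rank_number_def by (intro card_mono) auto
  then show ?thesis ..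
qed

text \<open>
  The mirror image: if a value at most \<open>i\<close> occurs at a position in \<open>{r<..j}\<close>, then none of the values
  in \<open>{i<..hi}\<close> occurs beyond \<open>j\<close>.
\<close>

lemma R_right:
  assumes av: "avoids_split_pattern n w r [3] [1, 2]" and j: "r < j" "j \<le> n" and i: "i < hi"
  shows "R i j \<le> R i r \<or> R i j + (hi - i) \<le> R hi j"
proof (cases "\<exists>q\<in>{r<..j}. w q \<le> i")
  case True
  then obtain q where q: "q \<in> {r<..j}" "w q \<le> i"
    by blast
  obtain a where a: "a \<in> {1..r}" "hi = w a"
    using hi(1) by blast
  have pos: "\<exists>k\<in>{1..j}. w k = v" if v: "v \<in> {i<..hi}" for v
  proof -
    have "v \<in> {1..n}"
      using v hi_in by auto
    then obtain p where p: "p \<in> {1..n}" "w p = v"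
      using w_surj by blast
    have "p \<le> j"
    proof (rule ccontr)
      assume "\<not> p \<le> j"
      then have "q < p" "w q < w p" "w p \<noteq> w a"
        using q a p v j w_inj[of p a] by auto
      then show False
        using av a p q v j unfolding contains_3_12_iff
        by (metis atLeastAtMost_iff greaterThanAtMost_iff le_neq_implies_less)
    qed
    then show ?thesis
      using p by auto
  qed
  have "{1..j} \<inter> w -` {i<..hi} = {k \<in> {1..j}. w k \<in> {i<..hi}}"
    by auto
  have im: "w ` {k \<in> {1..j}. w k \<in> {i<..hi}} = {i<..hi}"
    using pos by force
  have "card {k \<in> {1..j}. w k \<in> {i<..hi}} = card (w ` {k \<in> {1..j}. w k \<in> {i<..hi}})"
    by (rule card_image[symmetric]) (simp add: inj_on_def w_inj)
  then have "card {k \<in> {1..j}. w k \<in> {i<..hi}} = hi - i"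
    unfolding im by simp
  moreover have "{k \<in> {1..j}. w k \<le> i} \<union> {k \<in> {1..j}. w k \<in> {i<..hi}} = {k \<in> {1..j}. w k \<le> hi}"
    using i by auto
  then have "R hi j = R i j + card {k \<in> {1..j}. w k \<in> {i<..hi}}"
    unfolding rank_number_def by (subst card_Un_disjoint[symmetric]) auto
  ultimately show ?thesis by simp
next
  case False
  then have "{k \<in> {1..j}. w k \<le> i} \<subseteq> {k \<in> {1..r}. w k \<le> i}"
    by fastforce
  then have "R i j \<le> R i r"
    unfolding rank_number_def by (intro card_mono) auto
  then show ?thesis ..
qed

text \<open>
  The rows \<open>i\<close> are those in which all spaces \<open>y\<close> in the image contain \<open>E i\<close> or are contained in \<open>E i\<close>.
\<close>

definition essential :: "nat \<Rightarrow> nat \<Rightarrow> bool" where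
  "essential i j \<longleftrightarrow> i < lo \<and> j < r \<or> hi \<le> i \<and> r < j"

text \<open>
  Each rank condition off the column \<open>r\<close> and the essential rows follows from the one in the column
  \<open>r\<close>, from the one in the row \<open>lo - 1\<close> or from the one in the row \<open>hi\<close>, either by monotonicity or
  because shrinking a subspace lowers the dimension of an intersection by at most the codimension.
\<close>

lemma S_iff_essential:
  assumes av: "avoids_split_pattern n w r [2, 3] [1]" "avoids_split_pattern n w r [3] [1, 2]"
    and V: "V \<in> flags n" and y: "in_image_cond (V r)"
  shows "V \<in> S \<longleftrightarrow> (\<forall>i\<in>{1..n}. \<forall>j\<in>{1..<n}. essential i j \<longrightarrow> R i j \<le> fv.dim (E i \<inter> V j))"
proof
  assume ess: "\<forall>i\<in>{1..n}. \<forall>j\<in>{1..<n}. essential i j \<longrightarrow> R i j \<le> fv.dim (E i \<inter> V j)"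
  have fd: "finite_dim fun_scale (A \<inter> V j)" if "j \<in> {1..<n}" for A j
    by (rule finite_dim_in_Kn) (use flags_nth(2)[OF V that] in blast)
  have "R i j \<le> fv.dim (E i \<inter> V j)" if i: "i \<in> {1..n}" and j: "j \<in> {1..<n}" for i j
  proof -
    note Vj = flags_nth[OF V j] and Vr = flags_nth[OF V r_in]
    consider "essential i j" | "j = r" | "j < r" "lo \<le> i" | "r < j" "i < hi"
      by (force simp: essential_def)
    then show ?thesis
    proof cases
      case 1
      then show ?thesis
        using ess i j by blast
    next
      case 2
      then show ?thesis
        using y i by (simp add: in_image_cond_def)
    next
      case 3
      from R_left[OF av(1) 3] show ?thesis
      proof
        assume le: "R i j \<le> R (lo - 1) j"
        also have "R (lo - 1) j \<le> fv.dim (E (lo - 1) \<inter> V j)"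
        proof (cases "lo = 1")
          case True
          have z: "{k \<in> {1..j}. w k \<le> 0} = {}"
            using w_in j by fastforce
          have "R 0 j = 0"
            unfolding rank_number_def z by simp
          then show ?thesis
            using True by simp
        next
          case False
          then show ?thesis
          proof -
            have "lo - 1 \<in> {1..n}" "essential (lo - 1) j"
              using False lo_in 3(1) by (auto simp: essential_def)
            then show ?thesis
              using ess j by blast
          qed
        qed
        also have "\<dots> \<le> fv.dim (E i \<inter> V j)"
        proof -
          have "lo - 1 \<le> i"
            using 3(2) by simp
          then show ?thesis
            using E_mono[of "lo - 1" i] by (intro fv.finite_dim_mono[OF fd[OF j]]) auto
        qed
        finally show ?thesis .
      next
        assume le: "R i j + (r - j) \<le> R i r"
        have "fv.dim (E i \<inter> V r) + fv.dim (V j) \<le> fv.dim (E i \<inter> V j) + fv.dim (V r)"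
          using flags_mono[OF V j r_in] 3(1) Vj(1) Vr(1)
          by (intro fv.dim_Int_subspace[OF finite_dim_in_Kn[OF Vr(2)]] subspace_E) auto
        moreover have "R i r \<le> fv.dim (E i \<inter> V r)"
          using y i by (simp add: in_image_cond_def)
        ultimately show ?thesis
          using le Vj(3) Vr(3) 3(1) by simp
      qed
    next
      case 4
      have jn: "j \<le> n"
        using j by simp
      from R_right[OF av(2) 4(1) jn 4(2)] show ?thesis
      proof
        assume "R i j \<le> R i r"
        also have "R i r \<le> fv.dim (E i \<inter> V r)"
          using y i by (simp add: in_image_cond_def)
        also have "\<dots> \<le> fv.dim (E i \<inter> V j)"
          using flags_mono[OF V r_in j] 4(1) by (intro fv.finite_dim_mono[OF fd[OF j]]) auto
        finally show ?thesis .
      next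
        assume le: "R i j + (hi - i) \<le> R hi j"
        have "fv.dim (V j \<inter> E hi) + fv.dim (E i) \<le> fv.dim (V j \<inter> E i) + fv.dim (E hi)"
          using E_mono[of i hi] 4(2) hi_in Vj(1)
          by (intro fv.dim_Int_subspace[OF finite_dim_in_Kn[OF E_in_Kn]] subspace_E) auto
        moreover have "R hi j \<le> fv.dim (E hi \<inter> V j)"
          using ess hi_in j 4(1) by (simp add: essential_def)
        ultimately show ?thesis
          using le dim_E[of i] dim_E[of hi] i hi_in 4(2) by (simp add: Int_commute)
      qed
    qed
  qed
  then show "V \<in> S"
    using V by (simp add: S_iff)
qed (simp add: S_iff)

end

section \<open>Avoidance implies local triviality\<close>

lemma mv_Kn: "d \<le> n \<Longrightarrow> mv n g ` Kn d = fv.span (col g ` {1..d})"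
  unfolding affine_points_def by (rule span_cols[symmetric])

lemma Kn_mono: "i \<le> j \<Longrightarrow> Kn i \<subseteq> Kn j"
  by (auto simp: affine_points_def)

lemma swf_morphism_id: "swf_morphism X X (\<lambda>x. x)"
proof -
  have "{x \<in> pts X. x \<in> V} = V" if "openin (zar X) V" for V
    using openin_subset[OF that] by auto
  then show ?thesis
    by (auto simp: swf_morphism_def continuous_map_def comp_def)
qed

text \<open>If the upper \<open>d \<times> d\<close> block of \<open>u\<close> is the identity, the first \<open>d\<close> coordinates of a vector in
  the span of the first \<open>d\<close> columns are its coefficients.\<close>

lemma span_identity_block_0:
  assumes u: "\<And>i l. i \<in> {1..d} \<Longrightarrow> l \<in> {1..d} \<Longrightarrow> u (i, l) = (if i = l then 1 else (0::'k::field))"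
    and v: "v \<in> fv.span (col u ` {1..d})" and z: "\<And>i. i \<in> {1..d} \<Longrightarrow> v i = 0"
  shows "v = 0"
proof -
  obtain c where c: "v = (\<Sum>l\<in>{1..d}. fun_scale (c l) (col u l))"
    using v unfolding fv.span_image_eq_range[OF finite_atLeastAtMost] by blast
  have "c i = 0" if i: "i \<in> {1..d}" for i
  proof -
    have "v i = (\<Sum>l\<in>{1..d}. if i = l then c i else 0)"
      unfolding c sum_fun_apply
      by (rule sum.cong) (use u[OF i] in \<open>auto simp: fun_scale_def Defs.col_def\<close>)
    then show ?thesis
      using z[OF i] i by simp
  qed
  then show ?thesis
    unfolding c by (intro sum.neutral) (simp add: fun_scale_def zero_fun_def)
qed

sublocale schubert_projection \<subseteq> gr: flag_quotient n "\<lambda>j. if j \<le> r then r else n"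
  "\<lambda>g :: nat \<times> nat \<Rightarrow> 'k. fv.span (col g ` {1..r})"
  by (rule flag_quotient_grassmannian[OF r])

context schubert_projection
begin

abbreviation Fl :: "(nat \<Rightarrow> (nat \<Rightarrow> 'k) set, 'k) swf" where
  "Fl \<equiv> flag_variety n"

abbreviation Gr :: "((nat \<Rightarrow> 'k) set, 'k) swf" where
  "Gr \<equiv> grassmannian_variety r n"

lemma swf_Fl: "space_with_functions Fl"
  by (rule space_with_functions_flag_variety)

lemma swf_Gr: "space_with_functions Gr"
  unfolding grassmannian_variety_def by (rule gr.space_with_functions_Q)

lemma pts_Fl: "pts Fl = flags n"
  by (rule pts_flags[OF n])

lemma flag_proj_column_flag: "flag_proj r (column_flag n g) = fv.span (col g ` {1..r})"
  by (simp add: flag_proj_def column_flag_nth[OF r_in])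

lemma swf_morphism_flag_proj: "swf_morphism Fl Gr (flag_proj r)"
proof -
  let ?q = "column_flag n :: (nat \<times> nat \<Rightarrow> 'k) \<Rightarrow> _"
  have "swf_morphism (swf_sub (GL n) {g \<in> pts (GL n). ?q g \<in> pts Fl}) Gr (\<lambda>g. flag_proj r (?q g))"
    unfolding flag_proj_column_flag grassmannian_variety_def
    by (rule swf_morphism_compose[OF swf_morphism_inclusion swf_morphism_quotient])
  then have "swf_morphism (swf_sub Fl (pts Fl)) Gr (flag_proj r)"
    using swf_morphism_from_quotient[OF space_with_functions_GL openin_topspace[of "zar (swf_quotient (GL n) ?q)"]]
    unfolding flag_variety_def by blast
  moreover have "swf_morphism Fl (swf_sub Fl (pts Fl)) (\<lambda>V. V)"
    by (rule swf_morphism_into_sub[OF swf_Fl swf_morphism_id])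
  ultimately show ?thesis
    using swf_morphism_compose[of Fl _ "\<lambda>V. V" Gr "flag_proj r"] by blast
qed

text \<open>
  The model fiber. It lives on the coordinate flag instead of \<open>E\<close>, because the position of \<open>E i\<close>
  relative to a space in the image is constant in the essential rows, so that a change of basis
  takes both to coordinate subspaces.
\<close>

definition F0 :: "(nat \<Rightarrow> (nat \<Rightarrow> 'k) set) set" where
  "F0 = {V \<in> flags n. V r = Kn r \<and>
     (\<forall>i\<in>{1..n}. \<forall>j\<in>{1..<n}. essential i j \<longrightarrow> R i j \<le> fv.dim (Kn i \<inter> V j))}"

lemma closedin_F0: "closedin (zar Fl) F0"
proof -
  define B :: "nat \<Rightarrow> nat \<Rightarrow> (nat \<Rightarrow> (nat \<Rightarrow> 'k) set) set"
    where "B i j = {V \<in> flags n. (if essential i j then R i j else 0) \<le> fv.dim (Kn i \<inter> V j)}" for i j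
  have base: "V r = Kn r \<longleftrightarrow> r \<le> fv.dim (Kn r \<inter> V r)" if V: "V \<in> flags n" for V
  proof
    note Vr = flags_nth[OF V r_in]
    assume le: "r \<le> fv.dim (Kn r \<inter> V r)"
    have "Kn r \<inter> V r = V r"
      using le Vr by (intro fv.subspace_eq_if_dim_ge[OF finite_dim_in_Kn[OF Vr(2)]] fv.subspace_inter subspace_Kn) auto
    moreover have "Kn r \<inter> V r = Kn r"
      using le Vr by (intro fv.subspace_eq_if_dim_ge[OF finite_dim_Kn] fv.subspace_inter subspace_Kn) (auto simp: dim_Kn)
    ultimately show "V r = Kn r" by simp
  qed (simp add: dim_Kn)
  have "V \<in> F0 \<longleftrightarrow> V \<in> {V \<in> flags n. r \<le> fv.dim (Kn r \<inter> V r)} \<and> (\<forall>i\<in>{1..n}. \<forall>j\<in>{1..<n}. V \<in> B i j)" for V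
    unfolding F0_def B_def using base[of V] by (auto split: if_splits)
  then have e: "F0 = {V \<in> flags n. r \<le> fv.dim (Kn r \<inter> V r)} \<inter> (\<Inter>i\<in>{1..n}. \<Inter>j\<in>{1..<n}. B i j)"
    by blast
  have B: "closedin (zar Fl) (B i j)" if "i \<in> {1..n}" "j \<in> {1..<n}" for i j
    unfolding B_def using that by (intro closedin_flag_condition subspace_Kn Kn_mono) auto
  show ?thesis
    unfolding e
  proof (intro closedin_Int closedin_Inter)
    show "closedin (zar Fl) {V \<in> flags n. r \<le> fv.dim (Kn r \<inter> V r)}"
      using r by (intro closedin_flag_condition subspace_Kn Kn_mono r_in) auto
    fix C assume "C \<in> (\<lambda>i. \<Inter>j\<in>{1..<n}. B i j) ` {1..n}"
    then obtain i where i: "i \<in> {1..n}" "C = (\<Inter>j\<in>{1..<n}. B i j)"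
      by blast
    show "closedin (zar Fl) C"
      unfolding i(2) by (rule closedin_Inter) (use B[OF i(1)] r_in in auto)
  qed (use n in auto)
qed

text \<open>
  Such a matrix takes the model fiber to the fiber over \<open>y\<close>. The rows from \<open>lo\<close> to \<open>hi - 1\<close> are left
  free: there the position of \<open>E i\<close> relative to \<open>y\<close> depends on \<open>y\<close>.
\<close>

definition adapted :: "(nat \<times> nat \<Rightarrow> 'k) \<Rightarrow> (nat \<Rightarrow> 'k) set \<Rightarrow> bool" where
  "adapted h y \<longleftrightarrow> h \<in> GLs n \<and> mv n h ` Kn r = y \<and>
     (\<forall>i\<in>{1..n}. i < lo \<or> hi \<le> i \<longrightarrow> mv n h ` Kn i = E i)"

lemma act_in_S_iff:
  assumes av: "avoids_split_pattern n w r [2, 3] [1]" "avoids_split_pattern n w r [3] [1, 2]"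
    and h: "adapted h y" and y: "in_image_cond y" and V: "V \<in> flags n"
  shows "act n h V \<in> S \<and> act n h V r = y \<longleftrightarrow> V \<in> F0"
proof -
  have hG: "h \<in> GLs n" and hr: "mv n h ` Kn r = y"
    using h by (auto simp: adapted_def)
  have aV: "act n h V \<in> flags n"
    by (rule act_in_flags[OF n hG V])
  have "act n h V r = y \<longleftrightarrow> V r = Kn r"
    unfolding act_nth[OF r_in] hr[symmetric]
    using inj_on_image_eq_iff[OF inj_on_mv[OF hG] flags_nth(2)[OF V r_in] Kn_mono] r by simp
  moreover have "act n h V \<in> S \<longleftrightarrow>
      (\<forall>i\<in>{1..n}. \<forall>j\<in>{1..<n}. essential i j \<longrightarrow> R i j \<le> fv.dim (Kn i \<inter> V j))" if "act n h V r = y"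
  proof -
    have "fv.dim (E i \<inter> act n h V j) = fv.dim (Kn i \<inter> V j)"
      if ij: "i \<in> {1..n}" "j \<in> {1..<n}" "essential i j" for i j
    proof -
      have "E i = mv n h ` Kn i"
      proof -
        have "i < lo \<or> hi \<le> i"
          using ij(3) by (auto simp: essential_def)
        then show ?thesis
          using h ij(1) unfolding adapted_def by blast
      qed
      then show ?thesis
        using dim_Int_act[OF hG V ij(2) subspace_Kn Kn_mono, of i] ij(1) by simp
    qed
    then show ?thesis
      using S_iff_essential[OF av aV] y that by auto
  qed
  ultimately show ?thesis
    using V by (auto simp: F0_def)
qed

text \<open>
  The spaces \<open>E i\<close> for \<open>i < lo\<close>, then \<open>y\<close>, then the spaces \<open>E i\<close> for \<open>i \<ge> hi\<close> form a partial flag.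
\<close>

lemma adapted_exists:
  assumes y: "in_image_cond y"
  obtains a where "adapted a y"
proof -
  let ?D = "{i \<in> {1..n}. i < lo \<or> hi \<le> i} \<union> {r}"
  let ?W = "\<lambda>i. if i = r then y else E i"
  have yK: "fv.subspace y" "y \<subseteq> Kn n" "fv.dim y = r"
    using y by (auto simp: in_image_cond_def)
  have Er: "E r = y" if "r < lo \<or> hi \<le> r"
    using that
  proof
    assume "r < lo"
    from E_sub_if_below_lo[OF y this] show ?thesis
      using yK dim_E[of r] r by (intro fv.subspace_eq_if_dim_ge[OF finite_dim_in_Kn] subspace_E) auto
  next
    assume "hi \<le> r"
    from sub_E_if_above_hi[OF y this] show ?thesis
      using yK dim_E[of r] r by (intro fv.subspace_eq_if_dim_ge[OF finite_dim_in_Kn[OF E_in_Kn], symmetric]) auto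
  qed
  obtain a where a: "a \<in> GLs n" "\<And>i. i \<in> ?D \<Longrightarrow> fv.span (col a ` {1..i}) = ?W i"
  proof (rule adapted_basis[of ?D n ?W])
    show "?D \<subseteq> {1..n}" "n \<in> ?D"
      using r hi_in by auto
    fix i assume i: "i \<in> ?D"
    then show "fv.subspace (?W i) \<and> ?W i \<subseteq> Kn n \<and> fv.dim (?W i) = i"
      using yK subspace_E E_in_Kn[of i] dim_E[of i] by auto
    fix j assume j: "j \<in> ?D" "i \<le> j"
    have d: "fv.dim A \<le> fv.dim B" if "A \<subseteq> B" "B \<subseteq> Kn n" for A B :: "(nat \<Rightarrow> 'k) set"
      using fv.finite_dim_mono[OF finite_dim_in_Kn] that by blast
    show "?W i \<subseteq> ?W j"
    proof (cases "i = j \<or> i \<noteq> r \<and> j \<noteq> r")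
      case True
      then show ?thesis
        using E_mono[OF j(2)] by auto
    next
      case False
      then have ij: "i < j" "i = r \<or> j = r"
        using j(2) by auto
      show ?thesis
        using ij(2)
      proof
        assume ir: "i = r"
        then have jD: "j \<le> n" "j < lo \<or> hi \<le> j"
          using j(1) ij(1) by auto
        have "\<not> j < lo"
        proof
          assume jl: "j < lo"
          have "j \<le> r"
            using d[OF E_sub_if_below_lo[OF y jl] yK(2)] dim_E[OF jD(1)] yK(3) by simp
          then show False
            using ij ir by simp
        qed
        then have "y \<subseteq> E j"
          using sub_E_if_above_hi[OF y _ jD(1)] jD(2) by blast
        then show ?thesis
          using ij ir by simp
      next
        assume jr: "j = r"
        then have iD: "i \<le> n" "i < lo \<or> hi \<le> i"
          using i ij(1) by auto
        have "\<not> hi \<le> i"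
        proof
          assume ih: "hi \<le> i"
          have "r \<le> i"
            using d[OF sub_E_if_above_hi[OF y ih iD(1)] E_in_Kn[OF iD(1)]] dim_E[OF iD(1)] yK(3) by simp
          then show False
            using ij jr by simp
        qed
        then have "E i \<subseteq> y"
          using E_sub_if_below_lo[OF y] iD(2) by blast
        then show ?thesis
          using ij jr by simp
      qed
    qed
  next
    fix g assume "g \<in> GLs n" "\<And>i. i \<in> ?D \<Longrightarrow> fv.span (col g ` {1..i}) = ?W i"
    then show thesis
      by (rule that)
  qed
  have "adapted a y"
    unfolding adapted_def
  proof (intro conjI ballI impI a(1))
    show "mv n a ` Kn r = y"
      using a(2)[of r] mv_Kn[of r n a] r by simp
    fix i assume i: "i \<in> {1..n}" "i < lo \<or> hi \<le> i"
    then have "mv n a ` Kn i = ?W i"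
      using a(2)[of i] mv_Kn[of i n a] by simp
    then show "mv n a ` Kn i = E i"
      by (cases "i = r") (use Er i(2) in simp_all)
  qed
  then show ?thesis
    by (rule that)
qed

text \<open>
  The section around an adapted basis consists of adapted bases: since \<open>E i \<subseteq> y'\<close> for \<open>i < lo\<close>,
  the reduced vectors with index at most \<open>i\<close> are the standard ones, and \<open>y' \<subseteq> E i\<close> for
  \<open>i \<ge> hi\<close> keeps all reduced vectors in the coordinate space.
\<close>

lemma adapted_local_section:
  assumes a: "adapted a y" and y': "y' \<in> gr.chart a" "in_image_cond y'"
  shows "adapted (gr.local_section a y') y'"
proof -
  let ?g = "gr.local_section a y'"
  let ?u = "mm n (minv n a) ?g"
  have aG: "a \<in> GLs n" and aE: "\<And>i. i \<in> {1..n} \<Longrightarrow> i < lo \<or> hi \<le> i \<Longrightarrow> mv n a ` Kn i = E i"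
    using a unfolding adapted_def by blast+
  have gG: "?g \<in> GLs n"
    by (rule gr.local_section_in_GLs[OF aG y'(1)])
  have uG: "?u \<in> GLs n"
    by (rule mm_in_GLs[OF minv_in_GLs[OF aG] gG])
  have gu: "mv n ?g v = mv n a (mv n ?u v)" for v
    using mm_minv_cancel(1)[OF aG GLs_mats[OF gG]] mv_mm[of n a ?u v] by simp
  have gr: "mv n ?g ` Kn r = y'"
    using mv_Kn[of r n ?g] r gr.q_local_section[OF aG y'(1)] by simp
  have ur: "fv.span (col ?u ` {1..r}) = mv n (minv n a) ` y'"
    unfolding span_cols_mm gr.q_local_section[OF aG y'(1)] ..
  have uc: "?u (i, j) = (if i = j then 1 else 0)" if "j \<in> {1..n}" "i \<in> {1..if j \<le> r then r else n}" for i j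
    by (rule gr.local_section_coords[OF aG y'(1) that])
  have minvE: "mv n (minv n a) ` E i = Kn i" if i: "i \<in> {1..n}" "i < lo \<or> hi \<le> i" for i
  proof -
    have "mv n (minv n a) ` mv n a ` Kn i = (\<lambda>v. v) ` Kn i"
      unfolding image_image
      by (rule image_cong[OF refl]) (use mv_minv(2)[OF aG] Kn_mono[of i n] i(1) in auto)
    then show ?thesis
      using aE[OF i] by simp
  qed
  have uK: "fv.span (col ?u ` {1..i}) = Kn i" if i: "i \<in> {1..n}" "i < lo \<or> hi \<le> i" for i
    using i(2)
  proof
    assume il: "i < lo"
    have ir: "i \<le> r"
    proof -
      have "fv.dim (E i) \<le> fv.dim y'"
        using fv.finite_dim_mono[OF finite_dim_in_Kn[of y' n] E_sub_if_below_lo[OF y'(2) il]] y'(2)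
        by (simp add: in_image_cond_def)
      then show ?thesis
        using dim_E[of i] i(1) y'(2) by (simp add: in_image_cond_def)
    qed
    have sub: "Kn i \<subseteq> fv.span (col ?u ` {1..r})"
      unfolding ur minvE[OF i, symmetric] by (rule image_mono[OF E_sub_if_below_lo[OF y'(2) il]])
    have cs: "col ?u j = std j" if j: "j \<in> {1..i}" for j
    proof -
      have "std j - col ?u j = 0"
      proof (rule span_identity_block_0[of r ?u])
        fix k l assume "k \<in> {1..r}" "l \<in> {1..r}"
        then show "?u (k, l) = (if k = l then 1 else 0)"
          using r by (intro uc) auto
      next
        have "std j \<in> fv.span (col ?u ` {1..r})"
          using sub std_in_Kn[OF j] by blast
        moreover have "col ?u j \<in> fv.span (col ?u ` {1..r})"
          by (rule fv.span_base) (use j ir in auto)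
        ultimately show "std j - col ?u j \<in> fv.span (col ?u ` {1..r})"
          by (rule fv.span_diff)
      next
        fix k assume "k \<in> {1..r}"
        then have "?u (k, j) = (if k = j then 1 else 0)"
          using j ir r by (intro uc) auto
        then show "(std j - col ?u j) k = 0"
          by (simp add: std_def Defs.col_def)
      qed
      then show ?thesis by simp
    qed
    have "col ?u ` {1..i} = std ` {1..i}"
      by (rule image_cong[OF refl]) (rule cs)
    then show ?thesis
      using span_std[of i i] by simp
  next
    assume ih: "hi \<le> i"
    have in': "i \<le> n"
      using i(1) by simp
    have "mv n (minv n a) ` y' \<subseteq> Kn i"
      unfolding minvE[OF i, symmetric] by (rule image_mono[OF sub_E_if_above_hi[OF y'(2) ih in']])
    then have sub: "fv.span (col ?u ` {1..r}) \<subseteq> Kn i"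
      unfolding ur .
    have "col ?u j \<in> Kn i" if j: "j \<in> {1..i}" for j
    proof (cases "j \<le> r")
      case True
      then show ?thesis
        using j sub fv.span_base[of "col ?u j" "col ?u ` {1..r}"] by auto
    next
      case False
      have jn: "j \<in> {1..n}"
        using j in' by auto
      have "col ?u j = std j"
      proof (rule Kn_eqI[OF col_in_Kn[OF GLs_mats[OF uG]] std_in_Kn[OF jn]])
        fix k assume "k \<in> {1..n}"
        then show "col ?u j k = std j k"
          using uc[OF jn, of k] False by (simp add: std_def Defs.col_def)
      qed
      then show ?thesis
        using std_in_Kn[OF j] by simp
    qed
    then have "fv.span (col ?u ` {1..i}) \<subseteq> Kn i"
      by (intro fv.span_minimal subspace_Kn) auto
    then show ?thesis
      using dim_span_cols[OF uG in'] by (intro fv.subspace_eq_if_dim_ge[OF finite_dim_Kn] fv.subspace_span) (simp_all add: dim_Kn)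
  qed
  show ?thesis
    unfolding adapted_def
  proof (intro conjI ballI impI gG gr)
    fix i assume i: "i \<in> {1..n}" "i < lo \<or> hi \<le> i"
    have "mv n ?g ` Kn i = mv n a ` mv n ?u ` Kn i"
      by (simp add: image_image gu)
    also have "mv n ?u ` Kn i = Kn i"
      using mv_Kn[of i n ?u] uK[OF i] i(1) by simp
    finally show "mv n ?g ` Kn i = E i"
      using aE[OF i] by simp
  qed
qed

lemma reg_mat_flag_proj:
  assumes U: "openin (zar Gr) U" and \<alpha>: "reg_mat Gr n U \<alpha>"
  shows "reg_mat Fl n {V \<in> pts Fl. flag_proj r V \<in> U} (\<lambda>V. \<alpha> (flag_proj r V))"
  unfolding reg_mat_def
proof (intro ballI)
  fix i j assume "i \<in> {1..n}" "j \<in> {1..n}"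
  then have "(\<lambda>y. \<alpha> y (i, j)) \<in> reg Gr U"
    by (rule reg_matD[OF \<alpha>])
  then have "(\<lambda>y. \<alpha> y (i, j)) \<circ> flag_proj r \<in> reg Fl {V \<in> pts Fl. flag_proj r V \<in> U}"
    using swf_morphism_flag_proj U by (simp add: swf_morphism_def)
  then show "(\<lambda>V. \<alpha> (flag_proj r V) (i, j)) \<in> reg Fl {V \<in> pts Fl. flag_proj r V \<in> U}"
    by (simp add: comp_def)
qed

text \<open>
  Locally on \<open>F\<close> the flags lift to matrices, and the entries of the product of \<open>\<alpha>\<close> with the lift are
  tensor functions.
\<close>

lemma swf_morphism_act_prod:
  fixes Z :: "('z, 'k) swf"
  assumes Z: "space_with_functions Z" and F: "F \<subseteq> flags n"
    and GL: "\<And>z. z \<in> pts Z \<Longrightarrow> \<alpha> z \<in> GLs n" and \<alpha>: "reg_mat Z n (pts Z) \<alpha>"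
  shows "swf_morphism (swf_prod Z (swf_sub Fl F)) Fl (\<lambda>z. act n (\<alpha> (fst z)) (snd z))"
proof -
  let ?F = "swf_sub Fl F"
  let ?P = "swf_prod Z ?F"
  let ?q = "column_flag n :: (nat \<times> nat \<Rightarrow> 'k) \<Rightarrow> _"
  note sF = space_with_functions_sub[OF swf_Fl, of F]
  note P = space_with_functions_prod[OF Z sF]
  have pP: "pts ?P = pts Z \<times> F"
    using F by (auto simp: pts_prod[OF Z sF] pts_Fl)
  show ?thesis
  proof (rule swf_morphism_local[OF P])
    fix x assume x: "x \<in> pts ?P"
    then have xF: "snd x \<in> F"
      unfolding pP by auto
    then have "snd x \<in> ?q ` GLs n"
      unfolding pts_flag_variety[OF n] using F by (rule subsetD[rotated])
    then obtain b where b: "b \<in> GLs n" "?q b = snd x"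
      by (elim imageE) simp
    let ?s = "fl.local_section n b" and ?U = "fl.chart n b \<inter> F"
    let ?W = "pts Z \<times> ?U"
    have oc: "openin (zar Fl) (fl.chart n b)"
      unfolding flag_variety_def by (rule fl.openin_chart[OF b(1)])
    then have oU: "openin (zar ?F) ?U"
      unfolding zar_sub openin_subtopology by blast
    have oW: "openin (zar ?P) ?W"
      by (rule openin_prod_Times[OF Z sF openin_topspace oU])
    have xW: "x \<in> ?W"
      using x xF fl.base_in_cell[OF b(1)] b(2) unfolding pP fl.chart_def by (cases x) force
    have WP: "pts (swf_sub ?P ?W) = ?W"
      using openin_subset[OF oW] by auto
    have "reg_mat Fl n (fl.chart n b) ?s"
      unfolding flag_variety_def by (rule fl.reg_mat_local_section[OF b(1)])
    then have rs: "reg_mat ?F n ?U ?s"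
      by (rule reg_mat_sub[OF oc]) auto
    have "reg_mat ?P n ?W (\<lambda>z. mm n (\<alpha> (fst z)) (?s (snd z)))"
      unfolding reg_mat_def mm_def prod.case
    proof (intro ballI)
      fix i j assume ij: "i \<in> {1..n}" "j \<in> {1..n}"
      have "(\<lambda>z. \<Sum>l\<in>{1..n}. \<alpha> (fst z) (i, l) * ?s (snd z) (l, j)) \<in> tensor_functions Z ?F (pts Z) ?U"
      proof (rule tensor_sum)
        fix l assume l: "l \<in> {1..n}"
        show "(\<lambda>z. \<alpha> (fst z) (i, l) * ?s (snd z) (l, j)) \<in> tensor_functions Z ?F (pts Z) ?U"
          by (rule tensor_simple[OF reg_matD[OF \<alpha> ij(1) l] reg_matD[OF rs l ij(2)]])
      qed (use n in auto)
      then show "(\<lambda>z. \<Sum>l\<in>{1..n}. \<alpha> (fst z) (i, l) * ?s (snd z) (l, j)) \<in> reg ?P ?W"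
        by (rule tensor_in_reg_prod[OF Z sF openin_topspace oU _ order_refl])
    qed
    then have "reg_mat (swf_sub ?P ?W) n (pts (swf_sub ?P ?W)) (\<lambda>z. mm n (\<alpha> (fst z)) (?s (snd z)))"
      unfolding WP by (rule reg_mat_sub[OF oW _ order_refl])
    moreover have "mm n (\<alpha> (fst z)) (?s (snd z)) \<in> GLs n" if "z \<in> pts (swf_sub ?P ?W)" for z
      using that fl.local_section_in_GLs[OF b(1)] GL unfolding WP by (auto intro: mm_in_GLs)
    ultimately have "swf_morphism (swf_sub ?P ?W) (GL n) (\<lambda>z. mm n (\<alpha> (fst z)) (?s (snd z)))"
      by (intro swf_morphism_to_GL[OF space_with_functions_sub[OF P]])
    from swf_morphism_compose[OF this swf_morphism_quotient, of ?q]
    have "swf_morphism (swf_sub ?P ?W) Fl (\<lambda>z. ?q (mm n (\<alpha> (fst z)) (?s (snd z))))"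
      unfolding flag_variety_def .
    then have "swf_morphism (swf_sub ?P ?W) Fl (\<lambda>z. act n (\<alpha> (fst z)) (snd z))"
    proof (rule swf_morphism_cong[OF space_with_functions_sub[OF P]])
      fix z assume "z \<in> pts (swf_sub ?P ?W)"
      then have "snd z \<in> fl.chart n b"
        unfolding WP by auto
      then show "act n (\<alpha> (fst z)) (snd z) = ?q (mm n (\<alpha> (fst z)) (?s (snd z)))"
        using fl.q_local_section[OF b(1)] by (simp add: column_flag_mm)
    qed
    then show "\<exists>W. openin (zar ?P) W \<and> x \<in> W \<and> swf_morphism (swf_sub ?P W) Fl (\<lambda>z. act n (\<alpha> (fst z)) (snd z))"
      using oW xW by blast
  qed
qed

text \<open>
  Let \<open>\<alpha>\<close> be the local section through an adapted matrix. Its values are adapted, so that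
  \<open>(y, V) \<mapsto> \<alpha> y V\<close> is a trivialization, with inverse \<open>V \<mapsto> (V\<^sub>r, (\<alpha> V\<^sub>r)\<^sup>-\<^sup>1 V)\<close>.
\<close>

theorem locally_trivial_if_avoids:
  assumes av: "avoids_split_pattern n w r [2, 3] [1]" "avoids_split_pattern n w r [3] [1, 2]"
  shows "zariski_locally_trivial (swf_sub Fl S) (swf_sub Gr (flag_proj r ` S)) (flag_proj r)"
proof -
  let ?X = "swf_sub Fl S" and ?Y = "swf_sub Gr (flag_proj r ` S)" and ?F = "swf_sub Fl F0"
  have SF: "S \<subseteq> flags n"
    by (auto simp: S_iff)
  note X = space_with_functions_sub[OF swf_Fl, of S]
  note sF = space_with_functions_sub[OF swf_Fl, of F0]
  have pX: "pts ?X = S"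
    using SF by (auto simp: pts_Fl)
  have F0F: "F0 \<subseteq> flags n"
    by (auto simp: F0_def)
  have m: "swf_morphism ?X ?Y (flag_proj r)"
    by (rule swf_morphism_sub_sub[OF swf_Fl swf_morphism_flag_proj]) auto
  have "\<exists>U \<phi>. openin (zar ?Y) U \<and> y \<in> U \<and>
      swf_iso (swf_sub ?X {x \<in> pts ?X. flag_proj r x \<in> U}) (swf_prod (swf_sub ?Y U) ?F) \<phi> \<and>
      (\<forall>x\<in>pts ?X. flag_proj r x \<in> U \<longrightarrow> fst (\<phi> x) = flag_proj r x)"
    if y: "y \<in> pts ?Y" for y
  proof -
    have img: "in_image_cond y'" if "y' \<in> flag_proj r ` S" for y'
      using that in_image_cond_flag by (auto simp: flag_proj_def)
    have yS: "y \<in> flag_proj r ` S"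
      using y by auto
    obtain a where a: "adapted a y"
      by (rule adapted_exists[OF img[OF yS]])
    then have aG: "a \<in> GLs n"
      by (simp add: adapted_def)
    let ?U = "gr.chart a \<inter> flag_proj r ` S"
    let ?T = "{x \<in> pts ?X. flag_proj r x \<in> ?U}"
    define \<alpha> where "\<alpha> = gr.local_section a"
    have oc: "openin (zar Gr) (gr.chart a)"
      unfolding grassmannian_variety_def by (rule gr.openin_chart[OF aG])
    have oU: "openin (zar ?Y) ?U"
      using oc unfolding zar_sub openin_subtopology by blast
    have yU: "y \<in> ?U"
    proof -
      have "y = fv.span (col a ` {1..r})"
        using a mv_Kn[of r n a] r by (simp add: adapted_def)
      then show ?thesis
        using gr.base_in_cell[OF aG] yS unfolding gr.chart_def by blast
    qed
    have ad: "adapted (\<alpha> y') y'" if "y' \<in> ?U" for y'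
      unfolding \<alpha>_def using that by (intro adapted_local_section[OF a _ img]) auto
    have \<alpha>G: "\<alpha> y' \<in> GLs n" if "y' \<in> gr.chart a" for y'
      unfolding \<alpha>_def by (rule gr.local_section_in_GLs[OF aG that])
    have r\<alpha>: "reg_mat Gr n (gr.chart a) \<alpha>"
      unfolding \<alpha>_def grassmannian_variety_def by (rule gr.reg_mat_local_section[OF aG])
    let ?XT = "swf_sub ?X ?T" and ?YU = "swf_sub ?Y ?U"
    note XT = space_with_functions_sub[OF X, of ?T]
    note Y = space_with_functions_sub[OF swf_Gr, of "flag_proj r ` S"]
    note YU = space_with_functions_sub[OF Y, of ?U]
    have pYU: "pts ?YU = ?U"
      using openin_subset[OF oU] by auto
    have pXT: "pts ?XT = ?T"
      by auto
    have pF: "pts ?F = F0"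
      using F0F by (auto simp: pts_Fl)
    have pP: "pts (swf_prod ?YU ?F) = ?U \<times> F0"
      unfolding pts_prod[OF YU sF] pYU pF ..
    let ?\<phi> = "\<lambda>V. (flag_proj r V, act n (minv n (\<alpha> (flag_proj r V))) V)"
    let ?\<psi> = "\<lambda>z. act n (\<alpha> (fst z)) (snd z)"
    have T: "V \<in> S" "V \<in> flags n" "flag_proj r V \<in> ?U" "\<alpha> (flag_proj r V) \<in> GLs n" if "V \<in> ?T" for V
      using that SF \<alpha>G unfolding pX by auto
    have TF: "act n (minv n (\<alpha> (flag_proj r V))) V \<in> F0" if V: "V \<in> ?T" for V
    proof -
      note V' = T[OF V]
      let ?V = "act n (minv n (\<alpha> (flag_proj r V))) V"
      have "?V \<in> flags n"
        by (rule act_in_flags[OF n minv_in_GLs[OF V'(4)] V'(2)])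
      moreover have "act n (\<alpha> (flag_proj r V)) ?V = V"
        by (rule act_minv(2)[OF n V'(4,2)])
      ultimately show ?thesis
        using act_in_S_iff[OF av ad[OF V'(3)] img, of ?V] V'(1,3) by (auto simp: flag_proj_def)
    qed
    have PT: "?\<psi> z \<in> ?T" "flag_proj r (?\<psi> z) = fst z" if z: "z \<in> ?U \<times> F0" for z
    proof -
      have "?\<psi> z \<in> S \<and> ?\<psi> z r = fst z"
        using act_in_S_iff[OF av ad img, of "fst z" "snd z"] z F0F by auto
      then show "?\<psi> z \<in> ?T" "flag_proj r (?\<psi> z) = fst z"
        using z unfolding pX by (auto simp: flag_proj_def)
    qed
    have "swf_morphism ?XT (swf_prod ?YU ?F) ?\<phi>"
    proof (rule swf_morphism_pair[OF YU sF XT])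
      show "swf_morphism ?XT ?YU (flag_proj r)"
        by (rule swf_morphism_sub_sub[OF X m]) auto
      let ?W = "{V \<in> pts Fl. flag_proj r V \<in> gr.chart a}"
      have oW: "openin (zar Fl) ?W"
        by (rule swf_morphism_preimage[OF swf_morphism_flag_proj oc])
      have "reg_mat Fl n ?W (\<lambda>V. minv n (\<alpha> (flag_proj r V)))"
        by (rule reg_mat_minv[OF swf_Fl oW reg_mat_flag_proj[OF oc r\<alpha>]]) (use \<alpha>G in auto)
      then have act: "swf_morphism (swf_sub Fl ?W) Fl (\<lambda>V. act n (minv n (\<alpha> (flag_proj r V))) V)"
        by (intro swf_morphism_act[OF oW]) (use \<alpha>G minv_in_GLs in auto)
      have "swf_morphism ?XT Fl (\<lambda>V. V)"
        using swf_morphism_compose[OF swf_morphism_inclusion swf_morphism_inclusion] .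
      then have "swf_morphism ?XT (swf_sub Fl ?W) (\<lambda>V. V)"
      proof (rule swf_morphism_into_sub[OF XT])
        fix V assume "V \<in> pts ?XT"
        then have V: "V \<in> ?T"
          unfolding pXT .
        show "V \<in> ?W"
          unfolding pts_Fl using T(2,3)[OF V] by blast
      qed
      from swf_morphism_compose[OF this act]
      show "swf_morphism ?XT ?F (\<lambda>V. act n (minv n (\<alpha> (flag_proj r V))) V)"
        by (rule swf_morphism_into_sub[OF XT]) (use TF in \<open>unfold pXT, blast\<close>)
    qed
    moreover have "swf_morphism (swf_prod ?YU ?F) ?XT ?\<psi>"
    proof -
      note P = space_with_functions_prod[OF YU sF]
      have "reg_mat ?Y n ?U \<alpha>"
        by (rule reg_mat_sub[OF oc r\<alpha>]) auto
      then have "reg_mat ?YU n (pts ?YU) \<alpha>"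
        unfolding pYU by (rule reg_mat_sub[OF oU _ order_refl])
      then have "swf_morphism (swf_prod ?YU ?F) Fl ?\<psi>"
        by (intro swf_morphism_act_prod[OF YU F0F]) (use \<alpha>G in \<open>unfold pYU, auto\<close>)
      then have "swf_morphism (swf_prod ?YU ?F) ?X ?\<psi>"
        by (rule swf_morphism_into_sub[OF P]) (use PT T(1) in \<open>unfold pP, blast\<close>)
      then show ?thesis
        by (rule swf_morphism_into_sub[OF P]) (use PT in \<open>unfold pP, blast\<close>)
    qed
    moreover have "?\<psi> (?\<phi> V) = V" if "V \<in> pts ?XT" for V
      using act_minv(2)[OF n T(4,2)] that unfolding pXT by simp
    moreover have "?\<phi> (?\<psi> z) = z" if "z \<in> pts (swf_prod ?YU ?F)" for z
    proof -
      have z: "z \<in> ?U \<times> F0"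
        using that unfolding pP .
      then have "\<alpha> (fst z) \<in> GLs n" "snd z \<in> flags n"
        using \<alpha>G F0F by auto
      then show ?thesis
        using act_minv(1)[OF n, of "\<alpha> (fst z)" "snd z"] PT(2)[OF z] by simp
    qed
    ultimately have "swf_iso ?XT (swf_prod ?YU ?F) ?\<phi>"
      unfolding swf_iso_def by (intro conjI exI[of _ ?\<psi>] ballI)
    then show ?thesis
      using oU yU by (intro exI[of _ ?U] exI[of _ ?\<phi>]) simp
  qed
  then show ?thesis
    unfolding zariski_locally_trivial_def
    using m closed_sub_flag_variety[OF n closedin_F0] by (intro conjI exI[of _ ?F] ballI)
qed

end

section \<open>Local triviality implies avoidance\<close>

lemma continuous_map_prod_snd:
  assumes X: "space_with_functions X" and Y: "space_with_functions Y"
  shows "continuous_map (zar (swf_prod X Y)) (zar Y) snd"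
proof -
  have "openin (zar (swf_prod X Y)) {z \<in> pts (swf_prod X Y). snd z \<in> V}" if V: "openin (zar Y) V" for V
  proof -
    have "{z \<in> pts (swf_prod X Y). snd z \<in> V} = pts X \<times> V"
      using openin_subset[OF V] by (auto simp: pts_prod[OF X Y])
    then show ?thesis
      using openin_prod_Times[OF X Y openin_topspace V] by simp
  qed
  then show ?thesis
    by (auto simp: continuous_map_def pts_prod[OF X Y])
qed

text \<open>
  The topology is finer than the product topology, but a tensor function restricted to a slice is
  a linear combination of regular functions on the second factor.
\<close>

lemma continuous_map_prod_slice:
  assumes X: "space_with_functions X" and Y: "space_with_functions Y" and x: "x \<in> pts X"
  shows "continuous_map (zar Y) (zar (swf_prod X Y)) (Pair x)"
proof -
  have "openin (zar Y) {y \<in> pts Y. (x, y) \<in> W}" if W: "openin (zar (swf_prod X Y)) W" for W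
  proof (rule openin_localI)
    fix y assume "y \<in> {y \<in> pts Y. (x, y) \<in> W}"
    then have y: "(x, y) \<in> W" by simp
    obtain U V h where A: "openin (zar X) U" "openin (zar Y) V" "h \<in> tensor_functions X Y U V"
      "(x, y) \<in> U \<times> V" "h (x, y) \<noteq> 0" "{z \<in> U \<times> V. h z \<noteq> 0} \<subseteq> W"
      by (rule openin_prod_cases[OF X Y W y])
    obtain m :: nat and f g where h: "\<forall>i<m. f i \<in> reg X U \<and> g i \<in> reg Y V"
      "h = (\<lambda>z. \<Sum>i<m. f i (fst z) * g i (snd z))"
      by (rule tensorE[OF A(3)])
    have "(\<lambda>y. \<Sum>i<m. f i x * g i y) \<in> reg Y V"
      using h(1) by (intro swf_sum[OF Y A(2)] swf_mult[OF Y A(2)] swf_const[OF Y A(2)]) auto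
    from swf_nonzero_open[OF Y A(2) this]
    have "openin (zar Y) {y \<in> V. h (x, y) \<noteq> 0}"
      by (simp add: h(2))
    moreover have "{y \<in> V. h (x, y) \<noteq> 0} \<subseteq> {y \<in> pts Y. (x, y) \<in> W}"
      using A(4,6) openin_subset[OF A(2)] by auto
    ultimately show "\<exists>V. openin (zar Y) V \<and> y \<in> V \<and> V \<subseteq> {y \<in> pts Y. (x, y) \<in> W}"
      using A(4,5) by (intro exI[of _ "{y \<in> V. h (x, y) \<noteq> 0}"]) auto
  qed
  then show ?thesis
    using x by (auto simp: continuous_map_def pts_prod[OF X Y])
qed

text \<open>A trivialization identifies the fiber over each point with the model fiber.\<close>

lemma fibers_homeomorphic:
  fixes X :: "('a, 'k::field) swf" and Y :: "('b, 'k) swf"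
  assumes t: "zariski_locally_trivial X Y \<pi>" and Y: "space_with_functions Y"
    and y: "y \<in> pts Y" "y' \<in> pts Y"
  shows "subtopology (zar X) {x \<in> pts X. \<pi> x = y} homeomorphic_space
    subtopology (zar X) {x \<in> pts X. \<pi> x = y'}"
proof -
  obtain F :: "('a, 'k) swf" where F: "variety F" and
    loc: "\<forall>y\<in>pts Y. \<exists>U \<phi>. openin (zar Y) U \<and> y \<in> U \<and>
            swf_iso (swf_sub X {x \<in> pts X. \<pi> x \<in> U}) (swf_prod (swf_sub Y U) F) \<phi> \<and>
            (\<forall>x\<in>pts X. \<pi> x \<in> U \<longrightarrow> fst (\<phi> x) = \<pi> x)"
    using t unfolding zariski_locally_trivial_def by (elim conjE exE)
  have sF: "space_with_functions F"
    using F by (simp add: variety_def)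
  have h: "subtopology (zar X) {x \<in> pts X. \<pi> x = y} homeomorphic_space zar F" if y: "y \<in> pts Y" for y
  proof -
    obtain U \<phi> where U: "openin (zar Y) U" "y \<in> U"
      and iso: "swf_iso (swf_sub X {x \<in> pts X. \<pi> x \<in> U}) (swf_prod (swf_sub Y U) F) \<phi>"
      and fst: "\<forall>x\<in>pts X. \<pi> x \<in> U \<longrightarrow> fst (\<phi> x) = \<pi> x"
      using bspec[OF loc y] by (elim exE conjE)
    let ?T = "{x \<in> pts X. \<pi> x \<in> U}" and ?S = "{x \<in> pts X. \<pi> x = y}"
    let ?YU = "swf_sub Y U"
    note YU = space_with_functions_sub[OF Y, of U]
    have pT: "pts (swf_sub X ?T) = ?T" and pYU: "pts ?YU = U"
      using openin_subset[OF U(1)] by auto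
    have pP: "pts (swf_prod ?YU F) = U \<times> pts F"
      by (simp only: pts_prod[OF YU sF] pYU)
    obtain \<psi> where \<psi>: "swf_morphism (swf_prod ?YU F) (swf_sub X ?T) \<psi>"
      "\<forall>x\<in>?T. \<psi> (\<phi> x) = x" "\<forall>z\<in>U \<times> pts F. \<phi> (\<psi> z) = z" and \<phi>: "swf_morphism (swf_sub X ?T) (swf_prod ?YU F) \<phi>"
      using iso unfolding swf_iso_def pT pP by (elim exE conjE)
    have c\<phi>: "continuous_map (subtopology (zar X) ?T) (zar (swf_prod ?YU F)) \<phi>"
      using \<phi> by (simp add: swf_morphism_def)
    have c\<psi>: "continuous_map (zar (swf_prod ?YU F)) (subtopology (zar X) ?T) \<psi>"
      using \<psi>(1) by (simp add: swf_morphism_def)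
    have ST: "?S \<subseteq> ?T"
      using U(2) by auto
    have \<psi>S: "\<psi> (y, v) \<in> ?S" if "v \<in> pts F" for v
    proof -
      have z: "(y, v) \<in> U \<times> pts F"
        using that U(2) by simp
      then have "\<psi> (y, v) \<in> ?T"
        using swf_morphism_in_pts[OF \<psi>(1), of "(y, v)"] unfolding pP pT by blast
      moreover have "fst (\<phi> (\<psi> (y, v))) = y"
        using \<psi>(3) z by simp
      ultimately show ?thesis
        using fst by auto
    qed
    have "homeomorphic_maps (subtopology (zar X) ?S) (zar F) (\<lambda>x. snd (\<phi> x)) (\<lambda>v. \<psi> (y, v))"
      unfolding homeomorphic_maps_def
    proof (intro conjI ballI)
      have "continuous_map (subtopology (zar X) ?S) (zar (swf_prod ?YU F)) \<phi>"
        using continuous_map_from_subtopology_mono[OF c\<phi> ST] .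
      from continuous_map_compose[OF this continuous_map_prod_snd[OF YU sF]]
      show "continuous_map (subtopology (zar X) ?S) (zar F) (\<lambda>x. snd (\<phi> x))"
        by (simp add: comp_def)
      have "y \<in> pts ?YU"
        unfolding pYU by (rule U(2))
      from continuous_map_compose[OF continuous_map_prod_slice[OF YU sF this] c\<psi>]
      have "continuous_map (zar F) (zar X) (\<lambda>v. \<psi> (y, v))"
        by (simp add: comp_def continuous_map_in_subtopology)
      then show "continuous_map (zar F) (subtopology (zar X) ?S) (\<lambda>v. \<psi> (y, v))"
        using \<psi>S by (auto simp: continuous_map_in_subtopology)
    next
      fix x assume "x \<in> topspace (subtopology (zar X) ?S)"
      then have x: "x \<in> ?T" "\<pi> x = y"
        using U(2) by auto
      then have "(y, snd (\<phi> x)) = \<phi> x"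
        using fst by (metis (mono_tags, lifting) mem_Collect_eq prod.collapse)
      then show "\<psi> (y, snd (\<phi> x)) = x"
        using \<psi>(2) x(1) by simp
    next
      fix v assume "v \<in> topspace (zar F)"
      then show "snd (\<phi> (\<psi> (y, v))) = v"
        using \<psi>(3) U(2) by simp
    qed
    then show ?thesis
      unfolding homeomorphic_space_def by blast
  qed
  from homeomorphic_space_trans[OF h[OF y(1)] iffD1[OF homeomorphic_space_sym h[OF y(2)]]]
  show ?thesis .
qed

context schubert_projection
begin

subsection \<open>Coordinate flags\<close>

definition coord_flag :: "(nat \<Rightarrow> nat) \<Rightarrow> nat \<Rightarrow> (nat \<Rightarrow> 'k) set" where
  "coord_flag x = (\<lambda>j\<in>{1..<n}. fv.span (e ` x ` {1..j}))"

lemma coord_flag_nth: "j \<in> {1..<n} \<Longrightarrow> coord_flag x j = fv.span (e ` x ` {1..j})"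
  by (simp add: coord_flag_def)

lemma dim_span_e:
  assumes "J \<subseteq> {1..n}"
  shows "fv.dim (fv.span (e ` J)) = card J"
  by (rule fv.dim_span_image[OF e_basis(1,2) assms])

lemma span_e_Int:
  assumes "I \<subseteq> {1..n}" "J \<subseteq> {1..n}"
  shows "fv.span (e ` I) \<inter> fv.span (e ` J) = fv.span (e ` (I \<inter> J))"
  by (rule fv.span_image_Int[OF _ e_basis(1,2) assms]) simp

lemma span_e_in_Kn: "J \<subseteq> {1..n} \<Longrightarrow> fv.span (e ` J) \<subseteq> Kn n"
  unfolding e_basis(3)[symmetric] by (intro fv.span_mono image_mono)

context
  fixes x :: "nat \<Rightarrow> nat"
  assumes x: "bij_betw x {1..n} {1..n}"
begin

lemma x_image_sub: "j \<le> n \<Longrightarrow> x ` {1..j} \<subseteq> {1..n}"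
  using x unfolding bij_betw_def by auto

lemma card_x_image:
  assumes "J \<subseteq> {1..n}"
  shows "card (x ` J) = card J"
  using x assms by (intro card_image) (auto simp: bij_betw_def intro: inj_on_subset)

lemma coord_flag_in_flags: "coord_flag x \<in> flags n"
  unfolding flags_def
proof (intro CollectI conjI ballI impI)
  show "coord_flag x \<in> extensional {1..<n}"
    by (simp add: coord_flag_def)
  fix i assume i: "i \<in> {1..<n}"
  have xi: "x ` {1..i} \<subseteq> {1..n}"
    using i by (intro x_image_sub) simp
  show "fv.subspace (coord_flag x i)" "coord_flag x i \<subseteq> Kn n"
    using span_e_in_Kn[OF xi] by (simp_all add: coord_flag_nth[OF i])
  have "card (x ` {1..i}) = i"
    using card_x_image[of "{1..i}"] i by auto
  then show "fv.dim (coord_flag x i) = i"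
    using dim_span_e[OF xi] unfolding coord_flag_nth[OF i] by simp
  fix j assume j: "j \<in> {1..<n}" "i \<le> j"
  then show "coord_flag x i \<subseteq> coord_flag x j"
    unfolding coord_flag_nth[OF i] coord_flag_nth[OF j(1)] by (intro fv.span_mono image_mono) auto
qed

lemma dim_E_coord_flag:
  assumes i: "i \<in> {1..n}" and j: "j \<in> {1..<n}"
  shows "fv.dim (E i \<inter> coord_flag x j) = rank_number x i j"
proof -
  have sub: "x ` {1..j} \<subseteq> {1..n}" "{1..i} \<subseteq> {1..n}"
    using i j x_image_sub by auto
  have "{1..i} \<inter> x ` {1..j} = x ` {k \<in> {1..j}. x k \<le> i}"
    using sub(1) by (auto simp: image_subset_iff)
  moreover have "{k \<in> {1..j}. x k \<le> i} \<subseteq> {1..n}"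
    using j by auto
  ultimately have "card ({1..i} \<inter> x ` {1..j}) = rank_number x i j"
    unfolding rank_number_def by (simp only: card_x_image)
  then show ?thesis
    unfolding E_def coord_flag_nth[OF j] span_e_Int[OF sub(2,1)]
    using dim_span_e[OF le_infI1[OF sub(2)]] by simp
qed

lemma coord_flag_in_S_iff:
  "coord_flag x \<in> S \<longleftrightarrow> (\<forall>i\<in>{1..n}. \<forall>j\<in>{1..<n}. R i j \<le> rank_number x i j)"
  using coord_flag_in_flags dim_E_coord_flag by (simp add: S_iff)

end

subsection \<open>The sorting permutation\<close>

text \<open>
  The permutation \<open>\<sigma>\<close> sends the values of \<open>w\<close> on the left of the division increasingly to
  \<open>1, \<dots>, r\<close>, the other ones increasingly to \<open>r + 1, \<dots>, n\<close>. On basis vectors it moves the space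
  \<open>span {e v | v \<in> A}\<close>, the \<open>r\<close>-th one of the coordinate flag of \<open>w\<close>, to \<open>E r\<close>.
\<close>

definition A :: "nat set" where
  "A = w ` {1..r}"

definition below :: "nat \<Rightarrow> nat" where
  "below v = card (A \<inter> {1..v})"

definition \<sigma> :: "nat \<Rightarrow> nat" where
  "\<sigma> v = (if v \<in> A then below v else r + (v - below v))"

lemma A_sub: "A \<subseteq> {1..n}"
  using w_in r by (auto simp: A_def)

lemma finite_A: "finite A"
  by (simp add: A_def)

lemma card_A: "card A = r"
  unfolding A_def by (subst card_image) (auto simp: inj_on_def w_inj)

lemma in_A_iff:
  assumes "k \<in> {1..n}"
  shows "w k \<in> A \<longleftrightarrow> k \<le> r"
  using assms w_inj by (auto simp: A_def)

lemma R_r: "R i r = below i"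
proof -
  have "A \<inter> {1..i} = w ` {k \<in> {1..r}. w k \<le> i}"
    using w_in r by (fastforce simp: A_def)
  then show ?thesis
    unfolding below_def rank_number_def by (simp add: card_image inj_on_def w_inj)
qed

lemma below_le: "below v \<le> v" "below v \<le> r"
proof -
  have "below v \<le> card {1..v}"
    unfolding below_def by (rule card_mono) auto
  then show "below v \<le> v" by simp
  have "below v \<le> card A"
    unfolding below_def by (rule card_mono[OF finite_A]) auto
  then show "below v \<le> r" by (simp add: card_A)
qed

lemma below_add:
  assumes "v \<le> v'"
  shows "below v' = below v + card (A \<inter> {v<..v'})"
proof -
  have "A \<inter> {1..v'} = (A \<inter> {1..v}) \<union> (A \<inter> {v<..v'})"
    using assms A_sub by auto
  then show ?thesis
    unfolding below_def using finite_A by (simp add: card_Un_disjoint Int_def)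
qed

lemma below_less:
  assumes "v < v'" "v' \<in> A"
  shows "below v < below v'"
proof -
  have "v' \<in> A \<inter> {v<..v'}"
    using assms by auto
  then have "card (A \<inter> {v<..v'}) > 0"
    using finite_A card_gt_0_iff by blast
  then show ?thesis
    using below_add[of v v'] assms by simp
qed

lemma above_less:
  assumes "v < v'" "v' \<notin> A"
  shows "v - below v < v' - below v'"
proof -
  have "A \<inter> {v<..v'} \<subseteq> {v<..<v'}"
    using assms by (auto simp: order_le_less)
  then have "card (A \<inter> {v<..v'}) \<le> card {v<..<v'}"
    by (intro card_mono) auto
  then show ?thesis
    using below_add[of v v'] assms(1) below_le(1)[of v] by simp
qed

lemma \<sigma>_mono:
  assumes "v < v'" "v \<in> A \<longleftrightarrow> v' \<in> A"
  shows "\<sigma> v < \<sigma> v'"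
  using assms below_less[of v v'] above_less[of v v'] by (auto simp: \<sigma>_def)

lemma \<sigma>_A:
  assumes "v \<in> A"
  shows "\<sigma> v \<in> {1..r}"
proof -
  have "v \<in> A \<inter> {1..v}"
    using assms A_sub by auto
  then have "below v > 0"
    unfolding below_def using finite_A card_gt_0_iff by blast
  then show ?thesis
    using assms below_le(2)[of v] by (simp add: \<sigma>_def)
qed

lemma \<sigma>_not_A:
  assumes "v \<in> {1..n}" "v \<notin> A"
  shows "\<sigma> v \<in> {r<..n}"
proof -
  have "below n = r"
    using A_sub card_A by (simp add: below_def Int_absorb2)
  then have "card (A \<inter> {v<..n}) = r - below v"
    using below_add[of v n] assms(1) by simp
  moreover have "card (A \<inter> {v<..n}) \<le> card {v<..n}"
    by (rule card_mono) auto
  ultimately have "r - below v \<le> n - v"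
    by simp
  moreover have "below v < v"
  proof -
    have "A \<inter> {1..v} \<subseteq> {1..<v}"
      using assms by (auto simp: order_le_less)
    then have "below v \<le> card {1..<v}"
      unfolding below_def by (intro card_mono) auto
    then show ?thesis
      using assms(1) by auto
  qed
  ultimately show ?thesis
    using assms below_le[of v] by (auto simp: \<sigma>_def)
qed

lemma \<sigma>_inj: "inj_on \<sigma> {1..n}"
proof (rule inj_onI)
  fix v v' assume v: "v \<in> {1..n}" "v' \<in> {1..n}" "\<sigma> v = \<sigma> v'"
  have "v \<in> A \<longleftrightarrow> v' \<in> A"
    using \<sigma>_A[of v] \<sigma>_A[of v'] \<sigma>_not_A[of v] \<sigma>_not_A[of v'] v by fastforce
  then show "v = v'"
    using \<sigma>_mono[of v v'] \<sigma>_mono[of v' v] v(3) by (metis less_irrefl nat_neq_iff)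
qed

lemma bij_\<sigma>: "bij_betw \<sigma> {1..n} {1..n}"
proof -
  have "\<sigma> v \<in> {1..n}" if "v \<in> {1..n}" for v
    using \<sigma>_A[of v] \<sigma>_not_A[OF that] r by fastforce
  then have "\<sigma> ` {1..n} \<subseteq> {1..n}"
    by blast
  then show ?thesis
    using \<sigma>_inj endo_inj_surj[of "{1..n}" \<sigma>] by (simp add: bij_betw_def)
qed

lemma \<sigma>_image_A: "\<sigma> ` A = {1..r}"
proof (rule card_subset_eq)
  show "\<sigma> ` A \<subseteq> {1..r}"
    using \<sigma>_A by blast
  show "card (\<sigma> ` A) = card {1..r}"
    using card_image[OF inj_on_subset[OF \<sigma>_inj A_sub]] by (simp add: card_A)
qed simp

lemma bij_w: "bij_betw w {1..n} {1..n}"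
  using permutes_imp_bij[OF w] .

lemma bij_\<sigma>w: "bij_betw (\<sigma> \<circ> w) {1..n} {1..n}"
  by (rule bij_betw_trans[OF bij_w bij_\<sigma>])

lemma \<sigma>_preimage:
  assumes "i \<in> {1..n}"
  obtains v where "v \<in> {1..n}" "\<sigma> v = i" "v \<in> A \<longleftrightarrow> i \<le> r"
proof -
  obtain v where v: "v \<in> {1..n}" "\<sigma> v = i"
    using bij_\<sigma> assms unfolding bij_betw_def by (metis imageE)
  then have "v \<in> A \<longleftrightarrow> i \<le> r"
    using \<sigma>_A[of v] \<sigma>_not_A[of v] by fastforce
  then show ?thesis
    using v that by blast
qed

end

context schubert_projection
begin

subsection \<open>Moving a generic fiber into the special one\<close>

definition basis_mat :: "(nat \<Rightarrow> nat) \<Rightarrow> nat \<times> nat \<Rightarrow> 'k" where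
  "basis_mat x = (\<lambda>(i, j). if j \<in> {1..n} then e (x j) i else 0)"

text \<open>
  The first factor has the columns \<open>e (\<sigma> v)\<close>, the second one undoes the matrix with columns \<open>e v\<close>.
\<close>

definition sort_mat :: "nat \<times> nat \<Rightarrow> 'k" where
  "sort_mat = mm n (basis_mat \<sigma>) (minv n (basis_mat (\<lambda>j. j)))"

lemma col_basis_mat: "j \<in> {1..n} \<Longrightarrow> col (basis_mat x) j = e (x j)"
  by (simp add: Defs.col_def basis_mat_def)

lemma e_in_Kn: "v \<in> {1..n} \<Longrightarrow> e v \<in> Kn n"
  using fv.span_base[of "e v" "e ` {1..n}"] e_basis(3) by auto

lemma basis_mat_in_GLs:
  assumes x: "bij_betw x {1..n} {1..n}"
  shows "basis_mat x \<in> GLs n"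
  unfolding GLs_def
proof (intro CollectI conjI)
  have xin: "x j \<in> {1..n}" if "j \<in> {1..n}" for j
    using x that by (auto simp: bij_betw_def)
  show "basis_mat x \<in> mats n"
    unfolding mats_cols
  proof (intro conjI ballI allI impI)
    fix j assume j: "j \<in> {1..n}"
    then show "col (basis_mat x) j \<in> Kn n"
      unfolding col_basis_mat[OF j] by (intro e_in_Kn xin)
  qed (auto simp: basis_mat_def)
  have img: "col (basis_mat x) ` {1..n} = e ` {1..n}"
  proof -
    have "col (basis_mat x) ` {1..n} = (\<lambda>j. e (x j)) ` {1..n}"
      by (rule image_cong[OF refl col_basis_mat])
    also have "\<dots> = e ` x ` {1..n}"
      by (simp only: image_image)
    also have "x ` {1..n} = {1..n}"
      using x by (simp add: bij_betw_def)
    finally show ?thesis .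
  qed
  have "inj_on (\<lambda>j. e (x j)) {1..n}"
    using comp_inj_on[of x "{1..n}" e] x e_basis(1) by (simp add: bij_betw_def comp_def)
  then have "inj_on (col (basis_mat x)) {1..n}"
    by (subst inj_on_cong[OF col_basis_mat])
  then show "is_basis n (col (basis_mat x))"
    unfolding is_basis_def img using e_basis by simp
qed

lemma sort_mat_in_GLs: "sort_mat \<in> GLs n"
  unfolding sort_mat_def
  by (intro mm_in_GLs minv_in_GLs basis_mat_in_GLs bij_\<sigma>) (simp add: bij_betw_def)

lemma sort_mat_e:
  assumes v: "v \<in> {1..n}"
  shows "mv n sort_mat (e v) = e (\<sigma> v)"
proof -
  have b: "basis_mat (\<lambda>j. j) \<in> GLs n"
    by (rule basis_mat_in_GLs) (simp add: bij_betw_def)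
  have "e v = mv n (basis_mat (\<lambda>j. j)) (std v)"
    using v by (simp only: mv_std col_basis_mat)
  then have "mv n (minv n (basis_mat (\<lambda>j. j))) (e v) = std v"
    using mv_minv(2)[OF b std_in_Kn[OF v]] by simp
  then show ?thesis
    unfolding sort_mat_def mv_mm using v by (simp only: mv_std col_basis_mat)
qed

lemma sort_mat_span:
  assumes "J \<subseteq> {1..n}"
  shows "mv n sort_mat ` fv.span (e ` J) = fv.span (e ` \<sigma> ` J)"
proof -
  have "mv n sort_mat ` e ` J = e ` \<sigma> ` J"
    unfolding image_image by (rule image_cong[OF refl sort_mat_e]) (use assms in blast)
  then show ?thesis
    using mv.span_image[of n sort_mat "e ` J"] by simp
qed

lemma act_sort_coord_flag:
  assumes x: "bij_betw x {1..n} {1..n}"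
  shows "act n sort_mat (coord_flag x) = coord_flag (\<sigma> \<circ> x)"
proof (rule flags_eqI)
  show "act n sort_mat (coord_flag x) \<in> flags n"
    by (rule act_in_flags[OF n sort_mat_in_GLs coord_flag_in_flags[OF x]])
  show "coord_flag (\<sigma> \<circ> x) \<in> flags n"
    by (rule coord_flag_in_flags[OF bij_betw_trans[OF x bij_\<sigma>]])
  fix j assume j: "j \<in> {1..<n}"
  then have "x ` {1..j} \<subseteq> {1..n}"
    by (intro x_image_sub[OF x]) simp
  then show "act n sort_mat (coord_flag x) j = coord_flag (\<sigma> \<circ> x) j"
    unfolding act_nth[OF j] coord_flag_nth[OF j] image_comp[of \<sigma> x, symmetric] by (rule sort_mat_span)
qed

definition fiber :: "(nat \<Rightarrow> 'k) set \<Rightarrow> (nat \<Rightarrow> (nat \<Rightarrow> 'k) set) set" where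
  "fiber y = {V \<in> S. V r = y}"

abbreviation generic :: "(nat \<Rightarrow> 'k) set" where
  "generic \<equiv> fv.span (e ` A)"

lemma sort_mat_generic: "mv n sort_mat ` generic = E r"
  using sort_mat_span[OF A_sub] by (simp add: \<sigma>_image_A E_def)

text \<open>
  For \<open>i \<le> r\<close> the space \<open>E i\<close> contains the image of the part of \<open>E a\<close> in the generic space, where
  \<open>\<sigma> a = i\<close> and so \<open>a \<ge> i\<close>. For \<open>i > r\<close> it is the image of \<open>E b\<close> plus the generic space, where
  \<open>\<sigma> b = i\<close>. In both cases the rank condition for \<open>E a\<close> or \<open>E b\<close> implies the one for \<open>E i\<close>.
\<close>

lemma act_sort_fiber:
  assumes V: "V \<in> fiber generic"
  shows "act n sort_mat V \<in> fiber (E r)"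
proof -
  have VS: "V \<in> S" and VF: "V \<in> flags n" and Vr: "V r = generic"
    using V by (auto simp: fiber_def S_iff)
  let ?V = "act n sort_mat V"
  have VF': "?V \<in> flags n"
    by (rule act_in_flags[OF n sort_mat_in_GLs VF])
  have Vr': "?V r = E r"
    unfolding act_nth[OF r_in] Vr by (rule sort_mat_generic)
  have fd: "finite_dim fun_scale (E i \<inter> ?V j)" if "j \<in> {1..<n}" for i j
    by (rule finite_dim_in_Kn) (use flags_nth(2)[OF VF' that] in blast)
  have "R i j \<le> fv.dim (E i \<inter> ?V j)" if i: "i \<in> {1..n}" and j: "j \<in> {1..<n}" for i j
  proof (cases "j \<le> r")
    case jr: True
    show ?thesis
    proof (cases "i \<le> r")
      case True
      obtain a where a: "a \<in> {1..n}" "\<sigma> a = i" "a \<in> A \<longleftrightarrow> i \<le> r"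
        by (rule \<sigma>_preimage[OF i])
      have ia: "i = below a" "i \<le> a"
        using a True below_le(1)[of a] by (auto simp: \<sigma>_def)
      have "mv n sort_mat ` (E a \<inter> V j) \<subseteq> E i \<inter> ?V j"
      proof
        fix v assume "v \<in> mv n sort_mat ` (E a \<inter> V j)"
        then obtain u where u: "u \<in> E a" "u \<in> V j" "v = mv n sort_mat u"
          by blast
        have "u \<in> generic"
          using u(2) flags_mono[OF VF j r_in jr] Vr by blast
        then have "u \<in> fv.span (e ` ({1..a} \<inter> A))"
          using u(1) span_e_Int[of "{1..a}" A] A_sub a(1) unfolding E_def by auto
        then have "v \<in> fv.span (e ` \<sigma> ` ({1..a} \<inter> A))"
          using sort_mat_span[of "{1..a} \<inter> A"] A_sub u(3) by blast
        moreover have "\<sigma> ` ({1..a} \<inter> A) \<subseteq> {1..i}"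
        proof
          fix s assume "s \<in> \<sigma> ` ({1..a} \<inter> A)"
          then obtain t where t: "t \<le> a" "t \<in> A" "s = \<sigma> t"
            by auto
          then have "\<sigma> t \<le> \<sigma> a"
            using \<sigma>_mono[of t a] a True by (cases "t = a") auto
          then show "s \<in> {1..i}"
            using \<sigma>_A[OF t(2)] a(2) t(3) by simp
        qed
        ultimately have "v \<in> E i"
          unfolding E_def using fv.span_mono[OF image_mono[of "\<sigma> ` ({1..a} \<inter> A)" "{1..i}" e]] by blast
        then show "v \<in> E i \<inter> ?V j"
          using u by (simp add: act_nth[OF j])
      qed
      then have "fv.dim (mv n sort_mat ` (E a \<inter> V j)) \<le> fv.dim (E i \<inter> ?V j)"
        by (rule fv.finite_dim_mono[OF fd[OF j]])
      moreover have "fv.dim (mv n sort_mat ` (E a \<inter> V j)) = fv.dim (E a \<inter> V j)"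
        using flags_nth[OF VF j]
        by (intro dim_mv_image[OF sort_mat_in_GLs] fv.subspace_inter subspace_E) auto
      moreover have "R a j \<le> fv.dim (E a \<inter> V j)"
        using VS a(1) j by (simp add: S_iff)
      moreover have "R i j \<le> R a j"
        by (rule rank_number_mono[OF ia(2)])
      ultimately show ?thesis by linarith
    next
      case False
      then have "?V j \<subseteq> E i"
        using flags_mono[OF VF' j r_in jr] Vr' E_mono[of r i] by auto
      then have "E i \<inter> ?V j = ?V j"
        by blast
      then show ?thesis
        using flags_nth(3)[OF VF' j] rank_number_le[of w i j] by simp
    qed
  next
    case False
    then have rj: "r \<le> j"
      by simp
    show ?thesis
    proof (cases "i \<le> r")
      case True
      then have "E i \<subseteq> ?V j"
        using flags_mono[OF VF' r_in j rj] Vr' E_mono[of i r] by auto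
      then have "E i \<inter> ?V j = E i"
        by blast
      then show ?thesis
        using dim_E[of i] R_le_row[of i j] i j by simp
    next
      case False
      obtain b where b: "b \<in> {1..n}" "\<sigma> b = i" "b \<in> A \<longleftrightarrow> i \<le> r"
        by (rule \<sigma>_preimage[OF i])
      have ib: "i = r + (b - below b)"
        using b False by (auto simp: \<sigma>_def)
      have bi: "b \<le> i" "i - b = r - below b"
        using ib below_le[of b] by auto
      have sub: "\<sigma> ` ({1..b} \<union> A) \<subseteq> {1..i}"
      proof
        fix s assume "s \<in> \<sigma> ` ({1..b} \<union> A)"
        then obtain t where t: "t \<in> {1..b} \<union> A" "s = \<sigma> t"
          by blast
        show "s \<in> {1..i}"
        proof (cases "t \<in> A")
          case True
          then show ?thesis
            using \<sigma>_A[OF True] t(2) False by auto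
        next
          case nA: False
          then have "t \<le> b" "t \<in> {1..n}"
            using t(1) b(1) by auto
          moreover have "b \<notin> A"
            using b(3) False by simp
          ultimately have "\<sigma> t \<le> \<sigma> b"
            using \<sigma>_mono[of t b] nA by (cases "t = b") auto
          then show ?thesis
            using \<sigma>_not_A[OF \<open>t \<in> {1..n}\<close> nA] b(2) t(2) by auto
        qed
      qed
      have gV: "generic \<subseteq> V j"
        using flags_mono[OF VF r_in j rj] Vr by simp
      have gK: "generic \<subseteq> Kn n"
        by (rule span_e_in_Kn[OF A_sub])
      let ?U = "fv.span (E b \<inter> V j \<union> generic)"
      have UV: "?U \<subseteq> V j"
        using gV flags_nth(1)[OF VF j] by (intro fv.span_minimal) auto
      have "?U \<subseteq> fv.span (e ` ({1..b} \<union> A))"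
      proof (rule fv.span_minimal)
        show "E b \<inter> V j \<union> generic \<subseteq> fv.span (e ` ({1..b} \<union> A))"
          using fv.span_mono[of "e ` {1..b}" "e ` ({1..b} \<union> A)"] fv.span_mono[of "e ` A" "e ` ({1..b} \<union> A)"]
          unfolding E_def by blast
      qed simp
      then have "mv n sort_mat ` ?U \<subseteq> mv n sort_mat ` fv.span (e ` ({1..b} \<union> A))"
        by (rule image_mono)
      also have "\<dots> = fv.span (e ` \<sigma> ` ({1..b} \<union> A))"
        by (rule sort_mat_span) (use A_sub b(1) in auto)
      also have "\<dots> \<subseteq> E i"
        unfolding E_def by (rule fv.span_mono[OF image_mono[OF sub]])
      finally have "mv n sort_mat ` ?U \<subseteq> E i \<inter> ?V j"
        using UV unfolding act_nth[OF j] by blast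
      then have "fv.dim (mv n sort_mat ` ?U) \<le> fv.dim (E i \<inter> ?V j)"
        by (rule fv.finite_dim_mono[OF fd[OF j]])
      moreover have "fv.dim (mv n sort_mat ` ?U) = fv.dim ?U"
        using UV flags_nth(2)[OF VF j] by (intro dim_mv_image[OF sort_mat_in_GLs]) auto
      moreover have "fv.dim (E b \<inter> V j) + fv.dim generic = fv.dim (E b \<inter> V j \<inter> generic) + fv.dim ?U"
        using flags_nth[OF VF j] gK
        by (intro fv.dim_Int_Un finite_dim_in_Kn fv.subspace_inter subspace_E fv.subspace_span) auto
      moreover have "fv.dim generic = r"
        using dim_span_e[OF A_sub] by (simp add: card_A)
      moreover have "fv.dim (E b \<inter> V j \<inter> generic) = below b"
      proof -
        have "E b \<inter> V j \<inter> generic = fv.span (e ` ({1..b} \<inter> A))"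
          using gV span_e_Int[of "{1..b}" A] A_sub b(1) unfolding E_def by auto
        then show ?thesis
          using dim_span_e[of "{1..b} \<inter> A"] A_sub by (auto simp: below_def Int_commute)
      qed
      moreover have "R b j \<le> fv.dim (E b \<inter> V j)"
        using VS b(1) j by (simp add: S_iff)
      moreover have "R i j \<le> R b j + (i - b)"
      proof -
        have "{k \<in> {1..j}. w k \<le> i} \<subseteq> {k \<in> {1..j}. w k \<le> b} \<union> {k \<in> {1..j}. w k \<in> {b<..i}}"
          by auto
        then have "R i j \<le> card ({k \<in> {1..j}. w k \<le> b} \<union> {k \<in> {1..j}. w k \<in> {b<..i}})"
          unfolding rank_number_def by (intro card_mono) auto
        also have "\<dots> \<le> R b j + card {k \<in> {1..j}. w k \<in> {b<..i}}"
          unfolding rank_number_def by (rule card_Un_le)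
        also have "card {k \<in> {1..j}. w k \<in> {b<..i}} \<le> card {b<..i}"
          by (rule card_inj_on_le[of w]) (auto simp: inj_on_def w_inj)
        finally show ?thesis by simp
      qed
      ultimately show ?thesis
        using bi(2) below_le(2)[of b] by linarith
    qed
  qed
  then show ?thesis
    using VF' Vr' by (simp add: fiber_def S_iff)
qed

text \<open>
  Undoing the action, membership of \<open>V\<close> is described by rank conditions on \<open>V\<close> with respect to the
  moved flag, which are closed.
\<close>

lemma act_sort_fiber_iff:
  assumes V: "V \<in> fiber (E r)"
  shows "V \<in> act n sort_mat ` fiber generic \<longleftrightarrow>
    (\<forall>i\<in>{1..n}. \<forall>j\<in>{1..<n}. R i j \<le> fv.dim (mv n sort_mat ` E i \<inter> V j))"
proof -
  have VF: "V \<in> flags n" and Vr: "V r = E r"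
    using V by (auto simp: fiber_def S_iff)
  let ?V = "act n (minv n sort_mat) V"
  have VF': "?V \<in> flags n"
    by (rule act_in_flags[OF n minv_in_GLs[OF sort_mat_in_GLs] VF])
  have aV: "act n sort_mat ?V = V"
    by (rule act_minv(2)[OF n sort_mat_in_GLs VF])
  have "mv n sort_mat ` ?V r = mv n sort_mat ` generic"
    using fun_cong[OF aV, of r] act_nth[OF r_in, of sort_mat ?V] Vr by (simp add: sort_mat_generic)
  then have Vr': "?V r = generic"
    using inj_on_image_eq_iff[OF inj_on_mv[OF sort_mat_in_GLs] flags_nth(2)[OF VF' r_in] span_e_in_Kn[OF A_sub]]
    by simp
  have inj: "V0 = ?V" if "V0 \<in> flags n" "V = act n sort_mat V0" for V0
    using act_minv(1)[OF n sort_mat_in_GLs that(1)] that(2) by simp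
  have "V \<in> act n sort_mat ` fiber generic \<longleftrightarrow> ?V \<in> S"
    using aV inj Vr' unfolding fiber_def S_iff by (auto simp: image_iff)
  also have "\<dots> \<longleftrightarrow> (\<forall>i\<in>{1..n}. \<forall>j\<in>{1..<n}. R i j \<le> fv.dim (mv n sort_mat ` E i \<inter> V j))"
  proof -
    have "fv.dim (mv n sort_mat ` E i \<inter> V j) = fv.dim (E i \<inter> ?V j)"
      if "i \<in> {1..n}" "j \<in> {1..<n}" for i j
      using dim_Int_act[OF sort_mat_in_GLs VF' that(2) subspace_E E_in_Kn[of i]] that(1) aV by simp
    then show ?thesis
      using VF' by (simp add: S_iff)
  qed
  finally show ?thesis .
qed

text \<open>
  If the fibers are homeomorphic, the generic fiber moves onto the special one: otherwise the
  special fiber would be homeomorphic to a proper closed subset of itself.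
\<close>

lemma fiber_eq_if_locally_trivial:
  assumes t: "zariski_locally_trivial (swf_sub Fl S) (swf_sub Gr (flag_proj r ` S)) (flag_proj r)"
    and ne: "generic \<in> flag_proj r ` S" "E r \<in> flag_proj r ` S"
  shows "act n sort_mat ` fiber generic = fiber (E r)"
proof -
  let ?g = "act n sort_mat" and ?g' = "act n (minv n sort_mat)"
  let ?T = "\<lambda>y. subtopology (zar Fl) (fiber y)"
  have SF: "S \<subseteq> flags n"
    by (auto simp: S_iff)
  have FF: "fiber y \<subseteq> flags n" for y
    using SF by (auto simp: fiber_def)
  have top: "topspace (?T y) = fiber y" for y
    using FF by (auto simp: pts_Fl)
  have ptsGr: "flag_proj r ` S \<subseteq> pts Gr"
    using swf_morphism_in_pts[OF swf_morphism_flag_proj] SF by (auto simp: pts_Fl)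
  have e: "subtopology (zar (swf_sub Fl S)) {x \<in> pts (swf_sub Fl S). flag_proj r x = y} = ?T y" for y
  proof -
    have "S \<inter> {x \<in> pts (swf_sub Fl S). flag_proj r x = y} = fiber y"
      using SF by (auto simp: fiber_def flag_proj_def pts_Fl)
    then show ?thesis
      by (simp add: subtopology_subtopology)
  qed
  have "E r \<in> pts (swf_sub Gr (flag_proj r ` S))" "generic \<in> pts (swf_sub Gr (flag_proj r ` S))"
    using ne ptsGr by auto
  from fibers_homeomorphic[OF t space_with_functions_sub[OF swf_Gr] this]
  have "?T (E r) homeomorphic_space ?T generic"
    unfolding e .
  then obtain \<theta> where \<theta>: "homeomorphic_map (?T (E r)) (?T generic) \<theta>"
    unfolding homeomorphic_space by blast
  have \<theta>_im: "\<theta> ` fiber (E r) = fiber generic"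
    using homeomorphic_imp_surjective_map[OF \<theta>] by (simp only: top)
  have \<theta>_inj: "inj_on \<theta> (fiber (E r))"
    using homeomorphic_imp_injective_map[OF \<theta>] by (simp only: top)
  have g_inj: "inj_on ?g (flags n)"
    by (rule inj_on_inverseI[of _ ?g']) (rule act_minv(1)[OF n sort_mat_in_GLs])
  have g_im: "?g ` fiber generic \<subseteq> fiber (E r)"
    using act_sort_fiber by blast
  \<comment> \<open>The moved fiber is cut out of the special one by the closed set \<open>Z\<close>.\<close>
  define Z where "Z = (\<Inter>i\<in>{1..n}. \<Inter>j\<in>{1..<n}. {V \<in> flags n. R i j \<le> fv.dim (mv n sort_mat ` E i \<inter> V j)})"
  have Z: "closedin (zar Fl) Z"
    unfolding Z_def
  proof (intro closedin_Inter)
    fix C assume "C \<in> (\<lambda>i. \<Inter>j\<in>{1..<n}. {V \<in> flags n. R i j \<le> fv.dim (mv n sort_mat ` E i \<inter> V j)}) ` {1..n}"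
    then obtain i where C: "C = (\<Inter>j\<in>{1..<n}. {V \<in> flags n. R i j \<le> fv.dim (mv n sort_mat ` E i \<inter> V j)})"
      by blast
    show "closedin (zar Fl) C"
      unfolding C
      by (rule closedin_Inter)
        (use r_in closedin_flag_condition[OF mv.subspace_image[OF subspace_E]
            image_subsetI[OF mv_in_Kn[OF GLs_mats[OF sort_mat_in_GLs]]]] in auto)
  qed (use n in auto)
  have gZ: "?g ` fiber generic = fiber (E r) \<inter> Z"
  proof -
    have "V \<in> Z \<longleftrightarrow> V \<in> ?g ` fiber generic" if "V \<in> fiber (E r)" for V
      using act_sort_fiber_iff[OF that] FF that n r_in unfolding Z_def by auto
    then show ?thesis
      using g_im by blast
  qed
  have closed: "closed_map (?T (E r)) (?T (E r)) (\<lambda>V. ?g (\<theta> V))"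
    unfolding closed_map_def
  proof (intro allI impI)
    fix C assume "closedin (?T (E r)) C"
    then have "closedin (?T generic) (\<theta> ` C)"
      using homeomorphic_imp_closed_map[OF \<theta>] by (simp add: closed_map_def)
    then obtain K where K: "closedin (zar Fl) K" "\<theta> ` C = K \<inter> fiber generic"
      by (auto simp: closedin_subtopology)
    have K': "closedin (zar Fl) {V \<in> flags n. ?g' V \<in> K}"
      using closedin_continuous_map_preimage[OF continuous_map_act[OF minv_in_GLs[OF sort_mat_in_GLs]] K(1)]
      by (simp add: pts_Fl)
    have "?g ` (K \<inter> fiber generic) = ({V \<in> flags n. ?g' V \<in> K} \<inter> Z) \<inter> fiber (E r)"
    proof (intro subset_antisym subsetI)
      fix V assume "V \<in> ?g ` (K \<inter> fiber generic)"
      then obtain V0 where V0: "V0 \<in> K" "V0 \<in> fiber generic" "V = ?g V0"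
        by blast
      then have "?g' V = V0"
        using act_minv(1)[OF n sort_mat_in_GLs] FF by blast
      moreover have "V \<in> fiber (E r) \<inter> Z"
        using V0 gZ by blast
      ultimately show "V \<in> ({V \<in> flags n. ?g' V \<in> K} \<inter> Z) \<inter> fiber (E r)"
        using V0(1) FF by auto
    next
      fix V assume V: "V \<in> ({V \<in> flags n. ?g' V \<in> K} \<inter> Z) \<inter> fiber (E r)"
      then have "V \<in> ?g ` fiber generic"
        using gZ by blast
      then obtain V0 where V0: "V0 \<in> fiber generic" "V = ?g V0"
        by blast
      then have "?g' V = V0"
        using act_minv(1)[OF n sort_mat_in_GLs] FF by blast
      then show "V \<in> ?g ` (K \<inter> fiber generic)"
        using V V0 by auto
    qed
    then have "(\<lambda>V. ?g (\<theta> V)) ` C = ({V \<in> flags n. ?g' V \<in> K} \<inter> Z) \<inter> fiber (E r)"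
      by (simp only: image_image[symmetric] K(2))
    then show "closedin (?T (E r)) ((\<lambda>V. ?g (\<theta> V)) ` C)"
      using closedin_Int[OF K' Z] unfolding closedin_subtopology by blast
  qed
  have "(\<lambda>V. ?g (\<theta> V)) ` topspace (?T (E r)) = topspace (?T (E r))"
  proof (rule noetherian_space_closed_embedding_onto[OF _ closed])
    show "noetherian_space (?T (E r))"
      by (rule noetherian_space_subtopology[OF noetherian_space_flag_variety])
    show "(\<lambda>V. ?g (\<theta> V)) ` topspace (?T (E r)) \<subseteq> topspace (?T (E r))"
      unfolding top using \<theta>_im g_im by blast
    have "inj_on ?g (\<theta> ` fiber (E r))"
      unfolding \<theta>_im by (rule inj_on_subset[OF g_inj FF])
    from comp_inj_on[OF \<theta>_inj this] show "inj_on (\<lambda>V. ?g (\<theta> V)) (topspace (?T (E r)))"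
      unfolding top by (simp add: comp_def)
  qed
  then show ?thesis
    unfolding top image_image[of ?g \<theta>, symmetric] \<theta>_im .
qed

subsection \<open>A flag outside the moved generic fiber\<close>

lemma coord_flag_r:
  assumes "x ` {1..r} = B"
  shows "coord_flag x r = fv.span (e ` B)"
  using assms by (simp add: coord_flag_nth[OF r_in])

lemma coord_flag_w: "coord_flag w \<in> fiber generic"
  using coord_flag_in_S_iff[OF bij_w] coord_flag_r[of w A] by (simp add: fiber_def A_def)

lemma R_le_rank_sort:
  assumes "i \<in> {1..n}" "j \<in> {1..<n}"
  shows "R i j \<le> rank_number (\<sigma> \<circ> w) i j"
proof -
  have "coord_flag (\<sigma> \<circ> w) \<in> S"
    using act_sort_fiber[OF coord_flag_w] act_sort_coord_flag[OF bij_w] by (simp add: fiber_def)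
  then show ?thesis
    using coord_flag_in_S_iff[OF bij_\<sigma>w] assms by blast
qed

text \<open>
  Exchange two positions \<open>q\<^sub>1 < q\<^sub>2\<close> on the same side with consecutive sorted values. The coordinate
  flag of \<open>w\<close> with the two positions exchanged is not in \<open>S\<close>, because \<open>w\<close> increases there. But the
  sorted one is: the exchange of consecutive values only lowers ranks in the row \<open>\<sigma> (w q\<^sub>1)\<close> between
  the two positions, by one, and there the last hypothesis leaves room.
\<close>

lemma exchange_not_in_image:
  assumes q: "q\<^sub>1 \<in> {1..n}" "q\<^sub>2 \<in> {1..n}" "q\<^sub>1 < q\<^sub>2" "\<sigma> (w q\<^sub>2) = Suc (\<sigma> (w q\<^sub>1))"
    and side: "q\<^sub>2 \<le> r \<and> below (w q\<^sub>1) < w q\<^sub>1 \<or> r < q\<^sub>1 \<and> below (w q\<^sub>2) < r"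
  shows "\<exists>V. V \<in> fiber (E r) \<and> V \<notin> act n sort_mat ` fiber generic"
proof -
  let ?t = "Transposition.transpose q\<^sub>1 q\<^sub>2" and ?u = "\<sigma> \<circ> w"
  let ?x = "?u \<circ> ?t"
  let ?p = "\<sigma> (w q\<^sub>1)"
  have wA: "w q\<^sub>1 \<in> A \<longleftrightarrow> w q\<^sub>2 \<in> A"
    using side q(1-3) by (auto simp: in_A_iff)
  have w12: "w q\<^sub>1 < w q\<^sub>2"
  proof (rule ccontr)
    assume "\<not> w q\<^sub>1 < w q\<^sub>2"
    then have "w q\<^sub>2 < w q\<^sub>1"
      using q(3) by (simp add: not_less le_less w_inj)
    from \<sigma>_mono[OF this wA[symmetric]] q(4) show False
      by simp
  qed
  have t: "bij_betw ?t {1..n} {1..n}"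
    by (rule permutes_imp_bij[OF permutes_swap_id[OF q(1,2)]])
  have x: "bij_betw ?x {1..n} {1..n}"
    by (rule bij_betw_trans[OF t bij_\<sigma>w])
  have wt: "bij_betw (w \<circ> ?t) {1..n} {1..n}"
    by (rule bij_betw_trans[OF t bij_w])
  have "?t ` {1..r} = {1..r}"
  proof -
    have "q\<^sub>1 \<in> {1..r} \<longleftrightarrow> q\<^sub>2 \<in> {1..r}"
      using side q(1-3) by auto
    then show ?thesis
      by (rule transpose_image_eq)
  qed
  then have xr: "?x ` {1..r} = {1..r}"
    by (simp only: image_comp[symmetric] A_def[symmetric] \<sigma>_image_A)
  \<comment> \<open>On the left \<open>?p < w q\<^sub>1\<close>, and sorting does not lower the number of values at most \<open>w q\<^sub>1\<close>, among
    which the one at \<open>q\<^sub>1\<close> exceeds \<open>?p\<close>. On the right, in the row \<open>?p\<close> sorting gains all values of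
    \<open>A\<close> above \<open>w q\<^sub>1\<close>. Their number is \<open>?p - w q\<^sub>1\<close>, and \<open>w\<close> itself gains less from the row \<open>w q\<^sub>1\<close> to
    the row \<open>?p\<close>, as one of the values in between occurs at \<open>q\<^sub>2 > j\<close>.\<close>
  have strict: "R ?p j < rank_number ?u ?p j" if j: "q\<^sub>1 \<le> j" "j < q\<^sub>2" for j
    using side
  proof
    assume l: "q\<^sub>2 \<le> r \<and> below (w q\<^sub>1) < w q\<^sub>1"
    then have "w q\<^sub>1 \<in> A"
      using q(1,3) by (simp add: in_A_iff)
    then have p: "?p = below (w q\<^sub>1)"
      by (simp add: \<sigma>_def)
    have "{k \<in> {1..j}. w k \<le> w q\<^sub>1} \<subseteq> {k \<in> {1..j}. ?u k \<le> ?p}"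
    proof
      fix k assume k: "k \<in> {k \<in> {1..j}. w k \<le> w q\<^sub>1}"
      then have "w k \<in> A"
        using j l q(2) by (subst in_A_iff) auto
      then have "\<sigma> (w k) \<le> ?p"
        using \<sigma>_mono[of "w k" "w q\<^sub>1"] k \<open>w q\<^sub>1 \<in> A\<close> by (cases "w k = w q\<^sub>1") auto
      then show "k \<in> {k \<in> {1..j}. ?u k \<le> ?p}"
        using k by simp
    qed
    then have ge: "R (w q\<^sub>1) j \<le> rank_number ?u ?p j"
      unfolding rank_number_def by (intro card_mono) auto
    have "q\<^sub>1 \<in> {k \<in> {1..j}. w k \<le> w q\<^sub>1} - {k \<in> {1..j}. w k \<le> ?p}"
      using l j(1) q(1) unfolding p by simp
    moreover have "{k \<in> {1..j}. w k \<le> ?p} \<subseteq> {k \<in> {1..j}. w k \<le> w q\<^sub>1}"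
      using l unfolding p by auto
    ultimately have "{k \<in> {1..j}. w k \<le> ?p} \<subset> {k \<in> {1..j}. w k \<le> w q\<^sub>1}"
      by blast
    then have "R ?p j < R (w q\<^sub>1) j"
      unfolding rank_number_def by (intro psubset_card_mono) auto
    with ge show ?thesis by simp
  next
    assume rt: "r < q\<^sub>1 \<and> below (w q\<^sub>2) < r"
    let ?b = "w q\<^sub>1"
    have nA: "?b \<notin> A" "w q\<^sub>2 \<notin> A"
      using rt q(1-3) by (simp_all add: in_A_iff)
    have p: "?p = r + (?b - below ?b)" and p2: "Suc ?p = r + (w q\<^sub>2 - below (w q\<^sub>2))"
      using nA q(4) by (simp_all add: \<sigma>_def)
    have w2p: "w q\<^sub>2 \<le> ?p"
      using p2 rt below_le(1)[of "w q\<^sub>2"] by linarith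
    have pb: "?p = ?b + (r - below ?b)"
      using p below_le[of ?b] by linarith
    let ?M = "{k \<in> {r<..j}. w k \<le> ?b}"
    have rj: "r < j"
      using rt j by simp
    have "{1..r} \<union> ?M \<subseteq> {k \<in> {1..j}. ?u k \<le> ?p}"
    proof
      fix k assume k: "k \<in> {1..r} \<union> ?M"
      then have kj: "k \<in> {1..j}" "k \<in> {1..n}"
        using rj j q(2) by auto
      have "\<sigma> (w k) \<le> ?p"
      proof (cases "k \<le> r")
        case True
        then have "w k \<in> A"
          using kj(2) by (simp add: in_A_iff)
        then show ?thesis
          using \<sigma>_A[of "w k"] p by simp
      next
        case False
        then have "w k \<notin> A" "w k \<le> ?b"
          using kj(2) k by (auto simp: in_A_iff)
        then show ?thesis
          using \<sigma>_mono[of "w k" ?b] nA(1) by (cases "w k = ?b") auto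
      qed
      then show "k \<in> {k \<in> {1..j}. ?u k \<le> ?p}"
        using kj(1) by simp
    qed
    then have "card ({1..r} \<union> ?M) \<le> rank_number ?u ?p j"
      unfolding rank_number_def by (intro card_mono) auto
    moreover have "card ({1..r} \<union> ?M) = r + card ?M"
      by (subst card_Un_disjoint) auto
    moreover have "R ?b j = below ?b + card ?M"
    proof -
      have "{k \<in> {1..j}. w k \<le> ?b} = {k \<in> {1..r}. w k \<le> ?b} \<union> ?M"
        using rj by auto
      then have "R ?b j = R ?b r + card ?M"
        unfolding rank_number_def by (simp only:) (subst card_Un_disjoint, auto)
      then show ?thesis
        by (simp add: R_r)
    qed
    moreover have "R ?p j \<le> R ?b j + (r - below ?b - 1)"
    proof -
      let ?N = "{k \<in> {1..j}. w k \<in> {?b<..?p} - {w q\<^sub>2}}"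
      have "{k \<in> {1..j}. w k \<le> ?p} \<subseteq> {k \<in> {1..j}. w k \<le> ?b} \<union> ?N"
        using j(2) w_inj by auto
      then have "R ?p j \<le> card ({k \<in> {1..j}. w k \<le> ?b} \<union> ?N)"
        unfolding rank_number_def by (intro card_mono) auto
      also have "\<dots> \<le> R ?b j + card ?N"
        unfolding rank_number_def by (rule card_Un_le)
      also have "card ?N \<le> card ({?b<..?p} - {w q\<^sub>2})"
        by (rule card_inj_on_le[of w]) (auto simp: inj_on_def w_inj)
      also have "card ({?b<..?p} - {w q\<^sub>2}) = ?p - ?b - 1"
        using w12 w2p by simp
      finally show ?thesis
        using pb by simp
    qed
    moreover have "below ?b < r"
      using below_add[of ?b "w q\<^sub>2"] w12 rt by simp
    ultimately show ?thesis by linarith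
  qed
  have le: "R i j \<le> rank_number ?x i j" if i: "i \<in> {1..n}" and j: "j \<in> {1..<n}" for i j
  proof -
    have u: "R i j \<le> rank_number ?u i j"
      by (rule R_le_rank_sort[OF i j])
    consider "q\<^sub>2 \<le> j" | "j < q\<^sub>1" | "q\<^sub>1 \<le> j" "j < q\<^sub>2"
      by linarith
    then show ?thesis
    proof cases
      case 1
      have "{k \<in> {1..j}. ?x k \<le> i} = ?t ` {k \<in> {1..j}. ?u k \<le> i}"
      proof (intro subset_antisym subsetI)
        have tj: "?t k \<in> {1..j} \<longleftrightarrow> k \<in> {1..j}" for k
          using 1 q(1-3) by (auto simp: Transposition.transpose_def)
        fix k
        show "k \<in> ?t ` {k \<in> {1..j}. ?u k \<le> i}" if "k \<in> {k \<in> {1..j}. ?x k \<le> i}"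
          using that tj[of k] by (intro image_eqI[of _ _ "?t k"]) auto
        show "k \<in> {k \<in> {1..j}. ?x k \<le> i}" if "k \<in> ?t ` {k \<in> {1..j}. ?u k \<le> i}"
          using that tj by auto
      qed
      then have "rank_number ?x i j = rank_number ?u i j"
        unfolding rank_number_def by (simp only: card_image[OF inj_on_transpose])
      then show ?thesis
        using u by simp
    next
      case 2
      then have "?x k = ?u k" if "k \<in> {1..j}" for k
        using that q(3) by (simp add: Transposition.transpose_def)
      then have "{k \<in> {1..j}. ?x k \<le> i} = {k \<in> {1..j}. ?u k \<le> i}"
        by auto
      then show ?thesis
        using u by (simp add: rank_number_def)
    next
      case 3
      have xk: "?x k = ?u k" if "k \<in> {1..j}" "k \<noteq> q\<^sub>1" for k
        using that 3 by (simp add: Transposition.transpose_def)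
      have xq: "?x q\<^sub>1 = Suc ?p"
        using q(4) by simp
      show ?thesis
      proof (cases "i = ?p")
        case True
        have "{k \<in> {1..j}. ?u k \<le> i} \<subseteq> insert q\<^sub>1 {k \<in> {1..j}. ?x k \<le> i}"
          using xk by auto
        then have "rank_number ?u i j \<le> card (insert q\<^sub>1 {k \<in> {1..j}. ?x k \<le> i})"
          unfolding rank_number_def by (intro card_mono) auto
        also have "\<dots> \<le> Suc (rank_number ?x i j)"
          unfolding rank_number_def by (rule card_insert_le_m1) auto
        finally show ?thesis
          using strict[OF 3] True by simp
      next
        case False
        have "{k \<in> {1..j}. ?u k \<le> i} \<subseteq> {k \<in> {1..j}. ?x k \<le> i}"
        proof
          fix k assume k: "k \<in> {k \<in> {1..j}. ?u k \<le> i}"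
          show "k \<in> {k \<in> {1..j}. ?x k \<le> i}"
          proof (cases "k = q\<^sub>1")
            case True
            then show ?thesis
              using k False xq by simp
          next
            case False
            then show ?thesis
              using k xk[of k] by simp
          qed
        qed
        then have "rank_number ?u i j \<le> rank_number ?x i j"
          unfolding rank_number_def by (intro card_mono) auto
        then show ?thesis
          using u by simp
      qed
    qed
  qed
  have "coord_flag ?x \<in> fiber (E r)"
    using coord_flag_in_S_iff[OF x] le coord_flag_r[OF xr] by (simp add: fiber_def E_def)
  moreover have "coord_flag ?x \<notin> act n sort_mat ` fiber generic"
  proof
    assume "coord_flag ?x \<in> act n sort_mat ` fiber generic"
    then obtain V where V: "V \<in> S" "coord_flag ?x = act n sort_mat V"
      by (auto simp: fiber_def)
    have "act n sort_mat (coord_flag (w \<circ> ?t)) = act n sort_mat V"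
      using act_sort_coord_flag[OF wt] V(2) by (simp add: comp_assoc)
    then have "coord_flag (w \<circ> ?t) = V"
      using act_minv(1)[OF n sort_mat_in_GLs coord_flag_in_flags[OF wt]] act_minv(1)[OF n sort_mat_in_GLs, of V] V(1)
      by (simp add: S_iff)
    then have S': "coord_flag (w \<circ> ?t) \<in> S"
      using V(1) by simp
    have "w q\<^sub>1 \<in> {1..n}" "q\<^sub>1 \<in> {1..<n}"
      using w_in[OF q(1)] q(1-3) by auto
    then have "R (w q\<^sub>1) q\<^sub>1 \<le> rank_number (w \<circ> ?t) (w q\<^sub>1) q\<^sub>1"
      using S' coord_flag_in_S_iff[OF wt] by blast
    moreover have "{k \<in> {1..q\<^sub>1}. (w \<circ> ?t) k \<le> w q\<^sub>1} \<subset> {k \<in> {1..q\<^sub>1}. w k \<le> w q\<^sub>1}"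
    proof
      have wk: "(w \<circ> ?t) k = (if k = q\<^sub>1 then w q\<^sub>2 else w k)" if "k \<in> {1..q\<^sub>1}" for k
        using that q(3) by (simp add: Transposition.transpose_def)
      show "{k \<in> {1..q\<^sub>1}. (w \<circ> ?t) k \<le> w q\<^sub>1} \<subseteq> {k \<in> {1..q\<^sub>1}. w k \<le> w q\<^sub>1}"
        using wk w12 by (auto split: if_splits)
      have "q\<^sub>1 \<in> {k \<in> {1..q\<^sub>1}. w k \<le> w q\<^sub>1}" "q\<^sub>1 \<notin> {k \<in> {1..q\<^sub>1}. (w \<circ> ?t) k \<le> w q\<^sub>1}"
        using q(1) w12 by auto
      then show "{k \<in> {1..q\<^sub>1}. (w \<circ> ?t) k \<le> w q\<^sub>1} \<noteq> {k \<in> {1..q\<^sub>1}. w k \<le> w q\<^sub>1}"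
        by blast
    qed
    then have "rank_number (w \<circ> ?t) (w q\<^sub>1) q\<^sub>1 < R (w q\<^sub>1) q\<^sub>1"
      unfolding rank_number_def by (intro psubset_card_mono) auto
    ultimately show False by simp
  qed
  ultimately show ?thesis by blast
qed

text \<open>The position \<open>c\<close> of the value \<open>u a + 1\<close> either lies beyond \<open>a\<close>, or it can replace \<open>a\<close>.\<close>

lemma consecutive_ascent:
  assumes u: "bij_betw u {1..n} {1..n}" and ab: "a \<in> {1..n}" "b \<in> {1..n}" "a < b" "u a < u b"
  shows "\<exists>q\<^sub>1 q\<^sub>2. q\<^sub>1 \<in> {1..n} \<and> q\<^sub>2 \<in> {1..n} \<and> q\<^sub>1 < q\<^sub>2 \<and> u q\<^sub>2 = Suc (u q\<^sub>1) \<and> u a \<le> u q\<^sub>1 \<and> u q\<^sub>2 \<le> u b"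
  using ab
proof (induction "u b - u a" arbitrary: a rule: less_induct)
  case less
  have uin: "u k \<in> {1..n}" if "k \<in> {1..n}" for k
    using u that by (auto simp: bij_betw_def)
  have "Suc (u a) \<in> u ` {1..n}"
    using u uin[OF less.prems(1)] uin[OF less.prems(2)] less.prems(4) by (auto simp: bij_betw_def)
  then obtain c where c: "c \<in> {1..n}" "u c = Suc (u a)"
    by (metis imageE)
  show ?case
  proof (cases "a < c")
    case True
    then show ?thesis
      using c less.prems by (intro exI[of _ a] exI[of _ c]) auto
  next
    case False
    have "c \<noteq> a"
      using c(2) by auto
    then have cb: "c < b"
      using False less.prems(3) by simp
    have "u c \<noteq> u b"
      using inj_on_eq_iff[OF bij_betw_imp_inj_on[OF u] c(1) less.prems(2)] cb by simp
    then have "u c < u b"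
      using c(2) less.prems(4) by simp
    from less.hyps[OF _ c(1) less.prems(2) cb this] c(2) less.prems(4) show ?thesis
      by (metis Suc_leD diff_less_mono2 lessI)
  qed
qed

text \<open>
  The two values of the ascent stay above the value on the right of the division, so that sorting
  moves them down.
\<close>

lemma exchange_if_23_1:
  assumes "contains_split_pattern n w r [2, 3] [1]"
  shows "\<exists>V. V \<in> fiber (E r) \<and> V \<notin> act n sort_mat ` fiber generic"
proof -
  obtain a b c where abc: "1 \<le> a" "a < b" "b \<le> r" "r < c" "c \<le> n" "w c < w a" "w a < w b"
    using assms unfolding contains_23_1_iff by (elim exE conjE)
  then have ab: "a \<in> {1..n}" "b \<in> {1..n}" "c \<in> {1..n}"
    using r by auto
  have A: "w a \<in> A" "w b \<in> A" "w c \<notin> A"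
    using abc by (simp_all add: in_A_iff[OF ab(1)] in_A_iff[OF ab(2)] in_A_iff[OF ab(3)])
  have "(\<sigma> \<circ> w) a < (\<sigma> \<circ> w) b"
    using \<sigma>_mono[of "w a" "w b"] abc(7) A by simp
  from consecutive_ascent[OF bij_\<sigma>w ab(1,2) abc(2) this]
  obtain q\<^sub>1 q\<^sub>2 where q: "q\<^sub>1 \<in> {1..n}" "q\<^sub>2 \<in> {1..n}" "q\<^sub>1 < q\<^sub>2" "\<sigma> (w q\<^sub>2) = Suc (\<sigma> (w q\<^sub>1))"
    "\<sigma> (w a) \<le> \<sigma> (w q\<^sub>1)" "\<sigma> (w q\<^sub>2) \<le> \<sigma> (w b)"
    by auto
  have small: "w k \<in> A" if "k \<in> {1..n}" "\<sigma> (w k) \<le> \<sigma> (w b)" for k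
    using \<sigma>_not_A[OF w_in[OF that(1)]] \<sigma>_A[OF A(2)] that(2) by fastforce
  have qA: "w q\<^sub>1 \<in> A" "w q\<^sub>2 \<in> A"
    using small[OF q(1)] small[OF q(2)] q(4,6) by auto
  then have "q\<^sub>2 \<le> r"
    using q(2) by (simp add: in_A_iff)
  moreover have "w c < w q\<^sub>1"
    using \<sigma>_mono[of "w q\<^sub>1" "w a"] qA(1) A(1) q(5) abc(6) by (meson leD le_less_trans not_le order_less_le_trans)
  then have "w c \<in> {1..w q\<^sub>1} - A"
    using A(3) w_in[OF ab(3)] by simp
  then have "A \<inter> {1..w q\<^sub>1} \<subset> {1..w q\<^sub>1}"
    by blast
  then have "card (A \<inter> {1..w q\<^sub>1}) < card {1..w q\<^sub>1}"
    by (intro psubset_card_mono) auto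
  then have "below (w q\<^sub>1) < w q\<^sub>1"
    by (simp add: below_def)
  ultimately show ?thesis
    using exchange_not_in_image[OF q(1-4)] by blast
qed

text \<open>
  The two values of the ascent stay below the value on the left of the division, so that sorting
  moves them up.
\<close>

lemma exchange_if_3_12:
  assumes "contains_split_pattern n w r [3] [1, 2]"
  shows "\<exists>V. V \<in> fiber (E r) \<and> V \<notin> act n sort_mat ` fiber generic"
proof -
  obtain a b c where abc: "1 \<le> a" "a \<le> r" "r < b" "b < c" "c \<le> n" "w b < w c" "w c < w a"
    using assms unfolding contains_3_12_iff by (elim exE conjE)
  then have ab: "a \<in> {1..n}" "b \<in> {1..n}" "c \<in> {1..n}"
    using r by auto
  have A: "w a \<in> A" "w b \<notin> A" "w c \<notin> A"
    using abc by (simp_all add: in_A_iff[OF ab(1)] in_A_iff[OF ab(2)] in_A_iff[OF ab(3)])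
  have "(\<sigma> \<circ> w) b < (\<sigma> \<circ> w) c"
    using \<sigma>_mono[of "w b" "w c"] abc(6) A by simp
  from consecutive_ascent[OF bij_\<sigma>w ab(2,3) abc(4) this]
  obtain q\<^sub>1 q\<^sub>2 where q: "q\<^sub>1 \<in> {1..n}" "q\<^sub>2 \<in> {1..n}" "q\<^sub>1 < q\<^sub>2" "\<sigma> (w q\<^sub>2) = Suc (\<sigma> (w q\<^sub>1))"
    "\<sigma> (w b) \<le> \<sigma> (w q\<^sub>1)" "\<sigma> (w q\<^sub>2) \<le> \<sigma> (w c)"
    by auto
  have large: "w k \<notin> A" if "k \<in> {1..n}" "\<sigma> (w b) \<le> \<sigma> (w k)" for k
    using \<sigma>_not_A[OF w_in[OF ab(2)] A(2)] \<sigma>_A[of "w k"] that(2) by fastforce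
  have qA: "w q\<^sub>1 \<notin> A" "w q\<^sub>2 \<notin> A"
    using large[OF q(1)] large[OF q(2)] q(4,5) by auto
  then have "r < q\<^sub>1"
    using q(1) by (simp add: in_A_iff)
  moreover have "w q\<^sub>2 < w a"
    using \<sigma>_mono[of "w c" "w q\<^sub>2"] qA(2) A(3) q(6) abc(7) by (meson leD le_less_trans not_le)
  then have "w a \<in> A - {1..w q\<^sub>2}"
    using A(1) by simp
  then have "A \<inter> {1..w q\<^sub>2} \<subset> A"
    by blast
  then have "below (w q\<^sub>2) < r"
    using psubset_card_mono[OF finite_A] by (simp only: below_def card_A)
  ultimately show ?thesis
    using exchange_not_in_image[OF q(1-4)] by blast
qed

theorem avoids_if_locally_trivial:
  assumes t: "zariski_locally_trivial (swf_sub Fl S) (swf_sub Gr (flag_proj r ` S)) (flag_proj r)"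
  shows "avoids_split_pattern n w r [2, 3] [1]" "avoids_split_pattern n w r [3] [1, 2]"
proof -
  have "generic \<in> flag_proj r ` S"
    using coord_flag_w by (auto simp: fiber_def flag_proj_def image_iff)
  moreover have "E r \<in> flag_proj r ` S"
  proof -
    have "act n sort_mat (coord_flag w) \<in> fiber (E r)"
      by (rule act_sort_fiber[OF coord_flag_w])
    then show ?thesis
      by (auto simp: fiber_def flag_proj_def image_iff)
  qed
  ultimately have "act n sort_mat ` fiber generic = fiber (E r)"
    by (rule fiber_eq_if_locally_trivial[OF t])
  then show "avoids_split_pattern n w r [2, 3] [1]" "avoids_split_pattern n w r [3] [1, 2]"
    using exchange_if_23_1 exchange_if_3_12 by blast+
qed

end

theorem theorem1p1:
  fixes n r :: nat
    and w :: "nat \<Rightarrow> nat"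
    and e :: "nat \<Rightarrow> nat \<Rightarrow> 'k::alg_closed_field"
  assumes "0 < r" and "r < n"
    and "w permutes {1..n}"
    and "is_basis n e"
  shows "zariski_locally_trivial
           (swf_sub (flag_variety n) (schubert n e w))
           (swf_sub (grassmannian_variety r n) (flag_proj r ` schubert n e w))
           (flag_proj r)
         \<longleftrightarrow> avoids_split_pattern n w r [3] [1, 2] \<and> avoids_split_pattern n w r [2, 3] [1]"
proof -
  interpret schubert_projection n r w e
    by unfold_locales (use assms in auto)
  show ?thesis
    using locally_trivial_if_avoids avoids_if_locally_trivial unfolding S_def by blast
qed

end
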